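(* Let $d\in\mathbb N$, $\Lambda_n:=[0,n)^d\cap\mathbb Z^d$ for $n\in\mathbb N$, $\mathcal A\subseteq\mathbb R$, $\Omega:=\mathcal A^{\mathbb Z^d}$, and let $(\Omega,\mathcal B(\Omega),\mathbb P)$ be a probability space satisfying the properties (M1), (M2), (M3) (listed in the context) with correlation length $r\in\mathbb N_0$. Let $H_\omega=-\Delta+V_\omega$ be the random Schrödinger operator on $\ell^2(\mathbb Z^d)$ and let $$f(\Lambda,\omega)(x):=\operatorname{Tr}\bigl(\chi_{(-\infty,x]}(H_\omega^\Lambda)\bigr),\qquad \Lambda\in\mathcal F,\ \omega\in\Omega,\ x\in\mathbb R,$$ be the associated eigenvalue counting function. Then there exists a set $\tilde\Omega\in\mathcal B(\Omega)$ of full measure such that for all $\omega\in\tilde\Omega$ $$\lim_{n\to\infty}\Bigl\lVert\frac{f(\Lambda_n,\omega)}{|\Lambda_n|}-f^*\Bigr\rVert=0,$$ where $f^*\in\mathbb B$ is given by $f^*(x):=\mathbb E\bigl(\langle\delta_0,\chi_{(-\infty,x]}(H_\omega)\delta_0\rangle\bigr)$, $x\in\mathbb R$. Here $\delta_0\in\ell^2(\mathbb Z^d)$ is given by $\delta_0(0)=1$ and $\delta_0(x)=0$ for $x\ne0$, and $\chi_{(-\infty,x]}(H_\omega)$ is the spectral projection of $H_\omega$ on the interval $(-\infty,x]$. The convergence is quantified, for $\omega\in\tilde\Omega$, by $$\Bigl\lVert\frac{f(\Lambda_n,\omega)}{|\Lambda_n|}-f^*\Bigr\rVert\le2^{d+1}\Bigl(\frac{26m^d+8}{n-m}+\frac{34r^d+24}{m-r}\Bigr)+\sup_{g\in\mathcal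 U_{K,D,D',r'}}\frac{\bigl\lVert\langle g_{\Lambda_m^r},L_{m,n}^{r,\omega}-\mathbb P_{\Lambda_m^r}\rangle\bigr\rVert}{|\Lambda_m|}$$ for $n,m\in\mathbb N$, $m<n$, where $K=9$, $D=D'=8$ and $r'=1$.
   Context: Schrödinger operator: $(\Delta\varphi)(z)=\sum_{x:\|x-z\|_1=1}(\varphi(x)-\varphi(z))$ and $(V_\omega\varphi)(z)=\omega_z\varphi(z)$ for $\varphi\in\ell^2(\mathbb Z^d)$ (if $\omega$ is unbounded, $V_\omega$ and $H_\omega$ are taken on the natural domain $\{\varphi\in\ell^2:V_\omega\varphi\in\ell^2\}$, on which $H_\omega$ is self-adjoint). $\chi_{(-\infty,x]}(\cdot)$ denotes the spectral projection onto $(-\infty,x]$. For $\Lambda\in\mathcal F$, $H_\omega^\Lambda:=p_\Lambda H_\omega i_\Lambda\colon\ell^2(\Lambda)\to\ell^2(\Lambda)$, where $p_\Lambda\colon\ell^2(\mathbb Z^d)\to\ell^2(\Lambda)$ is restriction and $i_\Lambda\colon\ell^2(\Lambda)\to\ell^2(\mathbb Z^d)$ is extension by zero. So $f(\Lambda,\omega)(x)$ is the number of eigenvalues of $H_\omega^\Lambda$ (with multiplicity) not exceeding $x$. $\mathbb E$ is expectation with respect to $\mathbb P$. Geometry: $\mathcal F$ is the set of all finite subsets of $\mathbb Z^d$; $|\Lambda|$ is the cardinality of $\Lambda\in\mathcal F$; $\mathfrak d(x,y):=\|x-y\|_1$, $\mathfrak d(\Lambda_1,\Lambda_2):=\min\{\mathfrak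 d(x,y):x\in\Lambda_1,y\in\Lambda_2\}$, $\mathfrak d(x,\Lambda):=\mathfrak d(\{x\},\Lambda)$; $\Lambda+z:=\{x+z: x\in\Lambda\}$. A cube of side length $n$ is a set $([0,n)^d\cap\mathbb Z^d)+z$, $z\in\mathbb Z^d$. For $r\in\mathbb N_0$, $\partial^r(\Lambda):=\{x\in\Lambda:\mathfrak d(x,\mathbb Z^d\setminus\Lambda)\le r\}\cup\{x\in\mathbb Z^d\setminus\Lambda:\mathfrak d(x,\Lambda)\le r\}$ and $\Lambda^r:=\Lambda\setminus\partial^r(\Lambda)$; $\Lambda_m^r:=(\Lambda_m)^r$. Colorings: $\mathcal A$ carries the Borel $\sigma$-algebra $\mathcal B(\mathcal A)$ inherited from $\mathbb R$, and $\mathcal B(\Omega)$ is the product $\sigma$-algebra. For $z\in\mathbb Z^d$, $\tau_z\colon\Omega\to\Omega$, $(\tau_z\omega)_x:=\omega_{x+z}$. For $\Lambda\in\mathcal F$, $\Omega_\Lambda:=\mathcal A^\Lambda$ with product $\sigma$-algebra, $\Pi_\Lambda\colon\Omega\to\Omega_\Lambda$, $\Pi_\Lambda(\omega):=\omega_\Lambda:=(\omega_z)_{z\in\Lambda}$. Assumptions on $\mathbb P$: (M1) $\mathbb P\circ\tau_z^{-1}=\mathbb P$ for all $z\in\mathbb Z^d$. (M2) There are $\sigma$-finite measures $\mu_z$, $z\in\mathbb Z^d$, on $(\mathcal A,\mathcal B(\mathcal A))$ such that for each $\Lambda\in\mathcal F$ the marginal $\mathbb P_\Lambda:=\mathbb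 P\circ\Pi_\Lambda^{-1}$ is absolutely continuous with respect to $\mu_\Lambda:=\bigotimes_{z\in\Lambda}\mu_z$, with density $\rho_\Lambda:=d\mathbb P_\Lambda/d\mu_\Lambda$. (M3) There is $r\ge0$ (the correlation length) such that for all $n\in\mathbb N$ and non-empty $\Lambda_1,\dots,\Lambda_n\in\mathcal F$ with $\min\{\mathfrak d(\Lambda_i,\Lambda_j): i\ne j\}>r$ one has $\rho_\Lambda=\prod_{j=1}^n\rho_{\Lambda_j}$ ($\mu_\Lambda$-a.e., where $\rho_{\Lambda_j}$ is evaluated at $\omega_{\Lambda_j}$), $\Lambda=\bigcup_j\Lambda_j$. $\mathbb B:=\{F\colon\mathbb R\to\mathbb R\mid F\text{ right-continuous and bounded}\}$ with the supremum norm $\|\cdot\|$. A function $g\colon\mathcal F\times\Omega\to\mathbb B$ is admissible if: (i) $g(\Lambda+z,\omega)=g(\Lambda,\tau_z\omega)$ for all $\Lambda\in\mathcal F$, $z\in\mathbb Z^d$, $\omega\in\Omega$; (ii) $g(\Lambda,\omega)=g(\Lambda,\omega')$ whenever $\Lambda\in\mathcal F$ and $\Pi_\Lambda(\omega)=\Pi_\Lambda(\omega')$; (iii) there is $b_g\colon\mathcal F\to[0,\infty)$ such that for all $\omega\in\Omega$ and pairwise disjoint $\Lambda_1,\dots,\Lambda_n\in\mathcal F$ with union $\Lambda$, $\|g(\Lambda,\omega)-\sum_{i=1}^ng(\Lambda_i,\omega)\|\le\sum_{i=1}^nb_g(\Lambda_i)$, where $b_g(\Lambda+z)=b_g(\Lambda)$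 for all $\Lambda\in\mathcal F,z\in\mathbb Z^d$; there is $D_g>0$ with $b_g(\Lambda)\le D_g|\Lambda|$ for all $\Lambda\in\mathcal F$; and $b_g(\Lambda_i)/|\Lambda_i|\to0$ for every sequence $(\Lambda_i)$ of cubes with strictly increasing side length; (iv) there is $s\in\{-1,1\}^{\mathbb Z^d}$ such that for all $\Lambda\in\mathcal F$, $\omega,\omega'\in\Omega$, $z\in\Lambda$, $E\in\mathbb R$ with $\omega_{\Lambda\setminus\{z\}}=\omega'_{\Lambda\setminus\{z\}}$ and $\omega_z\le\omega'_z$: $g(\Lambda,\omega)(E)\le g(\Lambda,\omega')(E)$ if $s(z)=1$, and $g(\Lambda,\omega)(E)\ge g(\Lambda,\omega')(E)$ if $s(z)=-1$; (v) $\sup_{\omega\in\Omega}\|g(\{0\},\omega)\|<\infty$. For admissible $g$, $K_g:=\sup\{\|g(\Lambda,\omega)\|/|\Lambda| : \omega\in\Omega,\ \Lambda\in\mathcal F\setminus\{\emptyset\}\}<\infty$. The function $b_g$ is called a proper boundary term if in addition there are $r'_g\in\mathbb N$, $D'_g>0$ with $b_g(\Lambda)\le D'_g|\partial^{r'_g}\Lambda|$ for all cubes $\Lambda$. $\mathcal U_{K,D,D',r'}$ is the set of admissible $g$ (having a proper boundary term $b_g$) with $K_g\le K$, $D_g\le D$, $D'_g\le D'$, $r'_g\le r'$. For $\Lambda\in\mathcal F$, $g_\Lambda\colon\Omega_\Lambda\to\mathbb B$ is defined by $g_\Lambda(\omega_\Lambda):=g(\Lambda,\omega)$ (well-defined by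 (ii)). For $n\ge m$, $T_{m,n}:=\{t\in m\mathbb Z^d:\Lambda_m+t\subseteq\Lambda_n\}$, and $L_{m,n}^{r,\omega}:=\frac1{|T_{m,n}|}\sum_{t\in T_{m,n}}\delta_{(\tau_t\omega)_{\Lambda_m^r}}$ is the empirical probability measure on $\Omega_{\Lambda_m^r}$. For a measure $\nu$ on $\Omega_\Lambda$, $\langle h,\nu\rangle:=\int_{\Omega_\Lambda}h(\omega)\,d\nu(\omega)\in\mathbb B$, the integral being taken pointwise, $\langle h,\nu\rangle(E)=\int h(\omega)(E)\,d\nu(\omega)$ (with respect to the completion of $\nu$), and $\langle h,\nu_1-\nu_2\rangle:=\langle h,\nu_1\rangle-\langle h,\nu_2\rangle$.
   Formalization: The quantified bound is stated for r < m < n instead of m < n: for m = r it divides by zero, and for m < r the set Λ_m^r is empty, the supremum is 0 and the right-hand side is negative for large n, so the bound fails there. *)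

theory Defs
  imports "HOL-Probability.Probability" "HOL-Library.Extended_Nat"
begin

text \<open>The lattice of dimension \<open>d = CARD('d) \<ge> 1\<close> is the type \<open>int ^ 'd\<close>.\<close>

definition l1_norm :: "int ^ 'd \<Rightarrow> nat" where
  "l1_norm x = nat (\<Sum>i\<in>UNIV. \<bar>x $ i\<bar>)"

text \<open>Values in \<^typ>\<open>enat\<close>, so that the distance to the empty set is \<open>\<infinity>\<close>;
  for nonempty sets the infimum is attained.\<close>

definition set_dist :: "(int ^ 'd) set \<Rightarrow> (int ^ 'd) set \<Rightarrow> enat" where
  "set_dist \<Lambda>1 \<Lambda>2 = (INF x\<in>\<Lambda>1. INF y\<in>\<Lambda>2. enat (l1_norm (x - y)))"

definition translate :: "(int ^ 'd) set \<Rightarrow> int ^ 'd \<Rightarrow> (int ^ 'd) set" where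
  "translate \<Lambda> z = (\<lambda>x. x + z) ` \<Lambda>"

definition cube :: "nat \<Rightarrow> (int ^ 'd) set" where
  "cube n = {x. \<forall>i. 0 \<le> x $ i \<and> x $ i < int n}"

definition is_cube :: "nat \<Rightarrow> (int ^ 'd) set \<Rightarrow> bool" where
  "is_cube n \<Lambda> \<longleftrightarrow> (\<exists>z. \<Lambda> = translate (cube n) z)"

definition bdry :: "nat \<Rightarrow> (int ^ 'd) set \<Rightarrow> (int ^ 'd) set" where
  "bdry r \<Lambda> = {x \<in> \<Lambda>. set_dist {x} (- \<Lambda>) \<le> enat r} \<union> {x \<in> - \<Lambda>. set_dist {x} \<Lambda> \<le> enat r}"

definition inner_part :: "nat \<Rightarrow> (int ^ 'd) set \<Rightarrow> (int ^ 'd) set" where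
  "inner_part r \<Lambda> = \<Lambda> - bdry r \<Lambda>"

definition tiles :: "nat \<Rightarrow> nat \<Rightarrow> (int ^ 'd) set" where
  "tiles m n = {t. (\<forall>i. int m dvd t $ i) \<and> translate (cube m) t \<subseteq> cube n}"

definition configs :: "real set \<Rightarrow> (int ^ 'd \<Rightarrow> real) set" where
  "configs A = {\<omega>. \<forall>z. \<omega> z \<in> A}"

definition shift :: "int ^ 'd \<Rightarrow> (int ^ 'd \<Rightarrow> real) \<Rightarrow> (int ^ 'd \<Rightarrow> real)" where
  "shift z \<omega> = (\<lambda>x. \<omega> (x + z))"

text \<open>The measurable space \<open>A\<^sup>\<Lambda>\<close>; as usual for \<^const>\<open>PiM\<close>, its points are
  functions that are \<^const>\<open>undefined\<close> off \<open>\<Lambda>\<close>, and the coordinate projection is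
  \<open>\<lambda>\<omega>. restrict \<omega> \<Lambda>\<close>. The case \<open>\<Lambda> = UNIV\<close> is \<open>\<Omega>\<close>. Only the
  measurable-space structure matters here.\<close>

definition config_algebra :: "real set \<Rightarrow> (int ^ 'd) set \<Rightarrow> (int ^ 'd \<Rightarrow> real) measure" where
  "config_algebra A \<Lambda> = (\<Pi>\<^sub>M z\<in>\<Lambda>. restrict_space borel A)"

definition marginal ::
    "real set \<Rightarrow> (int ^ 'd \<Rightarrow> real) measure \<Rightarrow> (int ^ 'd) set \<Rightarrow> (int ^ 'd \<Rightarrow> real) measure" where
  "marginal A P \<Lambda> = distr P (config_algebra A \<Lambda>) (\<lambda>\<omega>. restrict \<omega> \<Lambda>)"

definition stationary :: "real set \<Rightarrow> (int ^ 'd \<Rightarrow> real) measure \<Rightarrow> bool" where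
  "stationary A P \<longleftrightarrow> (\<forall>z. distr P (config_algebra A UNIV) (shift z) = P)"

definition has_densities ::
    "real set \<Rightarrow> (int ^ 'd \<Rightarrow> real measure) \<Rightarrow> (int ^ 'd \<Rightarrow> real) measure \<Rightarrow> bool" where
  "has_densities A \<mu> P \<longleftrightarrow>
     (\<forall>z. sigma_finite_measure (\<mu> z) \<and> sets (\<mu> z) = sets (restrict_space borel A)) \<and>
     (\<forall>\<Lambda>. finite \<Lambda> \<longrightarrow> absolutely_continuous (Pi\<^sub>M \<Lambda> \<mu>) (marginal A P \<Lambda>))"

definition marginal_density ::
    "real set \<Rightarrow> (int ^ 'd \<Rightarrow> real measure) \<Rightarrow> (int ^ 'd \<Rightarrow> real) measure \<Rightarrow> (int ^ 'd) set \<Rightarrow>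
     (int ^ 'd \<Rightarrow> real) \<Rightarrow> ennreal" where
  "marginal_density A \<mu> P \<Lambda> = RN_deriv (Pi\<^sub>M \<Lambda> \<mu>) (marginal A P \<Lambda>)"

definition correlation_length ::
    "real set \<Rightarrow> (int ^ 'd \<Rightarrow> real measure) \<Rightarrow> (int ^ 'd \<Rightarrow> real) measure \<Rightarrow> nat \<Rightarrow> bool" where
  "correlation_length A \<mu> P r \<longleftrightarrow>
     (\<forall>(n::nat) \<Lambda>s. n \<ge> 1 \<longrightarrow> (\<forall>j\<in>{1..n}. finite (\<Lambda>s j) \<and> \<Lambda>s j \<noteq> {}) \<longrightarrow>
        (\<forall>i\<in>{1..n}. \<forall>j\<in>{1..n}. i \<noteq> j \<longrightarrow> set_dist (\<Lambda>s i) (\<Lambda>s j) > enat r) \<longrightarrow>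
        (AE \<eta> in Pi\<^sub>M (\<Union>j\<in>{1..n}. \<Lambda>s j) \<mu>.
           marginal_density A \<mu> P (\<Union>j\<in>{1..n}. \<Lambda>s j) \<eta> =
             (\<Prod>j\<in>{1..n}. marginal_density A \<mu> P (\<Lambda>s j) (restrict \<eta> (\<Lambda>s j)))))"

definition rc_bounded :: "(real \<Rightarrow> real) set" where
  "rc_bounded = {F. (\<forall>x. continuous (at_right x) F) \<and> bounded (range F)}"

definition sup_norm :: "(real \<Rightarrow> real) \<Rightarrow> real" where
  "sup_norm F = (SUP x. \<bar>F x\<bar>)"

type_synonym 'd field = "(int ^ 'd) set \<Rightarrow> (int ^ 'd \<Rightarrow> real) \<Rightarrow> (real \<Rightarrow> real)"

definition boundary_term ::
    "real set \<Rightarrow> 'd::finite field \<Rightarrow> ((int ^ 'd) set \<Rightarrow> real) \<Rightarrow> real \<Rightarrow> bool" where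
  "boundary_term A g b D \<longleftrightarrow>
     (\<forall>\<Lambda>. finite \<Lambda> \<longrightarrow> b \<Lambda> \<ge> 0) \<and>
     (\<forall>\<omega>\<in>configs A. \<forall>(n::nat) \<Lambda>s. n \<ge> 1 \<longrightarrow> (\<forall>i\<in>{1..n}. finite (\<Lambda>s i)) \<longrightarrow>
        disjoint_family_on \<Lambda>s {1..n} \<longrightarrow>
        sup_norm (\<lambda>E. g (\<Union>i\<in>{1..n}. \<Lambda>s i) \<omega> E - (\<Sum>i\<in>{1..n}. g (\<Lambda>s i) \<omega> E))
          \<le> (\<Sum>i\<in>{1..n}. b (\<Lambda>s i))) \<and>
     (\<forall>\<Lambda> z. finite \<Lambda> \<longrightarrow> b (translate \<Lambda> z) = b \<Lambda>) \<and>
     D > 0 \<and> (\<forall>\<Lambda>. finite \<Lambda> \<longrightarrow> b \<Lambda> \<le> D * real (card \<Lambda>)) \<and>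
     (\<forall>\<Lambda>s N. strict_mono N \<longrightarrow> (\<forall>i::nat. is_cube (N i) (\<Lambda>s i)) \<longrightarrow>
        (\<lambda>i. b (\<Lambda>s i) / real (card (\<Lambda>s i))) \<longlonglongrightarrow> 0)"

definition proper_boundary_term ::
    "((int ^ 'd) set \<Rightarrow> real) \<Rightarrow> real \<Rightarrow> nat \<Rightarrow> bool" where
  "proper_boundary_term b D' r' \<longleftrightarrow>
     D' > 0 \<and> r' \<ge> 1 \<and> (\<forall>n \<Lambda>. is_cube n \<Lambda> \<longrightarrow> b \<Lambda> \<le> D' * real (card (bdry r' \<Lambda>)))"

definition admissible :: "real set \<Rightarrow> 'd::finite field \<Rightarrow> bool" where
  "admissible A g \<longleftrightarrow>
     (\<forall>\<Lambda>. finite \<Lambda> \<longrightarrow> (\<forall>\<omega>\<in>configs A. g \<Lambda> \<omega> \<in> rc_bounded)) \<and>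
     (\<forall>\<Lambda> z. finite \<Lambda> \<longrightarrow> (\<forall>\<omega>\<in>configs A. g (translate \<Lambda> z) \<omega> = g \<Lambda> (shift z \<omega>))) \<and>
     (\<forall>\<Lambda>. finite \<Lambda> \<longrightarrow> (\<forall>\<omega>\<in>configs A. \<forall>\<omega>'\<in>configs A.
        restrict \<omega> \<Lambda> = restrict \<omega>' \<Lambda> \<longrightarrow> g \<Lambda> \<omega> = g \<Lambda> \<omega>')) \<and>
     (\<exists>b D. boundary_term A g b D) \<and>
     (\<exists>s :: int ^ 'd \<Rightarrow> int. (\<forall>z. s z \<in> {-1, 1}) \<and>
        (\<forall>\<Lambda>. finite \<Lambda> \<longrightarrow> (\<forall>\<omega>\<in>configs A. \<forall>\<omega>'\<in>configs A. \<forall>z\<in>\<Lambda>. \<forall>E.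
           restrict \<omega> (\<Lambda> - {z}) = restrict \<omega>' (\<Lambda> - {z}) \<longrightarrow> \<omega> z \<le> \<omega>' z \<longrightarrow>
           (s z = 1 \<longrightarrow> g \<Lambda> \<omega> E \<le> g \<Lambda> \<omega>' E) \<and>
           (s z = -1 \<longrightarrow> g \<Lambda> \<omega> E \<ge> g \<Lambda> \<omega>' E)))) \<and>
     bdd_above ((\<lambda>\<omega>. sup_norm (g {0} \<omega>)) ` configs A)"

definition field_bound :: "real set \<Rightarrow> 'd::finite field \<Rightarrow> real" where
  "field_bound A g =
     (SUP (\<Lambda>, \<omega>) \<in> {\<Lambda>. finite \<Lambda> \<and> \<Lambda> \<noteq> {}} \<times> configs A. sup_norm (g \<Lambda> \<omega>) / real (card \<Lambda>))"

text \<open>The constants attached to \<open>g\<close> belong to a choice of boundary term for \<open>g\<close>.\<close>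

definition admissible_class ::
    "real set \<Rightarrow> real \<Rightarrow> real \<Rightarrow> real \<Rightarrow> nat \<Rightarrow> 'd::finite field set" where
  "admissible_class A K D D' r' =
     {g. admissible A g \<and> field_bound A g \<le> K \<and>
         (\<exists>b Dg D'g r'g. boundary_term A g b Dg \<and> proper_boundary_term b D'g r'g \<and>
            Dg \<le> D \<and> D'g \<le> D' \<and> r'g \<le> r')}"

text \<open>\<open>g\<^sub>\<Lambda>\<close> on \<open>A\<^sup>\<Lambda>\<close>; for admissible \<open>g\<close> the choice of the
  extension of \<open>\<eta>\<close> to the whole lattice is irrelevant.\<close>

definition localize ::
    "real set \<Rightarrow> 'd::finite field \<Rightarrow> (int ^ 'd) set \<Rightarrow> (int ^ 'd \<Rightarrow> real) \<Rightarrow> real \<Rightarrow> real" where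
  "localize A g \<Lambda> \<eta> = g \<Lambda> (SOME \<omega>. \<omega> \<in> configs A \<and> restrict \<omega> \<Lambda> = \<eta>)"

text \<open>The average of the point masses at the patterns \<open>(\<tau>\<^sub>t \<omega>)\<close> restricted to the
  inner part of the cube, as the image of the uniform distribution on the tiles.\<close>

definition empirical_measure ::
    "real set \<Rightarrow> nat \<Rightarrow> nat \<Rightarrow> nat \<Rightarrow> (int ^ 'd \<Rightarrow> real) \<Rightarrow> (int ^ 'd \<Rightarrow> real) measure" where
  "empirical_measure A r m n \<omega> =
     distr (uniform_count_measure (tiles m n)) (config_algebra A (inner_part r (cube m)))
       (\<lambda>t. restrict (shift t \<omega>) (inner_part r (cube m)))"

definition pairing ::
    "((int ^ 'd \<Rightarrow> real) \<Rightarrow> real \<Rightarrow> real) \<Rightarrow> (int ^ 'd \<Rightarrow> real) measure \<Rightarrow> real \<Rightarrow> real" where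
  "pairing h \<nu> E = (\<integral>\<eta>. h \<eta> E \<partial>(completion \<nu>))"

text \<open>\<open>\<ell>\<^sup>2(S)\<close> is realized inside the functions on the whole index type, as the
  functions vanishing off \<open>S\<close>. Extension by zero thus becomes the inclusion.\<close>

definition ell2 :: "'a set \<Rightarrow> ('a \<Rightarrow> complex) set" where
  "ell2 S = {\<phi>. (\<forall>x. x \<notin> S \<longrightarrow> \<phi> x = 0) \<and> (\<lambda>x. (cmod (\<phi> x))\<^sup>2) summable_on S}"

definition ell2_inner :: "('a \<Rightarrow> complex) \<Rightarrow> ('a \<Rightarrow> complex) \<Rightarrow> complex" where
  "ell2_inner \<phi> \<psi> = (\<Sum>\<^sub>\<infinity>x. cnj (\<phi> x) * \<psi> x)"

definition ell2_norm :: "('a \<Rightarrow> complex) \<Rightarrow> real" where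
  "ell2_norm \<phi> = sqrt (\<Sum>\<^sub>\<infinity>x. (cmod (\<phi> x))\<^sup>2)"

definition delta :: "'a \<Rightarrow> 'a \<Rightarrow> complex" where
  "delta z = (\<lambda>x. if x = z then 1 else 0)"

definition orthogonal_projection ::
    "'a set \<Rightarrow> (('a \<Rightarrow> complex) \<Rightarrow> ('a \<Rightarrow> complex)) \<Rightarrow> bool" where
  "orthogonal_projection S Q \<longleftrightarrow>
     (\<forall>\<phi>\<in>ell2 S. Q \<phi> \<in> ell2 S \<and> Q (Q \<phi>) = Q \<phi>) \<and>
     (\<forall>\<phi>\<in>ell2 S. \<forall>\<psi>\<in>ell2 S. \<forall>c. Q (\<lambda>x. c * \<phi> x + \<psi> x) = (\<lambda>x. c * Q \<phi> x + Q \<psi> x)) \<and>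
     (\<forall>\<phi>\<in>ell2 S. \<forall>\<psi>\<in>ell2 S. ell2_inner (Q \<phi>) \<psi> = ell2_inner \<phi> (Q \<psi>))"

definition resolution_of_identity ::
    "'a set \<Rightarrow> (real \<Rightarrow> ('a \<Rightarrow> complex) \<Rightarrow> ('a \<Rightarrow> complex)) \<Rightarrow> bool" where
  "resolution_of_identity S Q \<longleftrightarrow>
     (\<forall>x. orthogonal_projection S (Q x)) \<and>
     (\<forall>\<phi>\<in>ell2 S.
        (\<forall>x y. Q x (Q y \<phi>) = Q (min x y) \<phi>) \<and>
        (\<forall>x. ((\<lambda>y. ell2_norm (\<lambda>z. Q y \<phi> z - Q x \<phi> z)) \<longlongrightarrow> 0) (at_right x)) \<and>
        ((\<lambda>y. ell2_norm (Q y \<phi>)) \<longlongrightarrow> 0) at_bot \<and>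
        ((\<lambda>y. ell2_norm (\<lambda>z. Q y \<phi> z - \<phi> z)) \<longlongrightarrow> 0) at_top)"

text \<open>The spectral measure of the vector \<open>\<phi>\<close>, i.e. the Stieltjes measure
  \<open>d\<langle>\<phi>, Q(x)\<phi>\<rangle>\<close>.\<close>

definition vector_spectral_measure ::
    "(real \<Rightarrow> ('a \<Rightarrow> complex) \<Rightarrow> ('a \<Rightarrow> complex)) \<Rightarrow> ('a \<Rightarrow> complex) \<Rightarrow> real measure" where
  "vector_spectral_measure Q \<phi> = interval_measure (\<lambda>x. Re (ell2_inner \<phi> (Q x \<phi>)))"

text \<open>\<open>Q\<close> is the spectral family of the (possibly unbounded) linear operator \<open>T\<close>
  with domain \<open>D\<close>: \<open>T\<close> equals the integral of \<open>t\<close> against \<open>dQ(t)\<close>, including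
  equality of domains. By polarization it suffices to state this for the quadratic form.\<close>

definition spectral_family ::
    "'a set \<Rightarrow> ('a \<Rightarrow> complex) set \<Rightarrow> (('a \<Rightarrow> complex) \<Rightarrow> ('a \<Rightarrow> complex)) \<Rightarrow>
     (real \<Rightarrow> ('a \<Rightarrow> complex) \<Rightarrow> ('a \<Rightarrow> complex)) \<Rightarrow> bool" where
  "spectral_family S D T Q \<longleftrightarrow>
     resolution_of_identity S Q \<and>
     D = {\<phi> \<in> ell2 S. integrable (vector_spectral_measure Q \<phi>) (\<lambda>t. t\<^sup>2)} \<and>
     (\<forall>\<phi>\<in>D. T \<phi> \<in> ell2 S \<and>
        ell2_inner \<phi> (T \<phi>) = of_real (\<integral>t. t \<partial>(vector_spectral_measure Q \<phi>)))"

text \<open>The spectral projection of \<open>T\<close> onto \<open>(-\<infinity>, x]\<close>. By the spectral theorem, a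
  self-adjoint \<open>T\<close> has a spectral family, and its values on \<open>\<ell>\<^sup>2(S)\<close> are unique.\<close>

definition spectral_projection_atMost ::
    "'a set \<Rightarrow> ('a \<Rightarrow> complex) set \<Rightarrow> (('a \<Rightarrow> complex) \<Rightarrow> ('a \<Rightarrow> complex)) \<Rightarrow>
     real \<Rightarrow> ('a \<Rightarrow> complex) \<Rightarrow> ('a \<Rightarrow> complex)" where
  "spectral_projection_atMost S D T = (SOME Q. spectral_family S D T Q)"

definition trace_on :: "'a set \<Rightarrow> (('a \<Rightarrow> complex) \<Rightarrow> ('a \<Rightarrow> complex)) \<Rightarrow> complex" where
  "trace_on S T = (\<Sum>z\<in>S. ell2_inner (delta z) (T (delta z)))"

definition laplacian :: "(int ^ 'd \<Rightarrow> complex) \<Rightarrow> (int ^ 'd \<Rightarrow> complex)" where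
  "laplacian \<phi> = (\<lambda>z. \<Sum>x | l1_norm (x - z) = 1. \<phi> x - \<phi> z)"

definition potential :: "(int ^ 'd \<Rightarrow> real) \<Rightarrow> (int ^ 'd \<Rightarrow> complex) \<Rightarrow> (int ^ 'd \<Rightarrow> complex)" where
  "potential \<omega> \<phi> = (\<lambda>z. of_real (\<omega> z) * \<phi> z)"

definition hamiltonian :: "(int ^ 'd \<Rightarrow> real) \<Rightarrow> (int ^ 'd \<Rightarrow> complex) \<Rightarrow> (int ^ 'd \<Rightarrow> complex)" where
  "hamiltonian \<omega> \<phi> = (\<lambda>z. - laplacian \<phi> z + potential \<omega> \<phi> z)"

definition hamiltonian_domain :: "(int ^ 'd \<Rightarrow> real) \<Rightarrow> (int ^ 'd \<Rightarrow> complex) set" where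
  "hamiltonian_domain \<omega> = {\<phi> \<in> ell2 UNIV. potential \<omega> \<phi> \<in> ell2 UNIV}"

definition local_hamiltonian ::
    "(int ^ 'd) set \<Rightarrow> (int ^ 'd \<Rightarrow> real) \<Rightarrow> (int ^ 'd \<Rightarrow> complex) \<Rightarrow> (int ^ 'd \<Rightarrow> complex)" where
  "local_hamiltonian \<Lambda> \<omega> \<phi> = (\<lambda>z. if z \<in> \<Lambda> then hamiltonian \<omega> \<phi> z else 0)"

text \<open>Traces and diagonal entries of orthogonal projections are real, so taking real parts
  below loses nothing.\<close>

definition eigenvalue_count :: "'d::finite field" where
  "eigenvalue_count \<Lambda> \<omega> x =
     Re (trace_on \<Lambda> (spectral_projection_atMost \<Lambda> (ell2 \<Lambda>) (local_hamiltonian \<Lambda> \<omega>) x))"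

definition ids :: "(int ^ 'd \<Rightarrow> real) measure \<Rightarrow> real \<Rightarrow> real" where
  "ids P x =
     (\<integral>\<omega>. Re (ell2_inner (delta 0)
        (spectral_projection_atMost UNIV (hamiltonian_domain \<omega>) (hamiltonian \<omega>) x (delta 0))) \<partial>P)"

end

theory Submission imports Defs begin

text \<open>The eigenvalue counting function is almost additive: by a Courant--Fischer comparison,
  cutting a box into pieces changes it by at most a constant times the size of the cut. Hence for a
  box tiled by cubes of side \<open>m\<close>, with corridors of width \<open>r\<close> removed, the normalized counting
  function agrees up to \<open>O(1/m + m/n)\<close> with an empirical average of counting functions of the
  tiles. Patterns in different tiles are independent by the factorization of the densities, so
  Hoeffding's inequality, Borel--Cantelli and a Glivenko--Cantelli argument make this average
  converge uniformly in the energy to its expectation, almost surely. Translating each lattice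
  site to the origin writes that expectation as an average of diagonal matrix elements of finite
  volume spectral projections. These are compared with the infinite volume ones by a
  Davis--Kahan estimate: truncation by a slowly varying cutoff almost commutes with the Hamiltonian,
  which is self-adjoint because weak limits of its finite volume spectral projections form a
  spectral family. The empirical error of the counting function itself is one of the terms of
  the supremum, which gives the quantitative bound for every configuration.\<close>

subsection \<open>Square summable functions as a real inner product space\<close>

text \<open>Three circumstances shape the proof. The definitions reach spectral projections through
  a choice operator, so nothing can be said about them before a spectral family is known to exist;
  for the unbounded \<omega> allowed here this amounts to the spectral theorem for the Hamiltonian.
  The integral identities in \<open>spectral_family\<close> are awkward under weak limits and are
  traded for commutation and order relations between quadratic forms (\<open>pfam\<close>). Finally,
  a supremum of reals dominates its members only if the set is bounded above, so the class of
  admissible fields must be bounded uniformly before its supremum can be used. All Hilbert space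
  work is done over the reals, with multiplication by i as an extra isometry; real dimensions are
  twice the complex ones, which explains the factors 2 in eigenvalue counts. The error that comes
  out is d(2+4r)/m twice plus 3dm/n, and 2d \<le> 2^(d+1) together with k \<le> k^d turns it into
  the stated constants.\<close>

lemma ell2_UNIV_iff: "\<phi> \<in> ell2 UNIV \<longleftrightarrow> (\<lambda>x. (cmod (\<phi> x))\<^sup>2) summable_on UNIV"
  by (simp add: ell2_def)

lemma cmod_add_power2_le: "(cmod (a + b))\<^sup>2 \<le> 2 * (cmod a)\<^sup>2 + 2 * (cmod b)\<^sup>2"
proof -
  have "(cmod (a + b))\<^sup>2 \<le> (cmod a + cmod b)\<^sup>2"
    by (intro power_mono norm_triangle_ineq) auto
  also have "\<dots> \<le> 2 * (cmod a)\<^sup>2 + 2 * (cmod b)\<^sup>2"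
    using zero_le_power2[of "cmod a - cmod b"] by (simp add: power2_eq_square algebra_simps)
  finally show ?thesis .
qed

lemma ell2_add:
  assumes "\<phi> \<in> ell2 UNIV" "\<psi> \<in> ell2 UNIV"
  shows "(\<lambda>x. \<phi> x + \<psi> x) \<in> ell2 UNIV"
proof -
  have "(\<lambda>x. 2 * (cmod (\<phi> x))\<^sup>2 + 2 * (cmod (\<psi> x))\<^sup>2) summable_on UNIV"
    using assms by (intro summable_on_add summable_on_cmult_right) (auto simp: ell2_UNIV_iff)
  then show ?thesis
    unfolding ell2_UNIV_iff
    by (rule summable_on_comparison_test) (auto simp: cmod_add_power2_le)
qed

lemma ell2_bounded_mult:
  assumes "\<phi> \<in> ell2 UNIV" "\<And>x. cmod (\<psi> x) \<le> C * cmod (\<phi> x)"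
  shows "\<psi> \<in> ell2 UNIV"
proof -
  have "(\<lambda>x. C\<^sup>2 * (cmod (\<phi> x))\<^sup>2) summable_on UNIV"
    using assms by (intro summable_on_cmult_right) (auto simp: ell2_UNIV_iff)
  then show ?thesis
    unfolding ell2_UNIV_iff
  proof (rule summable_on_comparison_test)
    show "(cmod (\<psi> x))\<^sup>2 \<le> C\<^sup>2 * (cmod (\<phi> x))\<^sup>2" for x
      using power_mono[OF assms(2)[of x], of 2] by (simp add: power_mult_distrib)
  qed auto
qed

lemma ell2_scale: "\<phi> \<in> ell2 UNIV \<Longrightarrow> (\<lambda>x. c * \<phi> x) \<in> ell2 UNIV"
  by (rule ell2_bounded_mult[where C = "cmod c"]) (auto simp: norm_mult)

lemma ell2_prod_summable:
  assumes "\<phi> \<in> ell2 UNIV" "\<psi> \<in> ell2 UNIV"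
  shows "(\<lambda>x. cnj (\<phi> x) * \<psi> x) summable_on UNIV"
proof (rule abs_summable_summable)
  have "(\<lambda>x. (cmod (\<phi> x))\<^sup>2 + (cmod (\<psi> x))\<^sup>2) summable_on UNIV"
    using assms by (intro summable_on_add) (auto simp: ell2_UNIV_iff)
  then show "(\<lambda>x. norm (cnj (\<phi> x) * \<psi> x)) summable_on UNIV"
  proof (rule summable_on_comparison_test)
    show "norm (cnj (\<phi> x) * \<psi> x) \<le> (cmod (\<phi> x))\<^sup>2 + (cmod (\<psi> x))\<^sup>2" for x
    proof -
      have "0 \<le> (cmod (\<phi> x) - cmod (\<psi> x))\<^sup>2" "0 \<le> cmod (\<phi> x) * cmod (\<psi> x)" by auto
      then show ?thesis
        unfolding norm_mult complex_mod_cnj power2_diff by linarith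
    qed
  qed auto
qed

text \<open>One type serves every volume: \<open>ell2 S\<close> for a smaller index set S becomes
  the subspace \<open>lsp S\<close>, so finite and infinite volume operators act on the same vectors
  and extension by zero is the identity.\<close>

typedef 'a l2 = "ell2 (UNIV :: 'a set)" morphisms l2_fun Abs_l2
  by (rule exI[of _ "\<lambda>x. 0"]) (simp add: ell2_UNIV_iff)

setup_lifting type_definition_l2

lemma l2_fun_in [simp]: "l2_fun \<phi> \<in> ell2 UNIV"
  using l2_fun by auto

lemma l2_eqI: "(\<And>x. l2_fun \<phi> x = l2_fun \<psi> x) \<Longrightarrow> \<phi> = \<psi>"
  by (simp add: l2_fun_inject[symmetric] fun_eq_iff)

instantiation l2 :: (type) real_vector
begin
lift_definition zero_l2 :: "'a l2" is "\<lambda>x. 0" by (simp add: ell2_UNIV_iff)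
lift_definition plus_l2 :: "'a l2 \<Rightarrow> 'a l2 \<Rightarrow> 'a l2" is "\<lambda>\<phi> \<psi> x. \<phi> x + \<psi> x" by (rule ell2_add)
lift_definition uminus_l2 :: "'a l2 \<Rightarrow> 'a l2" is "\<lambda>\<phi> x. - \<phi> x" by (simp add: ell2_UNIV_iff)
lift_definition minus_l2 :: "'a l2 \<Rightarrow> 'a l2 \<Rightarrow> 'a l2" is "\<lambda>\<phi> \<psi> x. \<phi> x - \<psi> x"
  using ell2_add[where \<psi> = "\<lambda>x. - \<psi> x" for \<psi>] by (simp add: ell2_UNIV_iff)
lift_definition scaleR_l2 :: "real \<Rightarrow> 'a l2 \<Rightarrow> 'a l2" is "\<lambda>c \<phi> x. of_real c * \<phi> x" by (rule ell2_scale)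
instance
  by standard (transfer; simp add: fun_eq_iff algebra_simps)+
end

text \<open>Only the real part of the Hermitian product is kept, which makes the theory of real
  inner product spaces applicable. The imaginary part is recovered as a product with
  \<open>imul \<phi>\<close>, see \<open>ell2_inner_eq\<close>.\<close>

instantiation l2 :: (type) real_inner
begin
lift_definition inner_l2 :: "'a l2 \<Rightarrow> 'a l2 \<Rightarrow> real" is
  "\<lambda>\<phi> \<psi>. \<Sum>\<^sub>\<infinity>x. Re (cnj (\<phi> x) * \<psi> x)" .
definition norm_l2 :: "'a l2 \<Rightarrow> real" where "norm_l2 \<phi> = sqrt (inner \<phi> \<phi>)"
definition sgn_l2 :: "'a l2 \<Rightarrow> 'a l2" where "sgn_l2 \<phi> = inverse (norm \<phi>) *\<^sub>R \<phi>"
definition dist_l2 :: "'a l2 \<Rightarrow> 'a l2 \<Rightarrow> real" where "dist_l2 \<phi> \<psi> = norm (\<phi> - \<psi>)"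
definition uniformity_l2 :: "('a l2 \<times> 'a l2) filter" where
  "uniformity_l2 = (INF e\<in>{0 <..}. principal {(x, y). dist x y < e})"
definition open_l2 :: "'a l2 set \<Rightarrow> bool" where
  "open_l2 U = (\<forall>x\<in>U. \<forall>\<^sub>F (x', y) in uniformity. x' = x \<longrightarrow> y \<in> U)"
instance
proof
  fix \<phi> \<psi> \<xi> :: "'a l2" and c :: real
  show "inner \<phi> \<psi> = inner \<psi> \<phi>"
    by transfer (auto simp: algebra_simps intro!: infsum_cong)
  show "inner (\<phi> + \<psi>) \<xi> = inner \<phi> \<xi> + inner \<psi> \<xi>"
  proof (transfer, goal_cases)
    case (1 \<phi> \<psi> \<xi>)
    show ?case
      unfolding infsum_add[OF summable_on_Re[OF ell2_prod_summable[OF 1(1,3)]]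
          summable_on_Re[OF ell2_prod_summable[OF 1(2,3)]], symmetric]
      by (intro infsum_cong) (simp add: algebra_simps)
  qed
  show "inner (c *\<^sub>R \<phi>) \<psi> = c * inner \<phi> \<psi>"
    by transfer (auto simp: algebra_simps simp flip: infsum_cmult_right' intro!: infsum_cong)
  show "0 \<le> inner \<phi> \<phi>"
    by transfer (auto intro!: infsum_nonneg)
  show "(inner \<phi> \<phi> = 0) = (\<phi> = 0)"
  proof (transfer, goal_cases)
    case (1 \<phi>)
    have eq: "Re (cnj (\<phi> x) * \<phi> x) = (cmod (\<phi> x))\<^sup>2" for x
      by (simp add: cmod_def power2_eq_square)
    have "\<phi> x = 0" if "(\<Sum>\<^sub>\<infinity>x. (cmod (\<phi> x))\<^sup>2) = 0" for x
    proof -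
      have "(cmod (\<phi> x))\<^sup>2 = 0"
        by (rule nonneg_infsum_le_0D[of "\<lambda>x. (cmod (\<phi> x))\<^sup>2" UNIV])
           (use 1 that in \<open>simp_all add: ell2_UNIV_iff\<close>)
      then show ?thesis by simp
    qed
    then show ?case unfolding eq by fastforce
  qed
  show "norm \<phi> = sqrt (inner \<phi> \<phi>)" by (rule norm_l2_def)
qed (simp_all add: norm_l2_def sgn_l2_def dist_l2_def uniformity_l2_def open_l2_def)
end

lemma l2_fun_zero [simp]: "l2_fun 0 x = 0"
  and l2_fun_add [simp]: "l2_fun (\<phi> + \<psi>) x = l2_fun \<phi> x + l2_fun \<psi> x"
  and l2_fun_diff [simp]: "l2_fun (\<phi> - \<psi>) x = l2_fun \<phi> x - l2_fun \<psi> x"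
  and l2_fun_uminus [simp]: "l2_fun (- \<phi>) x = - l2_fun \<phi> x"
  and l2_fun_scaleR [simp]: "l2_fun (c *\<^sub>R \<phi>) x = of_real c * l2_fun \<phi> x"
  by (simp_all add: zero_l2.rep_eq plus_l2.rep_eq minus_l2.rep_eq uminus_l2.rep_eq scaleR_l2.rep_eq)

lemma l2_fun_sum [simp]: "l2_fun (\<Sum>i\<in>I. f i) x = (\<Sum>i\<in>I. l2_fun (f i) x)"
  by (induction I rule: infinite_finite_induct) auto

lemma inner_l2_eq: "\<phi> \<bullet> \<psi> = (\<Sum>\<^sub>\<infinity>x. Re (cnj (l2_fun \<phi> x) * l2_fun \<psi> x))"
  by (rule inner_l2.rep_eq)

lemma l2_norm_power2: "(norm \<phi>)\<^sup>2 = (\<Sum>\<^sub>\<infinity>x. (cmod (l2_fun \<phi> x))\<^sup>2)"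
  unfolding power2_norm_eq_inner[of \<phi>] inner_l2_eq
  by (intro infsum_cong) (simp only: cmod_power2, simp add: power2_eq_square)

lemma l2_has_sum: "((\<lambda>x. (cmod (l2_fun \<phi> x))\<^sup>2) has_sum (norm \<phi>)\<^sup>2) UNIV"
  unfolding l2_norm_power2 using l2_fun_in[of \<phi>] unfolding ell2_UNIV_iff by (rule has_sum_infsum)

lemma l2_sum_le: "finite F \<Longrightarrow> (\<Sum>x\<in>F. (cmod (l2_fun \<phi> x))\<^sup>2) \<le> (norm \<phi>)\<^sup>2"
  using finite_sum_le_has_sum[OF l2_has_sum] by auto

lemma cmod_l2_fun_le: "cmod (l2_fun \<phi> x) \<le> norm \<phi>"
  using l2_sum_le[of "{x}" \<phi>] by (simp add: power2_le_iff_abs_le)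

lemma ell2_norm_l2_fun: "ell2_norm (l2_fun \<phi>) = norm \<phi>"
  unfolding ell2_norm_def l2_norm_power2[symmetric] by simp

lemma ell2_bounded_sums:
  assumes "\<And>F. finite F \<Longrightarrow> (\<Sum>x\<in>F. (cmod (v x))\<^sup>2) \<le> C"
  shows "v \<in> ell2 UNIV"
  unfolding ell2_UNIV_iff
  using assms by (intro nonneg_bdd_above_summable_on) (auto intro!: bdd_aboveI[of _ C])

lemma l2_fun_Abs: "v \<in> ell2 UNIV \<Longrightarrow> l2_fun (Abs_l2 v) = v"
  by (simp add: Abs_l2_inverse)

lemma norm_l2_le:
  assumes "\<And>F. finite F \<Longrightarrow> (\<Sum>x\<in>F. (cmod (l2_fun \<phi> x))\<^sup>2) \<le> C\<^sup>2" "0 \<le> C"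
  shows "norm \<phi> \<le> C"
proof -
  have "(norm \<phi>)\<^sup>2 \<le> C\<^sup>2"
    by (rule has_sum_le_finite_sums[OF l2_has_sum]) (use assms in auto)
  then show ?thesis using assms(2) by (simp add: power2_le_iff_abs_le)
qed

text \<open>With real scalars only, complex linearity of an operator means real linearity together
  with commutation with this isometry.\<close>

definition imul :: "'a l2 \<Rightarrow> 'a l2" where "imul \<phi> = Abs_l2 (\<lambda>x. \<i> * l2_fun \<phi> x)"

lemma l2_fun_imul [simp]: "l2_fun (imul \<phi>) x = \<i> * l2_fun \<phi> x"
  unfolding imul_def by (subst l2_fun_Abs) (auto intro: ell2_scale)

lemma imul_simps [simp]:
  "imul (\<phi> + \<psi>) = imul \<phi> + imul \<psi>" "imul (\<phi> - \<psi>) = imul \<phi> - imul \<psi>" "imul (- \<phi>) = - imul \<phi>"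
  "imul (c *\<^sub>R \<phi>) = c *\<^sub>R imul \<phi>" "imul (imul \<phi>) = - \<phi>" "imul 0 = 0"
  by (rule l2_eqI; simp add: algebra_simps)+

lemma inner_imul_imul [simp]: "imul \<phi> \<bullet> imul \<psi> = \<phi> \<bullet> \<psi>"
  by (simp add: inner_l2_eq)

lemma inner_imul_right: "\<phi> \<bullet> imul \<psi> = - (imul \<phi> \<bullet> \<psi>)"
  using inner_imul_imul[of \<phi> "imul \<psi>"] by (simp del: inner_imul_imul)

lemma norm_imul [simp]: "norm (imul \<phi>) = norm \<phi>"
  by (simp add: norm_eq_sqrt_inner)

lemma ell2_inner_eq: "ell2_inner (l2_fun \<phi>) (l2_fun \<psi>) = Complex (\<phi> \<bullet> \<psi>) (imul \<phi> \<bullet> \<psi>)"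
proof (rule complex_eqI)
  have s: "(\<lambda>x. cnj (l2_fun \<phi> x) * l2_fun \<psi> x) summable_on UNIV"
    by (rule ell2_prod_summable) auto
  show "Re (ell2_inner (l2_fun \<phi>) (l2_fun \<psi>)) = Re (Complex (\<phi> \<bullet> \<psi>) (imul \<phi> \<bullet> \<psi>))"
    unfolding ell2_inner_def using infsum_Re[OF s] by (simp add: inner_l2_eq)
  show "Im (ell2_inner (l2_fun \<phi>) (l2_fun \<psi>)) = Im (Complex (\<phi> \<bullet> \<psi>) (imul \<phi> \<bullet> \<psi>))"
    unfolding ell2_inner_def using infsum_Im[OF s] by (simp add: inner_l2_eq algebra_simps)
qed

text \<open>\<open>Abs_l2\<close> is meaningful only where the product is square summable. This is
  secured in two ways: g is bounded (\<open>l2_fun_mulop_bounded\<close>), or \<phi> lies in the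
  domain of the potential (\<open>l2_fun_mulop_Hdom\<close>).\<close>

definition mulop :: "('a \<Rightarrow> real) \<Rightarrow> 'a l2 \<Rightarrow> 'a l2" where
  "mulop g \<phi> = Abs_l2 (\<lambda>x. of_real (g x) * l2_fun \<phi> x)"

lemma mulop_in:
  assumes "\<And>x. \<bar>g x\<bar> \<le> C"
  shows "(\<lambda>x. of_real (g x) * l2_fun \<phi> x) \<in> ell2 UNIV"
  by (rule ell2_bounded_mult[where C = C, OF l2_fun_in[of \<phi>]]) (simp add: norm_mult assms mult_right_mono)

lemma l2_fun_mulop_bounded:
  assumes "\<And>x. \<bar>g x\<bar> \<le> C"
  shows "l2_fun (mulop g \<phi>) x = of_real (g x) * l2_fun \<phi> x"
  unfolding mulop_def by (subst l2_fun_Abs[OF mulop_in[OF assms]]) auto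

lemma norm_mulop_le:
  assumes g: "\<And>x. \<bar>g x\<bar> \<le> C"
  shows "norm (mulop g \<phi>) \<le> C * norm \<phi>"
proof -
  have C: "0 \<le> C" using g[of undefined] by linarith
  show ?thesis
  proof (rule norm_l2_le)
    fix F :: "'a set" assume "finite F"
    have "(\<Sum>x\<in>F. (cmod (l2_fun (mulop g \<phi>) x))\<^sup>2) \<le> (\<Sum>x\<in>F. C\<^sup>2 * (cmod (l2_fun \<phi> x))\<^sup>2)"
    proof (rule sum_mono)
      fix x
      have "\<bar>g x\<bar>\<^sup>2 \<le> C\<^sup>2" by (rule power_mono) (auto simp: g)
      then show "(cmod (l2_fun (mulop g \<phi>) x))\<^sup>2 \<le> C\<^sup>2 * (cmod (l2_fun \<phi> x))\<^sup>2"
        by (simp add: l2_fun_mulop_bounded[OF g] norm_mult power_mult_distrib mult_right_mono)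
    qed
    also have "\<dots> \<le> C\<^sup>2 * (norm \<phi>)\<^sup>2"
      using l2_sum_le[OF \<open>finite F\<close>, of \<phi>] by (simp add: mult_left_mono flip: sum_distrib_left)
    finally show "(\<Sum>x\<in>F. (cmod (l2_fun (mulop g \<phi>) x))\<^sup>2) \<le> (C * norm \<phi>)\<^sup>2"
      by (simp add: power_mult_distrib)
  qed (use C in auto)
qed

lemma mulop_inner:
  assumes g: "\<And>x. \<bar>g x\<bar> \<le> C"
  shows "mulop g \<phi> \<bullet> \<psi> = \<phi> \<bullet> mulop g \<psi>"
  unfolding inner_l2_eq by (rule infsum_cong) (simp add: l2_fun_mulop_bounded[OF g] algebra_simps)

abbreviation cutoff :: "'a set \<Rightarrow> 'a l2 \<Rightarrow> 'a l2" where "cutoff F \<equiv> mulop (indicator F)"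

lemma l2_fun_cutoff [simp]: "l2_fun (cutoff F \<phi>) x = (if x \<in> F then l2_fun \<phi> x else 0)"
  by (subst l2_fun_mulop_bounded[where C = 1]) (auto simp: indicator_def)

lemma cutoff_inner: "cutoff F \<phi> \<bullet> \<psi> = \<phi> \<bullet> cutoff F \<psi>"
  by (rule mulop_inner[where C = 1]) (auto simp: indicator_def)

lemma norm_cutoff_le: "norm (cutoff F \<phi>) \<le> norm \<phi>"
  using norm_mulop_le[of "indicator F" 1 \<phi>] by (auto simp: indicator_def)

lemma cutoff_simps [simp]:
  "cutoff F (\<phi> + \<psi>) = cutoff F \<phi> + cutoff F \<psi>" "cutoff F (\<phi> - \<psi>) = cutoff F \<phi> - cutoff F \<psi>"
  "cutoff F (- \<phi>) = - cutoff F \<phi>" "cutoff F (c *\<^sub>R \<phi>) = c *\<^sub>R cutoff F \<phi>"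
  "cutoff F (imul \<phi>) = imul (cutoff F \<phi>)" "cutoff F 0 = 0" "cutoff F (cutoff F \<phi>) = cutoff F \<phi>"
  by (rule l2_eqI; simp)+

definition dl :: "'a \<Rightarrow> 'a l2" where "dl z = Abs_l2 (delta z)"

lemma l2_fun_dl: "l2_fun (dl z) = delta z"
  unfolding dl_def
  by (rule l2_fun_Abs, rule ell2_bounded_sums[where C = 1])
     (auto simp: delta_def if_distrib[of cmod] if_distrib[of "\<lambda>t. t^2"] cong: if_cong)

lemma l2_fun_dl_apply [simp]: "l2_fun (dl z) x = (if x = z then 1 else 0)"
  by (simp add: l2_fun_dl delta_def)

lemma inner_dl: "\<phi> \<bullet> dl z = Re (l2_fun \<phi> z)" and inner_imul_dl: "\<phi> \<bullet> imul (dl z) = Im (l2_fun \<phi> z)"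
proof -
  have "\<phi> \<bullet> \<psi> = Re (cnj (l2_fun \<phi> z) * l2_fun \<psi> z)" if "\<And>x. x \<noteq> z \<Longrightarrow> l2_fun \<psi> x = 0" for \<psi>
  proof -
    have "\<phi> \<bullet> \<psi> = (\<Sum>\<^sub>\<infinity>x\<in>{z}. Re (cnj (l2_fun \<phi> x) * l2_fun \<psi> x))"
      unfolding inner_l2_eq by (rule infsum_cong_neutral) (auto simp: that)
    then show ?thesis by simp
  qed
  from this[of "dl z"] this[of "imul (dl z)"]
  show "\<phi> \<bullet> dl z = Re (l2_fun \<phi> z)" "\<phi> \<bullet> imul (dl z) = Im (l2_fun \<phi> z)" by simp_all
qed

lemma norm_dl [simp]: "norm (dl z) = 1"
  by (simp add: norm_eq_sqrt_inner inner_dl)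

definition lsp :: "'a set \<Rightarrow> 'a l2 set" where "lsp S = {\<phi>. \<forall>x. x \<notin> S \<longrightarrow> l2_fun \<phi> x = 0}"

lemma lsp_closed [intro]:
  "\<phi> \<in> lsp S \<Longrightarrow> \<psi> \<in> lsp S \<Longrightarrow> \<phi> + \<psi> \<in> lsp S" "\<phi> \<in> lsp S \<Longrightarrow> \<psi> \<in> lsp S \<Longrightarrow> \<phi> - \<psi> \<in> lsp S"
  "\<phi> \<in> lsp S \<Longrightarrow> - \<phi> \<in> lsp S"
  "\<phi> \<in> lsp S \<Longrightarrow> c *\<^sub>R \<phi> \<in> lsp S" "\<phi> \<in> lsp S \<Longrightarrow> imul \<phi> \<in> lsp S" "0 \<in> lsp S" "cutoff S \<phi> \<in> lsp S"
  "\<phi> \<in> lsp S \<Longrightarrow> cutoff F \<phi> \<in> lsp S" "z \<in> S \<Longrightarrow> dl z \<in> lsp S"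
  by (auto simp: lsp_def)

lemma lsp_sum [intro]: "(\<And>i. i \<in> I \<Longrightarrow> f i \<in> lsp S) \<Longrightarrow> (\<Sum>i\<in>I. f i) \<in> lsp S"
  by (auto simp: lsp_def intro: sum.neutral)

lemma lsp_UNIV [simp]: "lsp UNIV = UNIV"
  by (auto simp: lsp_def)

lemma lsp_mono: "S \<subseteq> S' \<Longrightarrow> lsp S \<subseteq> lsp S'"
  by (auto simp: lsp_def)

lemma cutoff_lsp: "\<phi> \<in> lsp S \<Longrightarrow> cutoff S \<phi> = \<phi>"
  by (rule l2_eqI) (auto simp: lsp_def)

lemma l2_fun_image_lsp: "l2_fun ` lsp S = ell2 S"
proof
  show "l2_fun ` lsp S \<subseteq> ell2 S"
  proof clarify
    fix \<phi> assume "\<phi> \<in> lsp S"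
    then show "l2_fun \<phi> \<in> ell2 S"
      using l2_fun_in[of \<phi>] unfolding ell2_def lsp_def by (auto intro: summable_on_subset)
  qed
  show "ell2 S \<subseteq> l2_fun ` lsp S"
  proof
    fix v assume v: "v \<in> ell2 S"
    then have "(\<lambda>x. (cmod (v x))\<^sup>2) summable_on UNIV"
      unfolding ell2_def using summable_on_cong_neutral[of UNIV S "\<lambda>x. (cmod (v x))\<^sup>2" "\<lambda>x. (cmod (v x))\<^sup>2"]
      by auto
    then have "l2_fun (Abs_l2 v) = v" by (intro l2_fun_Abs) (simp add: ell2_UNIV_iff)
    moreover have "Abs_l2 v \<in> lsp S" using v calculation by (auto simp: lsp_def ell2_def)
    ultimately show "v \<in> l2_fun ` lsp S" by (metis imageI)
  qed
qed

lemma l2_inner_eqI: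
  assumes "\<phi> \<in> lsp S" "\<psi> \<in> lsp S"
    and "\<And>z. z \<in> S \<Longrightarrow> \<phi> \<bullet> dl z = \<psi> \<bullet> dl z" "\<And>z. z \<in> S \<Longrightarrow> \<phi> \<bullet> imul (dl z) = \<psi> \<bullet> imul (dl z)"
  shows "\<phi> = \<psi>"
proof (rule l2_eqI)
  fix x show "l2_fun \<phi> x = l2_fun \<psi> x"
    using assms by (cases "x \<in> S") (auto simp: lsp_def inner_dl inner_imul_dl complex_eq_iff)
qed

text \<open>Test vectors: the potential is defined on them whatever \<omega> is, they are dense, and
  they decide norms (\<open>l2_norm_bound_dense\<close>) and operator domains
  (\<open>sym_op\<close>).\<close>

definition fsupp :: "'a set \<Rightarrow> 'a l2 set" where
  "fsupp S = {\<phi> \<in> lsp S. finite {x. l2_fun \<phi> x \<noteq> 0}}"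

lemma fsupp_lsp: "\<phi> \<in> fsupp S \<Longrightarrow> \<phi> \<in> lsp S"
  by (simp add: fsupp_def)

lemma fsupp_dl: "z \<in> S \<Longrightarrow> dl z \<in> fsupp S" "z \<in> S \<Longrightarrow> imul (dl z) \<in> fsupp S"
  by (auto simp: fsupp_def)

lemma fsupp_cutoff: "finite F \<Longrightarrow> \<phi> \<in> lsp S \<Longrightarrow> cutoff F \<phi> \<in> fsupp S"
  by (auto simp: fsupp_def intro: finite_subset[of _ F])

lemma fsupp_finite: "finite S \<Longrightarrow> fsupp S = lsp S"
  by (auto simp: fsupp_def lsp_def intro: finite_subset[of _ S])

lemma fsuppE:
  assumes "\<phi> \<in> fsupp S"
  obtains F where "finite F" "F \<subseteq> S" "\<phi> \<in> lsp F" "cutoff F \<phi> = \<phi>"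
proof
  let ?F = "{x. l2_fun \<phi> x \<noteq> 0}"
  show "finite ?F" "?F \<subseteq> S" "\<phi> \<in> lsp ?F" using assms by (auto simp: fsupp_def lsp_def)
  then show "cutoff ?F \<phi> = \<phi>" by (intro cutoff_lsp)
qed

text \<open>The squared distance is the tail of the convergent sum for the squared norm. Convergence
  along the net of finite subsets avoids enumerating the index set.\<close>

lemma cutoff_tendsto:
  fixes \<phi> :: "'a l2"
  shows "((\<lambda>F. cutoff F \<phi>) \<longlongrightarrow> \<phi>) (finite_subsets_at_top UNIV)"
proof -
  have eq: "(norm (cutoff F \<phi> - \<phi>))\<^sup>2 = (norm \<phi>)\<^sup>2 - (\<Sum>x\<in>F. (cmod (l2_fun \<phi> x))\<^sup>2)" if "finite F" for F
  proof -
    have "((\<lambda>x. (cmod (l2_fun (cutoff F \<phi>) x))\<^sup>2) has_sum (\<Sum>x\<in>F. (cmod (l2_fun \<phi> x))\<^sup>2)) UNIV"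
      by (rule has_sum_finite_neutralI[of F]) (use that in auto)
    then have 1: "(norm (cutoff F \<phi>))\<^sup>2 = (\<Sum>x\<in>F. (cmod (l2_fun \<phi> x))\<^sup>2)"
      using l2_has_sum[of "cutoff F \<phi>"] has_sum_unique by blast
    have "cutoff F \<phi> \<bullet> \<phi> = (norm (cutoff F \<phi>))\<^sup>2"
      by (metis cutoff_inner cutoff_simps(7) power2_norm_eq_inner)
    then have "(norm (cutoff F \<phi> - \<phi>))\<^sup>2 = (norm \<phi>)\<^sup>2 - (norm (cutoff F \<phi>))\<^sup>2"
      by (simp add: power2_norm_eq_inner inner_diff_left inner_diff_right inner_commute)
    then show ?thesis using 1 by simp
  qed
  have "((\<lambda>F. (norm \<phi>)\<^sup>2 - (\<Sum>x\<in>F. (cmod (l2_fun \<phi> x))\<^sup>2)) \<longlongrightarrow> (norm \<phi>)\<^sup>2 - (norm \<phi>)\<^sup>2)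
      (finite_subsets_at_top UNIV)"
    using l2_has_sum[of \<phi>] unfolding has_sum_def by (intro tendsto_intros)
  then have "((\<lambda>F. (norm (cutoff F \<phi> - \<phi>))\<^sup>2) \<longlongrightarrow> 0) (finite_subsets_at_top UNIV)"
    unfolding diff_self
    by (rule Lim_transform_eventually) (rule eventually_finite_subsets_at_top_weakI, simp add: eq)
  then have "((\<lambda>F. sqrt ((norm (cutoff F \<phi> - \<phi>))\<^sup>2)) \<longlongrightarrow> sqrt 0) (finite_subsets_at_top UNIV)"
    by (rule tendsto_real_sqrt)
  then show ?thesis by (simp add: tendsto_iff dist_norm)
qed

lemma fsupp_dense:
  assumes "\<phi> \<in> lsp S" "e > 0"
  obtains \<psi> where "\<psi> \<in> fsupp S" "norm (\<phi> - \<psi>) < e" "norm \<psi> \<le> norm \<phi>"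
proof -
  have "eventually (\<lambda>F. finite F \<and> norm (cutoff F \<phi> - \<phi>) < e) (finite_subsets_at_top UNIV)"
    using cutoff_tendsto[of \<phi>] assms(2)
    by (intro eventually_conj) (auto simp: tendsto_iff dist_norm intro: eventually_finite_subsets_at_top_weakI)
  then obtain F where "finite F" "norm (cutoff F \<phi> - \<phi>) < e"
    using eventually_happens'[OF finite_subsets_at_top_neq_bot] by blast
  then show ?thesis
    using that[of "cutoff F \<phi>"] assms fsupp_cutoff norm_cutoff_le by (metis norm_minus_commute)
qed

text \<open>The cutoffs of \<xi> are themselves test vectors, and testing with them bounds every
  finite partial sum of the squared norm. With C = 0 this later proves identities between
  vectors.\<close>

lemma l2_norm_bound_dense:
  assumes "\<xi> \<in> lsp S" "\<And>\<psi>. \<psi> \<in> fsupp S \<Longrightarrow> \<xi> \<bullet> \<psi> \<le> C * norm \<psi>" "0 \<le> C"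
  shows "norm \<xi> \<le> C"
proof (rule norm_l2_le)
  fix F :: "'a set" assume F: "finite F"
  have c: "cutoff F \<xi> \<in> fsupp S" by (rule fsupp_cutoff) (use F assms in auto)
  have "cutoff F \<xi> \<bullet> \<xi> = (norm (cutoff F \<xi>))\<^sup>2"
    by (metis cutoff_inner cutoff_simps(7) power2_norm_eq_inner)
  with assms(2)[OF c] have "norm (cutoff F \<xi>) * norm (cutoff F \<xi>) \<le> C * norm (cutoff F \<xi>)"
    by (simp add: inner_commute power2_eq_square)
  then have "norm (cutoff F \<xi>) \<le> C"
    using assms(3) by (cases "norm (cutoff F \<xi>) = 0") (auto simp: mult_le_cancel_right)
  have "(\<Sum>x\<in>F. (cmod (l2_fun \<xi> x))\<^sup>2) = (\<Sum>x\<in>F. (cmod (l2_fun (cutoff F \<xi>) x))\<^sup>2)"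
    by simp
  also have "\<dots> \<le> (norm (cutoff F \<xi>))\<^sup>2" by (rule l2_sum_le[OF F])
  also have "\<dots> \<le> C\<^sup>2" using \<open>norm (cutoff F \<xi>) \<le> C\<close> by (intro power_mono) auto
  finally show "(\<Sum>x\<in>F. (cmod (l2_fun \<xi> x))\<^sup>2) \<le> C\<^sup>2" .
qed (use assms in auto)

text \<open>A bounded net that converges pointwise converges weakly; this replaces weak compactness
  of the unit ball throughout.\<close>

lemma bounded_pointwise_limit:
  fixes u :: "'b \<Rightarrow> 'a l2"
  assumes G: "G \<noteq> bot" and bd: "\<forall>\<^sub>F i in G. norm (u i) \<le> C"
    and lim: "\<And>x. ((\<lambda>i. l2_fun (u i) x) \<longlongrightarrow> v x) G"
  shows "v \<in> ell2 UNIV" "norm (Abs_l2 v) \<le> C" "((\<lambda>i. \<phi> \<bullet> u i) \<longlongrightarrow> \<phi> \<bullet> Abs_l2 v) G"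
proof -
  have C: "0 \<le> C"
    using eventually_happens'[OF G bd] norm_ge_zero order_trans by blast
  have le: "(\<Sum>x\<in>F. (cmod (v x))\<^sup>2) \<le> C\<^sup>2" if F: "finite F" for F
  proof (rule tendsto_upperbound[OF _ _ G])
    show "((\<lambda>i. \<Sum>x\<in>F. (cmod (l2_fun (u i) x))\<^sup>2) \<longlongrightarrow> (\<Sum>x\<in>F. (cmod (v x))\<^sup>2)) G"
      by (intro tendsto_intros lim)
    show "\<forall>\<^sub>F i in G. (\<Sum>x\<in>F. (cmod (l2_fun (u i) x))\<^sup>2) \<le> C\<^sup>2"
      using bd
    proof eventually_elim
      case (elim i)
      then have "(norm (u i))\<^sup>2 \<le> C\<^sup>2" by (intro power_mono) auto
      then show ?case using l2_sum_le[OF F, of "u i"] by linarith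
    qed
  qed
  show v: "v \<in> ell2 UNIV" using le by (rule ell2_bounded_sums)
  show nv: "norm (Abs_l2 v) \<le> C" using le C by (intro norm_l2_le) (auto simp: l2_fun_Abs[OF v])
  \<comment> \<open>Against a finitely supported vector the pairing is a finite sum of coordinates,
    so pointwise convergence suffices; density and the uniform bound do the rest.\<close>
  have fs: "((\<lambda>i. \<phi> \<bullet> u i) \<longlongrightarrow> \<phi> \<bullet> Abs_l2 v) G" if \<phi>: "\<phi> \<in> fsupp UNIV" for \<phi>
  proof -
    obtain F where F: "finite F" "\<phi> \<in> lsp F" using \<phi> by (rule fsuppE)
    have *: "\<phi> \<bullet> w = (\<Sum>x\<in>F. Re (cnj (l2_fun \<phi> x) * l2_fun w x))" for w
    proof -
      have "\<phi> \<bullet> w = (\<Sum>\<^sub>\<infinity>x\<in>F. Re (cnj (l2_fun \<phi> x) * l2_fun w x))"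
        unfolding inner_l2_eq using F by (intro infsum_cong_neutral) (auto simp: lsp_def)
      then show ?thesis using F by simp
    qed
    show ?thesis unfolding * l2_fun_Abs[OF v] by (intro tendsto_intros lim)
  qed
  show "((\<lambda>i. \<phi> \<bullet> u i) \<longlongrightarrow> \<phi> \<bullet> Abs_l2 v) G"
  proof (rule tendstoI)
    fix e :: real assume e: "e > 0"
    \<comment> \<open>The summand 1 keeps the denominator positive when C is 0.\<close>
    define d where "d = e / (3 * (C + 1))"
    have d: "d > 0" "d * C \<le> e / 3" using e C by (auto simp: d_def field_simps)
    obtain \<psi> where \<psi>: "\<psi> \<in> fsupp UNIV" "norm (\<phi> - \<psi>) < d"
      using fsupp_dense[of \<phi> UNIV d] d by auto
    have small: "\<bar>\<phi> \<bullet> w - \<psi> \<bullet> w\<bar> \<le> e / 3" if "norm w \<le> C" for w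
    proof -
      have "\<bar>\<phi> \<bullet> w - \<psi> \<bullet> w\<bar> \<le> norm (\<phi> - \<psi>) * norm w"
        using Cauchy_Schwarz_ineq2[of "\<phi> - \<psi>" w] by (simp add: inner_diff_left)
      also have "\<dots> \<le> d * C" using \<psi> that d by (intro mult_mono) auto
      finally show ?thesis using d by simp
    qed
    show "\<forall>\<^sub>F i in G. dist (\<phi> \<bullet> u i) (\<phi> \<bullet> Abs_l2 v) < e"
      using bd tendstoD[OF fs[OF \<psi>(1)] divide_pos_pos[OF e zero_less_numeral[of "num.Bit1 num.One"]]]
    proof (eventually_elim)
      case (elim i)
      then show ?case using small[OF elim(1)] small[OF nv] unfolding dist_real_def by linarith
    qed
  qed
qed

subsection \<open>Spectral families\<close>

definition oproj :: "'a set \<Rightarrow> ('a l2 \<Rightarrow> 'a l2) \<Rightarrow> bool" where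
  "oproj S P \<longleftrightarrow>
     (\<forall>\<phi>\<in>lsp S. P \<phi> \<in> lsp S \<and> P (P \<phi>) = P \<phi> \<and> P (imul \<phi>) = imul (P \<phi>) \<and> (\<forall>c. P (c *\<^sub>R \<phi>) = c *\<^sub>R P \<phi>)) \<and>
     (\<forall>\<phi>\<in>lsp S. \<forall>\<psi>\<in>lsp S. P (\<phi> + \<psi>) = P \<phi> + P \<psi> \<and> P \<phi> \<bullet> \<psi> = \<phi> \<bullet> P \<psi>)"

lemma oprojD:
  assumes "oproj S P" "\<phi> \<in> lsp S"
  shows "P \<phi> \<in> lsp S" "P (P \<phi>) = P \<phi>" "P (imul \<phi>) = imul (P \<phi>)" "P (c *\<^sub>R \<phi>) = c *\<^sub>R P \<phi>"
    "\<psi> \<in> lsp S \<Longrightarrow> P (\<phi> + \<psi>) = P \<phi> + P \<psi>" "\<psi> \<in> lsp S \<Longrightarrow> P (\<phi> - \<psi>) = P \<phi> - P \<psi>"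
    "\<psi> \<in> lsp S \<Longrightarrow> P \<phi> \<bullet> \<psi> = \<phi> \<bullet> P \<psi>"
proof -
  show *: "P \<phi> \<in> lsp S" "P (P \<phi>) = P \<phi>" "P (imul \<phi>) = imul (P \<phi>)" "P (c *\<^sub>R \<phi>) = c *\<^sub>R P \<phi>"
    "\<psi> \<in> lsp S \<Longrightarrow> P (\<phi> + \<psi>) = P \<phi> + P \<psi>"  "\<psi> \<in> lsp S \<Longrightarrow> P \<phi> \<bullet> \<psi> = \<phi> \<bullet> P \<psi>"
    using assms unfolding oproj_def by blast+
  show "P (\<phi> - \<psi>) = P \<phi> - P \<psi>" if "\<psi> \<in> lsp S"
  proof -
    have "P (\<phi> + (-1) *\<^sub>R \<psi>) = P \<phi> + (-1) *\<^sub>R P \<psi>"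
      using assms that unfolding oproj_def by (metis lsp_closed(4))
    then show ?thesis by simp
  qed
qed

lemma oproj_inner:
  assumes "oproj S P" "\<phi> \<in> lsp S"
  shows "\<phi> \<bullet> P \<phi> = (norm (P \<phi>))\<^sup>2"
  using oprojD(7)[OF assms oprojD(1)[OF assms]] oprojD(2)[OF assms]
  by (simp add: power2_norm_eq_inner)

lemma oproj_norm:
  assumes "oproj S P" "\<phi> \<in> lsp S"
  shows "(norm \<phi>)\<^sup>2 = (norm (P \<phi>))\<^sup>2 + (norm (\<phi> - P \<phi>))\<^sup>2" "norm (P \<phi>) \<le> norm \<phi>"
    "norm (\<phi> - P \<phi>) \<le> norm \<phi>"
proof -
  show 1: "(norm \<phi>)\<^sup>2 = (norm (P \<phi>))\<^sup>2 + (norm (\<phi> - P \<phi>))\<^sup>2"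
    using oproj_inner[OF assms]
    by (simp add: power2_norm_eq_inner inner_diff_left inner_diff_right inner_commute)
  show "norm (P \<phi>) \<le> norm \<phi>" "norm (\<phi> - P \<phi>) \<le> norm \<phi>"
    by (rule power2_le_imp_le; simp add: 1)+
qed

lemma oproj_compl:
  assumes P: "oproj S P"
  shows "oproj S (\<lambda>\<phi>. \<phi> - P \<phi>)"
  unfolding oproj_def
proof (intro conjI ballI allI)
  fix \<phi> \<psi> c assume \<phi>: "\<phi> \<in> lsp S"
  note D = oprojD[OF P \<phi>]
  show "\<phi> - P \<phi> \<in> lsp S" using \<phi> D(1) by blast
  show "\<phi> - P \<phi> - P (\<phi> - P \<phi>) = \<phi> - P \<phi>" using D(6)[OF D(1)] D(2) by simp
  show "imul \<phi> - P (imul \<phi>) = imul (\<phi> - P \<phi>)" using D(3) by simp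
  show "c *\<^sub>R \<phi> - P (c *\<^sub>R \<phi>) = c *\<^sub>R (\<phi> - P \<phi>)" using D(4) by (simp add: scaleR_right_diff_distrib)
  assume \<psi>: "\<psi> \<in> lsp S"
  show "\<phi> + \<psi> - P (\<phi> + \<psi>) = \<phi> - P \<phi> + (\<psi> - P \<psi>)" using D(5)[OF \<psi>] by simp
  show "(\<phi> - P \<phi>) \<bullet> \<psi> = \<phi> \<bullet> (\<psi> - P \<psi>)" using D(7)[OF \<psi>] by (simp add: inner_diff_left inner_diff_right)
qed

definition roi :: "'a set \<Rightarrow> (real \<Rightarrow> 'a l2 \<Rightarrow> 'a l2) \<Rightarrow> bool" where
  "roi S Q \<longleftrightarrow> (\<forall>x. oproj S (Q x)) \<and>
     (\<forall>\<phi>\<in>lsp S. (\<forall>x y. Q x (Q y \<phi>) = Q (min x y) \<phi>) \<and>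
        (\<forall>x. ((\<lambda>y. Q y \<phi>) \<longlongrightarrow> Q x \<phi>) (at_right x)) \<and>
        ((\<lambda>y. Q y \<phi>) \<longlongrightarrow> 0) at_bot \<and> ((\<lambda>y. Q y \<phi>) \<longlongrightarrow> \<phi>) at_top)"

abbreviation smeas :: "(real \<Rightarrow> 'a l2 \<Rightarrow> 'a l2) \<Rightarrow> 'a l2 \<Rightarrow> real measure" where
  "smeas Q \<phi> \<equiv> interval_measure (\<lambda>x. \<phi> \<bullet> Q x \<phi>)"

text \<open>The clause with \<open>imul\<close> is the vanishing of the imaginary part in the
  complex equation of \<open>spectral_family\<close>.\<close>

definition sfam :: "'a set \<Rightarrow> 'a l2 set \<Rightarrow> ('a l2 \<Rightarrow> 'a l2) \<Rightarrow> (real \<Rightarrow> 'a l2 \<Rightarrow> 'a l2) \<Rightarrow> bool" where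
  "sfam S D T Q \<longleftrightarrow> roi S Q \<and> D = {\<phi> \<in> lsp S. integrable (smeas Q \<phi>) (\<lambda>t. t\<^sup>2)} \<and>
     (\<forall>\<phi>\<in>D. T \<phi> \<in> lsp S \<and> imul \<phi> \<bullet> T \<phi> = 0 \<and> \<phi> \<bullet> T \<phi> = (\<integral>t. t \<partial>(smeas Q \<phi>)))"

text \<open>A description of the spectral family that mentions no integrals and is stable under
  weak limits.\<close>

definition pfam :: "'a set \<Rightarrow> 'a l2 set \<Rightarrow> ('a l2 \<Rightarrow> 'a l2) \<Rightarrow> (real \<Rightarrow> 'a l2 \<Rightarrow> 'a l2) \<Rightarrow> bool" where
  "pfam S D T Q \<longleftrightarrow> roi S Q \<and>
     (\<forall>\<phi>\<in>D. \<forall>x. Q x \<phi> \<in> D \<and> T (Q x \<phi>) = Q x (T \<phi>) \<and>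
        (Q x \<phi> = \<phi> \<longrightarrow> \<phi> \<bullet> T \<phi> \<le> x * (norm \<phi>)\<^sup>2) \<and>
        (Q x \<phi> = 0 \<longrightarrow> \<phi> \<bullet> T \<phi> \<ge> x * (norm \<phi>)\<^sup>2))"

text \<open>\<open>T_max\<close> says that D contains the domain of the adjoint of T restricted to
  finitely supported vectors. Together with symmetry this is self-adjointness, in a form that can be
  checked by testing with vectors on which T is explicit.\<close>

locale sym_op =
  fixes S :: "'a set" and D :: "'a l2 set" and T :: "'a l2 \<Rightarrow> 'a l2"
  assumes D_lsp: "D \<subseteq> lsp S" and fsupp_D: "fsupp S \<subseteq> D"
    and D_add: "\<phi> \<in> D \<Longrightarrow> \<psi> \<in> D \<Longrightarrow> \<phi> + \<psi> \<in> D" and D_scale: "\<phi> \<in> D \<Longrightarrow> c *\<^sub>R \<phi> \<in> D"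
    and D_imul: "\<phi> \<in> D \<Longrightarrow> imul \<phi> \<in> D"
    and T_lsp: "\<phi> \<in> D \<Longrightarrow> T \<phi> \<in> lsp S"
    and T_add: "\<phi> \<in> D \<Longrightarrow> \<psi> \<in> D \<Longrightarrow> T (\<phi> + \<psi>) = T \<phi> + T \<psi>"
    and T_scale: "\<phi> \<in> D \<Longrightarrow> T (c *\<^sub>R \<phi>) = c *\<^sub>R T \<phi>"
    and T_imul: "\<phi> \<in> D \<Longrightarrow> T (imul \<phi>) = imul (T \<phi>)"
    and T_sym: "\<phi> \<in> D \<Longrightarrow> \<psi> \<in> D \<Longrightarrow> T \<phi> \<bullet> \<psi> = \<phi> \<bullet> T \<psi>"
    and T_max: "\<phi> \<in> lsp S \<Longrightarrow> (\<And>\<psi>. \<psi> \<in> fsupp S \<Longrightarrow> T \<psi> \<bullet> \<phi> \<le> C * norm \<psi>) \<Longrightarrow> \<phi> \<in> D"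
begin

lemma D_diff: "\<phi> \<in> D \<Longrightarrow> \<psi> \<in> D \<Longrightarrow> \<phi> - \<psi> \<in> D"
  using D_add[of \<phi> "(-1) *\<^sub>R \<psi>"] D_scale[of \<psi> "-1"] by simp

lemma T_diff: "\<phi> \<in> D \<Longrightarrow> \<psi> \<in> D \<Longrightarrow> T (\<phi> - \<psi>) = T \<phi> - T \<psi>"
  using T_add[of \<phi> "(-1) *\<^sub>R \<psi>"] D_scale[of \<psi> "-1"] T_scale[of \<psi> "-1"] by simp

lemma imul_T: "\<phi> \<in> D \<Longrightarrow> imul \<phi> \<bullet> T \<phi> = 0"
  using T_sym[of "imul \<phi>" \<phi>] T_imul[of \<phi>] D_imul[of \<phi>] inner_imul_right[of \<phi> "T \<phi>"]
  by (simp add: inner_commute)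

end

text \<open>Cauchy--Schwarz for a semidefinite form, stated for the polynomial t -> q(v + t u) so
  that it applies to forms that are not inner products.\<close>

lemma nonneg_quadratic_discriminant:
  fixes A B C :: real
  assumes "\<And>t. 0 \<le> A + 2 * t * B + t\<^sup>2 * C"
  shows "B\<^sup>2 \<le> A * C"
proof (cases "C = 0")
  case True
  have "B = 0"
  proof (rule ccontr)
    assume "B \<noteq> 0"
    then show False using assms[of "- (A + 1) / (2 * B)"] True by (simp add: field_simps)
  qed
  then show ?thesis using True by simp
next
  case False
  have "C > 0"
  proof (rule ccontr)
    assume "\<not> C > 0"
    then have C: "C < 0" using False by simp
    \<comment> \<open>Large enough for the negative quadratic term to outweigh the linear and the
      constant one.\<close>
    define t where "t = (\<bar>A\<bar> + 2 * \<bar>B\<bar> + 1) / (-C) + 1"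
    have t: "t \<ge> 1" using C by (simp add: t_def divide_nonneg_neg)
    have "t * (-C) \<ge> \<bar>A\<bar> + 2 * \<bar>B\<bar> + 1" using C by (simp add: t_def field_simps)
    then have "t * (t * (-C)) \<ge> t * (\<bar>A\<bar> + 2 * \<bar>B\<bar> + 1)" using t by (intro mult_left_mono) auto
    moreover have "t * \<bar>A\<bar> \<ge> \<bar>A\<bar>" using t by (metis abs_ge_zero mult.commute mult_right_mono mult_1)
    moreover have "t * B \<le> t * \<bar>B\<bar>" using t by (intro mult_left_mono) auto
    moreover have "t * (t * (-C)) = - (t\<^sup>2 * C)" by (simp add: power2_eq_square)
    moreover have "t * (\<bar>A\<bar> + 2 * \<bar>B\<bar> + 1) = t * \<bar>A\<bar> + 2 * (t * \<bar>B\<bar>) + t" by (simp add: algebra_simps)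
    moreover have "2 * t * B = 2 * (t * B)" by simp
    ultimately show False using assms[of t] t by linarith
  qed
  then show ?thesis using assms[of "- B / C"] by (simp add: field_simps power2_eq_square)
qed

section \<open>Spectral measures of vectors\<close>

context
  fixes S :: "'a set" and Q :: "real \<Rightarrow> 'a l2 \<Rightarrow> 'a l2"
  assumes roi: "roi S Q"
begin

lemma roi_oproj: "oproj S (Q x)"
  using roi by (simp add: roi_def)

lemma roi_lsp: "\<phi> \<in> lsp S \<Longrightarrow> Q x \<phi> \<in> lsp S"
  by (rule oprojD[OF roi_oproj])

lemma roi_min: "\<phi> \<in> lsp S \<Longrightarrow> Q x (Q y \<phi>) = Q (min x y) \<phi>"
  using roi by (simp add: roi_def)

lemma roi_linear:
  assumes "\<phi> \<in> lsp S" "\<psi> \<in> lsp S"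
  shows "Q x (\<phi> + \<psi>) = Q x \<phi> + Q x \<psi>" "Q x (\<phi> - \<psi>) = Q x \<phi> - Q x \<psi>" "Q x \<phi> \<bullet> \<psi> = \<phi> \<bullet> Q x \<psi>"
  using oprojD[OF roi_oproj assms(1)] assms by blast+

lemma roi_eq_le: "\<phi> \<in> lsp S \<Longrightarrow> Q x \<phi> = \<phi> \<Longrightarrow> x \<le> y \<Longrightarrow> Q y \<phi> = \<phi>"
  by (metis min.absorb2 roi_min)

lemma roi_zero_le: "\<phi> \<in> lsp S \<Longrightarrow> Q y \<phi> = 0 \<Longrightarrow> x \<le> y \<Longrightarrow> Q x \<phi> = 0"
proof -
  assume "\<phi> \<in> lsp S" "Q y \<phi> = 0" "x \<le> y"
  then have "Q x \<phi> = Q x 0" using roi_min[of \<phi> x y] by (simp add: min_def)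
  also have "\<dots> = 0" using oprojD(4)[OF roi_oproj lsp_closed(6)[of S], of x 0] by simp
  finally show ?thesis .
qed

lemma roi_inner: "\<phi> \<in> lsp S \<Longrightarrow> \<phi> \<bullet> Q x \<phi> = (norm (Q x \<phi>))\<^sup>2"
  by (rule oproj_inner[OF roi_oproj])

lemma roi_tendsto:
  assumes "\<phi> \<in> lsp S"
  shows "((\<lambda>y. Q y \<phi>) \<longlongrightarrow> Q x \<phi>) (at_right x)" "((\<lambda>y. Q y \<phi>) \<longlongrightarrow> 0) at_bot"
    "((\<lambda>y. Q y \<phi>) \<longlongrightarrow> \<phi>) at_top"
  using roi assms by (auto simp: roi_def)

lemma roi_mono: "\<phi> \<in> lsp S \<Longrightarrow> x \<le> y \<Longrightarrow> \<phi> \<bullet> Q x \<phi> \<le> \<phi> \<bullet> Q y \<phi>"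
  unfolding roi_inner
proof (rule power_mono)
  assume "\<phi> \<in> lsp S" "x \<le> y"
  then show "norm (Q x \<phi>) \<le> norm (Q y \<phi>)"
    using oproj_norm(2)[OF roi_oproj roi_lsp, of \<phi> x y] roi_min[of \<phi> x y] by (simp add: min_def)
qed auto

lemma smeas_properties:
  assumes \<phi>: "\<phi> \<in> lsp S"
  shows "continuous (at_right a) (\<lambda>x. \<phi> \<bullet> Q x \<phi>)" "((\<lambda>x. \<phi> \<bullet> Q x \<phi>) \<longlongrightarrow> 0) at_bot"
    "((\<lambda>x. \<phi> \<bullet> Q x \<phi>) \<longlongrightarrow> (norm \<phi>)\<^sup>2) at_top"
    "finite_borel_measure (smeas Q \<phi>)" "measure (smeas Q \<phi>) UNIV = (norm \<phi>)\<^sup>2"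
    "a \<le> b \<Longrightarrow> measure (smeas Q \<phi>) {a<..b} = \<phi> \<bullet> Q b \<phi> - \<phi> \<bullet> Q a \<phi>"
    "measure (smeas Q \<phi>) {..b} = \<phi> \<bullet> Q b \<phi>"
proof -
  note lims = roi_tendsto[OF \<phi>]
  show c: "continuous (at_right a) (\<lambda>x. \<phi> \<bullet> Q x \<phi>)" for a
    using tendsto_inner[OF tendsto_const lims(1)] by (simp add: continuous_within)
  show bot: "((\<lambda>x. \<phi> \<bullet> Q x \<phi>) \<longlongrightarrow> 0) at_bot"
    using tendsto_inner[OF tendsto_const[of \<phi>] lims(2)] by simp
  show top: "((\<lambda>x. \<phi> \<bullet> Q x \<phi>) \<longlongrightarrow> (norm \<phi>)\<^sup>2) at_top"
    using tendsto_inner[OF tendsto_const[of \<phi>] lims(3)] by (simp add: power2_norm_eq_inner)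
  note mono = roi_mono[OF \<phi>]
  show fin: "finite_borel_measure (smeas Q \<phi>)"
    by (rule finite_borel_measure_interval_measure[OF mono c bot top]) auto
  interpret finite_borel_measure "smeas Q \<phi>" by fact
  show "measure (smeas Q \<phi>) UNIV = (norm \<phi>)\<^sup>2"
    using interval_measure_UNIV[OF mono c bot top] by (simp add: measure_def)
  show Ioc: "measure (smeas Q \<phi>) {a<..b} = \<phi> \<bullet> Q b \<phi> - \<phi> \<bullet> Q a \<phi>" if "a \<le> b" for a b
    using that by (rule measure_interval_measure_Ioc[OF _ mono c])
  \<comment> \<open>The distribution function and the Stieltjes function have the same increments
    and both vanish at minus infinity, hence they agree.\<close>
  have "((\<lambda>a. cdf (smeas Q \<phi>) b - cdf (smeas Q \<phi>) a) \<longlongrightarrow> cdf (smeas Q \<phi>) b - 0) at_bot"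
    by (intro tendsto_intros cdf_lim_at_bot)
  moreover have "((\<lambda>a. \<phi> \<bullet> Q b \<phi> - \<phi> \<bullet> Q a \<phi>) \<longlongrightarrow> \<phi> \<bullet> Q b \<phi> - 0) at_bot"
    by (intro tendsto_intros bot)
  moreover have "\<forall>\<^sub>F a in at_bot. \<phi> \<bullet> Q b \<phi> - \<phi> \<bullet> Q a \<phi> = cdf (smeas Q \<phi>) b - cdf (smeas Q \<phi>) a"
    using eventually_le_at_bot[of "b - 1"]
    by eventually_elim (use Ioc in \<open>simp add: cdf_diff_eq\<close>)
  ultimately have "cdf (smeas Q \<phi>) b = \<phi> \<bullet> Q b \<phi>"
    using tendsto_unique[OF trivial_limit_at_bot_linorder] Lim_transform_eventually by fastforce
  then show "measure (smeas Q \<phi>) {..b} = \<phi> \<bullet> Q b \<phi>" by (simp add: cdf_def)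
qed

text \<open>Finite Borel measures on the line are determined by their distribution functions, so a
  spectral measure is recognised as a restriction of another one by evaluating it on half
  lines.\<close>

lemma smeas_restrict:
  assumes \<phi>: "\<phi> \<in> lsp S" and \<psi>: "\<psi> \<in> lsp S" and I: "I \<in> sets borel"
    and eq: "\<And>x. \<psi> \<bullet> Q x \<psi> = measure (smeas Q \<phi>) (I \<inter> {..x})"
  shows "smeas Q \<psi> = density (smeas Q \<phi>) (\<lambda>x. ennreal (indicator I x))"
proof (rule cdf_unique')
  interpret \<phi>: finite_borel_measure "smeas Q \<phi>" by (rule smeas_properties[OF \<phi>])
  show "finite_borel_measure (smeas Q \<psi>)" by (rule smeas_properties[OF \<psi>])
  let ?M = "density (smeas Q \<phi>) (\<lambda>x. ennreal (indicator I x))"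
  have em: "emeasure ?M A = emeasure (smeas Q \<phi>) (I \<inter> A)" if "A \<in> sets borel" for A
    using that I by (simp add: emeasure_density ennreal_indicator flip: indicator_inter_arith)
  interpret M: finite_measure ?M
    by (rule finite_measureI) (use em[of UNIV] in simp)
  show "finite_borel_measure ?M" by unfold_locales auto
  show "cdf (smeas Q \<psi>) = cdf ?M"
  proof
    fix x
    have "cdf (smeas Q \<psi>) x = measure (smeas Q \<phi>) (I \<inter> {..x})"
      unfolding cdf_def by (subst smeas_properties(7)[OF \<psi>]) (rule eq)
    also have "\<dots> = cdf ?M x"
      unfolding cdf_def measure_def by (subst em) auto
    finally show "cdf (smeas Q \<psi>) x = cdf ?M x" .
  qed
qed

text \<open>Below b the projections see only \<phi>; above b they fix \<phi> and see only \<psi>.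
  Hence the two spectral measures are restrictions of that of the sum to complementary half lines,
  and integrals add up without cross terms.\<close>

lemma smeas_split:
  assumes \<phi>: "\<phi> \<in> lsp S" "Q b \<phi> = \<phi>" and \<psi>: "\<psi> \<in> lsp S" "Q b \<psi> = 0"
  shows "smeas Q \<phi> = density (smeas Q (\<phi> + \<psi>)) (\<lambda>x. ennreal (indicator {..b} x))"
    "smeas Q \<psi> = density (smeas Q (\<phi> + \<psi>)) (\<lambda>x. ennreal (indicator {b<..} x))"
    "\<phi> \<bullet> \<psi> = 0"
proof -
  have s: "\<phi> + \<psi> \<in> lsp S" using \<phi> \<psi> by blast
  show orth: "\<phi> \<bullet> \<psi> = 0" using roi_linear(3)[of \<phi> \<psi> b] \<phi> \<psi> by simp
  have lo: "(\<phi> + \<psi>) \<bullet> Q x (\<phi> + \<psi>) = \<phi> \<bullet> Q x \<phi>" "\<psi> \<bullet> Q x \<psi> = 0" if "x \<le> b" for x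
  proof -
    have z: "Q x \<psi> = 0" by (rule roi_zero_le[OF \<psi> that])
    show "\<psi> \<bullet> Q x \<psi> = 0" using z by simp
    have "\<psi> \<bullet> Q x \<phi> = 0" using roi_linear(3)[OF \<psi>(1) \<phi>(1), of x] z by simp
    then show "(\<phi> + \<psi>) \<bullet> Q x (\<phi> + \<psi>) = \<phi> \<bullet> Q x \<phi>"
      using z by (simp add: roi_linear \<phi> \<psi> inner_add_left)
  qed
  have hi: "(\<phi> + \<psi>) \<bullet> Q x (\<phi> + \<psi>) = \<phi> \<bullet> \<phi> + \<psi> \<bullet> Q x \<psi>" "Q x \<phi> = \<phi>" if "b \<le> x" for x
  proof -
    show e: "Q x \<phi> = \<phi>" by (rule roi_eq_le[OF \<phi> that])
    have "\<phi> \<bullet> Q x \<psi> = 0" using roi_linear(3)[OF \<phi>(1) \<psi>(1), of x] e orth by simp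
    then show "(\<phi> + \<psi>) \<bullet> Q x (\<phi> + \<psi>) = \<phi> \<bullet> \<phi> + \<psi> \<bullet> Q x \<psi>"
      using e orth by (simp add: roi_linear \<phi> \<psi> inner_add_left inner_add_right inner_commute)
  qed
  show "smeas Q \<phi> = density (smeas Q (\<phi> + \<psi>)) (\<lambda>x. ennreal (indicator {..b} x))"
  proof (rule smeas_restrict[OF s \<phi>(1)])
    fix x
    have "{..b} \<inter> {..x} = {..min b x}" by auto
    then show "\<phi> \<bullet> Q x \<phi> = measure (smeas Q (\<phi> + \<psi>)) ({..b} \<inter> {..x})"
      using lo[of "min b x"] hi(2)[of x] \<phi> by (auto simp: smeas_properties(7)[OF s] min_def)
  qed auto
  show "smeas Q \<psi> = density (smeas Q (\<phi> + \<psi>)) (\<lambda>x. ennreal (indicator {b<..} x))"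
  proof (rule smeas_restrict[OF s \<psi>(1)])
    fix x
    have "{b<..} \<inter> {..x} = {b<..x}" by auto
    then show "\<psi> \<bullet> Q x \<psi> = measure (smeas Q (\<phi> + \<psi>)) ({b<..} \<inter> {..x})"
      using lo[of b] lo(2)[of x] hi[of x] \<phi>
      by (cases "b \<le> x") (auto simp: smeas_properties(6)[OF s])
  qed auto
qed

lemma smeas_window:
  assumes \<phi>: "\<phi> \<in> lsp S" and "a \<le> b"
  shows "smeas Q (Q b \<phi> - Q a \<phi>) = density (smeas Q \<phi>) (\<lambda>x. ennreal (indicator {a<..b} x))"
proof (rule smeas_restrict[OF \<phi>])
  note l = roi_lsp[OF \<phi>]
  show "Q b \<phi> - Q a \<phi> \<in> lsp S" using l by blast
  fix x
  have "{a<..b} \<inter> {..x} = {a<..min b x}" by auto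
  moreover have "(Q b \<phi> - Q a \<phi>) \<bullet> Q x (Q b \<phi> - Q a \<phi>) = \<phi> \<bullet> (Q (min b x) \<phi> - Q (min a x) \<phi>)"
    using \<open>a \<le> b\<close> roi_min[OF \<phi>] roi_linear(3)[OF \<phi>]
    by (simp add: roi_linear l inner_diff_left inner_diff_right roi_linear(3)[OF \<phi> l] roi_min[OF \<phi>])
       (auto simp: min_def)
  ultimately show "(Q b \<phi> - Q a \<phi>) \<bullet> Q x (Q b \<phi> - Q a \<phi>) = measure (smeas Q \<phi>) ({a<..b} \<inter> {..x})"
    using \<open>a \<le> b\<close> by (cases "a \<le> x") (auto simp: smeas_properties(6)[OF \<phi>] inner_diff_right min_def)
qed auto

lemma smeas_AE:
  assumes \<phi>: "\<phi> \<in> lsp S"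
  shows "Q b \<phi> = \<phi> \<Longrightarrow> AE t in smeas Q \<phi>. t \<le> b" "Q b \<phi> = 0 \<Longrightarrow> AE t in smeas Q \<phi>. t > b"
proof -
  interpret finite_borel_measure "smeas Q \<phi>" by (rule smeas_properties[OF \<phi>])
  show "AE t in smeas Q \<phi>. t > b" if "Q b \<phi> = 0"
  proof (rule AE_I)
    show "emeasure (smeas Q \<phi>) {..b} = 0"
      using smeas_properties(7)[OF \<phi>, of b] that by (simp add: emeasure_eq_measure)
  qed auto
  show "AE t in smeas Q \<phi>. t \<le> b" if "Q b \<phi> = \<phi>"
  proof (rule AE_I)
    have "measure (smeas Q \<phi>) (UNIV - {..b}) = measure (smeas Q \<phi>) UNIV - measure (smeas Q \<phi>) {..b}"
      by (subst finite_measure_Diff) auto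
    then show "emeasure (smeas Q \<phi>) (UNIV - {..b}) = 0"
      using that by (simp add: emeasure_eq_measure smeas_properties[OF \<phi>] power2_norm_eq_inner)
  qed auto
qed

lemma smeas_window_integral:
  fixes f :: "real \<Rightarrow> real"
  assumes \<phi>: "\<phi> \<in> lsp S" and "a \<le> b" and f[measurable]: "f \<in> borel_measurable borel"
  shows "integrable (smeas Q (Q b \<phi> - Q a \<phi>)) f \<longleftrightarrow> integrable (smeas Q \<phi>) (\<lambda>t. indicator {a<..b} t * f t)"
    "(\<integral>t. f t \<partial>smeas Q (Q b \<phi> - Q a \<phi>)) = (\<integral>t. indicator {a<..b} t * f t \<partial>smeas Q \<phi>)"
  unfolding smeas_window[OF assms(1,2)]
  by (subst integrable_density integral_density; simp)+

lemma smeas_split_integral: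
  fixes f :: "real \<Rightarrow> real"
  assumes \<phi>: "\<phi> \<in> lsp S" "Q b \<phi> = \<phi>" and \<psi>: "\<psi> \<in> lsp S" "Q b \<psi> = 0"
    and f: "integrable (smeas Q (\<phi> + \<psi>)) f"
  shows "integrable (smeas Q \<phi>) f" "integrable (smeas Q \<psi>) f"
    "(\<integral>t. f t \<partial>smeas Q (\<phi> + \<psi>)) = (\<integral>t. f t \<partial>smeas Q \<phi>) + (\<integral>t. f t \<partial>smeas Q \<psi>)"
proof -
  have [measurable]: "f \<in> borel_measurable borel" using f by (auto simp: integrable_iff_bounded)
  have i: "integrable (smeas Q (\<phi> + \<psi>)) (\<lambda>t. indicator {..b} t * f t)"
    "integrable (smeas Q (\<phi> + \<psi>)) (\<lambda>t. indicator {b<..} t * f t)"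
    using integrable_mult_indicator[OF _ f, of "{..b}"] integrable_mult_indicator[OF _ f, of "{b<..}"]
    by (simp_all add: mult.commute)
  note sp = smeas_split[OF assms(1-4)]
  have 1: "integrable (smeas Q \<phi>) f" "(\<integral>t. f t \<partial>smeas Q \<phi>) = (\<integral>t. indicator {..b} t * f t \<partial>smeas Q (\<phi> + \<psi>))"
    unfolding sp(1) by (subst integrable_density integral_density; use i in simp)+
  have 2: "integrable (smeas Q \<psi>) f" "(\<integral>t. f t \<partial>smeas Q \<psi>) = (\<integral>t. indicator {b<..} t * f t \<partial>smeas Q (\<phi> + \<psi>))"
    unfolding sp(2) by (subst integrable_density integral_density; use i in simp)+
  show "integrable (smeas Q \<phi>) f" "integrable (smeas Q \<psi>) f" using 1 2 by auto
  show "(\<integral>t. f t \<partial>smeas Q (\<phi> + \<psi>)) = (\<integral>t. f t \<partial>smeas Q \<phi>) + (\<integral>t. f t \<partial>smeas Q \<psi>)"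
    unfolding 1 2 Bochner_Integration.integral_add[OF i, symmetric]
    by (intro Bochner_Integration.integral_cong) (auto simp: indicator_def)
qed

lemma smeas_integrable_power:
  assumes \<phi>: "\<phi> \<in> lsp S" and "integrable (smeas Q \<phi>) (\<lambda>t. t\<^sup>2)"
  shows "integrable (smeas Q \<phi>) (\<lambda>t. t)"
proof -
  interpret finite_borel_measure "smeas Q \<phi>" by (rule smeas_properties[OF \<phi>])
  have "integrable (smeas Q \<phi>) (\<lambda>t. 1 + t\<^sup>2)" using assms(2) by simp
  then show ?thesis
  proof (rule Bochner_Integration.integrable_bound)
    have "\<bar>t\<bar> \<le> 1 + t\<^sup>2" for t :: real
    proof -
      have "0 \<le> (\<bar>t\<bar> - 1)\<^sup>2 + \<bar>t\<bar>" by simp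
      then show ?thesis unfolding power2_diff by (simp add: power2_abs)
    qed
    then show "AE t in smeas Q \<phi>. norm t \<le> norm (1 + t\<^sup>2)" by (auto intro: order_trans)
  qed auto
qed

lemma smeas_bounded_integral:
  fixes f :: "real \<Rightarrow> real"
  assumes \<phi>: "\<phi> \<in> lsp S" and f[measurable]: "f \<in> borel_measurable borel"
    and bd: "AE t in smeas Q \<phi>. \<bar>f t - c\<bar> \<le> d"
  shows "integrable (smeas Q \<phi>) f" "\<bar>(\<integral>t. f t \<partial>smeas Q \<phi>) - c * (norm \<phi>)\<^sup>2\<bar> \<le> d * (norm \<phi>)\<^sup>2"
proof -
  interpret finite_borel_measure "smeas Q \<phi>" by (rule smeas_properties[OF \<phi>])
  show i: "integrable (smeas Q \<phi>) f"
    by (rule integrable_const_bound[where B = "\<bar>c\<bar> + d"]) (use bd in \<open>auto elim!: eventually_mono\<close>)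
  have "(\<integral>t. f t - c \<partial>smeas Q \<phi>) \<le> (\<integral>t. d \<partial>smeas Q \<phi>)" "(\<integral>t. - d \<partial>smeas Q \<phi>) \<le> (\<integral>t. f t - c \<partial>smeas Q \<phi>)"
    by (rule integral_mono_AE; use i bd in \<open>auto elim!: eventually_mono\<close>)+
  then show "\<bar>(\<integral>t. f t \<partial>smeas Q \<phi>) - c * (norm \<phi>)\<^sup>2\<bar> \<le> d * (norm \<phi>)\<^sup>2"
    using i by (simp add: smeas_properties(5)[OF \<phi>] mult.commute)
qed

end

section \<open>From integrals to commutation and form bounds\<close>

context sym_op begin

text \<open>The form is given by integrals, which are additive over vectors below and above b.
  Polarization turns additivity into orthogonality of one half to the image of the other under T, so
  T respects the splitting and commutes with Q b. The two bounds integrate t over a half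
  line.\<close>

theorem sfam_imp_pfam:
  assumes sf: "sfam S D T Q"
  shows "pfam S D T Q"
proof -
  have r: "roi S Q" and Deq: "D = {\<phi> \<in> lsp S. integrable (smeas Q \<phi>) (\<lambda>t. t\<^sup>2)}"
    and form: "\<And>\<phi>. \<phi> \<in> D \<Longrightarrow> \<phi> \<bullet> T \<phi> = (\<integral>t. t \<partial>(smeas Q \<phi>))"
    using sf unfolding sfam_def by auto
  have i2: "integrable (smeas Q \<phi>) (\<lambda>t. t\<^sup>2)" and i1: "integrable (smeas Q \<phi>) (\<lambda>t. t)"
    and ls: "\<phi> \<in> lsp S" if "\<phi> \<in> D" for \<phi>
  proof -
    show "integrable (smeas Q \<phi>) (\<lambda>t. t\<^sup>2)" "\<phi> \<in> lsp S" using that Deq by blast+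
    then show "integrable (smeas Q \<phi>) (\<lambda>t. t)" by (intro smeas_integrable_power[OF r])
  qed
  have QD: "Q b \<phi> \<in> D" if "\<phi> \<in> D" for b \<phi>
  proof -
    note l = ls[OF that]
    have Ql: "Q b \<phi> \<in> lsp S" by (rule roi_lsp[OF r l])
    have *: "Q b (Q b \<phi>) = Q b \<phi>" "Q b (\<phi> - Q b \<phi>) = 0"
      using roi_min[OF r l, of b b] roi_linear(2)[OF r l Ql] by auto
    have "integrable (smeas Q (Q b \<phi>)) (\<lambda>t. t\<^sup>2)"
      by (rule smeas_split_integral(1)[OF r, where \<psi> = "\<phi> - Q b \<phi>" and b = b])
         (use * Ql l i2[OF that] in auto)
    with Ql show ?thesis by (subst Deq) simp
  qed
  \<comment> \<open>Additivity of the form makes the sum of the two cross terms 0, and symmetry of T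
    makes them equal.\<close>
  have orth: "\<phi> \<bullet> T \<psi> = 0" if "\<phi> \<in> D" "\<psi> \<in> D" "Q b \<phi> = \<phi>" "Q b \<psi> = 0" for b \<phi> \<psi>
  proof -
    have "(\<integral>t. t \<partial>smeas Q (\<phi> + \<psi>)) = (\<integral>t. t \<partial>smeas Q \<phi>) + (\<integral>t. t \<partial>smeas Q \<psi>)"
      by (rule smeas_split_integral(3)[OF r, of _ b]) (use that ls i1 D_add in auto)
    then have "(\<phi> + \<psi>) \<bullet> T (\<phi> + \<psi>) = \<phi> \<bullet> T \<phi> + \<psi> \<bullet> T \<psi>"
      using that by (simp add: form D_add)
    then have "\<phi> \<bullet> T \<psi> + \<psi> \<bullet> T \<phi> = 0"
      using that by (simp add: T_add inner_add_left inner_add_right)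
    then show ?thesis using T_sym[OF that(1,2)] by (simp add: inner_commute)
  qed
  have orth1: "Q b (T \<psi>) = 0" if "\<psi> \<in> D" "Q b \<psi> = 0" for b \<psi>
  proof -
    have "norm (Q b (T \<psi>)) \<le> 0"
    proof (rule l2_norm_bound_dense)
      show "Q b (T \<psi>) \<in> lsp S" using that T_lsp roi_lsp[OF r] by blast
      fix \<xi> assume x: "\<xi> \<in> fsupp S"
      then have xl: "\<xi> \<in> lsp S" "\<xi> \<in> D" using fsupp_lsp fsupp_D by auto
      have "Q b (T \<psi>) \<bullet> \<xi> = T \<psi> \<bullet> Q b \<xi>" using roi_linear(3)[OF r T_lsp xl(1)] that by blast
      also have "\<dots> = 0"
        using orth[OF QD[OF xl(2)] that(1) _ that(2), of b] roi_min[OF r xl(1), of b b]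
        by (simp add: inner_commute)
      finally show "Q b (T \<psi>) \<bullet> \<xi> \<le> 0 * norm \<xi>" by simp
    qed auto
    then show ?thesis by simp
  qed
  have orth2: "Q b (T \<phi>) = T \<phi>" if "\<phi> \<in> D" "Q b \<phi> = \<phi>" for b \<phi>
  proof -
    have "norm (T \<phi> - Q b (T \<phi>)) \<le> 0"
    proof (rule l2_norm_bound_dense)
      show "T \<phi> - Q b (T \<phi>) \<in> lsp S" using that T_lsp roi_lsp[OF r] by blast
      fix \<xi> assume x: "\<xi> \<in> fsupp S"
      then have xl: "\<xi> \<in> lsp S" "\<xi> \<in> D" using fsupp_lsp fsupp_D by auto
      have "(T \<phi> - Q b (T \<phi>)) \<bullet> \<xi> = T \<phi> \<bullet> (\<xi> - Q b \<xi>)"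
        using roi_linear(3)[OF r T_lsp xl(1), of \<phi> b] that by (simp add: inner_diff_left inner_diff_right)
      also have "\<dots> = \<phi> \<bullet> T (\<xi> - Q b \<xi>)"
        by (rule T_sym) (use that xl D_diff QD in auto)
      also have "\<dots> = 0"
        using roi_linear(2)[OF r xl(1) roi_lsp[OF r xl(1)], of b b] roi_min[OF r xl(1), of b b]
        by (intro orth[where b = b]) (use that xl D_diff QD in auto)
      finally show "(T \<phi> - Q b (T \<phi>)) \<bullet> \<xi> \<le> 0 * norm \<xi>" by simp
    qed auto
    then show ?thesis by simp
  qed
  \<comment> \<open>T keeps the part of \<phi> above b above b and the part below b below b.\<close>
  have comm: "T (Q b \<phi>) = Q b (T \<phi>)" if d: "\<phi> \<in> D" for b \<phi>
  proof -
    have z: "Q b (\<phi> - Q b \<phi>) = 0"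
      using roi_linear(2)[OF r ls[OF d] roi_lsp[OF r ls[OF d]], of b b] roi_min[OF r ls[OF d], of b b] by simp
    have "Q b (T (\<phi> - Q b \<phi>)) = 0" by (rule orth1) (use z d QD D_diff in auto)
    then have "Q b (T \<phi>) = Q b (T (Q b \<phi>))"
      using d QD[OF d, of b] T_diff T_lsp by (simp add: roi_linear(2)[OF r])
    also have "\<dots> = T (Q b \<phi>)"
      by (rule orth2[OF QD[OF d]]) (use roi_min[OF r ls[OF d], of b b] in simp)
    finally show ?thesis by simp
  qed
  have up: "\<phi> \<bullet> T \<phi> \<le> b * (norm \<phi>)\<^sup>2" if d: "\<phi> \<in> D" and q: "Q b \<phi> = \<phi>" for b \<phi>
  proof -
    interpret finite_borel_measure "smeas Q \<phi>" by (rule smeas_properties[OF r ls[OF d]])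
    have "(\<integral>t. t \<partial>smeas Q \<phi>) \<le> (\<integral>t. b \<partial>smeas Q \<phi>)"
      by (rule integral_mono_AE) (use smeas_AE(1)[OF r ls[OF d] q] i1[OF d] in auto)
    then show ?thesis using form[OF d] smeas_properties(5)[OF r ls[OF d]] by (simp add: mult.commute)
  qed
  have lo: "\<phi> \<bullet> T \<phi> \<ge> b * (norm \<phi>)\<^sup>2" if d: "\<phi> \<in> D" and q: "Q b \<phi> = 0" for b \<phi>
  proof -
    interpret finite_borel_measure "smeas Q \<phi>" by (rule smeas_properties[OF r ls[OF d]])
    have "(\<integral>t. b \<partial>smeas Q \<phi>) \<le> (\<integral>t. t \<partial>smeas Q \<phi>)"
      by (rule integral_mono_AE) (use smeas_AE(2)[OF r ls[OF d] q] i1[OF d] in \<open>auto elim!: eventually_mono\<close>)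
    then show ?thesis using form[OF d] smeas_properties(5)[OF r ls[OF d]] by (simp add: mult.commute)
  qed
  show ?thesis using r QD comm up lo unfolding pfam_def by blast
qed

end

lemma abs_diff_squares: "\<bar>x\<^sup>2 - y\<^sup>2\<bar> = \<bar>x + y\<bar> * \<bar>y - x\<bar>" for x y :: real
proof -
  have "x\<^sup>2 - y\<^sup>2 = - ((x + y) * (y - x))" by algebra
  then show ?thesis by (simp only: abs_minus_cancel abs_mult)
qed

section \<open>From form bounds back to integrals\<close>

context sym_op begin

context
  fixes Q
  assumes pf: "pfam S D T Q"
begin

lemma pfam_roi: "roi S Q"
  using pf by (simp add: pfam_def)

lemma pfam_props:
  assumes "\<phi> \<in> D"
  shows "Q x \<phi> \<in> D" "T (Q x \<phi>) = Q x (T \<phi>)"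
    "Q x \<phi> = \<phi> \<Longrightarrow> \<phi> \<bullet> T \<phi> \<le> x * (norm \<phi>)\<^sup>2" "Q x \<phi> = 0 \<Longrightarrow> \<phi> \<bullet> T \<phi> \<ge> x * (norm \<phi>)\<^sup>2"
  using pf assms by (auto simp: pfam_def)

lemma D_lspD: "\<phi> \<in> D \<Longrightarrow> \<phi> \<in> lsp S"
  using D_lsp by blast

lemma T_zero: "T 0 = 0"
proof -
  have "0 \<in> fsupp S" by (simp add: fsupp_def lsp_def)
  then have "0 \<in> D" using fsupp_D by blast
  then show ?thesis using T_scale[of 0 0] by simp
qed

lemma window:
  assumes \<phi>: "\<phi> \<in> lsp S" and "a \<le> b"
  shows "Q b (Q b \<phi> - Q a \<phi>) = Q b \<phi> - Q a \<phi>" "Q a (Q b \<phi> - Q a \<phi>) = 0"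
    "norm (Q b \<phi> - Q a \<phi>) \<le> norm \<phi>" "Q b \<phi> - Q a \<phi> \<in> lsp S"
proof -
  note r = pfam_roi
  note l = roi_lsp[OF r \<phi>]
  show 1: "Q b (Q b \<phi> - Q a \<phi>) = Q b \<phi> - Q a \<phi>" "Q a (Q b \<phi> - Q a \<phi>) = 0"
    using \<open>a \<le> b\<close> by (simp_all add: roi_linear(2)[OF r] l roi_min[OF r \<phi>] min_def)
  show "Q b \<phi> - Q a \<phi> \<in> lsp S" using l by blast
  have "Q b \<phi> - Q a \<phi> = Q b (\<phi> - Q a \<phi>)"
    using \<open>a \<le> b\<close> by (simp add: roi_linear(2)[OF r] l \<phi> roi_min[OF r \<phi>] min_def)
  then have "norm (Q b \<phi> - Q a \<phi>) \<le> norm (\<phi> - Q a \<phi>)"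
    using oproj_norm(2)[OF roi_oproj[OF r], of "\<phi> - Q a \<phi>" b] \<phi> l by (simp add: lsp_closed)
  also have "\<dots> \<le> norm \<phi>" by (rule oproj_norm(3)[OF roi_oproj[OF r] \<phi>])
  finally show "norm (Q b \<phi> - Q a \<phi>) \<le> norm \<phi>" .
qed

text \<open>On vectors with energies in the window both b - T and T - a are nonnegative forms, so b
  - T is bounded there by b - a as a form. Cauchy--Schwarz for the form b - T upgrades this to a
  norm bound.\<close>

lemma pfam_window_bound:
  assumes \<phi>: "\<phi> \<in> D" "Q b \<phi> = \<phi>" "Q a \<phi> = 0" and "a \<le> b"
  shows "norm (b *\<^sub>R \<phi> - T \<phi>) \<le> (b - a) * norm \<phi>"
proof (rule l2_norm_bound_dense)
  note r = pfam_roi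
  note \<phi>l = D_lspD[OF \<phi>(1)]
  let ?\<xi> = "b *\<^sub>R \<phi> - T \<phi>"
  show \<xi>l: "?\<xi> \<in> lsp S" using \<phi>l T_lsp[OF \<phi>(1)] by blast
  have Q\<xi>: "Q x ?\<xi> = b *\<^sub>R Q x \<phi> - T (Q x \<phi>)" for x
    using pfam_props(2)[OF \<phi>(1), of x] T_lsp[OF \<phi>(1)] \<phi>l
    by (simp add: roi_linear(2)[OF r] lsp_closed oprojD(4)[OF roi_oproj[OF r]])
  show "0 \<le> (b - a) * norm \<phi>" using \<open>a \<le> b\<close> by simp
  fix \<psi> assume "\<psi> \<in> fsupp S"
  then have \<psi>: "\<psi> \<in> D" "\<psi> \<in> lsp S" using fsupp_D fsupp_lsp by auto
  \<comment> \<open>Only the window component of the test vector matters, because the vector being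
    tested lies in the window.\<close>
  define w where "w = Q b \<psi> - Q a \<psi>"
  have w: "w \<in> D" "Q b w = w" "Q a w = 0" "norm w \<le> norm \<psi>" "w \<in> lsp S"
    unfolding w_def using window[OF \<psi>(2) \<open>a \<le> b\<close>] pfam_props(1)[OF \<psi>(1)] D_diff by auto
  have nn: "0 \<le> u \<bullet> (b *\<^sub>R u - T u)" if "u \<in> D" "Q b u = u" for u
    using pfam_props(3)[OF that] by (simp add: inner_diff_right power2_norm_eq_inner)
  have le: "u \<bullet> (b *\<^sub>R u - T u) \<le> (b - a) * (norm u)\<^sup>2" if "u \<in> D" "Q a u = 0" for u
    using pfam_props(4)[OF that] by (simp add: inner_diff_right power2_norm_eq_inner algebra_simps)
  have "(?\<xi> \<bullet> w)\<^sup>2 \<le> (\<phi> \<bullet> ?\<xi>) * (w \<bullet> (b *\<^sub>R w - T w))"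
  proof (rule nonneg_quadratic_discriminant)
    fix t :: real
    have d: "\<phi> + t *\<^sub>R w \<in> D" "t *\<^sub>R w \<in> D" using \<phi> w D_add D_scale by auto
    have "Q b (\<phi> + t *\<^sub>R w) = \<phi> + t *\<^sub>R w"
      using \<phi> \<phi>l w by (simp add: roi_linear(1)[OF r] lsp_closed oprojD(4)[OF roi_oproj[OF r]])
    from nn[OF d(1) this] show "0 \<le> \<phi> \<bullet> ?\<xi> + 2 * t * (?\<xi> \<bullet> w) + t\<^sup>2 * (w \<bullet> (b *\<^sub>R w - T w))"
      using \<phi> w d T_sym[OF \<phi>(1) w(1)]
      by (simp add: T_add T_scale inner_add_left inner_add_right inner_diff_left inner_diff_right
          inner_commute power2_eq_square algebra_simps)
  qed
  also have "\<dots> \<le> ((b - a) * (norm \<phi>)\<^sup>2) * ((b - a) * (norm w)\<^sup>2)"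
    by (intro mult_mono le nn) (use \<phi> w \<open>a \<le> b\<close> in auto)
  also have "\<dots> = ((b - a) * norm \<phi> * norm w)\<^sup>2" by (simp add: power2_eq_square)
  finally have "?\<xi> \<bullet> w \<le> (b - a) * norm \<phi> * norm w"
    by (rule power2_le_imp_le) (use \<open>a \<le> b\<close> in simp)
  also have "\<dots> \<le> (b - a) * norm \<phi> * norm \<psi>" using w \<open>a \<le> b\<close> by (intro mult_left_mono) auto
  also have "?\<xi> \<bullet> w = ?\<xi> \<bullet> \<psi>"
    using roi_linear(3)[OF r \<xi>l \<psi>(2), of b] roi_linear(3)[OF r \<xi>l \<psi>(2), of a] Q\<xi> \<phi> T_zero
    by (simp add: w_def inner_diff_right)
  finally show "?\<xi> \<bullet> \<psi> \<le> (b - a) * norm \<phi> * norm \<psi>" .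
qed

lemma pfam_window_bound':
  assumes \<phi>: "\<phi> \<in> D" "Q b \<phi> = \<phi>" "Q a \<phi> = 0" and "a \<le> b"
  shows "norm (T \<phi>) \<le> (\<bar>b\<bar> + (b - a)) * norm \<phi>"
proof -
  have "norm (T \<phi>) \<le> norm (b *\<^sub>R \<phi>) + norm (b *\<^sub>R \<phi> - T \<phi>)"
    by (metis norm_triangle_sub norm_minus_commute)
  then show ?thesis using pfam_window_bound[OF assms] by (simp add: algebra_simps)
qed

text \<open>Pairing T \<psi> with \<phi> involves only the window component of \<psi>, on which T is
  bounded; the resulting estimate by the norm of \<psi> is what \<open>T_max\<close> asks
  for.\<close>

lemma pfam_window_D:
  assumes \<phi>: "\<phi> \<in> lsp S" "Q b \<phi> = \<phi>" "Q a \<phi> = 0" and "a \<le> b"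
  shows "\<phi> \<in> D"
proof (rule T_max[OF \<phi>(1)])
  note r = pfam_roi
  fix \<psi> assume "\<psi> \<in> fsupp S"
  then have \<psi>: "\<psi> \<in> D" "\<psi> \<in> lsp S" using fsupp_D fsupp_lsp by auto
  define w where "w = Q b \<psi> - Q a \<psi>"
  have w: "w \<in> D" "Q b w = w" "Q a w = 0" "norm w \<le> norm \<psi>"
    unfolding w_def using window[OF \<psi>(2) \<open>a \<le> b\<close>] pfam_props(1)[OF \<psi>(1)] D_diff by auto
  have "T \<psi> \<bullet> \<phi> = T w \<bullet> \<phi>"
    using roi_linear(3)[OF r T_lsp[OF \<psi>(1)] \<phi>(1)] \<phi> pfam_props[OF \<psi>(1)] \<psi>
    by (simp add: w_def T_diff inner_diff_left)
  also have "\<dots> \<le> norm (T w) * norm \<phi>" by (rule norm_cauchy_schwarz)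
  also have "\<dots> \<le> ((\<bar>b\<bar> + (b - a)) * norm \<psi>) * norm \<phi>"
  proof (rule mult_right_mono)
    have "norm (T w) \<le> (\<bar>b\<bar> + (b - a)) * norm w" by (rule pfam_window_bound') (use w assms in auto)
    also have "\<dots> \<le> (\<bar>b\<bar> + (b - a)) * norm \<psi>" using w assms by (intro mult_left_mono) auto
    finally show "norm (T w) \<le> (\<bar>b\<bar> + (b - a)) * norm \<psi>" .
  qed auto
  finally show "T \<psi> \<bullet> \<phi> \<le> ((\<bar>b\<bar> + (b - a)) * norm \<phi>) * norm \<psi>" by (simp add: mult_ac)
qed

lemma window_integrable:
  assumes \<phi>: "\<phi> \<in> lsp S" "Q b \<phi> = \<phi>" "Q a \<phi> = 0" and ab: "-R \<le> a" "a \<le> b" "b \<le> R"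
  shows "integrable (smeas Q \<phi>) (\<lambda>t. t)" "integrable (smeas Q \<phi>) (\<lambda>t. t\<^sup>2)"
    "\<bar>(\<integral>t. t \<partial>smeas Q \<phi>) - b * (norm \<phi>)\<^sup>2\<bar> \<le> (b - a) * (norm \<phi>)\<^sup>2"
    "\<bar>(\<integral>t. t\<^sup>2 \<partial>smeas Q \<phi>) - b\<^sup>2 * (norm \<phi>)\<^sup>2\<bar> \<le> (2 * R * (b - a)) * (norm \<phi>)\<^sup>2"
proof -
  note r = pfam_roi
  have AE: "AE t in smeas Q \<phi>. a < t \<and> t \<le> b"
    using smeas_AE[OF r \<phi>(1)] \<phi> by auto
  then have 1: "AE t in smeas Q \<phi>. \<bar>t - b\<bar> \<le> b - a" by eventually_elim auto
  have 2: "AE t in smeas Q \<phi>. \<bar>t\<^sup>2 - b\<^sup>2\<bar> \<le> 2 * R * (b - a)"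
    using AE
  proof eventually_elim
    case (elim t)
    have "\<bar>t\<^sup>2 - b\<^sup>2\<bar> = \<bar>t + b\<bar> * \<bar>b - t\<bar>" by (rule abs_diff_squares)
    also have "\<dots> \<le> (2 * R) * (b - a)" using elim ab by (intro mult_mono) auto
    finally show ?case .
  qed
  show "integrable (smeas Q \<phi>) (\<lambda>t. t)" "\<bar>(\<integral>t. t \<partial>smeas Q \<phi>) - b * (norm \<phi>)\<^sup>2\<bar> \<le> (b - a) * (norm \<phi>)\<^sup>2"
    by (rule smeas_bounded_integral[OF r \<phi>(1) _ 1], simp)+
  show "integrable (smeas Q \<phi>) (\<lambda>t. t\<^sup>2)"
    "\<bar>(\<integral>t. t\<^sup>2 \<partial>smeas Q \<phi>) - b\<^sup>2 * (norm \<phi>)\<^sup>2\<bar> \<le> (2 * R * (b - a)) * (norm \<phi>)\<^sup>2"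
    by (rule smeas_bounded_integral[OF r \<phi>(1) _ 2], simp)+
qed

text \<open>Both moment identities are additive over the two halves of a window, while their defects
  on a window are of the order of its length; bisection therefore kills the defects.\<close>

lemma window_moments_approx:
  assumes "\<phi> \<in> lsp S" "Q b \<phi> = \<phi>" "Q a \<phi> = 0" "-R \<le> a" "a \<le> b" "b \<le> R"
  shows "\<bar>\<phi> \<bullet> T \<phi> - (\<integral>t. t \<partial>smeas Q \<phi>)\<bar> \<le> 2 * (b - a) / 2 ^ n * (norm \<phi>)\<^sup>2 \<and>
    \<bar>(norm (T \<phi>))\<^sup>2 - (\<integral>t. t\<^sup>2 \<partial>smeas Q \<phi>)\<bar> \<le> 6 * R * (b - a) / 2 ^ n * (norm \<phi>)\<^sup>2"
  using assms
proof (induction n arbitrary: \<phi> a b)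
  case 0
  note r = pfam_roi
  have d: "\<phi> \<in> D" by (rule pfam_window_D[OF 0(1,2,3,5)])
  note wi = window_integrable[OF 0]
  note wb = pfam_window_bound[OF d 0(2,3,5)]
  have R: "0 \<le> R" using 0 by linarith
  have up: "\<phi> \<bullet> T \<phi> \<le> b * (norm \<phi>)\<^sup>2" and lo: "\<phi> \<bullet> T \<phi> \<ge> a * (norm \<phi>)\<^sup>2"
    using pfam_props(3)[OF d 0(2)] pfam_props(4)[OF d 0(3)] by auto
  then have 1: "\<bar>\<phi> \<bullet> T \<phi> - b * (norm \<phi>)\<^sup>2\<bar> \<le> (b - a) * (norm \<phi>)\<^sup>2"
    by (auto simp: abs_le_iff algebra_simps)
  have "\<bar>(norm (T \<phi>))\<^sup>2 - b\<^sup>2 * (norm \<phi>)\<^sup>2\<bar> = \<bar>norm (T \<phi>) + norm (b *\<^sub>R \<phi>)\<bar> * \<bar>norm (b *\<^sub>R \<phi>) - norm (T \<phi>)\<bar>"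
    using abs_diff_squares[of "norm (T \<phi>)" "norm (b *\<^sub>R \<phi>)"] by (simp add: power_mult_distrib)
  also have "\<dots> \<le> (4 * R * norm \<phi>) * ((b - a) * norm \<phi>)"
  proof (rule mult_mono)
    have "norm (T \<phi>) \<le> (\<bar>b\<bar> + (b - a)) * norm \<phi>" by (rule pfam_window_bound'[OF d 0(2,3,5)])
    also have "\<dots> \<le> (3 * R) * norm \<phi>" using 0 by (intro mult_right_mono) auto
    finally have "norm (T \<phi>) \<le> (3 * R) * norm \<phi>" .
    moreover have "\<bar>b\<bar> * norm \<phi> \<le> R * norm \<phi>" using 0 by (intro mult_right_mono) auto
    ultimately show "\<bar>norm (T \<phi>) + norm (b *\<^sub>R \<phi>)\<bar> \<le> 4 * R * norm \<phi>" by simp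
    show "\<bar>norm (b *\<^sub>R \<phi>) - norm (T \<phi>)\<bar> \<le> (b - a) * norm \<phi>"
      using norm_triangle_ineq3 wb by (rule order_trans)
  qed (use R in auto)
  also have "\<dots> = (4 * R * (b - a)) * (norm \<phi>)\<^sup>2" by (simp add: power2_eq_square)
  finally have 2: "\<bar>(norm (T \<phi>))\<^sup>2 - b\<^sup>2 * (norm \<phi>)\<^sup>2\<bar> \<le> (4 * R * (b - a)) * (norm \<phi>)\<^sup>2" .
  \<comment> \<open>In units of the squared norm, the form and the first moment are each within b -
    a of b, while the squared norm of T \<phi> and the second moment are within 4R(b - a) and 2R(b -
    a) of b^2. This is the origin of the constants 2 and 6R.\<close>
  have "\<bar>\<phi> \<bullet> T \<phi> - (\<integral>t. t \<partial>smeas Q \<phi>)\<bar> \<le> 2 * ((b - a) * (norm \<phi>)\<^sup>2)"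
    using 1 wi(3) by linarith
  moreover have "\<bar>(norm (T \<phi>))\<^sup>2 - (\<integral>t. t\<^sup>2 \<partial>smeas Q \<phi>)\<bar>
      \<le> (4 * R * (b - a)) * (norm \<phi>)\<^sup>2 + (2 * R * (b - a)) * (norm \<phi>)\<^sup>2"
    using 2 wi(4) by linarith
  ultimately show ?case by (simp add: algebra_simps)
next
  case (Suc n)
  note r = pfam_roi
  define m where "m = (a + b) / 2"
  have m: "a \<le> m" "m \<le> b" "-R \<le> m" "m \<le> R" "m - a = (b - a) / 2" "b - m = (b - a) / 2"
    using Suc.prems by (auto simp: m_def field_simps)
  note l = roi_lsp[OF r Suc.prems(1)]
  define \<phi>1 \<phi>2 where "\<phi>1 = Q m \<phi>" and "\<phi>2 = \<phi> - Q m \<phi>"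
  have \<phi>eq: "\<phi> = \<phi>1 + \<phi>2" by (simp add: \<phi>1_def \<phi>2_def)
  have l1: "\<phi>1 \<in> lsp S" "\<phi>2 \<in> lsp S" using l Suc.prems by (auto simp: \<phi>1_def \<phi>2_def)
  have q: "Q m \<phi>1 = \<phi>1" "Q a \<phi>1 = 0" "Q b \<phi>2 = \<phi>2" "Q m \<phi>2 = 0"
    using Suc.prems(2,3) roi_min[OF r Suc.prems(1), of m m] roi_min[OF r Suc.prems(1), of a m]
      roi_min[OF r Suc.prems(1), of b m] unfolding \<phi>1_def \<phi>2_def
    by (simp_all add: roi_linear(2)[OF r] l Suc.prems(1) min.absorb1 min.absorb2 m(1,2))
  have d: "\<phi>1 \<in> D" "\<phi>2 \<in> D" "\<phi> \<in> D"
    using pfam_window_D[OF l1(1) q(1,2)] pfam_window_D[OF l1(2) q(3,4)] m \<phi>eq D_add by auto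
  have nrm: "(norm \<phi>)\<^sup>2 = (norm \<phi>1)\<^sup>2 + (norm \<phi>2)\<^sup>2"
    unfolding \<phi>1_def \<phi>2_def by (rule oproj_norm(1)[OF roi_oproj[OF r] Suc.prems(1)])
  have T: "T \<phi>1 = Q m (T \<phi>)" "T \<phi>2 = T \<phi> - Q m (T \<phi>)"
    using pfam_props(2)[OF d(3)] d T_diff[of \<phi> \<phi>1] by (auto simp: \<phi>1_def \<phi>2_def)
  have nT: "(norm (T \<phi>))\<^sup>2 = (norm (T \<phi>1))\<^sup>2 + (norm (T \<phi>2))\<^sup>2"
    unfolding T by (rule oproj_norm(1)[OF roi_oproj[OF r] T_lsp[OF d(3)]])
  have "T \<phi>1 \<bullet> \<phi>2 = 0"
    unfolding T using roi_linear(3)[OF r T_lsp[OF d(3)] l1(2), of m] q by simp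
  then have form: "\<phi> \<bullet> T \<phi> = \<phi>1 \<bullet> T \<phi>1 + \<phi>2 \<bullet> T \<phi>2"
    using T_sym[OF d(1,2)] d by (simp add: \<phi>eq T_add inner_add_left inner_add_right inner_commute)
  note int = window_integrable(1,2)[OF Suc.prems]
  note sp = smeas_split_integral(3)[OF r l1(1) q(1) l1(2) q(4), folded \<phi>eq]
  note s1 = sp[OF int(1)] and s2 = sp[OF int(2)]
  note IH1 = Suc.IH[OF l1(1) q(1,2) Suc.prems(4) m(1,4)]
    and IH2 = Suc.IH[OF l1(2) q(3,4) m(3,2) Suc.prems(6)]
  have "\<bar>\<phi> \<bullet> T \<phi> - (\<integral>t. t \<partial>smeas Q \<phi>)\<bar>
      \<le> 2 * (m - a) / 2 ^ n * (norm \<phi>1)\<^sup>2 + 2 * (b - m) / 2 ^ n * (norm \<phi>2)\<^sup>2"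
    unfolding form s1 using IH1 IH2 by linarith
  also have "\<dots> = 2 * (b - a) / 2 ^ Suc n * (norm \<phi>)\<^sup>2" unfolding m nrm by (simp add: field_simps)
  finally have 1: "\<bar>\<phi> \<bullet> T \<phi> - (\<integral>t. t \<partial>smeas Q \<phi>)\<bar> \<le> 2 * (b - a) / 2 ^ Suc n * (norm \<phi>)\<^sup>2" .
  have "\<bar>(norm (T \<phi>))\<^sup>2 - (\<integral>t. t\<^sup>2 \<partial>smeas Q \<phi>)\<bar>
      \<le> 6 * R * (m - a) / 2 ^ n * (norm \<phi>1)\<^sup>2 + 6 * R * (b - m) / 2 ^ n * (norm \<phi>2)\<^sup>2"
    unfolding nT s2 using IH1 IH2 by linarith
  also have "\<dots> = 6 * R * (b - a) / 2 ^ Suc n * (norm \<phi>)\<^sup>2" unfolding m nrm by (simp add: field_simps)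
  finally show ?case using 1 by blast
qed

lemma window_moments:
  assumes \<phi>: "\<phi> \<in> lsp S" "Q b \<phi> = \<phi>" "Q a \<phi> = 0" "a \<le> b"
  shows "\<phi> \<bullet> T \<phi> = (\<integral>t. t \<partial>smeas Q \<phi>)" "(norm (T \<phi>))\<^sup>2 = (\<integral>t. t\<^sup>2 \<partial>smeas Q \<phi>)"
proof -
  define R where "R = \<bar>a\<bar> + \<bar>b\<bar>"
  have ap: "\<bar>\<phi> \<bullet> T \<phi> - (\<integral>t. t \<partial>smeas Q \<phi>)\<bar> \<le> 2 * (b - a) / 2 ^ n * (norm \<phi>)\<^sup>2"
    "\<bar>(norm (T \<phi>))\<^sup>2 - (\<integral>t. t\<^sup>2 \<partial>smeas Q \<phi>)\<bar> \<le> 6 * R * (b - a) / 2 ^ n * (norm \<phi>)\<^sup>2" for n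
    using window_moments_approx[of \<phi> b a R n] assms by (auto simp: R_def)
  have lim: "(\<lambda>n. c / 2 ^ n * d) \<longlonglongrightarrow> 0" for c d :: real
  proof -
    have "(\<lambda>n. (c * d) * (1 / 2) ^ n) \<longlonglongrightarrow> (c * d) * 0"
      by (intro tendsto_intros LIMSEQ_realpow_zero) auto
    moreover have "c / 2 ^ n * d = (c * d) * (1 / 2) ^ n" for n :: nat
      by (simp add: power_one_over)
    ultimately show ?thesis by simp
  qed
  have "\<bar>\<phi> \<bullet> T \<phi> - (\<integral>t. t \<partial>smeas Q \<phi>)\<bar> \<le> 0"
    by (rule tendsto_lowerbound[OF lim[of "2 * (b - a)" "(norm \<phi>)\<^sup>2"]])
       (rule always_eventually, rule allI, rule ap(1), simp)
  moreover have "\<bar>(norm (T \<phi>))\<^sup>2 - (\<integral>t. t\<^sup>2 \<partial>smeas Q \<phi>)\<bar> \<le> 0"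
    by (rule tendsto_lowerbound[OF lim[of "6 * R * (b - a)" "(norm \<phi>)\<^sup>2"]])
       (rule always_eventually, rule allI, rule ap(2), simp)
  ultimately show "\<phi> \<bullet> T \<phi> = (\<integral>t. t \<partial>smeas Q \<phi>)" "(norm (T \<phi>))\<^sup>2 = (\<integral>t. t\<^sup>2 \<partial>smeas Q \<phi>)" by auto
qed

text \<open>Exhaustion by the windows (-n, n], on which the moment identities are exact. For \<phi>
  in D the truncated second moments converge to the squared norm of T \<phi>, so monotone
  convergence gives integrability. Conversely a finite second moment bounds T (w n \<phi>) uniformly
  in n, and this is the bound required by \<open>T_max\<close>.\<close>

theorem pfam_imp_sfam: "sfam S D T Q"
proof -
  note r = pfam_roi
  define w where "w n \<phi> = Q (real n) \<phi> - Q (- real n) \<phi>" for n :: nat and \<phi>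
  have w: "w n \<phi> \<in> D" "Q (real n) (w n \<phi>) = w n \<phi>" "Q (- real n) (w n \<phi>) = 0" "w n \<phi> \<in> lsp S"
    "norm (w n \<phi>) \<le> norm \<phi>" if "\<phi> \<in> lsp S" for n \<phi>
    using window[OF that, of "- real n" "real n"] pfam_window_D[of "w n \<phi>" "real n" "- real n"]
    by (auto simp: w_def)
  have w_lim: "(\<lambda>n. w n \<phi>) \<longlonglongrightarrow> \<phi>" if "\<phi> \<in> lsp S" for \<phi>
  proof -
    have "(\<lambda>n. Q (real n) \<phi> - Q (- real n) \<phi>) \<longlonglongrightarrow> \<phi> - 0"
      by (intro tendsto_diff filterlim_compose[OF roi_tendsto(3)[OF r that]]
          filterlim_compose[OF roi_tendsto(2)[OF r that]] filterlim_real_sequentially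
          filterlim_compose[OF filterlim_uminus_at_bot_at_top])
    then show ?thesis by (simp add: w_def)
  qed
  have mom: "w n \<phi> \<bullet> T (w n \<phi>) = (\<integral>t. indicator {- real n<..real n} t * t \<partial>smeas Q \<phi>)"
     "(norm (T (w n \<phi>)))\<^sup>2 = (\<integral>t. indicator {- real n<..real n} t * t\<^sup>2 \<partial>smeas Q \<phi>)"
     "integrable (smeas Q \<phi>) (\<lambda>t. indicator {- real n<..real n} t * t\<^sup>2)" if l: "\<phi> \<in> lsp S" for n \<phi>
  proof -
    note wl = w[OF l, of n]
    have wi: "integrable (smeas Q (w n \<phi>)) (\<lambda>t. t)" "integrable (smeas Q (w n \<phi>)) (\<lambda>t. t\<^sup>2)"
      using window_integrable[OF wl(4,2,3), of "real n"] by auto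
    note sw = smeas_window_integral[OF r l, of "- real n" "real n", folded w_def]
    show "w n \<phi> \<bullet> T (w n \<phi>) = (\<integral>t. indicator {- real n<..real n} t * t \<partial>smeas Q \<phi>)"
      by (subst window_moments(1)[OF wl(4,2,3)], simp, rule sw(2), simp_all)
    show "(norm (T (w n \<phi>)))\<^sup>2 = (\<integral>t. indicator {- real n<..real n} t * t\<^sup>2 \<partial>smeas Q \<phi>)"
      by (subst window_moments(2)[OF wl(4,2,3)], simp, rule sw(2), simp_all)
    show "integrable (smeas Q \<phi>) (\<lambda>t. indicator {- real n<..real n} t * t\<^sup>2)"
      by (rule iffD1[OF sw(1) wi(2)]) simp_all
  qed
  have ind: "(\<lambda>n. indicator {- real n<..real n} t * c) \<longlonglongrightarrow> c" for t c :: real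
  proof (rule tendsto_eventually)
    obtain N :: nat where N: "\<bar>t\<bar> < real N" using reals_Archimedean2 by blast
    show "\<forall>\<^sub>F n in sequentially. indicator {- real n<..real n} t * c = c"
      using eventually_ge_at_top[of N] by eventually_elim (use N in \<open>auto simp: indicator_def\<close>)
  qed
  have Tw: "T (w n \<phi>) = w n (T \<phi>)" if "\<phi> \<in> D" for n \<phi>
    using pfam_props[OF that] by (simp add: w_def T_diff)
  have fwd: "integrable (smeas Q \<phi>) (\<lambda>t. t\<^sup>2)" if d: "\<phi> \<in> D" for \<phi>
  proof (rule integrable_monotone_convergence)
    note l = D_lspD[OF d]
    show "integrable (smeas Q \<phi>) (\<lambda>t. indicator {- real n<..real n} t * t\<^sup>2)" for n
      by (rule mom(3)[OF l])
    show "AE t in smeas Q \<phi>. mono (\<lambda>n. indicator {- real n<..real n} t * t\<^sup>2)"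
      by (intro AE_I2 monoI mult_right_mono) (auto simp: indicator_def)
    show "AE t in smeas Q \<phi>. (\<lambda>n. indicator {- real n<..real n} t * t\<^sup>2) \<longlonglongrightarrow> t\<^sup>2"
      by (intro AE_I2 ind)
    have "(\<lambda>n. (norm (w n (T \<phi>)))\<^sup>2) \<longlonglongrightarrow> (norm (T \<phi>))\<^sup>2"
      by (intro tendsto_intros w_lim T_lsp d)
    then show "(\<lambda>n. \<integral>t. indicator {- real n<..real n} t * t\<^sup>2 \<partial>smeas Q \<phi>) \<longlonglongrightarrow> (norm (T \<phi>))\<^sup>2"
      by (simp add: Tw[OF d] flip: mom(2)[OF l])
  qed auto
  have form: "\<phi> \<bullet> T \<phi> = (\<integral>t. t \<partial>smeas Q \<phi>)" if d: "\<phi> \<in> D" for \<phi>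
  proof (rule LIMSEQ_unique)
    note l = D_lspD[OF d]
    show "(\<lambda>n. w n \<phi> \<bullet> T (w n \<phi>)) \<longlonglongrightarrow> \<phi> \<bullet> T \<phi>"
      unfolding Tw[OF d] by (intro tendsto_intros w_lim T_lsp d l)
    show "(\<lambda>n. w n \<phi> \<bullet> T (w n \<phi>)) \<longlonglongrightarrow> (\<integral>t. t \<partial>smeas Q \<phi>)"
      unfolding mom(1)[OF l]
    proof (rule integral_dominated_convergence)
      show "integrable (smeas Q \<phi>) (\<lambda>t. \<bar>t\<bar>)"
        using smeas_integrable_power[OF r l fwd[OF d]] by simp
      show "AE t in smeas Q \<phi>. norm (indicator {- real n<..real n} t * t) \<le> \<bar>t\<bar>" for n
        by (intro AE_I2) (auto simp: indicator_def)
    qed (auto intro: ind)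
  qed
  have bwd: "\<phi> \<in> D" if l: "\<phi> \<in> lsp S" and i: "integrable (smeas Q \<phi>) (\<lambda>t. t\<^sup>2)" for \<phi>
  proof (rule T_max[OF l])
    fix \<psi> assume "\<psi> \<in> fsupp S"
    then have \<psi>: "\<psi> \<in> D" "\<psi> \<in> lsp S" using fsupp_D fsupp_lsp by auto
    define C where "C = sqrt (\<integral>t. t\<^sup>2 \<partial>smeas Q \<phi>)"
    show "T \<psi> \<bullet> \<phi> \<le> C * norm \<psi>"
    proof (rule tendsto_upperbound)
      show "(\<lambda>n. T \<psi> \<bullet> w n \<phi>) \<longlonglongrightarrow> T \<psi> \<bullet> \<phi>" by (intro tendsto_intros w_lim l)
      show "\<forall>\<^sub>F n in sequentially. T \<psi> \<bullet> w n \<phi> \<le> C * norm \<psi>"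
      proof (intro always_eventually allI)
        fix n
        have "(norm (T (w n \<phi>)))\<^sup>2 \<le> (\<integral>t. t\<^sup>2 \<partial>smeas Q \<phi>)"
          unfolding mom(2)[OF l]
          by (rule integral_mono) (use i mom(3)[OF l] in \<open>auto simp: indicator_def\<close>)
        then have "norm (T (w n \<phi>)) \<le> C" unfolding C_def by (intro real_le_rsqrt)
        then have "norm \<psi> * norm (T (w n \<phi>)) \<le> norm \<psi> * C" by (intro mult_left_mono) auto
        moreover have "T \<psi> \<bullet> w n \<phi> \<le> norm \<psi> * norm (T (w n \<phi>))"
          using norm_cauchy_schwarz[of \<psi> "T (w n \<phi>)"] T_sym[OF \<psi>(1) w(1)[OF l]] by simp
        ultimately show "T \<psi> \<bullet> w n \<phi> \<le> C * norm \<psi>" by (simp add: mult.commute)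
      qed
    qed auto
  qed
  show ?thesis
    unfolding sfam_def using r fwd bwd form T_lsp imul_T D_lspD by blast
qed

end

end

section \<open>Dictionary between the real formulation and the complex definitions\<close>

definition cmul :: "complex \<Rightarrow> 'a l2 \<Rightarrow> 'a l2" where "cmul c \<phi> = Re c *\<^sub>R \<phi> + Im c *\<^sub>R imul \<phi>"

lemma l2_fun_cmul: "l2_fun (cmul c \<phi>) x = c * l2_fun \<phi> x"
  by (simp add: cmul_def complex_eq_iff)

lemma l2_fun_lincomb: "(\<lambda>x. c * l2_fun \<phi> x + l2_fun \<psi> x) = l2_fun (cmul c \<phi> + \<psi>)"
  "(\<lambda>x. l2_fun \<phi> x - l2_fun \<psi> x) = l2_fun (\<phi> - \<psi>)"
  by (simp_all add: fun_eq_iff l2_fun_cmul)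

lemma cmul_special: "cmul (of_real c) \<phi> = c *\<^sub>R \<phi>" "cmul \<i> \<phi> = imul \<phi>" "cmul 1 \<phi> = \<phi>"
  by (simp_all add: cmul_def)

lemma lsp_cmul: "\<phi> \<in> lsp S \<Longrightarrow> cmul c \<phi> \<in> lsp S"
  unfolding cmul_def by blast

lemma l2_fun_ell2: "\<phi> \<in> lsp S \<Longrightarrow> l2_fun \<phi> \<in> ell2 S"
  using l2_fun_image_lsp by blast

text \<open>Complex scalars are generated by the real ones and i, and the imaginary part of the
  Hermitian symmetry is the real symmetry applied to \<open>imul \<phi>\<close>.\<close>

lemma orthogonal_projection_iff_oproj:
  assumes P: "\<And>\<phi>. \<phi> \<in> lsp S \<Longrightarrow> Pr (l2_fun \<phi>) = l2_fun (P \<phi>)"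
  shows "orthogonal_projection S Pr \<longleftrightarrow> oproj S P"
proof
  assume op: "orthogonal_projection S Pr"
  have 1: "P \<phi> \<in> lsp S" if "\<phi> \<in> lsp S" for \<phi>
    using op l2_fun_ell2[OF that] P[OF that]
    unfolding orthogonal_projection_def l2_fun_image_lsp[symmetric]
    by (metis (no_types, opaque_lifting) imageE l2_fun_inject)
  have 2: "P (P \<phi>) = P \<phi>" if "\<phi> \<in> lsp S" for \<phi>
    using op l2_fun_ell2[OF that] P[OF that] P[OF 1[OF that]]
    unfolding orthogonal_projection_def by (metis l2_fun_inject)
  have 3: "P (cmul c \<phi> + \<psi>) = cmul c (P \<phi>) + P \<psi>" if "\<phi> \<in> lsp S" "\<psi> \<in> lsp S" for c \<phi> \<psi>
  proof -
    have "Pr (\<lambda>x. c * l2_fun \<phi> x + l2_fun \<psi> x) = (\<lambda>x. c * Pr (l2_fun \<phi>) x + Pr (l2_fun \<psi>) x)"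
      using op that l2_fun_ell2 unfolding orthogonal_projection_def by blast
    then show ?thesis
      unfolding P[OF that(1)] P[OF that(2)] l2_fun_lincomb
      by (subst (asm) P) (use that lsp_cmul in \<open>auto simp: l2_fun_inject\<close>)
  qed
  have 4: "P \<phi> \<bullet> \<psi> = \<phi> \<bullet> P \<psi>" if "\<phi> \<in> lsp S" "\<psi> \<in> lsp S" for \<phi> \<psi>
  proof -
    have "ell2_inner (Pr (l2_fun \<phi>)) (l2_fun \<psi>) = ell2_inner (l2_fun \<phi>) (Pr (l2_fun \<psi>))"
      using op that l2_fun_ell2 unfolding orthogonal_projection_def by blast
    then show ?thesis using P that by (simp add: ell2_inner_eq)
  qed
  have z: "P 0 = 0" using 3[of 0 0 "-1"] by (auto simp: cmul_def)
  show "oproj S P"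
    unfolding oproj_def
  proof (intro conjI ballI allI)
    fix \<phi> \<psi> c assume l: "\<phi> \<in> lsp S"
    show "P \<phi> \<in> lsp S" "P (P \<phi>) = P \<phi>" by (fact 1[OF l] 2[OF l])+
    show "P (imul \<phi>) = imul (P \<phi>)" using 3[OF l, of 0 \<i>] z by (auto simp: cmul_special)
    show "P (c *\<^sub>R \<phi>) = c *\<^sub>R P \<phi>" using 3[OF l, of 0 "of_real c"] z by (auto simp: cmul_special)
    assume l': "\<psi> \<in> lsp S"
    show "P (\<phi> + \<psi>) = P \<phi> + P \<psi>" using 3[OF l l', of 1] by (simp add: cmul_special)
    show "P \<phi> \<bullet> \<psi> = \<phi> \<bullet> P \<psi>" by (rule 4[OF l l'])
  qed
next
  assume op: "oproj S P"
  note D = oprojD[OF op]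
  have lin: "P (cmul c \<phi> + \<psi>) = cmul c (P \<phi>) + P \<psi>" if "\<phi> \<in> lsp S" "\<psi> \<in> lsp S" for c \<phi> \<psi>
    using that unfolding cmul_def by (simp add: D lsp_closed)
  show "orthogonal_projection S Pr"
    unfolding orthogonal_projection_def l2_fun_image_lsp[symmetric] Ball_image_comp o_def
  proof (intro conjI ballI allI)
    fix \<phi> \<psi> c assume l: "\<phi> \<in> lsp S"
    show "Pr (l2_fun \<phi>) \<in> l2_fun ` lsp S" using D(1)[OF l] P[OF l] by simp
    show "Pr (Pr (l2_fun \<phi>)) = Pr (l2_fun \<phi>)" using D(1,2)[OF l] P l by simp
    assume l': "\<psi> \<in> lsp S"
    show "Pr (\<lambda>x. c * l2_fun \<phi> x + l2_fun \<psi> x) = (\<lambda>x. c * Pr (l2_fun \<phi>) x + Pr (l2_fun \<psi>) x)"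
      unfolding P[OF l] P[OF l'] l2_fun_lincomb
      by (subst P) (use l l' lsp_cmul lin in auto)
    show "ell2_inner (Pr (l2_fun \<phi>)) (l2_fun \<psi>) = ell2_inner (l2_fun \<phi>) (Pr (l2_fun \<psi>))"
      unfolding P[OF l] P[OF l'] ell2_inner_eq
      using D(7)[OF l l'] D(7)[OF lsp_closed(5)[OF l] l'] D(3)[OF l] by simp
  qed
qed

lemma resolution_of_identity_iff_roi:
  assumes Q: "\<And>x \<phi>. \<phi> \<in> lsp S \<Longrightarrow> Qr x (l2_fun \<phi>) = l2_fun (Q x \<phi>)"
  shows "resolution_of_identity S Qr \<longleftrightarrow> roi S Q"
proof -
  have 1: "orthogonal_projection S (Qr x) \<longleftrightarrow> oproj S (Q x)" for x
    by (rule orthogonal_projection_iff_oproj) (rule Q)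
  have 2: "(\<forall>x y. Qr x (Qr y (l2_fun \<phi>)) = Qr (min x y) (l2_fun \<phi>)) \<longleftrightarrow>
      (\<forall>x y. Q x (Q y \<phi>) = Q (min x y) \<phi>)"
    if "\<forall>x. oproj S (Q x)" "\<phi> \<in> lsp S" for \<phi>
    using that oprojD(1)[OF spec[OF that(1)] that(2)] Q by (simp add: l2_fun_inject)
  have lim: "((\<lambda>y. ell2_norm (\<lambda>z. Qr y (l2_fun \<phi>) z - Qr x (l2_fun \<phi>) z)) \<longlongrightarrow> 0) F \<longleftrightarrow>
      ((\<lambda>y. Q y \<phi>) \<longlongrightarrow> Q x \<phi>) F"
     "((\<lambda>y. ell2_norm (\<lambda>z. Qr y (l2_fun \<phi>) z - l2_fun \<phi> z)) \<longlongrightarrow> 0) F \<longleftrightarrow>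
      ((\<lambda>y. Q y \<phi>) \<longlongrightarrow> \<phi>) F"
     "((\<lambda>y. ell2_norm (Qr y (l2_fun \<phi>))) \<longlongrightarrow> 0) F \<longleftrightarrow> ((\<lambda>y. Q y \<phi>) \<longlongrightarrow> 0) F"
     if "\<phi> \<in> lsp S" for \<phi> x F
    unfolding Q[OF that] l2_fun_lincomb ell2_norm_l2_fun
    by (simp_all add: tendsto_norm_zero_iff LIM_zero_iff)
  show ?thesis
    unfolding resolution_of_identity_def roi_def l2_fun_image_lsp[symmetric] Ball_image_comp o_def
    using 1 2 lim by (auto cong: ball_cong)
qed

lemma spectral_family_iff_sfam:
  assumes Q: "\<And>x \<phi>. \<phi> \<in> lsp S \<Longrightarrow> Qr x (l2_fun \<phi>) = l2_fun (Q x \<phi>)"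
    and D: "D \<subseteq> lsp S" and T: "\<And>\<phi>. \<phi> \<in> D \<Longrightarrow> Tr (l2_fun \<phi>) = l2_fun (T \<phi>)"
  shows "spectral_family S (l2_fun ` D) Tr Qr \<longleftrightarrow> sfam S D T Q"
proof -
  have 1: "resolution_of_identity S Qr \<longleftrightarrow> roi S Q"
    by (rule resolution_of_identity_iff_roi) (rule Q)
  have m: "vector_spectral_measure Qr (l2_fun \<phi>) = smeas Q \<phi>" if "\<phi> \<in> lsp S" for \<phi>
    unfolding vector_spectral_measure_def Q[OF that] ell2_inner_eq by simp
  have "{\<phi> \<in> ell2 S. integrable (vector_spectral_measure Qr \<phi>) (\<lambda>t. t\<^sup>2)} =
      l2_fun ` {\<phi> \<in> lsp S. integrable (smeas Q \<phi>) (\<lambda>t. t\<^sup>2)}"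
    unfolding l2_fun_image_lsp[symmetric] using m by auto
  then have 2: "l2_fun ` D = {\<phi> \<in> ell2 S. integrable (vector_spectral_measure Qr \<phi>) (\<lambda>t. t\<^sup>2)} \<longleftrightarrow>
      D = {\<phi> \<in> lsp S. integrable (smeas Q \<phi>) (\<lambda>t. t\<^sup>2)}"
    by (simp add: inj_image_eq_iff inj_on_def l2_fun_inject)
  have 3: "(\<forall>\<phi>\<in>l2_fun ` D. Tr \<phi> \<in> ell2 S \<and> ell2_inner \<phi> (Tr \<phi>) = of_real (\<integral>t. t \<partial>(vector_spectral_measure Qr \<phi>)))
     \<longleftrightarrow> (\<forall>\<phi>\<in>D. T \<phi> \<in> lsp S \<and> imul \<phi> \<bullet> T \<phi> = 0 \<and> \<phi> \<bullet> T \<phi> = (\<integral>t. t \<partial>(smeas Q \<phi>)))"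
    unfolding Ball_image_comp o_def
  proof (rule ball_cong[OF refl])
    fix \<phi> assume d: "\<phi> \<in> D"
    have "Tr (l2_fun \<phi>) \<in> ell2 S \<longleftrightarrow> T \<phi> \<in> lsp S"
      unfolding T[OF d] l2_fun_image_lsp[symmetric] by (auto simp: l2_fun_inject)
    moreover have "ell2_inner (l2_fun \<phi>) (Tr (l2_fun \<phi>)) = of_real (\<integral>t. t \<partial>(vector_spectral_measure Qr (l2_fun \<phi>)))
      \<longleftrightarrow> imul \<phi> \<bullet> T \<phi> = 0 \<and> \<phi> \<bullet> T \<phi> = (\<integral>t. t \<partial>(smeas Q \<phi>))"
      unfolding T[OF d] ell2_inner_eq using m[of \<phi>] D d by (auto simp: complex_eq_iff)
    ultimately show "(Tr (l2_fun \<phi>) \<in> ell2 S \<and> ell2_inner (l2_fun \<phi>) (Tr (l2_fun \<phi>)) = of_real (\<integral>t. t \<partial>(vector_spectral_measure Qr (l2_fun \<phi>))))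
      \<longleftrightarrow> (T \<phi> \<in> lsp S \<and> imul \<phi> \<bullet> T \<phi> = 0 \<and> \<phi> \<bullet> T \<phi> = (\<integral>t. t \<partial>(smeas Q \<phi>)))"
      by blast
  qed
  show ?thesis unfolding spectral_family_def sfam_def 1 2 3 by blast
qed

text \<open>The epsilon term of \<^const>\<open>spectral_projection_atMost\<close> is only meaningful once a
  spectral family exists; this reads it off in the type of square summable functions.\<close>

lemma (in sym_op) spectral_projection_atMost_pfam:
  assumes T: "\<And>\<phi>. \<phi> \<in> D \<Longrightarrow> Tr (l2_fun \<phi>) = l2_fun (T \<phi>)" and ex: "pfam S D T Q0"
  defines "Qr \<equiv> spectral_projection_atMost S (l2_fun ` D) Tr"
  obtains Q where "pfam S D T Q" "\<And>x \<phi>. \<phi> \<in> lsp S \<Longrightarrow> Qr x (l2_fun \<phi>) = l2_fun (Q x \<phi>)"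
proof -
  have "spectral_family S (l2_fun ` D) Tr (\<lambda>x v. l2_fun (Q0 x (Abs_l2 v))) \<longleftrightarrow> sfam S D T Q0"
    by (rule spectral_family_iff_sfam) (simp_all add: l2_fun_inverse T D_lsp)
  then have "spectral_family S (l2_fun ` D) Tr (\<lambda>x v. l2_fun (Q0 x (Abs_l2 v)))"
    using pfam_imp_sfam[OF ex] by blast
  then have sf: "spectral_family S (l2_fun ` D) Tr Qr"
    unfolding Qr_def spectral_projection_atMost_def
    by (rule someI[where P = "spectral_family S (l2_fun ` D) Tr"])
  define Q where "Q x \<phi> = Abs_l2 (Qr x (l2_fun \<phi>))" for x \<phi>
  have Q: "Qr x (l2_fun \<phi>) = l2_fun (Q x \<phi>)" if "\<phi> \<in> lsp S" for x \<phi>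
  proof -
    have "resolution_of_identity S Qr" using sf unfolding spectral_family_def by (elim conjE)
    then have "orthogonal_projection S (Qr x)" unfolding resolution_of_identity_def by (elim conjE allE)
    then have "Qr x (l2_fun \<phi>) \<in> ell2 S"
      using l2_fun_ell2[OF that] unfolding orthogonal_projection_def by (elim conjE) (drule (1) bspec, elim conjE)
    then obtain \<psi> where "Qr x (l2_fun \<phi>) = l2_fun \<psi>" using l2_fun_image_lsp by blast
    then show ?thesis by (simp only: Q_def l2_fun_inverse)
  qed
  have "spectral_family S (l2_fun ` D) Tr Qr \<longleftrightarrow> sfam S D T Q"
    by (rule spectral_family_iff_sfam) (simp_all add: Q T D_lsp)
  then have "pfam S D T Q" using sf sfam_imp_pfam by blast
  then show ?thesis using that Q by blast
qed

subsection \<open>Spectral subspaces and eigenvalue counting\<close>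

context sym_op begin

text \<open>Strictness comes from the right-continuity of the spectral family.\<close>

lemma pfam_strict:
  assumes pf: "pfam S D T Q" and \<phi>: "\<phi> \<in> D" "Q x \<phi> = 0" "\<phi> \<noteq> 0"
  shows "\<phi> \<bullet> T \<phi> > x * (norm \<phi>)\<^sup>2"
proof -
  note r = pfam_roi[OF pf]
  note l = D_lspD[OF pf \<phi>(1)]
  have "\<forall>\<^sub>F y in at_right x. norm (Q y \<phi> - 0) < norm \<phi>"
    using tendstoD[OF roi_tendsto(1)[OF r l, of x], of "norm \<phi>"] \<phi> by (simp add: dist_norm)
  moreover have "\<forall>\<^sub>F y in at_right x. x < y" by (simp add: eventually_at_right_less)
  ultimately have "\<forall>\<^sub>F y in at_right x. norm (Q y \<phi> - 0) < norm \<phi> \<and> x < y" by eventually_elim auto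
  then obtain y where y: "norm (Q y \<phi>) < norm \<phi>" "x < y"
    using eventually_happens'[OF trivial_limit_at_right_real] by fastforce
  define \<phi>1 \<phi>2 where "\<phi>1 = Q y \<phi>" and "\<phi>2 = \<phi> - Q y \<phi>"
  have d: "\<phi>1 \<in> D" "\<phi>2 \<in> D" using pfam_props(1)[OF pf \<phi>(1)] \<phi> D_diff by (auto simp: \<phi>1_def \<phi>2_def)
  have ne: "\<phi>2 \<noteq> 0" using y by (auto simp: \<phi>2_def)
  have q2: "Q y \<phi>2 = 0"
    using roi_min[OF r l, of y y] by (simp add: \<phi>2_def roi_linear(2)[OF r] l roi_lsp[OF r l])
  have q1: "Q x \<phi>1 = 0" using roi_min[OF r l, of x y] y \<phi> by (simp add: \<phi>1_def min_def)
  have T1: "T \<phi>1 = Q y (T \<phi>)" using pfam_props(2)[OF pf \<phi>(1)] by (simp add: \<phi>1_def)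
  have "T \<phi>1 \<bullet> \<phi>2 = 0"
    unfolding T1 using roi_linear(3)[OF r T_lsp[OF \<phi>(1)] D_lspD[OF pf d(2)], of y] q2 by simp
  then have form: "\<phi> \<bullet> T \<phi> = \<phi>1 \<bullet> T \<phi>1 + \<phi>2 \<bullet> T \<phi>2"
    using T_sym[OF d] T_add[OF d] by (simp add: \<phi>1_def \<phi>2_def inner_add_left inner_add_right inner_diff_left inner_diff_right inner_commute)
  have "(norm \<phi>)\<^sup>2 = (norm \<phi>1)\<^sup>2 + (norm \<phi>2)\<^sup>2"
    unfolding \<phi>1_def \<phi>2_def by (rule oproj_norm(1)[OF roi_oproj[OF r] l])
  then have "x * (norm \<phi>)\<^sup>2 = x * (norm \<phi>1)\<^sup>2 + x * (norm \<phi>2)\<^sup>2" by (simp add: distrib_left)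
  also have "\<dots> < x * (norm \<phi>1)\<^sup>2 + y * (norm \<phi>2)\<^sup>2" using y ne by simp
  also have "\<dots> \<le> \<phi> \<bullet> T \<phi>"
    unfolding form using pfam_props(4)[OF pf d(1) q1] pfam_props(4)[OF pf d(2) q2] by linarith
  finally show ?thesis .
qed

end

section \<open>Finite dimensional subspaces: compactness and continuity\<close>

lemma lsp_insert_decomp:
  "\<phi> \<in> lsp (insert z \<Lambda>) \<Longrightarrow> \<phi> = cmul (l2_fun \<phi> z) (dl z) + cutoff (\<Lambda> - {z}) \<phi>"
  by (rule l2_eqI) (auto simp: l2_fun_cmul lsp_def)

text \<open>Finite dimensionality enters here. Adding one site multiplies by a closed disc, and the
  new unit ball is a closed part of the resulting compact image.\<close>

lemma compact_lsp_ball: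
  assumes "finite \<Lambda>"
  shows "compact {\<phi> \<in> lsp \<Lambda>. norm \<phi> \<le> 1}"
  using assms
proof (induction \<Lambda>)
  case empty
  have "{\<phi> \<in> lsp {}. norm \<phi> \<le> 1} = {0 :: 'a l2}" by (auto simp: lsp_def intro: l2_eqI)
  then show ?case by simp
next
  case (insert z \<Lambda>)
  let ?B = "{\<phi> \<in> lsp \<Lambda>. norm \<phi> \<le> 1}"
  let ?f = "\<lambda>(c, \<psi>). cmul c (dl z) + \<psi>"
  have "compact (?f ` (cball 0 1 \<times> ?B))"
    unfolding cmul_def case_prod_unfold
    by (intro compact_continuous_image compact_Times compact_cball insert.IH continuous_intros)
  then have "compact (?f ` (cball 0 1 \<times> ?B) \<inter> cball 0 1)" by (rule compact_Int_closed) simp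
  moreover have "?f ` (cball 0 1 \<times> ?B) \<inter> cball 0 1 = {\<phi> \<in> lsp (insert z \<Lambda>). norm \<phi> \<le> 1}"
  proof (intro equalityI subsetI)
    fix \<phi> assume "\<phi> \<in> {\<phi> \<in> lsp (insert z \<Lambda>). norm \<phi> \<le> 1}"
    then have \<phi>: "\<phi> \<in> lsp (insert z \<Lambda>)" "norm \<phi> \<le> 1" by auto
    have "\<phi> = ?f (l2_fun \<phi> z, cutoff (\<Lambda> - {z}) \<phi>)" using lsp_insert_decomp[OF \<phi>(1)] by simp
    moreover have "l2_fun \<phi> z \<in> cball 0 1" using cmod_l2_fun_le[of \<phi> z] \<phi> by simp
    moreover have "cutoff (\<Lambda> - {z}) \<phi> \<in> ?B"
      using norm_cutoff_le[of "\<Lambda> - {z}" \<phi>] \<phi> by (auto simp: lsp_def)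
    ultimately show "\<phi> \<in> ?f ` (cball 0 1 \<times> ?B) \<inter> cball 0 1" using \<phi>(2) by (auto intro!: image_eqI)
  next
    fix \<phi> assume "\<phi> \<in> ?f ` (cball 0 1 \<times> ?B) \<inter> cball 0 1"
    then show "\<phi> \<in> {\<phi> \<in> lsp (insert z \<Lambda>). norm \<phi> \<le> 1}" by (auto simp: lsp_def l2_fun_cmul)
  qed
  ultimately show ?case by simp
qed

lemma lsp_expansion:
  assumes "finite \<Lambda>" "\<phi> \<in> lsp \<Lambda>"
  shows "\<phi> = (\<Sum>z\<in>\<Lambda>. Re (l2_fun \<phi> z) *\<^sub>R dl z + Im (l2_fun \<phi> z) *\<^sub>R imul (dl z))"
  by (rule l2_eqI)
     (use assms in \<open>auto simp: lsp_def complex_eq_iff if_distrib if_distribR sum.delta cong: if_cong\<close>)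

definition lin_on :: "'a set \<Rightarrow> ('a l2 \<Rightarrow> 'b::real_vector) \<Rightarrow> bool" where
  "lin_on \<Lambda> A \<longleftrightarrow> (\<forall>\<phi>\<in>lsp \<Lambda>. \<forall>\<psi>\<in>lsp \<Lambda>. A (\<phi> + \<psi>) = A \<phi> + A \<psi>) \<and> (\<forall>\<phi>\<in>lsp \<Lambda>. \<forall>c. A (c *\<^sub>R \<phi>) = c *\<^sub>R A \<phi>)"

lemma lin_onD:
  assumes "lin_on \<Lambda> A" "\<phi> \<in> lsp \<Lambda>"
  shows "\<psi> \<in> lsp \<Lambda> \<Longrightarrow> A (\<phi> + \<psi>) = A \<phi> + A \<psi>" "A (c *\<^sub>R \<phi>) = c *\<^sub>R A \<phi>" "\<psi> \<in> lsp \<Lambda> \<Longrightarrow> A (\<phi> - \<psi>) = A \<phi> - A \<psi>"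
    "A 0 = 0"
proof -
  show *: "\<psi> \<in> lsp \<Lambda> \<Longrightarrow> A (\<phi> + \<psi>) = A \<phi> + A \<psi>" "A (c *\<^sub>R \<phi>) = c *\<^sub>R A \<phi>" for \<psi> c
    using assms by (auto simp: lin_on_def)
  show "A 0 = 0" using *(2)[of 0] by simp
  show "A (\<phi> - \<psi>) = A \<phi> - A \<psi>" if "\<psi> \<in> lsp \<Lambda>"
  proof -
    have "A (\<phi> + (-1) *\<^sub>R \<psi>) = A \<phi> + (-1) *\<^sub>R A \<psi>"
      using assms that unfolding lin_on_def by (metis lsp_closed(4))
    then show ?thesis by simp
  qed
qed

lemma lin_on_sum:
  assumes "lin_on \<Lambda> A" "finite I" "\<And>i. i \<in> I \<Longrightarrow> f i \<in> lsp \<Lambda>"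
  shows "A (\<Sum>i\<in>I. c i *\<^sub>R f i) = (\<Sum>i\<in>I. c i *\<^sub>R A (f i))"
  using assms(2,3)
proof (induction I)
  case empty
  then show ?case using lin_onD(4)[OF assms(1) lsp_closed(6)] by simp
next
  case (insert i I)
  have "(\<Sum>i\<in>I. c i *\<^sub>R f i) \<in> lsp \<Lambda>" by (rule lsp_sum) (use insert in auto)
  then show ?case using insert by (simp add: lin_onD(1,2)[OF assms(1)] lsp_closed)
qed

lemma continuous_on_l2_fun [continuous_intros]: "continuous_on X (\<lambda>\<phi>. l2_fun \<phi> z)"
proof (rule continuous_onI)
  fix \<phi> e assume "\<phi> \<in> X" "0 < (e::real)"
  have "dist (l2_fun \<psi> z) (l2_fun \<phi> z) \<le> e" if "dist \<psi> \<phi> < e" for \<psi>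
    using that cmod_l2_fun_le[of "\<psi> - \<phi>" z] by (simp add: dist_norm)
  then show "\<exists>d>0. \<forall>\<psi>\<in>X. dist \<psi> \<phi> < d \<longrightarrow> dist (l2_fun \<psi> z) (l2_fun \<phi> z) \<le> e"
    using \<open>0 < e\<close> by blast
qed

lemma lin_on_continuous:
  fixes A :: "'a l2 \<Rightarrow> 'b :: real_normed_vector"
  assumes "finite \<Lambda>" and A: "lin_on \<Lambda> A"
  shows "continuous_on (lsp \<Lambda>) A"
proof -
  have "A \<phi> = (\<Sum>z\<in>\<Lambda>. Re (l2_fun \<phi> z) *\<^sub>R A (dl z) + Im (l2_fun \<phi> z) *\<^sub>R A (imul (dl z)))"
    if \<phi>: "\<phi> \<in> lsp \<Lambda>" for \<phi>
  proof -
    have dd: "dl z \<in> lsp \<Lambda>" "imul (dl z) \<in> lsp \<Lambda>" if "z \<in> \<Lambda>" for z using that by auto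
    have "A (\<Sum>z\<in>\<Lambda>. 1 *\<^sub>R (Re (l2_fun \<phi> z) *\<^sub>R dl z + Im (l2_fun \<phi> z) *\<^sub>R imul (dl z))) =
      (\<Sum>z\<in>\<Lambda>. 1 *\<^sub>R A (Re (l2_fun \<phi> z) *\<^sub>R dl z + Im (l2_fun \<phi> z) *\<^sub>R imul (dl z)))"
      by (rule lin_on_sum[OF A assms(1)]) (intro lsp_closed dd)
    also have "\<dots> = (\<Sum>z\<in>\<Lambda>. Re (l2_fun \<phi> z) *\<^sub>R A (dl z) + Im (l2_fun \<phi> z) *\<^sub>R A (imul (dl z)))"
      by (intro sum.cong refl) (simp add: lin_onD(1,2)[OF A] dd lsp_closed)
    finally show ?thesis using lsp_expansion[OF assms(1) \<phi>] by simp
  qed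
  then show ?thesis
    by (subst continuous_on_cong[OF refl]) (auto intro!: continuous_intros)
qed

text \<open>At a maximiser of one quadratic form relative to another the two bilinear forms
  are proportional.\<close>

lemma psd_form_critical:
  fixes q :: "'b::real_vector \<Rightarrow> real"
  assumes psd: "\<And>t. 0 \<le> q (v + t *\<^sub>R u)" and exp: "\<And>t. q (v + t *\<^sub>R u) = q v + 2 * t * B + t\<^sup>2 * C"
    and "q v = 0"
  shows "B = 0"
proof -
  have "B\<^sup>2 \<le> q v * C" by (rule nonneg_quadratic_discriminant) (use psd exp in metis)
  then show ?thesis using assms(3) by simp
qed

section \<open>A Davis--Kahan estimate by a variational argument\<close>

lemma norm_add_scaleR_power2:
  "(norm (v + t *\<^sub>R u))\<^sup>2 = (norm v)\<^sup>2 + 2 * t * (v \<bullet> u) + t\<^sup>2 * (norm u)\<^sup>2" for u v :: "'a::real_inner"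
  unfolding power2_norm_eq_inner
  by (simp add: inner_add_left inner_add_right inner_commute power2_eq_square)

text \<open>Let X = P J and let M be the norm of X on the range of P', attained at a unit vector v0
  by compactness. Criticality of v0 gives X v0 \<bullet> X (A v0) = M^2 (v0 \<bullet> A v0). Hence b
  M^2 \<le> X v0 \<bullet> T (X v0) \<le> X v0 \<bullet> X (A v0) + \<kappa> M \<le> a M^2 +
  \<kappa> M, and M \<le> \<kappa> / (b - a). The map J intertwines A and T up to \<kappa>; energies
  below a are carried almost entirely below b.\<close>

lemma davis_kahan:
  assumes fin: "finite \<Lambda>" and P': "oproj \<Lambda> P'" and A: "lin_on \<Lambda> A" "\<And>v. v \<in> lsp \<Lambda> \<Longrightarrow> A v \<in> lsp \<Lambda>"
    and comm': "\<And>v. v \<in> lsp \<Lambda> \<Longrightarrow> A (P' v) = P' (A v)"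
    and upper: "\<And>v. v \<in> lsp \<Lambda> \<Longrightarrow> P' v = v \<Longrightarrow> v \<bullet> A v \<le> a * (norm v)\<^sup>2"
    and P: "oproj S P" and D: "D \<subseteq> lsp S" "\<And>w. w \<in> D \<Longrightarrow> T w \<in> lsp S" "\<And>w. w \<in> D \<Longrightarrow> P w \<in> D"
    and comm: "\<And>w. w \<in> D \<Longrightarrow> T (P w) = P (T w)"
    and lower: "\<And>w. w \<in> D \<Longrightarrow> P w = w \<Longrightarrow> w \<bullet> T w \<ge> b * (norm w)\<^sup>2"
    and J: "lin_on \<Lambda> J" "\<And>v. v \<in> lsp \<Lambda> \<Longrightarrow> J v \<in> D"
    and \<kappa>: "\<And>v. v \<in> lsp \<Lambda> \<Longrightarrow> norm (T (J v) - J (A v)) \<le> \<kappa> * norm v"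
    and ab: "a < b" and v: "v \<in> lsp \<Lambda>"
  shows "norm (P (J (P' v))) \<le> \<kappa> / (b - a) * norm v"
proof -
  define X where "X v = P (J v)" for v
  have JS: "J v \<in> lsp S" if "v \<in> lsp \<Lambda>" for v using that J D by blast
  have linP': "lin_on \<Lambda> P'" using P' unfolding oproj_def lin_on_def by blast
  have linX: "lin_on \<Lambda> X"
    unfolding lin_on_def X_def
    using JS lin_onD[OF J(1)] oprojD(4,5)[OF P] by metis
  define R where "R = {v \<in> lsp \<Lambda>. norm v = 1 \<and> P' v = v}"
  have compR: "compact R"
  proof -
    let ?B = "{v \<in> lsp \<Lambda>. norm v \<le> 1}"
    have cl: "closed ?B" by (rule compact_imp_closed[OF compact_lsp_ball[OF fin]])
    have c: "continuous_on ?B (\<lambda>v. P' v - v)" "continuous_on ?B norm"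
      by (intro continuous_intros continuous_on_subset[OF lin_on_continuous[OF fin linP']]; auto)+
    have c2: "closed (?B \<inter> (\<lambda>v. P' v - v) -` {0})" "closed (?B \<inter> norm -` {1})"
      by (rule continuous_closed_preimage; use c cl in auto)+
    have "compact (?B \<inter> ((?B \<inter> (\<lambda>v. P' v - v) -` {0}) \<inter> (?B \<inter> norm -` {1})))"
      by (rule compact_Int_closed[OF compact_lsp_ball[OF fin] closed_Int[OF c2]])
    also have "?B \<inter> ((?B \<inter> (\<lambda>v. P' v - v) -` {0}) \<inter> (?B \<inter> norm -` {1})) = R" by (auto simp: R_def)
    finally show ?thesis .
  qed
  have \<kappa>0: "0 \<le> \<kappa> * norm v" using \<kappa>[OF v] norm_ge_zero order_trans by blast
  define w where "w = P' v"
  have w: "w \<in> lsp \<Lambda>" "P' w = w" "norm w \<le> norm v"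
    unfolding w_def using oprojD(1,2)[OF P' v] oproj_norm(2)[OF P' v] by auto
  show ?thesis
  \<comment> \<open>The maximiser is sought among unit vectors in the range of P', and w provides
    one unless it is 0.\<close>
  proof (cases "w = 0")
    case True
    have "J 0 = 0" by (rule lin_onD(4)[OF J(1) v])
    moreover have "P 0 = 0" using oprojD(4)[OF P lsp_closed(6), of 0] by simp
    ultimately show ?thesis using True \<kappa>0 ab by (simp add: w_def)
  next
    case False
    have wR: "(1 / norm w) *\<^sub>R w \<in> R"
      using w False by (auto simp: R_def lsp_closed oprojD(4)[OF P'])
    have "continuous_on R (\<lambda>v. norm (X v))"
      by (intro continuous_intros continuous_on_subset[OF lin_on_continuous[OF fin linX]]) (auto simp: R_def)
    then obtain v0 where v0: "v0 \<in> R" "\<And>u. u \<in> R \<Longrightarrow> norm (X u) \<le> norm (X v0)"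
      using continuous_attains_sup[OF compR] wR by blast
    then have v0l: "v0 \<in> lsp \<Lambda>" "norm v0 = 1" "P' v0 = v0" by (auto simp: R_def)
    define M where "M = norm (X v0)"
    have bd: "norm (X u) \<le> M * norm u" if "u \<in> lsp \<Lambda>" "P' u = u" for u
    proof (cases "u = 0")
      case True
      then show ?thesis using lin_onD(4)[OF linX v] by simp
    next
      case False
      have "(1 / norm u) *\<^sub>R u \<in> R"
        using that False by (auto simp: R_def lsp_closed oprojD(4)[OF P'])
      from v0(2)[OF this] show ?thesis
        using that False by (simp add: lin_onD(2)[OF linX] M_def field_simps)
    qed
    \<comment> \<open>Varying the maximiser in the direction A v0 is legitimate because A commutes
      with P' and so preserves its range.\<close>
    define u where "u = A v0"
    have u: "u \<in> lsp \<Lambda>" "P' u = u" using A(2)[OF v0l(1)] comm'[OF v0l(1)] v0l by (auto simp: u_def)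
    have crit: "M\<^sup>2 * (v0 \<bullet> u) - X v0 \<bullet> X u = 0"
    proof (rule psd_form_critical[where q = "\<lambda>v. M\<^sup>2 * (norm v)\<^sup>2 - (norm (X v))\<^sup>2" and v = v0 and u = u
          and C = "M\<^sup>2 * (norm u)\<^sup>2 - (norm (X u))\<^sup>2"])
      fix t
      have *: "t *\<^sub>R u \<in> lsp \<Lambda>" "v0 + t *\<^sub>R u \<in> lsp \<Lambda>" "P' (v0 + t *\<^sub>R u) = v0 + t *\<^sub>R u"
        using u v0l by (auto simp: lsp_closed oprojD(4,5)[OF P'])
      show "0 \<le> M\<^sup>2 * (norm (v0 + t *\<^sub>R u))\<^sup>2 - (norm (X (v0 + t *\<^sub>R u)))\<^sup>2"
        using power_mono[OF bd[OF *(2,3)] norm_ge_zero, of 2] by (simp add: power_mult_distrib)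
      show "M\<^sup>2 * (norm (v0 + t *\<^sub>R u))\<^sup>2 - (norm (X (v0 + t *\<^sub>R u)))\<^sup>2 =
        M\<^sup>2 * (norm v0)\<^sup>2 - (norm (X v0))\<^sup>2 + 2 * t * (M\<^sup>2 * (v0 \<bullet> u) - X v0 \<bullet> X u) +
        t\<^sup>2 * (M\<^sup>2 * (norm u)\<^sup>2 - (norm (X u))\<^sup>2)"
        unfolding lin_onD(1)[OF linX v0l(1) *(1)] lin_onD(2)[OF linX u(1)] norm_add_scaleR_power2
        by algebra
    qed (use v0l in \<open>simp add: M_def\<close>)
    have XD: "X v0 \<in> D" "P (X v0) = X v0"
      using J(2)[OF v0l(1)] D(3) oprojD(2)[OF P JS[OF v0l(1)]] by (auto simp: X_def)
    have Xl: "X v0 \<in> lsp S" using XD D by blast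
    have TJ: "T (J v0) \<in> lsp S" using D(2) J(2) v0l by blast
    have JA: "J (A v0) \<in> lsp S" using JS A(2) v0l by blast
    have "b * M\<^sup>2 \<le> X v0 \<bullet> T (X v0)" using lower[OF XD] by (simp add: M_def)
    also have "\<dots> = X v0 \<bullet> P (T (J v0))" using comm[OF J(2)[OF v0l(1)]] by (simp add: X_def)
    also have "\<dots> = X v0 \<bullet> T (J v0)" using oprojD(7)[OF P Xl TJ] XD by simp
    also have "\<dots> = X v0 \<bullet> J (A v0) + X v0 \<bullet> (T (J v0) - J (A v0))" by (simp add: inner_diff_right)
    also have "X v0 \<bullet> J (A v0) = X v0 \<bullet> X u" using oprojD(7)[OF P Xl JA] XD by (simp add: X_def u_def)
    also have "\<dots> = M\<^sup>2 * (v0 \<bullet> A v0)" using crit by (simp add: u_def)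
    also have "X v0 \<bullet> (T (J v0) - J (A v0)) \<le> norm (X v0) * norm (T (J v0) - J (A v0))"
      by (rule norm_cauchy_schwarz)
    also have "\<dots> \<le> M * \<kappa>" using \<kappa>[OF v0l(1)] v0l by (simp add: M_def mult_left_mono)
    also have "M\<^sup>2 * (v0 \<bullet> A v0) \<le> M\<^sup>2 * a" using upper[OF v0l(1,3)] v0l by (simp add: mult_left_mono)
    finally have "(b - a) * M * M \<le> \<kappa> * M" by (simp add: power2_eq_square algebra_simps)
    moreover have M0: "0 \<le> M" by (simp add: M_def)
    moreover have "0 \<le> \<kappa>" using order_trans[OF norm_ge_zero \<kappa>[OF v0l(1)]] v0l by simp
    ultimately have "(b - a) * M \<le> \<kappa>"
      by (cases "M = 0") (auto simp: mult_le_cancel_right)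
    then have "M \<le> \<kappa> / (b - a)" using ab by (simp add: field_simps)
    then have "M * norm w \<le> \<kappa> / (b - a) * norm v"
      using w(3) M0 by (intro mult_mono) (auto intro: order_trans)
    then show ?thesis using bd[OF w(1,2)] by (simp add: X_def w_def)
  qed
qed

section \<open>Orthonormal systems over the reals and eigenvalue counts\<close>

definition onset :: "'a::real_inner set \<Rightarrow> bool" where
  "onset E \<longleftrightarrow> (\<forall>e\<in>E. norm e = 1) \<and> (\<forall>e\<in>E. \<forall>f\<in>E. e \<noteq> f \<longrightarrow> e \<bullet> f = 0)"

lemma onset_inner: "onset E \<Longrightarrow> e \<in> E \<Longrightarrow> f \<in> E \<Longrightarrow> e \<bullet> f = (if e = f then 1 else 0)"
  by (auto simp: onset_def norm_eq_sqrt_inner)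

lemma onset_subset: "onset E \<Longrightarrow> C \<subseteq> E \<Longrightarrow> onset C"
  by (auto simp: onset_def subset_iff)

lemma onset_inner_sum:
  assumes "onset E" "finite C" "C \<subseteq> E" "f \<in> E"
  shows "f \<bullet> (\<Sum>e\<in>C. c e *\<^sub>R e) = (if f \<in> C then c f else 0)"
proof -
  have "f \<bullet> (\<Sum>e\<in>C. c e *\<^sub>R e) = (\<Sum>e\<in>C. if f = e then c e else 0)"
    unfolding inner_sum_right
    by (intro sum.cong refl) (use assms onset_inner[OF assms(1,4)] in auto)
  then show ?thesis using assms by simp
qed

lemma onset_independent: "onset E \<Longrightarrow> independent E"
  by (rule pairwise_orthogonal_independent)
     (auto simp: onset_def pairwise_def orthogonal_def)

lemma onset_bessel:
  assumes "onset E" "finite E"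
  shows "(\<Sum>e\<in>E. (e \<bullet> \<phi>)\<^sup>2) \<le> (norm \<phi>)\<^sup>2"
proof -
  define p where "p = (\<Sum>e\<in>E. (e \<bullet> \<phi>) *\<^sub>R e)"
  have "p \<bullet> p = (\<Sum>e\<in>E. (e \<bullet> \<phi>) * (e \<bullet> p))" by (simp add: p_def inner_sum_left)
  also have "\<dots> = (\<Sum>e\<in>E. (e \<bullet> \<phi>)\<^sup>2)"
    using onset_inner_sum[OF assms(1,2) order_refl] by (simp add: p_def power2_eq_square)
  finally have pp: "p \<bullet> p = (\<Sum>e\<in>E. (e \<bullet> \<phi>)\<^sup>2)" .
  have "p \<bullet> \<phi> = (\<Sum>e\<in>E. (e \<bullet> \<phi>)\<^sup>2)" by (simp add: p_def inner_sum_left power2_eq_square)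
  then have "(norm (\<phi> - p))\<^sup>2 = (norm \<phi>)\<^sup>2 - (\<Sum>e\<in>E. (e \<bullet> \<phi>)\<^sup>2)"
    using pp by (simp add: power2_norm_eq_inner inner_diff_left inner_diff_right inner_commute)
  then show ?thesis using zero_le_power2[of "norm (\<phi> - p)"] by linarith
qed

lemma norm_lsp_sum:
  assumes "finite \<Lambda>" "\<phi> \<in> lsp \<Lambda>"
  shows "(norm \<phi>)\<^sup>2 = (\<Sum>z\<in>\<Lambda>. (\<phi> \<bullet> dl z)\<^sup>2 + (\<phi> \<bullet> imul (dl z))\<^sup>2)"
proof -
  have "((\<lambda>x. (cmod (l2_fun \<phi> x))\<^sup>2) has_sum (\<Sum>x\<in>\<Lambda>. (cmod (l2_fun \<phi> x))\<^sup>2)) UNIV"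
    by (rule has_sum_finite_neutralI[of \<Lambda>]) (use assms in \<open>auto simp: lsp_def\<close>)
  then have "(norm \<phi>)\<^sup>2 = (\<Sum>x\<in>\<Lambda>. (cmod (l2_fun \<phi> x))\<^sup>2)"
    using l2_has_sum[of \<phi>] has_sum_unique by blast
  then show ?thesis by (simp add: inner_dl inner_imul_dl cmod_power2)
qed

text \<open>Bessel's inequality, summed over the 2 |\<Lambda>| real coordinate vectors
  \<open>dl z\<close> and \<open>imul (dl z)\<close>.\<close>

lemma onset_card_le:
  assumes "finite \<Lambda>" "onset E" "finite E" "E \<subseteq> lsp \<Lambda>"
  shows "card E \<le> 2 * card \<Lambda>"
proof -
  have "real (card E) = (\<Sum>e\<in>E. (norm e)\<^sup>2)" using assms by (simp add: onset_def)
  also have "\<dots> = (\<Sum>e\<in>E. \<Sum>z\<in>\<Lambda>. (e \<bullet> dl z)\<^sup>2 + (e \<bullet> imul (dl z))\<^sup>2)"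
    using assms by (intro sum.cong refl norm_lsp_sum) auto
  also have "\<dots> = (\<Sum>z\<in>\<Lambda>. (\<Sum>e\<in>E. (e \<bullet> dl z)\<^sup>2) + (\<Sum>e\<in>E. (e \<bullet> imul (dl z))\<^sup>2))"
    by (subst sum.swap) (simp add: sum.distrib)
  also have "\<dots> \<le> (\<Sum>z\<in>\<Lambda>. 1 + 1)"
    using onset_bessel[OF assms(2,3), of "dl z" for z] onset_bessel[OF assms(2,3), of "imul (dl z)" for z]
    by (intro sum_mono add_mono) auto
  finally have "real (card E) \<le> real (2 * card \<Lambda>)" by simp
  then show ?thesis by (simp only: of_nat_le_iff)
qed

text \<open>Let B be a maximal independent subset of V. Summing (b \<bullet> w) b over B is linear
  in w with values in the span of B, whose dimension is less than card C. A kernel vector is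
  orthogonal to B, hence to V.\<close>

lemma kernel_exists:
  fixes C V :: "'a::real_inner set"
  assumes "finite C" "finite V" "independent C" "card V < card C"
  obtains w where "w \<in> span C" "w \<noteq> 0" "\<And>v. v \<in> V \<Longrightarrow> v \<bullet> w = 0"
proof -
  obtain B where B: "B \<subseteq> V" "independent B" "V \<subseteq> span B" by (rule maximal_independent_subset)
  have finB: "finite B" using B assms finite_subset by blast
  define f where "f w = (\<Sum>b\<in>B. (b \<bullet> w) *\<^sub>R b)" for w :: 'a
  have lin: "linear f"
    by (intro linearI) (simp_all add: f_def inner_add_right scaleR_left_distrib sum.distrib scaleR_sum_right)
  have "\<exists>w\<in>span C. w \<noteq> 0 \<and> f w = 0"
  proof (rule ccontr)
    assume "\<not> ?thesis"
    then have inj: "inj_on f (span C)"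
      using linear_inj_on_iff_eq_0[OF lin subspace_span] by blast
    then have "independent (f ` C)" by (rule linear_independent_injective_image[OF lin assms(3)])
    moreover have "f w \<in> span B" for w unfolding f_def by (intro span_sum span_scale) (rule span_base)
    then have "f ` C \<subseteq> span B" by blast
    ultimately have "card (f ` C) \<le> card B" using independent_span_bound[OF finB] by blast
    moreover have "card (f ` C) = card C" by (rule card_image) (rule inj_on_subset[OF inj], rule span_superset)
    moreover have "card B \<le> card V" by (rule card_mono) (use B assms in auto)
    ultimately show False using assms by simp
  qed
  then obtain w where w: "w \<in> span C" "w \<noteq> 0" "f w = 0" by blast
  have 0: "b \<bullet> w = 0" if "b \<in> B" for b
    using independentD[OF B(2) finB order_refl _ that, of "\<lambda>b. b \<bullet> w"] w by (simp add: f_def)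
  have "v \<bullet> w = 0" if "v \<in> V" for v
    using orthogonal_to_span[of v B w] B that 0 by (auto simp: orthogonal_def inner_commute)
  then show ?thesis using w that by blast
qed

text \<open>Orthonormality is over the reals, so for a complex linear A each complex dimension of an
  eigenspace contributes two elements, and counts are twice the complex multiplicities. Eigenvalues
  are not stored but read off as e \<bullet> A e.\<close>

definition eigbasis :: "'a set \<Rightarrow> ('a l2 \<Rightarrow> 'a l2) \<Rightarrow> 'a l2 set \<Rightarrow> bool" where
  "eigbasis \<Lambda> A E \<longleftrightarrow> finite E \<and> E \<subseteq> lsp \<Lambda> \<and> onset E \<and> (\<forall>e\<in>E. A e = (e \<bullet> A e) *\<^sub>R e) \<and>
     (\<forall>\<phi>\<in>lsp \<Lambda>. (\<forall>e\<in>E. e \<bullet> \<phi> = 0) \<longrightarrow> \<phi> = 0)"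

definition cnt :: "('a l2 \<Rightarrow> 'a l2) \<Rightarrow> 'a l2 set \<Rightarrow> real \<Rightarrow> nat" where
  "cnt A E x = card {e \<in> E. e \<bullet> A e \<le> x}"

lemma eigbasisD:
  assumes "eigbasis \<Lambda> A E"
  shows "finite E" "E \<subseteq> lsp \<Lambda>" "onset E" "e \<in> E \<Longrightarrow> A e = (e \<bullet> A e) *\<^sub>R e" "e \<in> E \<Longrightarrow> e \<in> lsp \<Lambda>"
    "\<phi> \<in> lsp \<Lambda> \<Longrightarrow> (\<And>e. e \<in> E \<Longrightarrow> e \<bullet> \<phi> = 0) \<Longrightarrow> \<phi> = 0"
  using assms by (auto simp: eigbasis_def)

lemma eigbasis_expansion:
  assumes E: "eigbasis \<Lambda> A E" and "\<phi> \<in> lsp \<Lambda>"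
  shows "\<phi> = (\<Sum>e\<in>E. (e \<bullet> \<phi>) *\<^sub>R e)"
proof -
  note D = eigbasisD[OF E]
  have "\<phi> - (\<Sum>e\<in>E. (e \<bullet> \<phi>) *\<^sub>R e) = 0"
  proof (rule D(6))
    show "\<phi> - (\<Sum>e\<in>E. (e \<bullet> \<phi>) *\<^sub>R e) \<in> lsp \<Lambda>"
      by (intro lsp_closed(2) lsp_sum lsp_closed(4) D assms)
    show "e \<bullet> (\<phi> - (\<Sum>e\<in>E. (e \<bullet> \<phi>) *\<^sub>R e)) = 0" if "e \<in> E" for e
      using onset_inner_sum[OF D(3,1) order_refl that] that by (simp add: inner_diff_right)
  qed
  then show ?thesis by simp
qed

lemma eigbasis_norm:
  assumes E: "eigbasis \<Lambda> A E" and \<phi>: "\<phi> \<in> lsp \<Lambda>"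
  shows "(norm \<phi>)\<^sup>2 = (\<Sum>e\<in>E. (e \<bullet> \<phi>)\<^sup>2)"
proof -
  have "\<phi> \<bullet> \<phi> = (\<Sum>e\<in>E. (e \<bullet> \<phi>) *\<^sub>R e) \<bullet> \<phi>" using eigbasis_expansion[OF E \<phi>] by simp
  then have "\<phi> \<bullet> \<phi> = (\<Sum>e\<in>E. (e \<bullet> \<phi>)\<^sup>2)" by (simp add: inner_sum_left power2_eq_square)
  then show ?thesis by (simp only: power2_norm_eq_inner)
qed

lemma eigbasis_form:
  assumes E: "eigbasis \<Lambda> A E" and A: "lin_on \<Lambda> A" and \<phi>: "\<phi> \<in> lsp \<Lambda>"
  shows "A \<phi> = (\<Sum>e\<in>E. ((e \<bullet> A e) * (e \<bullet> \<phi>)) *\<^sub>R e)" "\<phi> \<bullet> A \<phi> = (\<Sum>e\<in>E. (e \<bullet> A e) * (e \<bullet> \<phi>)\<^sup>2)"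
proof -
  note D = eigbasisD[OF E]
  have "A \<phi> = A (\<Sum>e\<in>E. (e \<bullet> \<phi>) *\<^sub>R e)" using eigbasis_expansion[OF E \<phi>] by simp
  also have "\<dots> = (\<Sum>e\<in>E. (e \<bullet> \<phi>) *\<^sub>R A e)" by (rule lin_on_sum[OF A D(1)]) (rule D(5))
  also have "\<dots> = (\<Sum>e\<in>E. ((e \<bullet> A e) * (e \<bullet> \<phi>)) *\<^sub>R e)"
    by (intro sum.cong refl) (metis D(4) mult.commute scaleR_scaleR)
  finally show *: "A \<phi> = (\<Sum>e\<in>E. ((e \<bullet> A e) * (e \<bullet> \<phi>)) *\<^sub>R e)" .
  show "\<phi> \<bullet> A \<phi> = (\<Sum>e\<in>E. (e \<bullet> A e) * (e \<bullet> \<phi>)\<^sup>2)"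
    unfolding * inner_sum_right by (simp add: power2_eq_square inner_commute mult.assoc)
qed

lemma span_onset_zero:
  assumes "onset E" "C \<subseteq> E" "w \<in> span C" "e \<in> E" "e \<notin> C"
  shows "e \<bullet> w = 0"
proof -
  have "orthogonal e y" if "y \<in> C" for y
    using onset_inner[OF assms(1,4), of y] assms(2,5) that by (auto simp: orthogonal_def)
  then show ?thesis using orthogonal_to_span[OF assms(3)] by (simp add: orthogonal_def)
qed

text \<open>Courant--Fischer in the form of a comparison of two operators up to finitely many
  linear constraints.\<close>

lemma cnt_compare:
  assumes E: "eigbasis \<Lambda> A E" "lin_on \<Lambda> A" and E': "eigbasis \<Lambda> A' E'" "lin_on \<Lambda> A'"
    and U: "finite U" "\<And>w. w \<in> lsp \<Lambda> \<Longrightarrow> (\<And>u. u \<in> U \<Longrightarrow> u \<bullet> w = 0) \<Longrightarrow> w \<bullet> A w \<le> w \<bullet> A' w"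
  shows "cnt A' E' x \<le> cnt A E x + card U"
proof (rule ccontr)
  assume neg: "\<not> ?thesis"
  note D = eigbasisD[OF E(1)] and D' = eigbasisD[OF E'(1)]
  \<comment> \<open>If the count of A' were too large, some nonzero combination of its low
    eigenvectors would be orthogonal to U and to all low eigenvectors of A. Its form is at most x
    for A' but exceeds x for A (relative to the squared norm), against the comparison of
    forms.\<close>
  let ?C = "{e \<in> E'. e \<bullet> A' e \<le> x}" and ?V = "{e \<in> E. e \<bullet> A e \<le> x}"
  have "card (?V \<union> U) \<le> card ?V + card U" by (rule card_Un_le)
  also have "\<dots> < card ?C" using neg by (simp add: cnt_def)
  finally have lt: "card (?V \<union> U) < card ?C" .
  have "independent ?C" by (rule onset_independent[OF onset_subset[OF D'(3)]]) auto
  then obtain w where w: "w \<in> span ?C" "w \<noteq> 0" "\<And>v. v \<in> ?V \<union> U \<Longrightarrow> v \<bullet> w = 0"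
    using kernel_exists[of ?C "?V \<union> U"] lt D D' U by auto
  have subsp: "subspace (lsp \<Lambda>)" by (auto simp: subspace_def)
  have wl: "w \<in> lsp \<Lambda>"
  proof -
    have "?C \<subseteq> lsp \<Lambda>" using D'(2) by blast
    from span_minimal[OF this subsp] show ?thesis using w(1) by blast
  qed
  have "w \<bullet> A' w = (\<Sum>e\<in>E'. (e \<bullet> A' e) * (e \<bullet> w)\<^sup>2)" by (rule eigbasis_form(2)[OF E' wl])
  also have "\<dots> \<le> (\<Sum>e\<in>E'. x * (e \<bullet> w)\<^sup>2)"
  proof (rule sum_mono)
    fix e assume e: "e \<in> E'"
    show "(e \<bullet> A' e) * (e \<bullet> w)\<^sup>2 \<le> x * (e \<bullet> w)\<^sup>2"
    proof (cases "e \<in> ?C")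
      case True then show ?thesis by (intro mult_right_mono) auto
    next
      case False
      then show ?thesis using span_onset_zero[OF D'(3) _ w(1) e] by auto
    qed
  qed
  also have "\<dots> = x * (norm w)\<^sup>2" by (simp add: eigbasis_norm[OF E'(1) wl] sum_distrib_left)
  finally have up: "w \<bullet> A' w \<le> x * (norm w)\<^sup>2" .
  have "(\<Sum>e\<in>E. x * (e \<bullet> w)\<^sup>2) < (\<Sum>e\<in>E. (e \<bullet> A e) * (e \<bullet> w)\<^sup>2)"
  proof (rule sum_strict_mono_ex1)
    show "\<forall>e\<in>E. x * (e \<bullet> w)\<^sup>2 \<le> (e \<bullet> A e) * (e \<bullet> w)\<^sup>2"
    proof
      fix e assume "e \<in> E"
      then show "x * (e \<bullet> w)\<^sup>2 \<le> (e \<bullet> A e) * (e \<bullet> w)\<^sup>2"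
        using w(3)[of e] by (cases "e \<bullet> A e \<le> x") (auto intro: mult_right_mono)
    qed
    obtain e where e: "e \<in> E" "e \<bullet> w \<noteq> 0" using D(6)[OF wl] w(2) by blast
    then have "x < e \<bullet> A e" using w(3)[of e] by (cases "e \<bullet> A e \<le> x") auto
    then show "\<exists>e\<in>E. x * (e \<bullet> w)\<^sup>2 < (e \<bullet> A e) * (e \<bullet> w)\<^sup>2" using e by (intro bexI[of _ e]) auto
  qed (rule D)
  then have "x * (norm w)\<^sup>2 < w \<bullet> A w"
    by (simp add: eigbasis_form(2)[OF E wl] eigbasis_norm[OF E(1) wl] sum_distrib_left)
  moreover have "w \<bullet> A w \<le> w \<bullet> A' w" by (rule U(2)[OF wl]) (use w in auto)
  ultimately show False using up by linarith
qed

text \<open>A largest orthonormal system of eigenvectors exists because its size is bounded. Were it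
  incomplete, the minimiser of the Rayleigh quotient on the unit sphere of the orthogonal complement
  would be a further eigenvector.\<close>

lemma eigbasis_exists:
  assumes fin: "finite \<Lambda>" and A: "lin_on \<Lambda> A" "\<And>v. v \<in> lsp \<Lambda> \<Longrightarrow> A v \<in> lsp \<Lambda>"
    and sym: "\<And>v w. v \<in> lsp \<Lambda> \<Longrightarrow> w \<in> lsp \<Lambda> \<Longrightarrow> A v \<bullet> w = v \<bullet> A w"
  obtains E where "eigbasis \<Lambda> A E"
proof -
  define F where "F E \<longleftrightarrow> finite E \<and> E \<subseteq> lsp \<Lambda> \<and> onset E \<and> (\<forall>e\<in>E. A e = (e \<bullet> A e) *\<^sub>R e)" for E
  have "F {}" by (simp add: F_def onset_def)
  moreover have "\<forall>E. F E \<longrightarrow> card E < Suc (2 * card \<Lambda>)"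
    using onset_card_le[OF fin] by (simp add: F_def less_Suc_eq_le)
  ultimately have "\<exists>E. F E \<and> (\<forall>E'. F E' \<longrightarrow> card E' \<le> card E)"
    by (rule Lattices_Big.ex_has_greatest_nat)
  then obtain E where E: "F E" "\<And>E'. F E' \<Longrightarrow> card E' \<le> card E" by (elim exE conjE) simp
  have "\<phi> = 0" if \<phi>: "\<phi> \<in> lsp \<Lambda>" "\<And>e. e \<in> E \<Longrightarrow> e \<bullet> \<phi> = 0" for \<phi>
  proof (rule ccontr)
    assume ne: "\<phi> \<noteq> 0"
    define W where "W = {v \<in> lsp \<Lambda>. \<forall>e\<in>E. e \<bullet> v = 0}"
    define R where "R = {v \<in> lsp \<Lambda>. norm v \<le> 1} \<inter> {v. norm v = 1 \<and> (\<forall>e\<in>E. e \<bullet> v = 0)}"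
    have "closed ({v :: 'a l2. norm v = 1} \<inter> (\<Inter>e\<in>E. {v. e \<bullet> v = 0}))"
      by (intro closed_Int closed_INT ballI closed_Collect_eq continuous_intros)
    moreover have "{v :: 'a l2. norm v = 1} \<inter> (\<Inter>e\<in>E. {v. e \<bullet> v = 0}) = {v. norm v = 1 \<and> (\<forall>e\<in>E. e \<bullet> v = 0)}"
      by auto
    ultimately have "closed {v :: 'a l2. norm v = 1 \<and> (\<forall>e\<in>E. e \<bullet> v = 0)}" by simp
    then have "compact R" unfolding R_def by (rule compact_Int_closed[OF compact_lsp_ball[OF fin]])
    moreover have "(1 / norm \<phi>) *\<^sub>R \<phi> \<in> R" using \<phi> ne by (auto simp: R_def)
    moreover have "continuous_on R (\<lambda>v. v \<bullet> A v)"
      by (intro continuous_intros continuous_on_subset[OF lin_on_continuous[OF fin A(1)]]) (auto simp: R_def)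
    ultimately obtain v0 where v0: "v0 \<in> R" "\<And>u. u \<in> R \<Longrightarrow> v0 \<bullet> A v0 \<le> u \<bullet> A u"
      using continuous_attains_inf[of R] by blast
    define q where "q = v0 \<bullet> A v0"
    have v0W: "v0 \<in> W" "v0 \<in> lsp \<Lambda>" "norm v0 = 1" using v0 by (auto simp: R_def W_def)
    have Wl: "u \<in> lsp \<Lambda>" if "u \<in> W" for u using that by (simp add: W_def)
    have lo: "q * (norm u)\<^sup>2 \<le> u \<bullet> A u" if u: "u \<in> W" for u
    proof (cases "u = 0")
      case True then show ?thesis by simp
    next
      case False
      have "(1 / norm u) *\<^sub>R u \<in> R" using u False by (auto simp: R_def W_def)
      from v0(2)[OF this] show ?thesis
        using False by (simp add: lin_onD(2)[OF A(1) Wl[OF u]] q_def field_simps power2_eq_square)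
    qed
    \<comment> \<open>Varying the minimiser in the direction of its own residual shows that the
      residual has norm 0.\<close>
    define u where "u = A v0 - q *\<^sub>R v0"
    have uW: "u \<in> W"
    proof -
      have "e \<bullet> A v0 = 0" if "e \<in> E" for e
      proof -
        have el: "e \<in> lsp \<Lambda>" and ee: "A e = (e \<bullet> A e) *\<^sub>R e" using E(1) that by (auto simp: F_def)
        have "e \<bullet> A v0 = A e \<bullet> v0" using sym[OF el v0W(2)] by simp
        also have "\<dots> = (e \<bullet> A e) * (e \<bullet> v0)" by (subst ee) simp
        finally show ?thesis using v0W that by (simp add: W_def)
      qed
      then show ?thesis using v0W A(2) by (auto simp: u_def W_def inner_diff_right)
    qed
    have "u \<bullet> A v0 - q * (v0 \<bullet> u) = 0"
    proof (rule psd_form_critical[where q = "\<lambda>v. v \<bullet> A v - q * (norm v)\<^sup>2" and v = v0 and u = u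
          and C = "u \<bullet> A u - q * (norm u)\<^sup>2"])
      fix t
      have tu: "t *\<^sub>R u \<in> lsp \<Lambda>" "v0 + t *\<^sub>R u \<in> W" using uW v0W by (auto simp: W_def inner_add_right)
      show "0 \<le> (v0 + t *\<^sub>R u) \<bullet> A (v0 + t *\<^sub>R u) - q * (norm (v0 + t *\<^sub>R u))\<^sup>2"
        using lo[OF tu(2)] by simp
      have "v0 \<bullet> A u = u \<bullet> A v0" using sym[OF v0W(2) Wl[OF uW]] by (simp add: inner_commute)
      then show "(v0 + t *\<^sub>R u) \<bullet> A (v0 + t *\<^sub>R u) - q * (norm (v0 + t *\<^sub>R u))\<^sup>2 =
        v0 \<bullet> A v0 - q * (norm v0)\<^sup>2 + 2 * t * (u \<bullet> A v0 - q * (v0 \<bullet> u)) + t\<^sup>2 * (u \<bullet> A u - q * (norm u)\<^sup>2)"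
        unfolding lin_onD(1)[OF A(1) v0W(2) tu(1)] lin_onD(2)[OF A(1) Wl[OF uW]] norm_add_scaleR_power2
        by (simp add: inner_add_left inner_add_right power2_eq_square algebra_simps)
    qed (use v0W in \<open>simp add: q_def\<close>)
    then have "u \<bullet> u = 0" by (simp add: u_def inner_diff_left inner_diff_right inner_commute algebra_simps)
    then have "A v0 = q *\<^sub>R v0" by (simp add: u_def)
    moreover have "v0 \<notin> E"
    proof
      assume "v0 \<in> E"
      then have "v0 \<bullet> v0 = 0" using v0W by (auto simp: W_def)
      then show False using v0W by simp
    qed
    ultimately have "F (insert v0 E)"
      using E(1) v0W by (auto simp: F_def onset_def W_def q_def inner_commute)
    from E(2)[OF this] show False using E(1) \<open>v0 \<notin> E\<close> by (simp add: F_def)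
  qed
  then have "eigbasis \<Lambda> A E" using E(1) by (auto simp: eigbasis_def F_def)
  then show ?thesis by (rule that)
qed

section \<open>The spectral family of an operator in finite volume\<close>

definition eproj :: "('a l2 \<Rightarrow> 'a l2) \<Rightarrow> 'a l2 set \<Rightarrow> real \<Rightarrow> 'a l2 \<Rightarrow> 'a l2" where
  "eproj A E x \<phi> = (\<Sum>e | e \<in> E \<and> e \<bullet> A e \<le> x. (e \<bullet> \<phi>) *\<^sub>R e)"

lemma eigbasis_eqI:
  assumes E: "eigbasis \<Lambda> A E" and l: "\<phi> \<in> lsp \<Lambda>" "\<psi> \<in> lsp \<Lambda>" and "\<And>e. e \<in> E \<Longrightarrow> e \<bullet> \<phi> = e \<bullet> \<psi>"
  shows "\<phi> = \<psi>"
proof -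
  have "\<phi> - \<psi> = 0"
    by (rule eigbasisD(6)[OF E]) (use assms in \<open>auto simp: inner_diff_right\<close>)
  then show ?thesis by simp
qed

lemma eigbasis_inner:
  assumes E: "eigbasis \<Lambda> A E" and l: "\<phi> \<in> lsp \<Lambda>"
  shows "\<phi> \<bullet> \<psi> = (\<Sum>e\<in>E. (e \<bullet> \<phi>) * (e \<bullet> \<psi>))"
proof -
  have "\<phi> \<bullet> \<psi> = (\<Sum>e\<in>E. (e \<bullet> \<phi>) *\<^sub>R e) \<bullet> \<psi>" using eigbasis_expansion[OF E l] by simp
  then show ?thesis by (simp add: inner_sum_left)
qed

lemma eproj_lsp: "eigbasis \<Lambda> A E \<Longrightarrow> eproj A E x \<phi> \<in> lsp \<Lambda>"
  unfolding eproj_def by (intro lsp_sum lsp_closed(4)) (auto simp: eigbasis_def)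

lemma inner_eproj:
  assumes E: "eigbasis \<Lambda> A E" and f: "f \<in> E"
  shows "f \<bullet> eproj A E x \<phi> = (if f \<bullet> A f \<le> x then f \<bullet> \<phi> else 0)"
  unfolding eproj_def
  by (subst onset_inner_sum[OF eigbasisD(3)[OF E]]) (use f eigbasisD(1)[OF E] in auto)

context sym_op begin

context
  fixes E assumes DS: "D = lsp S" and E: "eigbasis S T E"
begin

lemma T_lin_on: "lin_on S T"
  unfolding lin_on_def using T_add T_scale DS by blast

lemma inner_T_eig: "e \<in> E \<Longrightarrow> \<phi> \<in> lsp S \<Longrightarrow> e \<bullet> T \<phi> = (e \<bullet> T e) * (e \<bullet> \<phi>)"
proof -
  assume e: "e \<in> E" and \<phi>: "\<phi> \<in> lsp S"
  have "e \<bullet> T \<phi> = T e \<bullet> \<phi>" using T_sym[of e \<phi>] e \<phi> eigbasisD(5)[OF E] DS by simp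
  also have "\<dots> = (e \<bullet> T e) * (e \<bullet> \<phi>)" by (subst eigbasisD(4)[OF E e]) simp
  finally show ?thesis .
qed

lemma eig_imul:
  assumes "e \<in> E" "f \<in> E" "e \<bullet> imul f \<noteq> 0"
  shows "e \<bullet> T e = f \<bullet> T f"
proof -
  have l: "e \<in> lsp S" "f \<in> lsp S" using assms eigbasisD(5)[OF E] by auto
  have "e \<bullet> T (imul f) = (e \<bullet> T e) * (e \<bullet> imul f)" by (rule inner_T_eig) (use assms l in auto)
  moreover have "T (imul f) = (f \<bullet> T f) *\<^sub>R imul f"
    using T_imul[of f] DS l eigbasisD(4)[OF E assms(2)] by (metis imul_simps(4))
  ultimately show ?thesis using assms(3) by simp
qed

text \<open>The real eigenbasis need not be invariant under \<open>imul\<close>, but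
  \<open>imul f\<close> expands only into basis vectors with the eigenvalue of f
  (\<open>eig_imul\<close>), so cutting the expansion at an energy commutes with
  \<open>imul\<close>.\<close>

lemma eproj_imul:
  assumes \<phi>: "\<phi> \<in> lsp S"
  shows "eproj T E x (imul \<phi>) = imul (eproj T E x \<phi>)"
proof (rule eigbasis_eqI[OF E])
  show "eproj T E x (imul \<phi>) \<in> lsp S" "imul (eproj T E x \<phi>) \<in> lsp S"
    using eproj_lsp[OF E] by auto
  fix f assume f: "f \<in> E"
  have fl: "imul f \<in> lsp S" using f eigbasisD(5)[OF E] by auto
  have "f \<bullet> imul (eproj T E x \<phi>) = - (\<Sum>e\<in>E. (e \<bullet> imul f) * (e \<bullet> eproj T E x \<phi>))"
    by (simp add: inner_imul_right eigbasis_inner[OF E fl])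
  also have "(\<Sum>e\<in>E. (e \<bullet> imul f) * (e \<bullet> eproj T E x \<phi>)) =
      (\<Sum>e\<in>E. (if f \<bullet> T f \<le> x then 1 else 0) * ((e \<bullet> imul f) * (e \<bullet> \<phi>)))"
  proof (rule sum.cong[OF refl])
    fix e assume e: "e \<in> E"
    show "(e \<bullet> imul f) * (e \<bullet> eproj T E x \<phi>) = (if f \<bullet> T f \<le> x then 1 else 0) * ((e \<bullet> imul f) * (e \<bullet> \<phi>))"
      using eig_imul[OF e f] by (cases "e \<bullet> imul f = 0") (simp_all add: inner_eproj[OF E e])
  qed
  also have "- \<dots> = (if f \<bullet> T f \<le> x then 1 else 0) * (f \<bullet> imul \<phi>)"
    by (simp add: inner_imul_right eigbasis_inner[OF E fl] sum_negf flip: sum_distrib_left)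
  finally show "f \<bullet> eproj T E x (imul \<phi>) = f \<bullet> imul (eproj T E x \<phi>)"
    by (simp add: inner_eproj[OF E f])
qed

lemma eproj_oproj: "oproj S (eproj T E x)"
  unfolding oproj_def
proof (intro conjI ballI allI)
  fix \<phi> \<psi> c assume l: "\<phi> \<in> lsp S"
  show "eproj T E x \<phi> \<in> lsp S" by (rule eproj_lsp[OF E])
  show "eproj T E x (eproj T E x \<phi>) = eproj T E x \<phi>"
    by (rule eigbasis_eqI[OF E]) (auto simp: inner_eproj[OF E] eproj_lsp[OF E])
  show "eproj T E x (imul \<phi>) = imul (eproj T E x \<phi>)" by (rule eproj_imul[OF l])
  show "eproj T E x (c *\<^sub>R \<phi>) = c *\<^sub>R eproj T E x \<phi>" by (simp add: eproj_def scaleR_sum_right)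
  assume l': "\<psi> \<in> lsp S"
  show "eproj T E x (\<phi> + \<psi>) = eproj T E x \<phi> + eproj T E x \<psi>"
    by (simp add: eproj_def inner_add_right scaleR_left_distrib sum.distrib)
  show "eproj T E x \<phi> \<bullet> \<psi> = \<phi> \<bullet> eproj T E x \<psi>"
    unfolding eigbasis_inner[OF E l] eigbasis_inner[OF E eproj_lsp[OF E]]
    by (intro sum.cong refl) (simp add: inner_eproj[OF E])
qed

text \<open>There are finitely many eigenvalues, so y -> Q y \<phi> is a step function and each
  limit is eventually attained.\<close>

lemma eproj_roi: "roi S (eproj T E)"
proof -
  have fin: "finite E" by (rule eigbasisD[OF E])
  \<comment> \<open>E' will be E itself or the empty set; the latter encodes the limit at minus
    infinity.\<close>
  have ev: "\<forall>\<^sub>F y in F. eproj T E y \<phi> = eproj T E' x \<phi>"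
    if "\<And>e. e \<in> E \<Longrightarrow> \<forall>\<^sub>F y in F. (e \<bullet> T e \<le> y) = (e \<in> E' \<and> e \<bullet> T e \<le> x)" "E' \<subseteq> E" for F E' x \<phi>
  proof -
    have "\<forall>\<^sub>F y in F. \<forall>e\<in>E. (e \<bullet> T e \<le> y) = (e \<in> E' \<and> e \<bullet> T e \<le> x)"
      by (rule eventually_ball_finite[OF fin]) (use that in auto)
    then show ?thesis
    proof eventually_elim
      case (elim y)
      then have "{e \<in> E. e \<bullet> T e \<le> y} = {e \<in> E'. e \<bullet> T e \<le> x}" using that(2) by auto
      then show ?case by (simp add: eproj_def)
    qed
  qed
  show ?thesis
    unfolding roi_def
  proof (intro conjI allI ballI)
    show "oproj S (eproj T E x)" for x by (rule eproj_oproj)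
    fix \<phi> x y assume l: "\<phi> \<in> lsp S"
    show "eproj T E x (eproj T E y \<phi>) = eproj T E (min x y) \<phi>"
      by (rule eigbasis_eqI[OF E]) (auto simp: inner_eproj[OF E] eproj_lsp[OF E])
    show "((\<lambda>y. eproj T E y \<phi>) \<longlongrightarrow> eproj T E x \<phi>) (at_right x)"
    proof (rule tendsto_eventually, rule ev)
      fix e
      show "\<forall>\<^sub>F y in at_right x. (e \<bullet> T e \<le> y) = (e \<in> E \<and> e \<bullet> T e \<le> x)" if "e \<in> E"
      proof (cases "e \<bullet> T e \<le> x")
        case True
        then show ?thesis using that eventually_at_right_less[of x] by (auto elim: eventually_mono)
      next
        case False
        then show ?thesis using that
            eventually_at_right_real[of x "e \<bullet> T e"] by (auto elim!: eventually_mono)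
      qed
    qed auto
    have "((\<lambda>y. eproj T E y \<phi>) \<longlongrightarrow> eproj T {} 0 \<phi>) at_bot"
    proof (rule tendsto_eventually, rule ev)
      show "\<forall>\<^sub>F y in at_bot. (e \<bullet> T e \<le> y) = (e \<in> {} \<and> e \<bullet> T e \<le> 0)" for e
        using eventually_le_at_bot[of "e \<bullet> T e - 1"] by eventually_elim auto
    qed auto
    then show "((\<lambda>y. eproj T E y \<phi>) \<longlongrightarrow> 0) at_bot" by (simp add: eproj_def)
    have "((\<lambda>y. eproj T E y \<phi>) \<longlongrightarrow> eproj T E (\<Sum>e\<in>E. \<bar>e \<bullet> T e\<bar>) \<phi>) at_top"
    proof (rule tendsto_eventually, rule ev)
      fix e assume e: "e \<in> E"
      have "e \<bullet> T e \<le> (\<Sum>e\<in>E. \<bar>e \<bullet> T e\<bar>)"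
        using member_le_sum[OF e, of "\<lambda>e. \<bar>e \<bullet> T e\<bar>"] fin by auto
      then show "\<forall>\<^sub>F y in at_top. (e \<bullet> T e \<le> y) = (e \<in> E \<and> e \<bullet> T e \<le> (\<Sum>e\<in>E. \<bar>e \<bullet> T e\<bar>))"
        using e eventually_ge_at_top[of "e \<bullet> T e"] by (auto elim!: eventually_mono)
    qed auto
    moreover have "eproj T E (\<Sum>e\<in>E. \<bar>e \<bullet> T e\<bar>) \<phi> = \<phi>"
    proof (rule eigbasis_eqI[OF E eproj_lsp[OF E] l])
      fix e assume e: "e \<in> E"
      have "e \<bullet> T e \<le> (\<Sum>e\<in>E. \<bar>e \<bullet> T e\<bar>)"
        using member_le_sum[OF e, of "\<lambda>e. \<bar>e \<bullet> T e\<bar>"] fin by auto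
      then show "e \<bullet> eproj T E (\<Sum>e\<in>E. \<bar>e \<bullet> T e\<bar>) \<phi> = e \<bullet> \<phi>" by (simp add: inner_eproj[OF E e])
    qed
    ultimately show "((\<lambda>y. eproj T E y \<phi>) \<longlongrightarrow> \<phi>) at_top" by simp
  qed
qed

theorem eproj_pfam: "pfam S D T (eproj T E)"
  unfolding pfam_def DS
proof (intro conjI ballI allI impI)
  show "roi S (eproj T E)" by (rule eproj_roi)
  fix \<phi> x assume l: "\<phi> \<in> lsp S"
  show "eproj T E x \<phi> \<in> lsp S" by (rule eproj_lsp[OF E])
  show "T (eproj T E x \<phi>) = eproj T E x (T \<phi>)"
    by (rule eigbasis_eqI[OF E])
       (auto simp: inner_eproj[OF E] eproj_lsp[OF E] inner_T_eig l DS intro!: T_lsp)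
  show "\<phi> \<bullet> T \<phi> \<le> x * (norm \<phi>)\<^sup>2" if q: "eproj T E x \<phi> = \<phi>"
    unfolding eigbasis_form(2)[OF E T_lin_on l] eigbasis_norm[OF E l] sum_distrib_left
  proof (rule sum_mono)
    fix e assume e: "e \<in> E"
    show "(e \<bullet> T e) * (e \<bullet> \<phi>)\<^sup>2 \<le> x * (e \<bullet> \<phi>)\<^sup>2"
      using inner_eproj[OF E e, of x \<phi>] q by (cases "e \<bullet> T e \<le> x") (auto intro: mult_right_mono)
  qed
  show "x * (norm \<phi>)\<^sup>2 \<le> \<phi> \<bullet> T \<phi>" if q: "eproj T E x \<phi> = 0"
    unfolding eigbasis_form(2)[OF E T_lin_on l] eigbasis_norm[OF E l] sum_distrib_left
  proof (rule sum_mono)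
    fix e assume e: "e \<in> E"
    show "x * (e \<bullet> \<phi>)\<^sup>2 \<le> (e \<bullet> T e) * (e \<bullet> \<phi>)\<^sup>2"
      using inner_eproj[OF E e, of x \<phi>] q by (cases "e \<bullet> T e \<le> x") (auto intro: mult_right_mono)
  qed
qed

text \<open>Q x splits an eigenvector into two vectors that satisfy the same eigenvalue equation,
  one with energies at most x and one, by \<open>pfam_strict\<close>, with energies strictly above
  x. The one that contradicts the eigenvalue must vanish. This frees the finite volume results from
  the choice inside \<open>spectral_projection_atMost\<close>.\<close>

theorem pfam_eq_eproj:
  assumes pf: "pfam S D T Q" and \<phi>: "\<phi> \<in> lsp S"
  shows "Q x \<phi> = eproj T E x \<phi>"
proof (rule eigbasis_eqI[OF E _ eproj_lsp[OF E]])
  note r = pfam_roi[OF pf]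
  show "Q x \<phi> \<in> lsp S" by (rule roi_lsp[OF r \<phi>])
  fix f assume f: "f \<in> E"
  define lam where "lam = f \<bullet> T f"
  have fl: "f \<in> lsp S" "f \<in> D" using eigbasisD(5)[OF E f] DS by auto
  have Tf: "T f = lam *\<^sub>R f" using eigbasisD(4)[OF E f] by (simp add: lam_def)
  define u w where "u = Q x f" and "w = f - Q x f"
  have ul: "u \<in> lsp S" "w \<in> lsp S" using roi_lsp[OF r fl(1)] fl by (auto simp: u_def w_def)
  have Tu: "T u = lam *\<^sub>R u"
    using pfam_props(2)[OF pf fl(2), of x] oprojD(4)[OF roi_oproj[OF r] fl(1)] by (simp add: u_def Tf)
  have Tw: "T w = lam *\<^sub>R w"
    using T_diff[of f u] ul fl DS Tu Tf by (simp add: w_def u_def algebra_simps)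
  have qu: "Q x u = u" "Q x w = 0"
    using roi_min[OF r fl(1), of x x] roi_linear(2)[OF r fl(1) roi_lsp[OF r fl(1)]] by (auto simp: u_def w_def)
  have "Q x f = (if lam \<le> x then f else 0)"
  proof (cases "lam \<le> x")
    case True
    have "w = 0"
    proof (rule ccontr)
      assume ne: "w \<noteq> 0"
      have "x * (norm w)\<^sup>2 < w \<bullet> T w" by (rule pfam_strict[OF pf]) (use ul DS qu ne in auto)
      then have "x * (norm w)\<^sup>2 < lam * (norm w)\<^sup>2" by (simp add: Tw power2_norm_eq_inner)
      then show False using True ne by (simp add: mult_less_cancel_right)
    qed
    then show ?thesis using True by (simp add: w_def)
  next
    case False
    have "u \<bullet> T u \<le> x * (norm u)\<^sup>2" by (rule pfam_props(3)[OF pf]) (use ul DS qu in auto)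
    then have "lam * (norm u)\<^sup>2 \<le> x * (norm u)\<^sup>2" by (simp add: Tu power2_norm_eq_inner)
    then have "u = 0" using False by (auto simp: mult_le_cancel_right)
    then show ?thesis using False by (simp add: u_def)
  qed
  then show "f \<bullet> Q x \<phi> = f \<bullet> eproj T E x \<phi>"
    using roi_linear(3)[OF r fl(1) \<phi>, of x] by (auto simp: inner_eproj[OF E f] lam_def)
qed

text \<open>The real trace runs over \<open>dl z\<close> and \<open>imul (dl z)\<close>, which
  contribute equally because the projection commutes with \<open>imul\<close>; it is therefore twice
  the complex trace.\<close>

theorem cnt_trace:
  assumes fin: "finite S"
  shows "2 * (\<Sum>z\<in>S. dl z \<bullet> eproj T E x (dl z)) = real (cnt T E x)"
proof -
  let ?C = "{e \<in> E. e \<bullet> T e \<le> x}"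
  have 1: "\<phi> \<bullet> eproj T E x \<phi> = (\<Sum>e\<in>?C. (e \<bullet> \<phi>)\<^sup>2)" for \<phi>
    by (simp add: eproj_def inner_sum_right power2_eq_square inner_commute)
  have 2: "imul (dl z) \<bullet> eproj T E x (imul (dl z)) = dl z \<bullet> eproj T E x (dl z)" if "z \<in> S" for z
    using that by (subst eproj_imul) auto
  have "2 * (\<Sum>z\<in>S. dl z \<bullet> eproj T E x (dl z)) =
     (\<Sum>z\<in>S. dl z \<bullet> eproj T E x (dl z) + imul (dl z) \<bullet> eproj T E x (imul (dl z)))"
    unfolding sum_distrib_left by (intro sum.cong refl) (simp add: 2)
  also have "\<dots> = (\<Sum>z\<in>S. \<Sum>e\<in>?C. (e \<bullet> dl z)\<^sup>2 + (e \<bullet> imul (dl z))\<^sup>2)"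
    by (simp add: 1 sum.distrib)
  also have "\<dots> = (\<Sum>e\<in>?C. \<Sum>z\<in>S. (e \<bullet> dl z)\<^sup>2 + (e \<bullet> imul (dl z))\<^sup>2)" by (rule sum.swap)
  also have "\<dots> = (\<Sum>e\<in>?C. (norm e)\<^sup>2)"
    by (intro sum.cong refl norm_lsp_sum[symmetric] fin) (use eigbasisD(5)[OF E] in auto)
  also have "\<dots> = real (card ?C)" using eigbasisD(3)[OF E] by (simp add: onset_def)
  finally show ?thesis by (simp add: cnt_def)
qed

end

end

subsection \<open>The Hamiltonian\<close>

lemma int_l1_norm: "int (l1_norm x) = (\<Sum>i\<in>UNIV. \<bar>x $ i\<bar>)"
  by (simp add: l1_norm_def sum_nonneg)

lemma l1_norm_triangle: "l1_norm (x + y) \<le> l1_norm x + l1_norm y"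
proof -
  have "int (l1_norm (x + y)) \<le> int (l1_norm x + l1_norm y)"
    by (simp add: int_l1_norm sum.distrib[symmetric] sum_mono abs_triangle_ineq)
  then show ?thesis by (simp only: of_nat_le_iff)
qed

lemma l1_norm_minus [simp]: "l1_norm (- x) = l1_norm x"
  by (simp add: l1_norm_def)

lemma l1_norm_zero [simp]: "l1_norm 0 = 0"
  by (simp add: l1_norm_def)

lemma component_le_l1_norm: "\<bar>x $ i\<bar> \<le> int (l1_norm x)"
  unfolding int_l1_norm by (rule member_le_sum) auto

lemma finite_vec_box: "finite {x :: int ^ 'd. \<forall>i. a \<le> x $ i \<and> x $ i \<le> b}"
proof (rule finite_subset)
  show "{x :: int ^ 'd. \<forall>i. a \<le> x $ i \<and> x $ i \<le> b} \<subseteq> vec_lambda ` (PiE UNIV (\<lambda>_. {a..b}))"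
  proof
    fix x :: "int ^ 'd" assume "x \<in> {x. \<forall>i. a \<le> x $ i \<and> x $ i \<le> b}"
    then have "(\<lambda>i. x $ i) \<in> PiE UNIV (\<lambda>_. {a..b})" "x = vec_lambda (\<lambda>i. x $ i)"
      by (auto simp: PiE_def vec_lambda_eta)
    then show "x \<in> vec_lambda ` (PiE UNIV (\<lambda>_. {a..b}))" by (metis imageI)
  qed
qed (intro finite_imageI finite_PiE, auto)

definition l1_ball :: "nat \<Rightarrow> (int ^ 'd) set" where "l1_ball N = {z. l1_norm z < N}"

lemma finite_l1_norm_le: "finite {z :: int ^ 'd. l1_norm z \<le> N}"
proof (rule finite_subset[OF _ finite_vec_box[of "- int N" "int N"]])
  show "{z. l1_norm z \<le> N} \<subseteq> {x :: int ^ 'd. \<forall>i. - int N \<le> x $ i \<and> x $ i \<le> int N}"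
  proof clarify
    fix z :: "int ^ 'd" and i assume "l1_norm z \<le> N"
    then show "- int N \<le> z $ i \<and> z $ i \<le> int N" using component_le_l1_norm[of z i] by linarith
  qed
qed

lemma finite_l1_ball [simp]: "finite (l1_ball N)"
  by (rule finite_subset[OF _ finite_l1_norm_le[of N]]) (auto simp: l1_ball_def)

definition nb :: "(int ^ 'd) set" where "nb = {u. l1_norm u = 1}"

lemma finite_nb [simp]: "finite nb"
  by (rule finite_subset[OF _ finite_l1_norm_le[of 1]]) (auto simp: nb_def)

lemma nb_uminus: "uminus ` nb = nb"
proof
  show "uminus ` nb \<subseteq> nb" by (auto simp: nb_def)
  show "nb \<subseteq> uminus ` nb"
  proof
    fix u assume "u \<in> nb"
    then have "- u \<in> nb" "u = - (- u)" by (auto simp: nb_def)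
    then show "u \<in> uminus ` nb" by blast
  qed
qed

lemma bij_add_vec: "bij_betw (\<lambda>z. z + u) UNIV (UNIV :: (int ^ 'd) set)"
  by (rule bij_betw_byWitness[where f' = "\<lambda>z. z - u"]) auto

text \<open>Oriented like \<open>shift\<close> on configurations, so that moving the configuration
  and the vector by the same z moves the Hamiltonian (\<open>Hloc_shiftop\<close>).\<close>

definition shiftop :: "int ^ 'd \<Rightarrow> (int ^ 'd) l2 \<Rightarrow> (int ^ 'd) l2" where
  "shiftop u \<phi> = Abs_l2 (\<lambda>z. l2_fun \<phi> (z + u))"

lemma l2_fun_shiftop [simp]: "l2_fun (shiftop u \<phi>) z = l2_fun \<phi> (z + u)"
proof -
  have "(\<lambda>z. (cmod (l2_fun \<phi> (z + u)))\<^sup>2) summable_on UNIV"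
    using summable_on_reindex_bij_betw[OF bij_add_vec[of u], of "\<lambda>z. (cmod (l2_fun \<phi> z))\<^sup>2"]
      l2_fun_in[of \<phi>] by (simp add: ell2_UNIV_iff)
  then show ?thesis unfolding shiftop_def by (subst l2_fun_Abs) (simp_all add: ell2_UNIV_iff)
qed

lemma shiftop_simps [simp]:
  "shiftop u (\<phi> + \<psi>) = shiftop u \<phi> + shiftop u \<psi>" "shiftop u (c *\<^sub>R \<phi>) = c *\<^sub>R shiftop u \<phi>"
  "shiftop u (imul \<phi>) = imul (shiftop u \<phi>)" "shiftop u (shiftop v \<phi>) = shiftop (u + v) \<phi>" "shiftop 0 \<phi> = \<phi>"
  by (rule l2_eqI; simp add: ac_simps)+

lemma shiftop_inner: "shiftop u \<phi> \<bullet> \<psi> = \<phi> \<bullet> shiftop (- u) \<psi>"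
proof -
  have "\<phi> \<bullet> shiftop (- u) \<psi> = (\<Sum>\<^sub>\<infinity>z. Re (cnj (l2_fun \<phi> (z + u)) * l2_fun (shiftop (- u) \<psi>) (z + u)))"
    unfolding inner_l2_eq by (rule infsum_reindex_bij_betw[OF bij_add_vec[of u], symmetric])
  then show ?thesis by (simp add: inner_l2_eq)
qed

lemma shiftop_inner_shiftop [simp]: "shiftop u \<phi> \<bullet> shiftop u \<psi> = \<phi> \<bullet> \<psi>"
  by (simp add: shiftop_inner)

lemma norm_shiftop [simp]: "norm (shiftop u \<phi>) = norm \<phi>"
  by (simp add: norm_eq_sqrt_inner)

definition lap :: "(int ^ 'd) l2 \<Rightarrow> (int ^ 'd) l2" where "lap \<phi> = (\<Sum>u\<in>nb. shiftop u \<phi> - \<phi>)"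

lemma lap_simps [simp]:
  "lap (\<phi> + \<psi>) = lap \<phi> + lap \<psi>" "lap (c *\<^sub>R \<phi>) = c *\<^sub>R lap \<phi>" "lap (imul \<phi>) = imul (lap \<phi>)"
proof -
  show 1: "lap (\<phi> + \<psi>) = lap \<phi> + lap \<psi>" for \<phi> \<psi> :: "(int ^ 'd) l2"
    unfolding lap_def sum.distrib[symmetric] by (intro sum.cong refl) (simp add: algebra_simps)
  show "lap (c *\<^sub>R \<phi>) = c *\<^sub>R lap \<phi>"
    unfolding lap_def scaleR_sum_right by (intro sum.cong refl) (simp add: algebra_simps)
  show "lap (imul \<phi>) = imul (lap \<phi>)"
    by (rule l2_eqI) (simp add: lap_def sum_distrib_left algebra_simps)
qed

lemma lap_diff: "lap (\<phi> - \<psi>) = lap \<phi> - lap \<psi>"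
  using lap_simps(1)[of \<phi> "(-1) *\<^sub>R \<psi>"] lap_simps(2)[of "-1" \<psi>] by simp

lemma lap_inner: "lap \<phi> \<bullet> \<psi> = \<phi> \<bullet> lap \<psi>"
proof -
  have "(\<Sum>u\<in>nb. \<phi> \<bullet> shiftop (- u) \<psi>) = (\<Sum>u\<in>uminus ` nb. \<phi> \<bullet> shiftop u \<psi>)"
    by (subst sum.reindex) (auto simp: inj_on_def)
  then have "(\<Sum>u\<in>nb. shiftop u \<phi> \<bullet> \<psi>) = (\<Sum>u\<in>nb. \<phi> \<bullet> shiftop u \<psi>)"
    by (simp add: shiftop_inner nb_uminus)
  then show ?thesis
    by (simp add: lap_def inner_sum_left inner_sum_right inner_diff_left inner_diff_right sum_subtractf)
qed

lemma norm_lap_le: "norm (lap \<phi>) \<le> 2 * real (card (nb :: (int ^ 'd) set)) * norm \<phi>"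
  for \<phi> :: "(int ^ 'd) l2"
proof -
  have "norm (lap \<phi>) \<le> (\<Sum>u\<in>(nb :: (int ^ 'd) set). 2 * norm \<phi>)"
    unfolding lap_def
  proof (rule sum_norm_le)
    fix u :: "int ^ 'd"
    show "norm (shiftop u \<phi> - \<phi>) \<le> 2 * norm \<phi>" using norm_triangle_ineq4[of "shiftop u \<phi>" \<phi>] by simp
  qed
  then show ?thesis by simp
qed

lemma laplacian_eq_lap: "laplacian (l2_fun \<phi>) = l2_fun (lap \<phi>)" for \<phi> :: "(int ^ 'd) l2"
proof
  fix z :: "int ^ 'd"
  have "{x. l1_norm (x - z) = 1} = (\<lambda>u. z + u) ` nb"
  proof (intro equalityI subsetI)
    fix x assume "x \<in> {x. l1_norm (x - z) = 1}"
    then have "x - z \<in> nb" "x = z + (x - z)" by (auto simp: nb_def)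
    then show "x \<in> (\<lambda>u. z + u) ` nb" by blast
  qed (auto simp: nb_def)
  then show "laplacian (l2_fun \<phi>) z = l2_fun (lap \<phi>) z"
    unfolding laplacian_def by (simp add: sum.reindex lap_def)
qed

section \<open>Hamiltonians in infinite and finite volume\<close>

definition Hdom :: "(int ^ 'd \<Rightarrow> real) \<Rightarrow> (int ^ 'd) l2 set" where
  "Hdom \<omega> = {\<phi>. (\<lambda>x. of_real (\<omega> x) * l2_fun \<phi> x) \<in> ell2 UNIV}"

definition Hop :: "(int ^ 'd \<Rightarrow> real) \<Rightarrow> (int ^ 'd) l2 \<Rightarrow> (int ^ 'd) l2" where
  "Hop \<omega> \<phi> = mulop \<omega> \<phi> - lap \<phi>"

text \<open>The potential is set to 0 off \<Lambda> inside the formula. The operator, as a function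
  on the whole type, is then determined by \<omega> on \<Lambda>, and so is the eigenbasis chosen
  for it (\<open>Qf_local\<close>).\<close>

definition Hloc :: "(int ^ 'd) set \<Rightarrow> (int ^ 'd \<Rightarrow> real) \<Rightarrow> (int ^ 'd) l2 \<Rightarrow> (int ^ 'd) l2" where
  "Hloc \<Lambda> \<omega> \<phi> = cutoff \<Lambda> (mulop (\<lambda>z. if z \<in> \<Lambda> then \<omega> z else 0) \<phi> - lap \<phi>)"

lemma l2_fun_mulop_Hdom: "\<phi> \<in> Hdom \<omega> \<Longrightarrow> l2_fun (mulop \<omega> \<phi>) x = of_real (\<omega> x) * l2_fun \<phi> x"
  unfolding mulop_def Hdom_def by (simp add: l2_fun_Abs)

lemma ell2_finite_support:
  assumes "finite {x. v x \<noteq> 0}"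
  shows "v \<in> ell2 UNIV"
  unfolding ell2_UNIV_iff
  by (rule finite_nonzero_values_imp_summable_on) (use assms in simp)

lemma fsupp_Hdom: "\<phi> \<in> fsupp S \<Longrightarrow> \<phi> \<in> Hdom \<omega>"
  unfolding Hdom_def fsupp_def by (auto intro!: ell2_finite_support elim: finite_subset[rotated])

lemma lsp_Hdom: "finite \<Lambda> \<Longrightarrow> \<phi> \<in> lsp \<Lambda> \<Longrightarrow> \<phi> \<in> Hdom \<omega>"
  using fsupp_finite[of \<Lambda>] fsupp_Hdom by blast

lemma Hdom_closed:
  "\<phi> \<in> Hdom \<omega> \<Longrightarrow> \<psi> \<in> Hdom \<omega> \<Longrightarrow> \<phi> + \<psi> \<in> Hdom \<omega>" "\<phi> \<in> Hdom \<omega> \<Longrightarrow> c *\<^sub>R \<phi> \<in> Hdom \<omega>"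
  "\<phi> \<in> Hdom \<omega> \<Longrightarrow> imul \<phi> \<in> Hdom \<omega>" "\<phi> \<in> Hdom \<omega> \<Longrightarrow> cutoff F \<phi> \<in> Hdom \<omega>"
proof -
  show "\<phi> \<in> Hdom \<omega> \<Longrightarrow> \<psi> \<in> Hdom \<omega> \<Longrightarrow> \<phi> + \<psi> \<in> Hdom \<omega>"
    using ell2_add[of "\<lambda>x. of_real (\<omega> x) * l2_fun \<phi> x" "\<lambda>x. of_real (\<omega> x) * l2_fun \<psi> x"]
    by (simp add: Hdom_def algebra_simps)
  show "\<phi> \<in> Hdom \<omega> \<Longrightarrow> c *\<^sub>R \<phi> \<in> Hdom \<omega>"
    using ell2_scale[of "\<lambda>x. of_real (\<omega> x) * l2_fun \<phi> x" "of_real c"]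
    by (simp add: Hdom_def algebra_simps)
  show "\<phi> \<in> Hdom \<omega> \<Longrightarrow> imul \<phi> \<in> Hdom \<omega>"
    using ell2_scale[of "\<lambda>x. of_real (\<omega> x) * l2_fun \<phi> x" \<i>]
    by (simp add: Hdom_def algebra_simps)
  show "\<phi> \<in> Hdom \<omega> \<Longrightarrow> cutoff F \<phi> \<in> Hdom \<omega>"
    unfolding Hdom_def mem_Collect_eq
    by (rule ell2_bounded_mult[where C = 1]) (auto simp: norm_mult)
qed

lemma mulop_Hdom:
  assumes "\<phi> \<in> Hdom \<omega>"
  shows "\<psi> \<in> Hdom \<omega> \<Longrightarrow> mulop \<omega> (\<phi> + \<psi>) = mulop \<omega> \<phi> + mulop \<omega> \<psi>"
    "mulop \<omega> (c *\<^sub>R \<phi>) = c *\<^sub>R mulop \<omega> \<phi>" "mulop \<omega> (imul \<phi>) = imul (mulop \<omega> \<phi>)"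
    "mulop \<omega> (cutoff F \<phi>) = cutoff F (mulop \<omega> \<phi>)"
    "\<psi> \<in> Hdom \<omega> \<Longrightarrow> mulop \<omega> \<phi> \<bullet> \<psi> = \<phi> \<bullet> mulop \<omega> \<psi>"
proof -
  note c = Hdom_closed[OF assms] Hdom_closed(2-4)[OF assms]
  show "\<psi> \<in> Hdom \<omega> \<Longrightarrow> mulop \<omega> (\<phi> + \<psi>) = mulop \<omega> \<phi> + mulop \<omega> \<psi>"
    by (rule l2_eqI) (simp add: l2_fun_mulop_Hdom assms Hdom_closed algebra_simps)
  show "mulop \<omega> (c *\<^sub>R \<phi>) = c *\<^sub>R mulop \<omega> \<phi>" "mulop \<omega> (imul \<phi>) = imul (mulop \<omega> \<phi>)"
    "mulop \<omega> (cutoff F \<phi>) = cutoff F (mulop \<omega> \<phi>)"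
    by (rule l2_eqI; simp add: l2_fun_mulop_Hdom assms Hdom_closed algebra_simps)+
  show "\<psi> \<in> Hdom \<omega> \<Longrightarrow> mulop \<omega> \<phi> \<bullet> \<psi> = \<phi> \<bullet> mulop \<omega> \<psi>"
    unfolding inner_l2_eq by (rule infsum_cong) (simp add: l2_fun_mulop_Hdom assms algebra_simps)
qed

lemma Hloc_eq_cutoff:
  assumes "finite \<Lambda>" "\<phi> \<in> lsp \<Lambda>"
  shows "Hloc \<Lambda> \<omega> \<phi> = cutoff \<Lambda> (Hop \<omega> \<phi>)"
proof (rule l2_eqI)
  fix x
  have bd: "\<bar>if z \<in> \<Lambda> then \<omega> z else 0\<bar> \<le> (\<Sum>z\<in>\<Lambda>. \<bar>\<omega> z\<bar>)" for z
    using assms(1) by (auto intro: member_le_sum sum_nonneg)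
  show "l2_fun (Hloc \<Lambda> \<omega> \<phi>) x = l2_fun (cutoff \<Lambda> (Hop \<omega> \<phi>)) x"
    using assms by (simp add: Hloc_def Hop_def l2_fun_mulop_bounded[OF bd] l2_fun_mulop_Hdom lsp_Hdom)
qed

lemma Hop_linear:
  assumes "\<phi> \<in> Hdom \<omega>"
  shows "\<psi> \<in> Hdom \<omega> \<Longrightarrow> Hop \<omega> (\<phi> + \<psi>) = Hop \<omega> \<phi> + Hop \<omega> \<psi>" "Hop \<omega> (c *\<^sub>R \<phi>) = c *\<^sub>R Hop \<omega> \<phi>"
    "Hop \<omega> (imul \<phi>) = imul (Hop \<omega> \<phi>)" "\<psi> \<in> Hdom \<omega> \<Longrightarrow> Hop \<omega> \<phi> \<bullet> \<psi> = \<phi> \<bullet> Hop \<omega> \<psi>"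
  by (simp_all add: Hop_def mulop_Hdom[OF assms] lap_inner inner_diff_left inner_diff_right algebra_simps)

text \<open>Maximality of the domain: testing with \<psi>, the product \<omega> \<phi> cut off to a
  finite set F, turns the assumed bound into |\<psi>|^2 \<le> K |\<psi>| with K independent of F,
  because the Laplacian is bounded. Letting F grow makes \<omega> \<phi> square summable.\<close>

lemma sym_op_Hop: "sym_op UNIV (Hdom \<omega>) (Hop (\<omega> :: int ^ 'd \<Rightarrow> real))"
proof
  show "fsupp UNIV \<subseteq> Hdom \<omega>" using fsupp_Hdom by blast
  fix \<phi> :: "(int ^ 'd) l2" and C
  assume bd: "\<And>\<psi>. \<psi> \<in> fsupp UNIV \<Longrightarrow> Hop \<omega> \<psi> \<bullet> \<phi> \<le> C * norm \<psi>"
  define K where "K = \<bar>C\<bar> + 2 * real (card (nb :: (int ^ 'd) set)) * norm \<phi>"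
  have K: "0 \<le> K" by (simp add: K_def)
  show "\<phi> \<in> Hdom \<omega>"
    unfolding Hdom_def mem_Collect_eq
  proof (rule ell2_bounded_sums)
    fix F :: "(int ^ 'd) set" assume F: "finite F"
    define g where "g x = (if x \<in> F then \<omega> x else 0)" for x
    define \<psi> where "\<psi> = mulop g \<phi>"
    have gbd: "\<bar>g z\<bar> \<le> (\<Sum>z\<in>F. \<bar>\<omega> z\<bar>)" for z
      using F by (auto simp: g_def intro: member_le_sum sum_nonneg)
    have \<psi>x: "l2_fun \<psi> x = of_real (g x) * l2_fun \<phi> x" for x
      unfolding \<psi>_def by (rule l2_fun_mulop_bounded[OF gbd])
    have \<psi>: "\<psi> \<in> fsupp UNIV"
      unfolding fsupp_def using F by (auto simp: \<psi>x g_def intro: finite_subset)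
    have "mulop \<omega> \<psi> \<bullet> \<phi> = \<psi> \<bullet> \<psi>"
      unfolding inner_l2_eq
      by (rule infsum_cong) (simp add: l2_fun_mulop_Hdom[OF fsupp_Hdom[OF \<psi>]] \<psi>x g_def)
    then have "(norm \<psi>)\<^sup>2 = Hop \<omega> \<psi> \<bullet> \<phi> + lap \<psi> \<bullet> \<phi>"
      by (simp add: Hop_def inner_diff_left power2_norm_eq_inner)
    also have "\<dots> \<le> \<bar>C\<bar> * norm \<psi> + (2 * real (card (nb :: (int ^ 'd) set)) * norm \<psi>) * norm \<phi>"
    proof (rule add_mono)
      show "Hop \<omega> \<psi> \<bullet> \<phi> \<le> \<bar>C\<bar> * norm \<psi>"
        using bd[OF \<psi>] mult_right_mono[OF abs_ge_self[of C] norm_ge_zero[of \<psi>]] by linarith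
      show "lap \<psi> \<bullet> \<phi> \<le> (2 * real (card (nb :: (int ^ 'd) set)) * norm \<psi>) * norm \<phi>"
        by (rule order_trans[OF norm_cauchy_schwarz mult_right_mono[OF norm_lap_le]]) auto
    qed
    also have "\<dots> = K * norm \<psi>" by (simp add: K_def algebra_simps)
    finally have "norm \<psi> \<le> K"
      using K by (cases "norm \<psi> = 0") (auto simp: power2_eq_square mult_le_cancel_right)
    have "(\<Sum>x\<in>F. (cmod (of_real (\<omega> x) * l2_fun \<phi> x))\<^sup>2) = (\<Sum>x\<in>F. (cmod (l2_fun \<psi> x))\<^sup>2)"
      by (intro sum.cong) (simp_all add: \<psi>x g_def)
    also have "\<dots> \<le> (norm \<psi>)\<^sup>2" by (rule l2_sum_le[OF F])
    also have "\<dots> \<le> K\<^sup>2" using \<open>norm \<psi> \<le> K\<close> by (intro power_mono) auto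
    finally show "(\<Sum>x\<in>F. (cmod (of_real (\<omega> x) * l2_fun \<phi> x))\<^sup>2) \<le> K\<^sup>2" .
  qed
qed (auto simp: Hop_linear Hdom_closed)

lemma sym_op_Hloc:
  assumes fin: "finite \<Lambda>"
  shows "sym_op \<Lambda> (lsp \<Lambda>) (Hloc \<Lambda> \<omega>)"
proof
  fix \<phi> \<psi> c assume l: "\<phi> \<in> lsp \<Lambda>"
  note d = lsp_Hdom[OF fin]
  show "Hloc \<Lambda> \<omega> \<phi> \<in> lsp \<Lambda>" by (simp add: Hloc_def lsp_closed)
  show "Hloc \<Lambda> \<omega> (c *\<^sub>R \<phi>) = c *\<^sub>R Hloc \<Lambda> \<omega> \<phi>" "Hloc \<Lambda> \<omega> (imul \<phi>) = imul (Hloc \<Lambda> \<omega> \<phi>)"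
    using l by (simp_all add: Hloc_eq_cutoff[OF fin] lsp_closed Hop_linear d)
  assume l': "\<psi> \<in> lsp \<Lambda>"
  show "Hloc \<Lambda> \<omega> (\<phi> + \<psi>) = Hloc \<Lambda> \<omega> \<phi> + Hloc \<Lambda> \<omega> \<psi>"
    using l l' by (simp add: Hloc_eq_cutoff[OF fin] lsp_closed Hop_linear d)
  show "Hloc \<Lambda> \<omega> \<phi> \<bullet> \<psi> = \<phi> \<bullet> Hloc \<Lambda> \<omega> \<psi>"
    using l l' cutoff_inner[of \<Lambda> "Hop \<omega> \<phi>" \<psi>] cutoff_inner[of \<Lambda> \<phi> "Hop \<omega> \<psi>"] cutoff_lsp[OF l] cutoff_lsp[OF l']
    by (simp add: Hloc_eq_cutoff[OF fin] Hop_linear(4) d)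
qed (auto simp: fsupp_lsp)

lemma Hloc_lin_on: "finite \<Lambda> \<Longrightarrow> lin_on \<Lambda> (Hloc \<Lambda> \<omega>)"
  unfolding lin_on_def using sym_op.T_add[OF sym_op_Hloc] sym_op.T_scale[OF sym_op_Hloc] by blast

text \<open>Finitely supported vectors form a core: cutoffs commute with the potential, and the
  Laplacian is bounded.\<close>

lemma Hop_graph_dense:
  assumes \<phi>: "\<phi> \<in> Hdom \<omega>"
  shows "((\<lambda>F. Hop \<omega> (cutoff F \<phi>)) \<longlongrightarrow> Hop \<omega> \<phi>) (finite_subsets_at_top UNIV)"
proof -
  have lapc: "((\<lambda>F. lap (cutoff F \<phi>)) \<longlongrightarrow> lap \<phi>) (finite_subsets_at_top UNIV)"
  proof (rule Lim_null_comparison[THEN LIM_zero_cancel])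
    show "\<forall>\<^sub>F F in finite_subsets_at_top UNIV. norm (lap (cutoff F \<phi>) - lap \<phi>) \<le>
        2 * real (card (nb :: (int ^ 'a) set)) * norm (cutoff F \<phi> - \<phi>)"
      using norm_lap_le[of "cutoff F \<phi> - \<phi>" for F] by (simp add: lap_diff)
    have "((\<lambda>F. 2 * real (card (nb :: (int ^ 'a) set)) * norm (cutoff F \<phi> - \<phi>)) \<longlongrightarrow>
        2 * real (card (nb :: (int ^ 'a) set)) * norm (\<phi> - \<phi>)) (finite_subsets_at_top UNIV)"
      by (intro tendsto_intros cutoff_tendsto)
    then show "((\<lambda>F. 2 * real (card (nb :: (int ^ 'a) set)) * norm (cutoff F \<phi> - \<phi>)) \<longlongrightarrow> 0)
      (finite_subsets_at_top UNIV)" by simp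
  qed
  show ?thesis
    unfolding Hop_def mulop_Hdom(4)[OF \<phi>] by (intro tendsto_diff cutoff_tendsto lapc)
qed

lemma hamiltonian_eq_Hop: "\<phi> \<in> Hdom \<omega> \<Longrightarrow> hamiltonian \<omega> (l2_fun \<phi>) = l2_fun (Hop \<omega> \<phi>)"
  by (rule ext) (simp add: hamiltonian_def potential_def laplacian_eq_lap Hop_def l2_fun_mulop_Hdom)

lemma hamiltonian_domain_eq: "hamiltonian_domain \<omega> = l2_fun ` Hdom \<omega>"
  unfolding hamiltonian_domain_def l2_fun_image_lsp[symmetric] Hdom_def potential_def
  by (auto simp: l2_fun_image_lsp)

lemma local_hamiltonian_eq_Hloc:
  assumes "finite \<Lambda>" "\<phi> \<in> lsp \<Lambda>"
  shows "local_hamiltonian \<Lambda> \<omega> (l2_fun \<phi>) = l2_fun (Hloc \<Lambda> \<omega> \<phi>)"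
  by (rule ext) (simp add: local_hamiltonian_def hamiltonian_eq_Hop[OF lsp_Hdom[OF assms]] Hloc_eq_cutoff[OF assms])

definition ebasis :: "(int ^ 'd) set \<Rightarrow> (int ^ 'd \<Rightarrow> real) \<Rightarrow> (int ^ 'd) l2 set" where
  "ebasis \<Lambda> \<omega> = (SOME E. eigbasis \<Lambda> (Hloc \<Lambda> \<omega>) E)"

lemma ebasis: "finite \<Lambda> \<Longrightarrow> eigbasis \<Lambda> (Hloc \<Lambda> \<omega>) (ebasis \<Lambda> \<omega>)"
  unfolding ebasis_def
proof (rule someI_ex)
  assume fin: "finite \<Lambda>"
  interpret sym_op \<Lambda> "lsp \<Lambda>" "Hloc \<Lambda> \<omega>" by (rule sym_op_Hloc[OF fin])
  show "\<exists>E. eigbasis \<Lambda> (Hloc \<Lambda> \<omega>) E"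
    using eigbasis_exists[OF fin Hloc_lin_on[OF fin] T_lsp T_sym] by blast
qed

abbreviation Qf :: "(int ^ 'd) set \<Rightarrow> (int ^ 'd \<Rightarrow> real) \<Rightarrow> real \<Rightarrow> (int ^ 'd) l2 \<Rightarrow> (int ^ 'd) l2" where
  "Qf \<Lambda> \<omega> \<equiv> eproj (Hloc \<Lambda> \<omega>) (ebasis \<Lambda> \<omega>)"

lemma Qf_pfam: "finite \<Lambda> \<Longrightarrow> pfam \<Lambda> (lsp \<Lambda>) (Hloc \<Lambda> \<omega>) (Qf \<Lambda> \<omega>)"
  by (rule sym_op.eproj_pfam[OF sym_op_Hloc refl ebasis])

lemma Qf_eq:
  "finite \<Lambda> \<Longrightarrow> eigbasis \<Lambda> (Hloc \<Lambda> \<omega>) E \<Longrightarrow> \<phi> \<in> lsp \<Lambda> \<Longrightarrow> Qf \<Lambda> \<omega> x \<phi> = eproj (Hloc \<Lambda> \<omega>) E x \<phi>"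
  by (rule sym_op.pfam_eq_eproj[OF sym_op_Hloc refl _ Qf_pfam])

lemma Qf_roi: "finite \<Lambda> \<Longrightarrow> roi \<Lambda> (Qf \<Lambda> \<omega>)"
  by (rule sym_op.pfam_roi[OF sym_op_Hloc Qf_pfam])

text \<open>Whatever family the choice operator returns, \<open>pfam_eq_eproj\<close> identifies it
  on the subspace with the projections built from the eigenbasis.\<close>

lemma eigenvalue_count_trace:
  assumes fin: "finite \<Lambda>"
  shows "eigenvalue_count \<Lambda> \<omega> x = (\<Sum>z\<in>\<Lambda>. (norm (Qf \<Lambda> \<omega> x (dl z)))\<^sup>2)"
proof -
  interpret sym_op \<Lambda> "lsp \<Lambda>" "Hloc \<Lambda> \<omega>" by (rule sym_op_Hloc[OF fin])
  obtain Q where Q: "pfam \<Lambda> (lsp \<Lambda>) (Hloc \<Lambda> \<omega>) Q"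
    "\<And>x \<phi>. \<phi> \<in> lsp \<Lambda> \<Longrightarrow> spectral_projection_atMost \<Lambda> (l2_fun ` lsp \<Lambda>) (local_hamiltonian \<Lambda> \<omega>) x (l2_fun \<phi>) = l2_fun (Q x \<phi>)"
    using spectral_projection_atMost_pfam[OF local_hamiltonian_eq_Hloc[OF fin] Qf_pfam[OF fin]] by blast
  have "ell2_inner (delta z) (spectral_projection_atMost \<Lambda> (ell2 \<Lambda>) (local_hamiltonian \<Lambda> \<omega>) x (delta z))
      = Complex (dl z \<bullet> Qf \<Lambda> \<omega> x (dl z)) (imul (dl z) \<bullet> Qf \<Lambda> \<omega> x (dl z))" if "z \<in> \<Lambda>" for z
    using Q(2)[of "dl z" x] that pfam_eq_eproj[OF refl ebasis[OF fin] Q(1), of "dl z" x]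
    by (simp add: l2_fun_dl[symmetric] l2_fun_image_lsp lsp_closed ell2_inner_eq)
  then show ?thesis
    unfolding eigenvalue_count_def trace_on_def Re_sum
    by (intro sum.cong refl) (simp add: roi_inner[OF Qf_roi[OF fin]] lsp_closed)
qed

lemma eigenvalue_count_cnt:
  assumes fin: "finite \<Lambda>" and E: "eigbasis \<Lambda> (Hloc \<Lambda> \<omega>) E"
  shows "eigenvalue_count \<Lambda> \<omega> x = real (cnt (Hloc \<Lambda> \<omega>) E x) / 2"
proof -
  interpret sym_op \<Lambda> "lsp \<Lambda>" "Hloc \<Lambda> \<omega>" by (rule sym_op_Hloc[OF fin])
  have "eigenvalue_count \<Lambda> \<omega> x = (\<Sum>z\<in>\<Lambda>. dl z \<bullet> eproj (Hloc \<Lambda> \<omega>) E x (dl z))"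
    unfolding eigenvalue_count_trace[OF fin]
  proof (intro sum.cong refl)
    fix z assume z: "z \<in> \<Lambda>"
    have "(norm (Qf \<Lambda> \<omega> x (dl z)))\<^sup>2 = dl z \<bullet> Qf \<Lambda> \<omega> x (dl z)"
      by (rule roi_inner[OF Qf_roi[OF fin], symmetric]) (use z in auto)
    moreover have "Qf \<Lambda> \<omega> x (dl z) = eproj (Hloc \<Lambda> \<omega>) E x (dl z)" by (rule Qf_eq[OF fin E]) (use z in auto)
    ultimately show "(norm (Qf \<Lambda> \<omega> x (dl z)))\<^sup>2 = dl z \<bullet> eproj (Hloc \<Lambda> \<omega>) E x (dl z)" by simp
  qed
  then show ?thesis using cnt_trace[OF refl E fin, of x] by simp
qed

text \<open>Multiplications commute, so only the hopping terms contribute, each weighted by a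
  difference of \<eta> between neighbours. The restriction to \<Lambda> in \<open>Hloc\<close> is
  invisible after multiplication by \<eta>, which vanishes off \<Lambda>.\<close>

lemma Hop_commutator:
  fixes \<omega> :: "int ^ 'd \<Rightarrow> real"
  assumes fin: "finite \<Lambda>" and supp: "\<And>z. z \<notin> \<Lambda> \<Longrightarrow> \<eta> z = 0" and bd: "\<And>z. \<bar>\<eta> z\<bar> \<le> 1"
    and slow: "\<And>z u. u \<in> nb \<Longrightarrow> \<bar>\<eta> (z + u) - \<eta> z\<bar> \<le> \<delta>" and v: "v \<in> lsp \<Lambda>"
  shows "norm (Hop \<omega> (mulop \<eta> v) - mulop \<eta> (Hloc \<Lambda> \<omega> v)) \<le> real (card (nb :: (int ^ 'd) set)) * \<delta> * norm v"
proof -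
  note m = l2_fun_mulop_bounded[OF bd]
  have l: "mulop \<eta> v \<in> lsp \<Lambda>" using supp by (auto simp: lsp_def m)
  have bd2: "\<bar>if u \<in> nb then \<eta> (z + u) - \<eta> z else 0\<bar> \<le> 2" for z u
    using bd[of z] bd[of "z + u"] by auto
  \<comment> \<open>The hop by u, weighted by the discrete derivative of \<eta> in that
    direction.\<close>
  define C where "C u = mulop (\<lambda>z. if u \<in> nb then \<eta> (z + u) - \<eta> z else 0) (shiftop u v)" for u
  have Cx: "l2_fun (C u) z = of_real (if u \<in> nb then \<eta> (z + u) - \<eta> z else 0) * l2_fun v (z + u)" for u z
    unfolding C_def l2_fun_mulop_bounded[OF bd2] by simp
  have "Hop \<omega> (mulop \<eta> v) - mulop \<eta> (Hloc \<Lambda> \<omega> v) = - (\<Sum>u\<in>nb. C u)"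
  proof (rule l2_eqI)
    fix z
    have "(\<Sum>u\<in>nb. l2_fun (C u) z) = (\<Sum>u\<in>nb. (of_real (\<eta> (z + u)) * l2_fun v (z + u) - of_real (\<eta> z) * l2_fun v z)
        - of_real (\<eta> z) * (l2_fun v (z + u) - l2_fun v z))"
      by (intro sum.cong refl) (simp add: Cx algebra_simps)
    then show "l2_fun (Hop \<omega> (mulop \<eta> v) - mulop \<eta> (Hloc \<Lambda> \<omega> v)) z = l2_fun (- (\<Sum>u\<in>nb. C u)) z"
      using supp[of z]
      by (cases "z \<in> \<Lambda>")
         (simp_all add: Hloc_eq_cutoff[OF fin v] Hop_def l2_fun_mulop_Hdom lsp_Hdom[OF fin] l v m lap_def
           sum_subtractf sum_distrib_left algebra_simps)
  qed
  then have "norm (Hop \<omega> (mulop \<eta> v) - mulop \<eta> (Hloc \<Lambda> \<omega> v)) = norm (\<Sum>u\<in>nb. C u)" by simp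
  also have "\<dots> \<le> (\<Sum>u\<in>(nb :: (int ^ 'd) set). \<delta> * norm v)"
  proof (rule sum_norm_le)
    fix u :: "int ^ 'd" assume u: "u \<in> nb"
    have "norm (C u) \<le> \<delta> * norm (shiftop u v)"
      unfolding C_def by (rule norm_mulop_le) (use slow[OF u] u in auto)
    then show "norm (C u) \<le> \<delta> * norm v" by simp
  qed
  finally show ?thesis by (simp add: mult.assoc)
qed

lemma Hloc_commutator:
  fixes \<omega> :: "int ^ 'd \<Rightarrow> real"
  assumes fin: "finite \<Lambda>" and supp: "\<And>z. z \<notin> \<Lambda> \<Longrightarrow> \<eta> z = 0" and bd: "\<And>z. \<bar>\<eta> z\<bar> \<le> 1"
    and slow: "\<And>z u. u \<in> nb \<Longrightarrow> \<bar>\<eta> (z + u) - \<eta> z\<bar> \<le> \<delta>" and v: "v \<in> lsp \<Lambda>"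
    and sub: "\<Lambda> \<subseteq> \<Lambda>'" "finite \<Lambda>'"
  shows "norm (Hloc \<Lambda>' \<omega> (mulop \<eta> v) - mulop \<eta> (Hloc \<Lambda> \<omega> v)) \<le> real (card (nb :: (int ^ 'd) set)) * \<delta> * norm v"
proof -
  note m = l2_fun_mulop_bounded[OF bd]
  have l: "mulop \<eta> w \<in> lsp \<Lambda>'" for w using supp sub by (auto simp: lsp_def m)
  have "Hloc \<Lambda>' \<omega> (mulop \<eta> v) - mulop \<eta> (Hloc \<Lambda> \<omega> v) =
      cutoff \<Lambda>' (Hop \<omega> (mulop \<eta> v) - mulop \<eta> (Hloc \<Lambda> \<omega> v))"
    by (simp add: Hloc_eq_cutoff[OF sub(2) l] cutoff_lsp[OF l])
  also have "norm \<dots> \<le> norm (Hop \<omega> (mulop \<eta> v) - mulop \<eta> (Hloc \<Lambda> \<omega> v))" by (rule norm_cutoff_le)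
  also have "\<dots> \<le> real (card (nb :: (int ^ 'd) set)) * \<delta> * norm v"
    by (rule Hop_commutator[OF fin supp bd slow v])
  finally show ?thesis .
qed

subsection \<open>Existence of the spectral family in infinite volume\<close>

lemma l2_weak_norm_le:
  assumes G: "G \<noteq> bot" and lim: "\<And>\<psi>. ((\<lambda>i. \<psi> \<bullet> u i) \<longlongrightarrow> \<psi> \<bullet> v) G" and le: "\<forall>\<^sub>F i in G. norm (u i) \<le> C"
  shows "norm v \<le> C"
proof -
  have "v \<bullet> v \<le> norm v * C"
  proof (rule tendsto_upperbound[OF lim _ G])
    show "\<forall>\<^sub>F i in G. v \<bullet> u i \<le> norm v * C"
      using le
    proof eventually_elim
      case (elim i)
      then show ?case using norm_cauchy_schwarz[of v "u i"] mult_left_mono[OF elim, of "norm v"] by simp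
    qed
  qed
  then have "norm v * norm v \<le> norm v * C" by (simp add: norm_eq_sqrt_inner)
  moreover have "0 \<le> C" using eventually_happens'[OF G le] norm_ge_zero order_trans by blast
  ultimately show ?thesis by (cases "norm v = 0") auto
qed

text \<open>The coordinates will be matrix entries at all real energies, an uncountable family. In
  place of a diagonal subsequence, compactness of the product of discs yields a filter finer than
  \<open>sequentially\<close> along which every coordinate converges.\<close>

lemma cluster_filter:
  fixes f :: "nat \<Rightarrow> 'i \<Rightarrow> complex"
  assumes "\<And>n i. norm (f n i) \<le> 1"
  obtains G r where "G \<noteq> bot" "G \<le> sequentially" "\<And>i. ((\<lambda>n. f n i) \<longlongrightarrow> r i) G"
proof -
  define U where "U = PiE (UNIV :: 'i set) (\<lambda>_. cball (0 :: complex) 1)"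
  have "compactin (product_topology (\<lambda>_. euclidean) UNIV) U"
    unfolding U_def compactin_PiE by simp
  then have "compact U" by (simp add: euclidean_product_topology)
  moreover have "filtermap f sequentially \<noteq> bot" by (simp add: filtermap_bot_iff)
  moreover have "\<forall>\<^sub>F x in filtermap f sequentially. x \<in> U"
    using assms by (simp add: eventually_filtermap U_def PiE_def Pi_def)
  ultimately obtain x where x: "inf (nhds x) (filtermap f sequentially) \<noteq> bot"
    unfolding compact_filter by blast
  \<comment> \<open>This restricts the sequence to the indices at which f is near the cluster point
    x.\<close>
  define G where "G = inf (filtercomap f (nhds x)) sequentially"
  have "G \<noteq> bot"
  proof
    assume "G = bot"
    then have "eventually (\<lambda>_. False) (inf (filtercomap f (nhds x)) sequentially)"
      by (simp add: G_def)
    then obtain P Q where PQ: "eventually P (filtercomap f (nhds x))" "eventually Q sequentially"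
      "\<And>n. P n \<Longrightarrow> Q n \<Longrightarrow> False" unfolding eventually_inf by blast
    then obtain P' where P': "eventually P' (nhds x)" "\<And>n. P' (f n) \<Longrightarrow> P n"
      unfolding eventually_filtercomap by blast
    have "eventually (\<lambda>y. \<exists>n. y = f n \<and> Q n) (filtermap f sequentially)"
      unfolding eventually_filtermap using PQ(2) by (auto elim: eventually_mono)
    with P'(1) have "eventually (\<lambda>_. False) (inf (nhds x) (filtermap f sequentially))"
      unfolding eventually_inf using P'(2) PQ(3) by blast
    then show False using x by (simp add: trivial_limit_def)
  qed
  moreover have "G \<le> sequentially" by (simp add: G_def)
  moreover have "((\<lambda>n. f n i) \<longlongrightarrow> x i) G" for i
  proof -
    have fx: "filterlim f (nhds x) G"
      unfolding G_def by (rule filterlim_mono[OF filterlim_filtercomap order_refl]) simp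
    have xi: "((\<lambda>y. y i) \<longlongrightarrow> x i) (at x)"
    proof -
      have "continuous_on UNIV (\<lambda>y :: 'i \<Rightarrow> complex. y i)" by (rule continuous_on_product_coordinates)
      then show ?thesis by (simp add: continuous_on_def)
    qed
    show ?thesis by (rule tendsto_compose[where g = "\<lambda>y. y i", OF xi fx])
  qed
  ultimately show ?thesis using that by blast
qed

text \<open>Convergence of the matrix entries gives the columns of the limit. By symmetry the
  coordinates of B \<phi> are pairings of \<phi> with columns, so they converge as well, and
  boundedness makes this weak convergence.\<close>

lemma weak_cluster_operators:
  fixes B :: "nat \<Rightarrow> 'i \<Rightarrow> 'a l2 \<Rightarrow> 'a l2"
  assumes bd: "\<And>N a \<phi>. norm (B N a \<phi>) \<le> norm \<phi>" and sym: "\<And>N a \<phi> \<psi>. B N a \<phi> \<bullet> \<psi> = \<phi> \<bullet> B N a \<psi>"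
    and im: "\<And>N a \<phi>. B N a (imul \<phi>) = imul (B N a \<phi>)"
  obtains G R where "G \<noteq> bot" "G \<le> sequentially" "\<And>a \<phi> \<psi>. ((\<lambda>N. \<psi> \<bullet> B N a \<phi>) \<longlongrightarrow> \<psi> \<bullet> R a \<phi>) G"
proof -
  define f where "f N = (\<lambda>(x, y, a). l2_fun (B N a (dl y)) x)" for N
  have "norm (f N i) \<le> 1" for N i
  proof (cases i)
    case (fields x y a)
    have "cmod (l2_fun (B N a (dl y)) x) \<le> norm (dl y)" by (rule order_trans[OF cmod_l2_fun_le bd])
    then show ?thesis by (simp add: f_def fields)
  qed
  then obtain G r where G: "G \<noteq> bot" "G \<le> sequentially" and r: "\<And>i. ((\<lambda>n. f n i) \<longlongrightarrow> r i) G"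
    using cluster_filter[of f] by metis
  define w where "w a y = Abs_l2 (\<lambda>x. r (x, y, a))" for a y
  have w: "((\<lambda>N. \<phi> \<bullet> B N a (dl y)) \<longlongrightarrow> \<phi> \<bullet> w a y) G" for \<phi> a y
    unfolding w_def
  proof (rule bounded_pointwise_limit(3)[OF G(1)])
    show "\<forall>\<^sub>F N in G. norm (B N a (dl y)) \<le> 1" using bd[of _ a "dl y"] by simp
    show "((\<lambda>N. l2_fun (B N a (dl y)) x) \<longlongrightarrow> r (x, y, a)) G" for x
      using r[of "(x, y, a)"] by (simp add: f_def)
  qed
  define R where "R a \<phi> = Abs_l2 (\<lambda>x. Complex (\<phi> \<bullet> w a x) (- (imul \<phi> \<bullet> w a x)))" for a \<phi>
  have "((\<lambda>N. \<psi> \<bullet> B N a \<phi>) \<longlongrightarrow> \<psi> \<bullet> R a \<phi>) G" for a \<phi> \<psi>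
    unfolding R_def
  proof (rule bounded_pointwise_limit(3)[OF G(1)])
    show "\<forall>\<^sub>F N in G. norm (B N a \<phi>) \<le> norm \<phi>" using bd by simp
    fix x
    have "l2_fun (B N a \<phi>) x = Complex (\<phi> \<bullet> B N a (dl x)) (- (imul \<phi> \<bullet> B N a (dl x)))" for N
      using inner_dl[of "B N a \<phi>" x] inner_imul_dl[of "B N a \<phi>" x] sym[of N a \<phi> "dl x"] sym[of N a \<phi> "imul (dl x)"]
      by (simp add: complex_eq_iff im inner_imul_right)
    then show "((\<lambda>N. l2_fun (B N a \<phi>) x) \<longlongrightarrow> Complex (\<phi> \<bullet> w a x) (- (imul \<phi> \<bullet> w a x))) G"
      by (simp only:) (intro tendsto_Complex tendsto_minus w)
  qed
  then show ?thesis using G that by blast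
qed

section \<open>Slowly varying cutoffs and comparison of volumes\<close>

definition eta :: "nat \<Rightarrow> int ^ 'd \<Rightarrow> real" where
  "eta N z = max 0 (1 - real (l1_norm z) / real N)"

text \<open>The tent has slope 1/N, so by \<open>Hop_commutator\<close> it commutes with the
  Hamiltonian up to O(1/N); its value 1 at the origin means that it fixes
  \<open>dl 0\<close>.\<close>

lemma eta_props:
  assumes "N \<ge> 1"
  shows "\<bar>eta N z\<bar> \<le> 1" "z \<notin> l1_ball N \<Longrightarrow> eta N z = 0" "u \<in> nb \<Longrightarrow> \<bar>eta N (z + u) - eta N z\<bar> \<le> 1 / real N"
    "eta N 0 = 1"
proof -
  show "\<bar>eta N z\<bar> \<le> 1" "eta N 0 = 1" by (auto simp: eta_def)
  show "z \<notin> l1_ball N \<Longrightarrow> eta N z = 0" using assms by (auto simp: eta_def l1_ball_def field_simps)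
  show "\<bar>eta N (z + u) - eta N z\<bar> \<le> 1 / real N" if "u \<in> nb"
  proof -
    have "l1_norm (z + u) \<le> l1_norm z + 1" "l1_norm z \<le> l1_norm (z + u) + 1"
      using l1_norm_triangle[of z u] l1_norm_triangle[of "z + u" "- u"] that by (auto simp: nb_def)
    then have "\<bar>real (l1_norm (z + u)) - real (l1_norm z)\<bar> \<le> 1" by linarith
    then have "\<bar>real (l1_norm (z + u)) / real N - real (l1_norm z) / real N\<bar> \<le> 1 / real N"
      using assms by (simp add: diff_divide_distrib[symmetric] divide_right_mono)
    then show ?thesis unfolding eta_def by linarith
  qed
qed

lemma eta_tendsto: "(\<lambda>N. eta N z) \<longlonglongrightarrow> 1"
proof -
  have "(\<lambda>N. max 0 (1 - real (l1_norm z) / real N)) \<longlonglongrightarrow> max 0 (1 - 0)"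
    by (intro tendsto_max tendsto_diff tendsto_const lim_const_over_n)
  then show ?thesis by (simp add: eta_def)
qed

lemma mulop_linear:
  assumes "\<And>z. \<bar>g z\<bar> \<le> C"
  shows "mulop g (\<phi> + \<psi>) = mulop g \<phi> + mulop g \<psi>" "mulop g (\<phi> - \<psi>) = mulop g \<phi> - mulop g \<psi>"
    "mulop g (c *\<^sub>R \<phi>) = c *\<^sub>R mulop g \<phi>" "mulop g (imul \<phi>) = imul (mulop g \<phi>)"
  by (rule l2_eqI; simp add: l2_fun_mulop_bounded[OF assms] algebra_simps)+

lemma norm_mulop_le1: "(\<And>z. \<bar>g z\<bar> \<le> 1) \<Longrightarrow> norm (mulop g \<phi>) \<le> norm \<phi>"
  using norm_mulop_le[of g 1 \<phi>] by simp

lemma mulop_eta_tendsto: "(\<lambda>N. mulop (eta (Suc N)) \<phi>) \<longlonglongrightarrow> \<phi>"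
proof (rule LIMSEQ_I)
  fix e :: real assume e: "0 < e"
  obtain \<psi> where \<psi>: "\<psi> \<in> fsupp UNIV" "norm (\<phi> - \<psi>) < e / 3"
    using fsupp_dense[of \<phi> UNIV "e / 3"] e by auto
  obtain F where F: "finite F" "\<psi> \<in> lsp F" using \<psi>(1) by (rule fsuppE)
  note bd = eta_props(1)[of "Suc N" for N, simplified]
  note m = l2_fun_mulop_bounded[OF bd]
  have l: "mulop (eta (Suc N)) \<psi> - \<psi> \<in> lsp F" for N using F by (auto simp: lsp_def m)
  have "(\<lambda>N. \<Sum>z\<in>F. ((eta (Suc N) z - 1) * Re (l2_fun \<psi> z))\<^sup>2 + ((eta (Suc N) z - 1) * Im (l2_fun \<psi> z))\<^sup>2) \<longlonglongrightarrow>
      (\<Sum>z\<in>F. ((1 - 1) * Re (l2_fun \<psi> z))\<^sup>2 + ((1 - 1) * Im (l2_fun \<psi> z))\<^sup>2)"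
    by (intro tendsto_intros LIMSEQ_Suc[OF eta_tendsto])
  then have "(\<lambda>N. (norm (mulop (eta (Suc N)) \<psi> - \<psi>))\<^sup>2) \<longlonglongrightarrow> 0"
    by (simp add: norm_lsp_sum[OF F(1) l] inner_dl inner_imul_dl m algebra_simps)
  then have "(\<lambda>N. sqrt ((norm (mulop (eta (Suc N)) \<psi> - \<psi>))\<^sup>2)) \<longlonglongrightarrow> sqrt 0" by (rule tendsto_real_sqrt)
  then have "(\<lambda>N. norm (mulop (eta (Suc N)) \<psi> - \<psi>)) \<longlonglongrightarrow> 0" by simp
  then obtain N0 where N0: "\<And>N. N \<ge> N0 \<Longrightarrow> norm (mulop (eta (Suc N)) \<psi> - \<psi>) < e / 3"
    using LIMSEQ_D[of _ 0 "e / 3"] e by fastforce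
  have "norm (mulop (eta (Suc N)) \<phi> - \<phi>) < e" if "N \<ge> N0" for N
  proof -
    have "mulop (eta (Suc N)) \<phi> - \<phi> = mulop (eta (Suc N)) (\<phi> - \<psi>) + (mulop (eta (Suc N)) \<psi> - \<psi>) - (\<phi> - \<psi>)"
      by (simp add: mulop_linear[OF bd])
    also have "norm \<dots> \<le> norm (mulop (eta (Suc N)) (\<phi> - \<psi>)) + norm (mulop (eta (Suc N)) \<psi> - \<psi>) + norm (\<phi> - \<psi>)"
      by (intro order_trans[OF norm_triangle_ineq4] add_mono norm_triangle_ineq order_refl)
    also have "norm (mulop (eta (Suc N)) (\<phi> - \<psi>)) \<le> norm (\<phi> - \<psi>)" by (rule norm_mulop_le1[OF bd])
    finally show ?thesis using N0[OF that] \<psi>(2) by linarith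
  qed
  then show "\<exists>no. \<forall>n\<ge>no. norm (mulop (eta (Suc n)) \<phi> - \<phi>) < e" by blast
qed

text \<open>Both bounds are adjoints of Davis--Kahan estimates. The direct estimates carry spectral
  subspaces of the finite volume \<Lambda> over to T; what is needed is to carry those of T back to
  \<Lambda>, and passing to the adjoint keeps the norm.\<close>

lemma transfer_bounds:
  fixes \<Lambda> S :: "(int ^ 'd) set" and \<omega> :: "int ^ 'd \<Rightarrow> real"
  assumes so: "sym_op S D T" and pf: "pfam S D T Q" and fin: "finite \<Lambda>"
    and supp: "\<And>z. z \<notin> \<Lambda> \<Longrightarrow> \<eta> z = 0" and bd: "\<And>z. \<bar>\<eta> z\<bar> \<le> 1"
    and J: "\<And>v. v \<in> lsp \<Lambda> \<Longrightarrow> mulop \<eta> v \<in> D"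
    and \<kappa>: "\<And>v. v \<in> lsp \<Lambda> \<Longrightarrow> norm (T (mulop \<eta> v) - mulop \<eta> (Hloc \<Lambda> \<omega> v)) \<le> \<kappa> * norm v"
    and ab: "a < b" and \<kappa>0: "0 \<le> \<kappa>"
  shows "\<psi> \<in> lsp S \<Longrightarrow> norm (Qf \<Lambda> \<omega> a (mulop \<eta> (\<psi> - Q b \<psi>))) \<le> \<kappa> / (b - a) * norm \<psi>" (is "_ \<Longrightarrow> ?A")
    and "\<psi> \<in> lsp S \<Longrightarrow> norm (mulop \<eta> (Q a \<psi>) - Qf \<Lambda> \<omega> b (mulop \<eta> (Q a \<psi>))) \<le> \<kappa> / (b - a) * norm \<psi>" (is "_ \<Longrightarrow> ?B")
proof -
  interpret sym_op S D T by fact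
  note r = pfam_roi[OF pf] and rf = Qf_roi[OF fin, of \<omega>]
  note P = pfam_props[OF pf] and P' = sym_op.pfam_props[OF sym_op_Hloc[OF fin] Qf_pfam[OF fin, of \<omega>]]
  note ml = mulop_linear[OF bd]
  have linJ: "lin_on \<Lambda> (mulop \<eta>)" unfolding lin_on_def by (simp add: ml)
  have Hl: "Hloc \<Lambda> \<omega> v \<in> lsp \<Lambda>" for v by (simp add: Hloc_def lsp_closed)
  have mlsp: "mulop \<eta> v \<in> lsp \<Lambda>" for v using supp by (auto simp: lsp_def l2_fun_mulop_bounded[OF bd])
  have mS: "mulop \<eta> v \<in> lsp S" if "v \<in> lsp \<Lambda>" for v using J[OF that] D_lsp by blast
  have 1: "norm (mulop \<eta> (Qf \<Lambda> \<omega> a v) - Q b (mulop \<eta> (Qf \<Lambda> \<omega> a v))) \<le> \<kappa> / (b - a) * norm v"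
    if v: "v \<in> lsp \<Lambda>" for v
  proof (rule davis_kahan[where P = "\<lambda>w. w - Q b w" and P' = "Qf \<Lambda> \<omega> a" and J = "mulop \<eta>" and A = "Hloc \<Lambda> \<omega>"
        and S = S and D = D and T = T and \<Lambda> = \<Lambda>])
    show "oproj \<Lambda> (Qf \<Lambda> \<omega> a)" by (rule roi_oproj[OF rf])
    show "oproj S (\<lambda>w. w - Q b w)" by (rule oproj_compl[OF roi_oproj[OF r]])
    show "w - Q b w \<in> D" if "w \<in> D" for w using that P(1) D_diff by blast
    show "T (w - Q b w) = T w - Q b (T w)" if "w \<in> D" for w using that P(1,2) T_diff by simp
    show "b * (norm w)\<^sup>2 \<le> w \<bullet> T w" if "w \<in> D" "w - Q b w = w" for w by (rule P(4)) (use that in auto)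
  qed (use fin Hloc_lin_on[OF fin] Hl P' D_lsp T_lsp linJ J \<kappa> ab v in auto)
  \<comment> \<open>Negating both operators exchanges lower and upper spectral subspaces, with -b <
    -a in place of a < b.\<close>
  have 2: "norm (Q a (mulop \<eta> (v - Qf \<Lambda> \<omega> b v))) \<le> \<kappa> / (b - a) * norm v"
    if v: "v \<in> lsp \<Lambda>" for v
  proof -
    have "norm (Q a (mulop \<eta> (v - Qf \<Lambda> \<omega> b v))) \<le> \<kappa> / (- a - (- b)) * norm v"
    proof (rule davis_kahan[where P = "Q a" and P' = "\<lambda>w. w - Qf \<Lambda> \<omega> b w" and J = "mulop \<eta>" and A = "\<lambda>v. - Hloc \<Lambda> \<omega> v"
          and S = S and D = D and T = "\<lambda>v. - T v" and \<Lambda> = \<Lambda>])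
      show "oproj \<Lambda> (\<lambda>w. w - Qf \<Lambda> \<omega> b w)" by (rule oproj_compl[OF roi_oproj[OF rf]])
      show "oproj S (Q a)" by (rule roi_oproj[OF r])
      show "lin_on \<Lambda> (\<lambda>v. - Hloc \<Lambda> \<omega> v)" using Hloc_lin_on[OF fin, of \<omega>] by (simp add: lin_on_def)
      show "- Hloc \<Lambda> \<omega> v \<in> lsp \<Lambda>" for v using Hl by blast
      show "- Hloc \<Lambda> \<omega> (w - Qf \<Lambda> \<omega> b w) = - Hloc \<Lambda> \<omega> w - Qf \<Lambda> \<omega> b (- Hloc \<Lambda> \<omega> w)" if w: "w \<in> lsp \<Lambda>" for w
        using lin_onD(3)[OF Hloc_lin_on[OF fin] w P'(1)[OF w]] P'(2)[OF w] oprojD(4)[OF roi_oproj[OF rf] Hl, of b "-1"] by simp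
      show "w \<bullet> - Hloc \<Lambda> \<omega> w \<le> - b * (norm w)\<^sup>2" if "w \<in> lsp \<Lambda>" "w - Qf \<Lambda> \<omega> b w = w" for w
        using P'(4)[of w b] that by simp
      show "- T w \<in> lsp S" if "w \<in> D" for w using T_lsp[OF that] by blast
      show "- T (Q a w) = Q a (- T w)" if "w \<in> D" for w
        using P(2)[OF that] oprojD(4)[OF roi_oproj[OF r] T_lsp[OF that], of a "-1"] by simp
      show "- a * (norm w)\<^sup>2 \<le> w \<bullet> - T w" if "w \<in> D" "Q a w = w" for w using P(3)[of w a] that by simp
      show "norm (- T (mulop \<eta> v) - mulop \<eta> (- Hloc \<Lambda> \<omega> v)) \<le> \<kappa> * norm v" if "v \<in> lsp \<Lambda>" for v
        using \<kappa>[OF that] ml(3)[where c = "-1" and \<phi> = "Hloc \<Lambda> \<omega> v"] by (simp add: norm_minus_commute)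
    qed (use fin D_lsp P linJ J ab v in auto)
    then show ?thesis by simp
  qed
  \<comment> \<open>Here z is the adjoint operator applied to \<xi>, where \<xi> is the image of
    \<psi>. A bound for z in terms of \<xi> thus bounds \<xi> in terms of \<psi>.\<close>
  have dual: "norm \<xi> \<le> \<kappa> / (b - a) * norm \<psi>"
    if "\<xi> \<bullet> \<xi> = z \<bullet> \<psi>" "norm z \<le> \<kappa> / (b - a) * norm \<xi>" for \<xi> z \<psi> :: "(int ^ 'd) l2"
  proof -
    have "norm \<xi> * norm \<xi> = z \<bullet> \<psi>" using that(1) power2_norm_eq_inner[of \<xi>] by (simp add: power2_eq_square)
    also have "\<dots> \<le> norm z * norm \<psi>" by (rule norm_cauchy_schwarz)
    also have "\<dots> \<le> (\<kappa> / (b - a) * norm \<xi>) * norm \<psi>" using that by (intro mult_right_mono) auto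
    finally have "norm \<xi> * norm \<xi> \<le> (\<kappa> / (b - a) * norm \<psi>) * norm \<xi>" by (simp add: mult_ac)
    then show ?thesis
      using mult_right_le_imp_le[of "norm \<xi>" "norm \<xi>" "\<kappa> / (b - a) * norm \<psi>"] \<kappa>0 ab
      by (cases "\<xi> = 0") simp_all
  qed
  show ?A if \<psi>: "\<psi> \<in> lsp S"
  proof -
    define \<xi> where "\<xi> = Qf \<Lambda> \<omega> a (mulop \<eta> (\<psi> - Q b \<psi>))"
    have \<xi>: "\<xi> \<in> lsp \<Lambda>" "Qf \<Lambda> \<omega> a \<xi> = \<xi>"
      unfolding \<xi>_def using oprojD(1,2)[OF roi_oproj[OF rf] mlsp] by auto
    have "\<xi> \<bullet> \<xi> = \<xi> \<bullet> mulop \<eta> (\<psi> - Q b \<psi>)"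
      using oprojD(7)[OF roi_oproj[OF rf] \<xi>(1) mlsp, of a "\<psi> - Q b \<psi>"] \<xi>(2) by (simp add: \<xi>_def)
    also have "\<dots> = mulop \<eta> \<xi> \<bullet> (\<psi> - Q b \<psi>)" by (rule mulop_inner[OF bd, symmetric])
    also have "\<dots> = (mulop \<eta> \<xi> - Q b (mulop \<eta> \<xi>)) \<bullet> \<psi>"
      using roi_linear(3)[OF r mS[OF \<xi>(1)] \<psi>, of b] by (simp add: inner_diff_left inner_diff_right)
    finally show ?thesis
      unfolding \<xi>_def[symmetric] by (rule dual) (use 1[OF \<xi>(1)] \<xi>(2) in simp)
  qed
  show ?B if \<psi>: "\<psi> \<in> lsp S"
  proof -
    define w where "w = mulop \<eta> (Q a \<psi>)"
    define \<xi> where "\<xi> = w - Qf \<Lambda> \<omega> b w"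
    note opc = oproj_compl[OF roi_oproj[OF rf], of b]
    have w: "w \<in> lsp \<Lambda>" unfolding w_def by (rule mlsp)
    have \<xi>: "\<xi> \<in> lsp \<Lambda>" "\<xi> - Qf \<Lambda> \<omega> b \<xi> = \<xi>"
      unfolding \<xi>_def using oprojD(1,2)[OF opc w] by auto
    have "\<xi> \<bullet> \<xi> = \<xi> \<bullet> w"
      using oprojD(7)[OF opc \<xi>(1) w] \<xi>(2) by (simp add: \<xi>_def)
    also have "\<dots> = mulop \<eta> \<xi> \<bullet> Q a \<psi>" unfolding w_def by (rule mulop_inner[OF bd, symmetric])
    also have "\<dots> = Q a (mulop \<eta> \<xi>) \<bullet> \<psi>"
      using roi_linear(3)[OF r mS[OF \<xi>(1)] \<psi>, of a] by simp
    finally show ?thesis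
      unfolding \<xi>_def[symmetric] w_def[symmetric] by (rule dual) (use 2[OF \<xi>(1)] \<xi>(2) in simp)
  qed
qed

lemma mulop_eta_lsp: "N \<ge> 1 \<Longrightarrow> mulop (eta N) \<phi> \<in> lsp (l1_ball N)"
  using eta_props(2)[of N] by (auto simp: lsp_def l2_fun_mulop_bounded[OF eta_props(1)])

text \<open>The energies \<open>a + \<epsilon>\<^sub>N\<close> approach \<open>a\<close> so slowly that \<open>\<epsilon>\<^sub>N\<close> dominates
  the commutator of order \<open>1/N\<close>; this makes the weak limits of the finite volume projections
  projections again.\<close>

definition slack :: "nat \<Rightarrow> real" where "slack N = 1 / sqrt (real (Suc N))"

lemma slack_props: "0 < slack N" "slack \<longlonglongrightarrow> 0" "slack N \<le> 1"
  "(\<lambda>N. 1 / real (Suc N) / slack N) \<longlonglongrightarrow> 0"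
proof -
  show "0 < slack N" "slack N \<le> 1" by (simp_all add: slack_def)
  show l: "slack \<longlonglongrightarrow> 0"
  proof -
    have "(\<lambda>N. sqrt (1 / real (Suc N))) \<longlonglongrightarrow> sqrt 0"
      by (intro tendsto_real_sqrt LIMSEQ_Suc[OF lim_1_over_n])
    then show ?thesis by (simp add: slack_def[abs_def] real_sqrt_divide)
  qed
  have "1 / real (Suc N) / slack N = slack N" for N
    using real_sqrt_mult_self[of "real (Suc N)"] by (simp add: slack_def field_simps)
  then show "(\<lambda>N. 1 / real (Suc N) / slack N) \<longlonglongrightarrow> 0" using l by simp
qed

text \<open>The cutoff extends the finite volume projection by zero, so that all volumes can be
  compared as symmetric contractions on one space.\<close>

definition Bop :: "(int ^ 'd \<Rightarrow> real) \<Rightarrow> nat \<Rightarrow> real \<Rightarrow> (int ^ 'd) l2 \<Rightarrow> (int ^ 'd) l2" where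
  "Bop \<omega> N a \<phi> = Qf (l1_ball (Suc N)) \<omega> (a + slack N) (cutoff (l1_ball (Suc N)) \<phi>)"

lemma Bop_props:
  fixes \<omega> :: "int ^ 'd \<Rightarrow> real"
  shows "norm (Bop \<omega> N a \<phi>) \<le> norm \<phi>" "Bop \<omega> N a \<phi> \<bullet> \<psi> = \<phi> \<bullet> Bop \<omega> N a \<psi>"
    "Bop \<omega> N a (imul \<phi>) = imul (Bop \<omega> N a \<phi>)" "Bop \<omega> N a \<phi> \<in> lsp (l1_ball (Suc N))"
    "\<phi> \<bullet> Bop \<omega> N a \<phi> = (norm (Bop \<omega> N a \<phi>))\<^sup>2" "Bop \<omega> N a (\<phi> - \<psi>) = Bop \<omega> N a \<phi> - Bop \<omega> N a \<psi>"
proof -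
  let ?\<Lambda> = "l1_ball (Suc N) :: (int ^ 'd) set"
  note op = roi_oproj[OF Qf_roi[OF finite_l1_ball[of "Suc N"]], of \<omega> "a + slack N"]
  have c: "cutoff ?\<Lambda> \<phi> \<in> lsp ?\<Lambda>" for \<phi> by blast
  show "norm (Bop \<omega> N a \<phi>) \<le> norm \<phi>"
    unfolding Bop_def by (rule order_trans[OF oproj_norm(2)[OF op c] norm_cutoff_le])
  show l: "Bop \<omega> N a \<phi> \<in> lsp ?\<Lambda>" for \<phi> unfolding Bop_def by (rule oprojD(1)[OF op c])
  show sym: "Bop \<omega> N a \<phi> \<bullet> \<psi> = \<phi> \<bullet> Bop \<omega> N a \<psi>" for \<phi> \<psi>
  proof -
    have "Bop \<omega> N a \<phi> \<bullet> \<psi> = Bop \<omega> N a \<phi> \<bullet> cutoff ?\<Lambda> \<psi>" using cutoff_lsp[OF l, of \<phi>] cutoff_inner by metis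
    also have "\<dots> = cutoff ?\<Lambda> \<phi> \<bullet> Bop \<omega> N a \<psi>" unfolding Bop_def by (rule oprojD(7)[OF op c c])
    also have "\<dots> = \<phi> \<bullet> Bop \<omega> N a \<psi>" using cutoff_lsp[OF l, of \<psi>] cutoff_inner by metis
    finally show ?thesis .
  qed
  show "Bop \<omega> N a (imul \<phi>) = imul (Bop \<omega> N a \<phi>)" "Bop \<omega> N a (\<phi> - \<psi>) = Bop \<omega> N a \<phi> - Bop \<omega> N a \<psi>"
    unfolding Bop_def by (simp_all add: oprojD(3,6)[OF op c] lsp_closed)
  have "Bop \<omega> N a (Bop \<omega> N a \<phi>) = Bop \<omega> N a \<phi>"
    using oprojD(2)[OF op c, of \<phi>] cutoff_lsp[OF l, of \<phi>] by (simp add: Bop_def)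
  then show "\<phi> \<bullet> Bop \<omega> N a \<phi> = (norm (Bop \<omega> N a \<phi>))\<^sup>2"
    using sym[of \<phi> "Bop \<omega> N a \<phi>"] by (simp add: power2_norm_eq_inner)
qed

text \<open>In \<open>transfer_bounds\<close> the smaller ball M plays the finite volume and the
  larger ball N supplies T. The bound depends on N only through \<open>slack N\<close>, so M can
  stay fixed while N tends to infinity.\<close>

lemma Bop_transfer:
  fixes \<omega> :: "int ^ 'd \<Rightarrow> real"
  assumes "M \<le> N" "a + slack N < b + slack M"
  defines "X \<equiv> \<lambda>w. mulop (eta (Suc M)) w - Bop \<omega> M b (mulop (eta (Suc M)) w)"
  shows "norm (X (Bop \<omega> N a \<phi>)) \<le> real (card (nb :: (int ^ 'd) set)) * (1 / real (Suc M)) / (b + slack M - (a + slack N)) * norm \<phi>"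
proof -
  let ?L = "l1_ball (Suc N) :: (int ^ 'd) set" and ?M = "l1_ball (Suc M) :: (int ^ 'd) set"
  have sub: "?M \<subseteq> ?L" using assms(1) by (auto simp: l1_ball_def)
  note e = eta_props[of "Suc M", simplified]
  have ml: "mulop (eta (Suc M)) w \<in> lsp ?M" for w using mulop_eta_lsp[of "Suc M"] by simp
  have "norm (mulop (eta (Suc M)) (Qf ?L \<omega> (a + slack N) \<psi>) -
      Qf ?M \<omega> (b + slack M) (mulop (eta (Suc M)) (Qf ?L \<omega> (a + slack N) \<psi>)))
      \<le> real (card (nb :: (int ^ 'd) set)) * (1 / real (Suc M)) / (b + slack M - (a + slack N)) * norm \<psi>"
    if "\<psi> \<in> lsp ?L" for \<psi>
  proof (rule transfer_bounds(2)[OF sym_op_Hloc Qf_pfam])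
    show "mulop (eta (Suc M)) v \<in> lsp ?L" for v using ml lsp_mono[OF sub] by blast
    show "norm (Hloc ?L \<omega> (mulop (eta (Suc M)) v) - mulop (eta (Suc M)) (Hloc ?M \<omega> v))
        \<le> real (card (nb :: (int ^ 'd) set)) * (1 / real (Suc M)) * norm v" if "v \<in> lsp ?M" for v
      by (rule Hloc_commutator) (use e that sub in auto)
  qed (use e assms that in auto)
  from this[of "cutoff ?L \<phi>"]
  have "norm (X (Bop \<omega> N a \<phi>)) \<le> real (card (nb :: (int ^ 'd) set)) * (1 / real (Suc M)) / (b + slack M - (a + slack N)) * norm (cutoff ?L \<phi>)"
    by (simp add: X_def Bop_def cutoff_lsp[OF ml] lsp_closed)
  also have "\<dots> \<le> real (card (nb :: (int ^ 'd) set)) * (1 / real (Suc M)) / (b + slack M - (a + slack N)) * norm \<phi>"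
    by (rule mult_left_mono[OF norm_cutoff_le]) (use assms in simp)
  finally show ?thesis .
qed

text \<open>The projected vector lives in the ball, so \<open>Hop\<close> may be replaced by the
  finite volume operator. The Hamiltonian is applied to fixed vectors only and squared norms equal
  pairings of \<phi> with its projection, so all relations are linear in the projection and pass to
  weak limits.\<close>

lemma Bop_energy:
  fixes \<omega> :: "int ^ 'd \<Rightarrow> real"
  assumes \<phi>: "\<phi> \<in> lsp (l1_ball (Suc N))" and \<psi>: "\<psi> \<in> lsp (l1_ball (Suc N))"
  shows "Hop \<omega> \<psi> \<bullet> Bop \<omega> N a \<phi> = \<psi> \<bullet> Bop \<omega> N a (Hop \<omega> \<phi>)"
    "Hop \<omega> \<phi> \<bullet> Bop \<omega> N a \<phi> \<le> (a + slack N) * (norm (Bop \<omega> N a \<phi>))\<^sup>2"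
    "Hop \<omega> \<phi> \<bullet> (\<phi> - Bop \<omega> N a \<phi>) \<ge> (a + slack N) * (norm (\<phi> - Bop \<omega> N a \<phi>))\<^sup>2"
proof -
  let ?\<Lambda> = "l1_ball (Suc N) :: (int ^ 'd) set"
  interpret sym_op ?\<Lambda> "lsp ?\<Lambda>" "Hloc ?\<Lambda> \<omega>" by (rule sym_op_Hloc) simp
  note pf = Qf_pfam[OF finite_l1_ball[of "Suc N"], of \<omega>]
  note P = pfam_props[OF pf]
  note r = pfam_roi[OF pf]
  let ?Q = "Qf ?\<Lambda> \<omega> (a + slack N)"
  have H: "Hop \<omega> \<phi> \<bullet> w = Hloc ?\<Lambda> \<omega> \<phi> \<bullet> w" if "w \<in> lsp ?\<Lambda>" "\<phi> \<in> lsp ?\<Lambda>" for w \<phi>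
    using Hloc_eq_cutoff[OF _ that(2), of \<omega>] cutoff_inner[of ?\<Lambda> "Hop \<omega> \<phi>" w] cutoff_lsp[OF that(1)] by simp
  have B: "Bop \<omega> N a \<phi> = ?Q \<phi>" if "\<phi> \<in> lsp ?\<Lambda>" for \<phi> by (simp add: Bop_def cutoff_lsp[OF that])
  have BH: "Bop \<omega> N a (Hop \<omega> \<phi>) = ?Q (Hloc ?\<Lambda> \<omega> \<phi>)" if "\<phi> \<in> lsp ?\<Lambda>" for \<phi>
    by (simp add: Bop_def Hloc_eq_cutoff[OF _ that])
  have Ql: "?Q \<phi> \<in> lsp ?\<Lambda>" if "\<phi> \<in> lsp ?\<Lambda>" for \<phi> by (rule roi_lsp[OF r that])
  show "Hop \<omega> \<psi> \<bullet> Bop \<omega> N a \<phi> = \<psi> \<bullet> Bop \<omega> N a (Hop \<omega> \<phi>)"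
    unfolding B[OF \<phi>] BH[OF \<phi>] H[OF Ql[OF \<phi>] \<psi>] using T_sym[OF \<psi> Ql[OF \<phi>]] P(2)[OF \<phi>] by simp
  have QQ: "?Q (?Q \<phi>) = ?Q \<phi>" using roi_min[OF r \<phi>] by simp
  have "?Q \<phi> \<bullet> Hloc ?\<Lambda> \<omega> (?Q \<phi>) \<le> (a + slack N) * (norm (?Q \<phi>))\<^sup>2"
    by (rule P(3)[OF Ql[OF \<phi>] QQ])
  moreover have 1: "Hop \<omega> \<phi> \<bullet> ?Q \<phi> = ?Q \<phi> \<bullet> Hloc ?\<Lambda> \<omega> (?Q \<phi>)"
    using H[OF Ql[OF \<phi>] \<phi>] P(2)[OF \<phi>] roi_linear(3)[OF r Ql[OF \<phi>] T_lsp[OF \<phi>], of "a + slack N"] QQ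
    by (simp add: inner_commute)
  ultimately show "Hop \<omega> \<phi> \<bullet> Bop \<omega> N a \<phi> \<le> (a + slack N) * (norm (Bop \<omega> N a \<phi>))\<^sup>2" by (simp add: B[OF \<phi>])
  let ?w = "\<phi> - ?Q \<phi>"
  have wl: "?w \<in> lsp ?\<Lambda>" using \<phi> Ql by blast
  have Qw: "?Q ?w = 0" using QQ by (simp add: roi_linear(2)[OF r \<phi> Ql[OF \<phi>]])
  have "?w \<bullet> Hloc ?\<Lambda> \<omega> ?w \<ge> (a + slack N) * (norm ?w)\<^sup>2" by (rule P(4)[OF wl Qw])
  moreover have "Hop \<omega> \<phi> \<bullet> ?w = ?w \<bullet> Hloc ?\<Lambda> \<omega> ?w"
  proof -
    have "Hloc ?\<Lambda> \<omega> ?w = Hloc ?\<Lambda> \<omega> \<phi> - ?Q (Hloc ?\<Lambda> \<omega> \<phi>)" using T_diff[OF \<phi> Ql[OF \<phi>]] P(2)[OF \<phi>] by simp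
    moreover have "?w \<bullet> ?Q (Hloc ?\<Lambda> \<omega> \<phi>) = 0" using roi_linear(3)[OF r wl T_lsp[OF \<phi>], of "a + slack N"] Qw by simp
    ultimately show ?thesis using H[OF wl \<phi>] by (simp add: inner_diff_right inner_commute)
  qed
  ultimately show "Hop \<omega> \<phi> \<bullet> (\<phi> - Bop \<omega> N a \<phi>) \<ge> (a + slack N) * (norm (\<phi> - Bop \<omega> N a \<phi>))\<^sup>2"
    by (simp add: B[OF \<phi>])
qed

lemma fsupp_l1_ball:
  assumes "\<phi> \<in> fsupp UNIV"
  shows "\<forall>\<^sub>F N in sequentially. \<phi> \<in> lsp (l1_ball (Suc N) :: (int ^ 'd) set)"
proof -
  obtain F where F: "finite F" "\<phi> \<in> lsp F" using assms by (rule fsuppE)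
  have "\<forall>\<^sub>F N in sequentially. \<forall>z\<in>F. z \<in> l1_ball (Suc N)"
  proof (rule eventually_ball_finite[OF F(1)], rule ballI)
    fix z show "\<forall>\<^sub>F N in sequentially. z \<in> l1_ball (Suc N)"
      using eventually_ge_at_top[of "l1_norm z"] by eventually_elim (simp add: l1_ball_def)
  qed
  then show ?thesis
  proof eventually_elim
    case (elim N)
    then have "F \<subseteq> l1_ball (Suc N)" by (simp add: subset_iff)
    from subsetD[OF lsp_mono[OF this] F(2)] show ?case .
  qed
qed

text \<open>Weak limits R a of projections are symmetric contractions, but idempotence and
  right-continuity can be lost in the limit. Both are rescued by \<open>Bop_transfer\<close>: for a
  \<le> b a vector in the range of R a has, up to an error vanishing with M, no component above b +
  slack M in the ball M. Commutation and energy bounds pass to the limit on finitely supported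
  vectors and extend from this core to the domain.\<close>

theorem Hop_pfam_exists:
  fixes \<omega> :: "int ^ 'd \<Rightarrow> real"
  obtains Q where "pfam UNIV (Hdom \<omega>) (Hop \<omega>) Q"
proof -
  interpret sym_op UNIV "Hdom \<omega>" "Hop \<omega>" by (rule sym_op_Hop)
  let ?n = "real (card (nb :: (int ^ 'd) set))"
  note B = Bop_props[where \<omega> = \<omega>]
  obtain G R where G: "G \<noteq> bot" "G \<le> sequentially"
    and lim: "\<And>a \<phi> \<psi>. ((\<lambda>N. \<psi> \<bullet> Bop \<omega> N a \<phi>) \<longlongrightarrow> \<psi> \<bullet> R a \<phi>) G"
    by (rule weak_cluster_operators[of "Bop \<omega>", OF B(1-3)]) blast
  have evG: "eventually P G" if "eventually P sequentially" for P
    using that G(2) by (simp add: le_filter_def)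
  have limG: "(f \<longlongrightarrow> l) G" if "f \<longlonglongrightarrow> l" for f :: "nat \<Rightarrow> 'e::topological_space" and l
    using that G(2) by (rule filterlim_mono[OF _ order_refl])
  have uniq: "l = l'" if "(f \<longlongrightarrow> l) G" "(f \<longlongrightarrow> l') G" for f :: "nat \<Rightarrow> real" and l l'
    using tendsto_unique[OF G(1) that] .
  have lim': "((\<lambda>N. Bop \<omega> N a \<phi> \<bullet> \<psi>) \<longlongrightarrow> R a \<phi> \<bullet> \<psi>) G" for a \<phi> \<psi>
    using lim[of \<psi> a \<phi>] by (simp add: inner_commute)
  have Rsym: "R a \<phi> \<bullet> \<psi> = \<phi> \<bullet> R a \<psi>" for a \<phi> \<psi>
    by (rule uniq[OF lim'[of a \<phi> \<psi>]]) (use lim[of \<phi> a \<psi>] in \<open>simp add: B(2)\<close>)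
  have eqI: "u = v" if "\<And>\<psi>. \<psi> \<bullet> u = \<psi> \<bullet> v" for u v :: "(int ^ 'd) l2"
    using that vector_eq_ldot by blast
  have Radd: "R a (\<phi> + \<psi>) = R a \<phi> + R a \<psi>" and Rscale: "R a (c *\<^sub>R \<phi>) = c *\<^sub>R R a \<phi>"
    for a c \<phi> \<psi>
    by (rule eqI; simp add: Rsym[symmetric] inner_add_right)+
  have Rimul: "R a (imul \<phi>) = imul (R a \<phi>)" for a \<phi>
  proof (rule eqI)
    fix \<psi>
    have "((\<lambda>N. \<psi> \<bullet> Bop \<omega> N a (imul \<phi>)) \<longlongrightarrow> \<psi> \<bullet> imul (R a \<phi>)) G"
      unfolding B(3) inner_imul_right by (intro tendsto_minus lim)
    then show "\<psi> \<bullet> R a (imul \<phi>) = \<psi> \<bullet> imul (R a \<phi>)" by (rule uniq[OF lim])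
  qed
  have Rnorm: "norm (R a \<phi>) \<le> norm \<phi>" for a \<phi>
    by (rule l2_weak_norm_le[OF G(1) lim]) (simp add: B(1))
  have Rdiff: "R a (\<phi> - \<psi>) = R a \<phi> - R a \<psi>" for a \<phi> \<psi>
    using Radd[of a \<phi> "(-1) *\<^sub>R \<psi>"] Rscale[of a "-1" \<psi>] by simp
  \<comment> \<open>The part of the truncated vector that lies above energy b + slack M in the ball
    M.\<close>
  define X where "X M b w = mulop (eta (Suc M)) w - Bop \<omega> M b (mulop (eta (Suc M)) w)" for M b and w :: "(int ^ 'd) l2"
  note bd1 = eta_props(1)[of "Suc M" for M, simplified]
  have Xw: "\<psi> \<bullet> X M b w = mulop (eta (Suc M)) (\<psi> - Bop \<omega> M b \<psi>) \<bullet> w" for \<psi> M b w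
  proof -
    have "\<psi> \<bullet> X M b w = (\<psi> - Bop \<omega> M b \<psi>) \<bullet> mulop (eta (Suc M)) w"
      by (simp add: X_def inner_diff_right inner_diff_left B(2))
    then show ?thesis by (simp add: mulop_inner[OF bd1])
  qed
  \<comment> \<open>M stays fixed while N runs along G; half of the energy gap is reserved for
    \<open>slack N\<close>.\<close>
  have XR: "norm (X M b (R a \<phi>)) \<le> ?n * (1 / real (Suc M)) / ((b + slack M - a) / 2) * norm \<phi>"
    if "a < b + slack M" for M a b \<phi>
  proof (rule l2_weak_norm_le[OF G(1)])
    show "((\<lambda>N. \<psi> \<bullet> X M b (Bop \<omega> N a \<phi>)) \<longlongrightarrow> \<psi> \<bullet> X M b (R a \<phi>)) G" for \<psi>
      unfolding Xw by (rule lim)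
    have "\<forall>\<^sub>F N in sequentially. slack N < (b + slack M - a) / 2"
      using slack_props(2) that by (intro order_tendstoD(2)) auto
    then have "\<forall>\<^sub>F N in sequentially. slack N < (b + slack M - a) / 2 \<and> N \<ge> M"
      using eventually_ge_at_top by (rule eventually_conj)
    then show "\<forall>\<^sub>F N in G. norm (X M b (Bop \<omega> N a \<phi>)) \<le> ?n * (1 / real (Suc M)) / ((b + slack M - a) / 2) * norm \<phi>"
    proof (rule evG[OF eventually_mono])
      fix N assume N: "slack N < (b + slack M - a) / 2 \<and> N \<ge> M"
      have "norm (X M b (Bop \<omega> N a \<phi>)) \<le> ?n * (1 / real (Suc M)) / (b + slack M - (a + slack N)) * norm \<phi>"
        unfolding X_def by (rule Bop_transfer) (use N that in auto)
      also have "\<dots> \<le> ?n * (1 / real (Suc M)) / ((b + slack M - a) / 2) * norm \<phi>"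
        by (intro mult_right_mono divide_left_mono mult_pos_pos) (use N that in auto)
      finally show "norm (X M b (Bop \<omega> N a \<phi>)) \<le> ?n * (1 / real (Suc M)) / ((b + slack M - a) / 2) * norm \<phi>" .
    qed
  qed
  \<comment> \<open>For a \<le> b + slack M / 2 the gap b + slack M - a is at least slack M / 2, of
    which half is available: hence the factor 4. The choice of \<open>slack\<close> makes this tend
    to 0.\<close>
  define e where "e M = 4 * ?n * (1 / real (Suc M) / slack M)" for M
  have e0: "e \<longlonglongrightarrow> 0" unfolding e_def using tendsto_mult_left[OF slack_props(4), of "4 * ?n"] by simp
  have XR': "norm (X M b (R a \<phi>)) \<le> e M * norm \<phi>" if "a \<le> b + slack M / 2" for M a b \<phi>
  proof -
    have "norm (X M b (R a \<phi>)) \<le> ?n * (1 / real (Suc M)) / ((b + slack M - a) / 2) * norm \<phi>"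
      by (rule XR) (use that slack_props(1)[of M] in linarith)
    also have "\<dots> \<le> ?n * (1 / real (Suc M)) / (slack M / 4) * norm \<phi>"
      by (intro mult_right_mono divide_left_mono mult_pos_pos) (use that slack_props(1)[of M] in auto)
    also have "\<dots> = e M * norm \<phi>" by (simp add: e_def)
    finally show ?thesis .
  qed
  \<comment> \<open>A vector u in the range of R a is the norm limit of Bop \<omega> M b u, whereas
    the weak limit of the same sequence along G is R b u.\<close>
  have Rmin1: "R b (R a \<phi>) = R a \<phi>" if "a \<le> b" for a b \<phi>
  proof (rule eqI)
    fix \<psi>
    let ?u = "R a \<phi>"
    have "(\<lambda>M. 2 * norm (mulop (eta (Suc M)) ?u - ?u) + e M * norm \<phi>) \<longlonglongrightarrow> 2 * norm (?u - ?u) + 0 * norm \<phi>"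
      by (intro tendsto_intros mulop_eta_tendsto e0)
    then have z: "(\<lambda>M. 2 * norm (mulop (eta (Suc M)) ?u - ?u) + e M * norm \<phi>) \<longlonglongrightarrow> 0" by simp
    have le: "norm (Bop \<omega> M b ?u - ?u) \<le> 2 * norm (mulop (eta (Suc M)) ?u - ?u) + e M * norm \<phi>" for M
    proof -
      let ?m = "mulop (eta (Suc M)) ?u"
      have "Bop \<omega> M b ?u - ?u = - Bop \<omega> M b (?m - ?u) - X M b ?u + (?m - ?u)"
        by (simp add: X_def B(6))
      also have "norm \<dots> \<le> norm (Bop \<omega> M b (?m - ?u)) + norm (X M b ?u) + norm (?m - ?u)"
        using norm_triangle_ineq[of "- Bop \<omega> M b (?m - ?u) - X M b ?u" "?m - ?u"]
          norm_triangle_ineq4[of "- Bop \<omega> M b (?m - ?u)" "X M b ?u"] unfolding norm_minus_cancel by linarith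
      also have "norm (X M b ?u) \<le> e M * norm \<phi>" by (rule XR') (use that slack_props(1)[of M] in linarith)
      also have "norm (Bop \<omega> M b (?m - ?u)) \<le> norm (?m - ?u)" by (rule B(1))
      finally show ?thesis by simp
    qed
    have "(\<lambda>M. norm (Bop \<omega> M b ?u - ?u)) \<longlonglongrightarrow> 0"
      by (rule tendsto_sandwich[OF _ _ tendsto_const z]) (use le in auto)
    then have "(\<lambda>M. Bop \<omega> M b ?u) \<longlonglongrightarrow> ?u" by (simp add: tendsto_norm_zero_iff LIM_zero_iff)
    then have "(\<lambda>M. \<psi> \<bullet> Bop \<omega> M b ?u) \<longlonglongrightarrow> \<psi> \<bullet> ?u" by (intro tendsto_intros)
    from uniq[OF lim limG[OF this]] show "\<psi> \<bullet> R b (R a \<phi>) = \<psi> \<bullet> R a \<phi>" .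
  qed
  have Rmin: "R x (R y \<phi>) = R (min x y) \<phi>" for x y \<phi>
  proof (cases "y \<le> x")
    case True then show ?thesis using Rmin1 by (simp add: min_def)
  next
    case False
    then have "R x (R y \<phi>) = R x \<phi>"
      by (intro eqI) (metis Rmin1 Rsym linorder_le_cases)
    then show ?thesis using False by (simp add: min_def)
  qed
  have Rop: "oproj UNIV (R a)" for a
    unfolding oproj_def using Radd Rscale Rimul Rsym Rmin[of a a] by simp
  \<comment> \<open>The distribution function of the spectral measure of \<phi>. Its increments are
    squared distances between projections, so right-continuity becomes a scalar question.\<close>
  define h where "h \<phi> a = \<phi> \<bullet> R a \<phi>" for a \<phi>
  have h_norm: "h \<phi> a = (norm (R a \<phi>))\<^sup>2" for a \<phi> unfolding h_def by (rule oproj_inner[OF Rop]) simp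
  have Rdist: "(norm (R y \<phi> - R x \<phi>))\<^sup>2 = h \<phi> y - h \<phi> x" if "x \<le> y" for x y \<phi>
  proof -
    have "R y \<phi> \<bullet> R x \<phi> = h \<phi> x" using Rsym[of y \<phi> "R x \<phi>"] Rmin1[OF that, of \<phi>] by (simp add: h_def)
    then show ?thesis
      by (simp add: h_norm power2_norm_eq_inner inner_diff_left inner_diff_right inner_commute)
  qed
  have hmono: "h \<phi> x \<le> h \<phi> y" if "x \<le> y" for x y \<phi> using Rdist[OF that, of \<phi>] zero_le_power2[of "norm (R y \<phi> - R x \<phi>)"] by linarith
  \<comment> \<open>One M is fixed at which the weak limit at x is nearly attained and the errors
    are small. It serves all y up to x + slack M / 2 at once, because the projection in the ball M
    already reaches up to x + slack M.\<close>
  have rc: "((\<lambda>y. R y \<phi>) \<longlongrightarrow> R x \<phi>) (at_right x)" for x \<phi>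
  proof (rule tendstoI)
    fix d :: real assume d: "0 < d"
    define t where "t = d\<^sup>2 / 4"
    have t: "0 < t" using d by (simp add: t_def)
    define g where "g M = e M * (norm \<phi>)\<^sup>2 + norm (mulop (eta (Suc M)) \<phi> - \<phi>) * norm \<phi>" for M
    have "g \<longlonglongrightarrow> 0 * (norm \<phi>)\<^sup>2 + norm (\<phi> - \<phi>) * norm \<phi>"
      unfolding g_def by (intro tendsto_intros e0 mulop_eta_tendsto)
    then have "g \<longlonglongrightarrow> 0" by simp
    then have "\<forall>\<^sub>F M in G. g M < t" using t by (intro evG order_tendstoD(2)) auto
    moreover have "\<forall>\<^sub>F M in G. \<phi> \<bullet> Bop \<omega> M x \<phi> < h \<phi> x + t"
      using lim[of \<phi> x \<phi>] t by (intro order_tendstoD(2)) (auto simp: h_def)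
    ultimately have "\<forall>\<^sub>F M in G. g M < t \<and> \<phi> \<bullet> Bop \<omega> M x \<phi> < h \<phi> x + t" by (rule eventually_conj)
    then obtain M where M: "g M < t" "\<phi> \<bullet> Bop \<omega> M x \<phi> < h \<phi> x + t"
      using eventually_happens'[OF G(1)] by blast
    have "h \<phi> y < h \<phi> x + 4 * t" if y: "x < y" "y < x + slack M / 2" for y
    proof -
      let ?u = "R y \<phi>" and ?m = "mulop (eta (Suc M))"
      have c1: "h \<phi> y = ?m \<phi> \<bullet> ?u - (?m \<phi> - \<phi>) \<bullet> ?u" by (simp add: h_def inner_diff_left)
      have c2: "?m \<phi> \<bullet> ?u = \<phi> \<bullet> X M x ?u + Bop \<omega> M x \<phi> \<bullet> ?m ?u"
        by (simp add: X_def inner_diff_right mulop_inner[OF bd1] B(2))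
      have c3: "\<phi> \<bullet> X M x ?u \<le> norm \<phi> * (e M * norm \<phi>)"
        by (rule order_trans[OF norm_cauchy_schwarz mult_left_mono[OF XR']]) (use y in auto)
      have c4: "Bop \<omega> M x \<phi> \<bullet> ?m ?u \<le> norm (Bop \<omega> M x \<phi>) * norm ?u"
        by (rule order_trans[OF norm_cauchy_schwarz mult_left_mono[OF norm_mulop_le1[OF bd1]]]) auto
      have c5: "- ((?m \<phi> - \<phi>) \<bullet> ?u) \<le> norm (?m \<phi> - \<phi>) * norm \<phi>"
      proof -
        have "- ((?m \<phi> - \<phi>) \<bullet> ?u) \<le> norm (?m \<phi> - \<phi>) * norm ?u"
          using Cauchy_Schwarz_ineq2[of "?m \<phi> - \<phi>" ?u] by linarith
        also have "\<dots> \<le> norm (?m \<phi> - \<phi>) * norm \<phi>" by (intro mult_left_mono Rnorm) auto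
        finally show ?thesis .
      qed
      have 1: "h \<phi> y \<le> g M + norm (Bop \<omega> M x \<phi>) * norm ?u"
      proof -
        have "g M = norm \<phi> * (e M * norm \<phi>) + norm (?m \<phi> - \<phi>) * norm \<phi>"
          by (simp add: g_def power2_eq_square)
        then show ?thesis using c1 c2 c3 c4 c5 by linarith
      qed
      \<comment> \<open>The inequality of arithmetic and geometric means; its term h \<phi> y / 2 is
        absorbed into the left side of the preceding bound.\<close>
      have "0 \<le> (norm (Bop \<omega> M x \<phi>) - norm ?u)\<^sup>2" by simp
      then have 2: "norm (Bop \<omega> M x \<phi>) * norm ?u \<le> (\<phi> \<bullet> Bop \<omega> M x \<phi> + h \<phi> y) / 2"
        unfolding power2_diff B(5) h_norm by simp
      then have 3: "norm (Bop \<omega> M x \<phi>) * norm ?u \<le> (\<phi> \<bullet> Bop \<omega> M x \<phi>) / 2 + h \<phi> y / 2"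
        by (simp only: add_divide_distrib)
      from 1 3 M t show ?thesis by linarith
    qed
    then have "dist (R y \<phi>) (R x \<phi>) < d" if "x < y" "y < x + slack M / 2" for y
    proof -
      assume *: "\<And>y. x < y \<Longrightarrow> y < x + slack M / 2 \<Longrightarrow> h \<phi> y < h \<phi> x + 4 * t"
      have "(norm (R y \<phi> - R x \<phi>))\<^sup>2 < d\<^sup>2" using Rdist[of x y \<phi>] *[OF that] that by (simp add: t_def)
      then show ?thesis using d by (simp add: dist_norm power_less_imp_less_base)
    qed
    moreover have "\<forall>\<^sub>F y in at_right x. y \<in> {x<..<x + slack M / 2}"
      by (rule eventually_at_right_real) (use slack_props(1)[of M] in simp)
    ultimately show "\<forall>\<^sub>F y in at_right x. dist (R y \<phi>) (R x \<phi>) < d" by (auto elim!: eventually_mono)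
  qed
  \<comment> \<open>A Chebyshev estimate at low energies. The -1 accounts for \<open>slack\<close>,
    which is at most 1.\<close>
  have low: "norm (R a \<phi>) \<le> norm (Hop \<omega> \<phi>) / (- a - 1)" if \<phi>: "\<phi> \<in> fsupp UNIV" and a: "a < -1" for a \<phi>
  proof (rule l2_weak_norm_le[OF G(1) lim], rule evG)
    show "\<forall>\<^sub>F N in sequentially. norm (Bop \<omega> N a \<phi>) \<le> norm (Hop \<omega> \<phi>) / (- a - 1)"
      using fsupp_l1_ball[OF \<phi>]
    proof eventually_elim
      case (elim N)
      let ?u = "Bop \<omega> N a \<phi>"
      have "(- a - 1) * (norm ?u)\<^sup>2 \<le> (- (a + slack N)) * (norm ?u)\<^sup>2"
        using slack_props(3)[of N] by (intro mult_right_mono) auto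
      also have "\<dots> \<le> - (Hop \<omega> \<phi> \<bullet> ?u)" using Bop_energy(2)[OF elim elim, of \<omega> a]
        unfolding mult_minus_left by linarith
      also have "\<dots> \<le> norm (Hop \<omega> \<phi>) * norm ?u" using Cauchy_Schwarz_ineq2[of "Hop \<omega> \<phi>" ?u] by linarith
      finally have "((- a - 1) * norm ?u) * norm ?u \<le> norm (Hop \<omega> \<phi>) * norm ?u" by (simp add: power2_eq_square mult.assoc)
      then have "(- a - 1) * norm ?u \<le> norm (Hop \<omega> \<phi>)" by (cases "norm ?u = 0") (auto simp: mult_le_cancel_right)
      then show ?case using a by (simp add: pos_le_divide_eq mult.commute)
    qed
  qed
  have high: "norm (\<phi> - R a \<phi>) \<le> norm (Hop \<omega> \<phi>) / a" if \<phi>: "\<phi> \<in> fsupp UNIV" and a: "0 < a" for a \<phi>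
  proof (rule l2_weak_norm_le[OF G(1), where u = "\<lambda>N. \<phi> - Bop \<omega> N a \<phi>"])
    show "((\<lambda>N. \<psi> \<bullet> (\<phi> - Bop \<omega> N a \<phi>)) \<longlongrightarrow> \<psi> \<bullet> (\<phi> - R a \<phi>)) G" for \<psi>
      unfolding inner_diff_right by (intro tendsto_diff tendsto_const lim)
    show "\<forall>\<^sub>F N in G. norm (\<phi> - Bop \<omega> N a \<phi>) \<le> norm (Hop \<omega> \<phi>) / a"
      using evG[OF fsupp_l1_ball[OF \<phi>]]
    proof eventually_elim
      case (elim N)
      let ?u = "\<phi> - Bop \<omega> N a \<phi>"
      have "a * (norm ?u)\<^sup>2 \<le> (a + slack N) * (norm ?u)\<^sup>2"
        using slack_props(1)[of N] by (intro mult_right_mono) auto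
      also have "\<dots> \<le> Hop \<omega> \<phi> \<bullet> ?u" by (rule Bop_energy(3)[OF elim elim])
      also have "\<dots> \<le> norm (Hop \<omega> \<phi>) * norm ?u" by (rule norm_cauchy_schwarz)
      finally have "(a * norm ?u) * norm ?u \<le> norm (Hop \<omega> \<phi>) * norm ?u" by (simp add: power2_eq_square mult.assoc)
      then have "a * norm ?u \<le> norm (Hop \<omega> \<phi>)" by (cases "norm ?u = 0") (auto simp: mult_le_cancel_right)
      then show ?case using a by (simp add: pos_le_divide_eq mult.commute)
    qed
  qed
  \<comment> \<open>Convergence to 0 on finitely supported vectors extends to all vectors, because
    replacing \<phi> by \<psi> costs at most their distance.\<close>
  have dens: "(f \<longlongrightarrow> 0) F" if "\<And>\<psi> a. f a \<le> k \<psi> a + norm (\<phi> - \<psi>)" "\<And>\<psi>. \<psi> \<in> fsupp UNIV \<Longrightarrow> (k \<psi> \<longlongrightarrow> 0) F"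
    "\<And>a. 0 \<le> f a" for f :: "real \<Rightarrow> real" and k F and \<phi> :: "(int ^ 'd) l2"
  proof (rule tendstoI)
    fix d :: real assume d: "0 < d"
    obtain \<psi> where \<psi>: "\<psi> \<in> fsupp UNIV" "norm (\<phi> - \<psi>) < d / 2"
      using fsupp_dense[of \<phi> UNIV "d / 2"] d by auto
    have "\<forall>\<^sub>F a in F. k \<psi> a < d / 2" by (rule order_tendstoD(2)[OF that(2)[OF \<psi>(1)]]) (use d in simp)
    then show "\<forall>\<^sub>F a in F. dist (f a) 0 < d"
    proof eventually_elim
      case (elim a)
      then show ?case using that(1)[of a \<psi>] that(3)[of a] \<psi>(2) by (simp add: dist_real_def)
    qed
  qed
  have bot: "((\<lambda>a. R a \<phi>) \<longlongrightarrow> 0) at_bot" for \<phi>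
  proof -
    have "((\<lambda>a. norm (R a \<phi>)) \<longlongrightarrow> 0) at_bot"
    proof (rule dens[of _ "\<lambda>\<psi> a. norm (R a \<psi>)" \<phi>])
      show "norm (R a \<phi>) \<le> norm (R a \<psi>) + norm (\<phi> - \<psi>)" for a \<psi>
        using norm_triangle_ineq[of "R a \<psi>" "R a (\<phi> - \<psi>)"] Rnorm[of a "\<phi> - \<psi>"] by (simp add: Rdiff)
      fix \<psi> :: "(int ^ 'd) l2" assume \<psi>: "\<psi> \<in> fsupp UNIV"
      have lim0: "((\<lambda>a. norm (Hop \<omega> \<psi>) / (- a - 1)) \<longlongrightarrow> 0) at_bot"
      proof (rule real_tendsto_divide_at_top[OF tendsto_const])
        show "filterlim (\<lambda>a :: real. - a - 1) at_top at_bot"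
          unfolding filterlim_at_top
        proof
          fix Z :: real
          show "\<forall>\<^sub>F a in at_bot. Z \<le> - a - 1"
            using eventually_le_at_bot[of "- Z - 1"] by eventually_elim simp
        qed
      qed
      have ub: "\<forall>\<^sub>F a in at_bot. norm (R a \<psi>) \<le> norm (Hop \<omega> \<psi>) / (- a - 1)"
        using eventually_le_at_bot[of "-2 :: real"]
      proof eventually_elim
        case (elim a)
        then show ?case by (intro low[OF \<psi>]) simp
      qed
      show "((\<lambda>a. norm (R a \<psi>)) \<longlongrightarrow> 0) at_bot"
        by (rule tendsto_sandwich[OF _ ub tendsto_const lim0]) simp
    qed auto
    then show ?thesis by (simp add: tendsto_norm_zero_iff)
  qed
  have top: "((\<lambda>a. R a \<phi>) \<longlongrightarrow> \<phi>) at_top" for \<phi>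
  proof -
    have "((\<lambda>a. norm (\<phi> - R a \<phi>)) \<longlongrightarrow> 0) at_top"
    proof (rule dens[of _ "\<lambda>\<psi> a. norm (\<psi> - R a \<psi>)" \<phi>])
      show "norm (\<phi> - R a \<phi>) \<le> norm (\<psi> - R a \<psi>) + norm (\<phi> - \<psi>)" for a \<psi>
      proof -
        have "\<phi> - R a \<phi> = (\<psi> - R a \<psi>) + ((\<phi> - \<psi>) - R a (\<phi> - \<psi>))" by (simp add: Rdiff)
        then have "norm (\<phi> - R a \<phi>) \<le> norm (\<psi> - R a \<psi>) + norm ((\<phi> - \<psi>) - R a (\<phi> - \<psi>))"
          by (simp only: norm_triangle_ineq)
        also have "norm ((\<phi> - \<psi>) - R a (\<phi> - \<psi>)) \<le> norm (\<phi> - \<psi>)"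
          by (rule oproj_norm(3)[OF Rop]) simp
        finally show ?thesis by simp
      qed
      fix \<psi> :: "(int ^ 'd) l2" assume \<psi>: "\<psi> \<in> fsupp UNIV"
      have lim0: "((\<lambda>a. norm (Hop \<omega> \<psi>) / a) \<longlongrightarrow> 0) at_top"
        by (rule real_tendsto_divide_at_top[OF tendsto_const filterlim_ident])
      have ub: "\<forall>\<^sub>F a in at_top. norm (\<psi> - R a \<psi>) \<le> norm (Hop \<omega> \<psi>) / a"
        using eventually_gt_at_top[of "0 :: real"] by eventually_elim (rule high[OF \<psi>])
      show "((\<lambda>a. norm (\<psi> - R a \<psi>)) \<longlongrightarrow> 0) at_top"
        by (rule tendsto_sandwich[OF _ ub tendsto_const lim0]) simp
    qed auto
    then have "((\<lambda>a. \<phi> - (\<phi> - R a \<phi>)) \<longlongrightarrow> \<phi> - 0) at_top"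
      by (intro tendsto_intros) (simp add: tendsto_norm_zero_iff)
    then show ?thesis by simp
  qed
  have roi: "roi UNIV R" unfolding roi_def using Rop Rmin rc bot top by blast
  have Rcont: "((\<lambda>F. R a (u F)) \<longlongrightarrow> R a v) H" if "(u \<longlongrightarrow> v) H" for u v a and H :: "'e filter"
  proof (rule Lim_null_comparison[THEN LIM_zero_cancel])
    show "\<forall>\<^sub>F F in H. norm (R a (u F) - R a v) \<le> norm (u F - v)" using Rnorm by (simp flip: Rdiff)
    show "((\<lambda>F. norm (u F - v)) \<longlongrightarrow> 0) H" using that by (simp add: tendsto_norm_zero_iff LIM_zero_iff)
  qed
  let ?H = "finite_subsets_at_top (UNIV :: (int ^ 'd) set)"
  have Hn: "?H \<noteq> bot" by simp
  have evfs: "\<forall>\<^sub>F F in ?H. cutoff F \<phi> \<in> fsupp UNIV" for \<phi>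
    by (rule eventually_finite_subsets_at_top_weakI) (simp add: fsupp_cutoff)
  have comm_fs: "Hop \<omega> \<psi> \<bullet> R b \<phi> = \<psi> \<bullet> R b (Hop \<omega> \<phi>)" if "\<phi> \<in> fsupp UNIV" "\<psi> \<in> fsupp UNIV" for b \<phi> \<psi>
  proof (rule uniq[OF lim])
    have "\<forall>\<^sub>F N in G. \<psi> \<bullet> Bop \<omega> N b (Hop \<omega> \<phi>) = Hop \<omega> \<psi> \<bullet> Bop \<omega> N b \<phi>"
      using evG[OF fsupp_l1_ball[OF that(1)]] evG[OF fsupp_l1_ball[OF that(2)]]
      by eventually_elim (simp add: Bop_energy(1))
    then show "((\<lambda>N. Hop \<omega> \<psi> \<bullet> Bop \<omega> N b \<phi>) \<longlongrightarrow> \<psi> \<bullet> R b (Hop \<omega> \<phi>)) G"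
      by (rule Lim_transform_eventually[OF lim])
  qed
  have comm_w: "Hop \<omega> \<psi> \<bullet> R b \<phi> = \<psi> \<bullet> R b (Hop \<omega> \<phi>)" if "\<phi> \<in> Hdom \<omega>" "\<psi> \<in> fsupp UNIV" for b \<phi> \<psi>
  proof (rule tendsto_unique[OF Hn])
    show "((\<lambda>F. Hop \<omega> \<psi> \<bullet> R b (cutoff F \<phi>)) \<longlongrightarrow> Hop \<omega> \<psi> \<bullet> R b \<phi>) ?H"
      by (intro tendsto_intros Rcont cutoff_tendsto)
    have "((\<lambda>F. \<psi> \<bullet> R b (Hop \<omega> (cutoff F \<phi>))) \<longlongrightarrow> \<psi> \<bullet> R b (Hop \<omega> \<phi>)) ?H"
      by (intro tendsto_intros Rcont Hop_graph_dense that)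
    then show "((\<lambda>F. Hop \<omega> \<psi> \<bullet> R b (cutoff F \<phi>)) \<longlongrightarrow> \<psi> \<bullet> R b (Hop \<omega> \<phi>)) ?H"
      by (rule Lim_transform_eventually) (use evfs[of \<phi>] in eventually_elim, use comm_fs that in simp)
  qed
  \<comment> \<open>The commutation relation itself supplies the boundedness required by
    \<open>T_max\<close>.\<close>
  have RD: "R b \<phi> \<in> Hdom \<omega>" if "\<phi> \<in> Hdom \<omega>" for b \<phi>
  proof (rule T_max[where C = "norm (R b (Hop \<omega> \<phi>))"])
    fix \<psi> :: "(int ^ 'd) l2" assume "\<psi> \<in> fsupp UNIV"
    then show "Hop \<omega> \<psi> \<bullet> R b \<phi> \<le> norm (R b (Hop \<omega> \<phi>)) * norm \<psi>"
      using comm_w[OF that] norm_cauchy_schwarz[of \<psi> "R b (Hop \<omega> \<phi>)"] by (simp add: mult.commute)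
  qed simp
  have RT: "Hop \<omega> (R b \<phi>) = R b (Hop \<omega> \<phi>)" if "\<phi> \<in> Hdom \<omega>" for b \<phi>
  proof (rule l2_inner_eqI[where S = UNIV])
    have *: "Hop \<omega> (R b \<phi>) \<bullet> \<psi> = R b (Hop \<omega> \<phi>) \<bullet> \<psi>" if "\<psi> \<in> fsupp UNIV" for \<psi>
      using T_sym[OF RD[OF \<open>\<phi> \<in> Hdom \<omega>\<close>] fsupp_Hdom[OF that]] comm_w[OF \<open>\<phi> \<in> Hdom \<omega>\<close> that, of b]
      by (simp add: inner_commute)
    show "Hop \<omega> (R b \<phi>) \<bullet> dl z = R b (Hop \<omega> \<phi>) \<bullet> dl z" "Hop \<omega> (R b \<phi>) \<bullet> imul (dl z) = R b (Hop \<omega> \<phi>) \<bullet> imul (dl z)" for z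
      by (rule *, rule fsupp_dl, simp)+
  qed auto
  have sl: "((\<lambda>N. a + slack N) \<longlongrightarrow> a) G" for a
    using limG[OF slack_props(2)] tendsto_add[OF tendsto_const[of a]] by fastforce
  have up_fs: "Hop \<omega> \<phi> \<bullet> R b \<phi> \<le> b * (\<phi> \<bullet> R b \<phi>)" and lo_fs: "b * (\<phi> \<bullet> (\<phi> - R b \<phi>)) \<le> Hop \<omega> \<phi> \<bullet> (\<phi> - R b \<phi>)"
    if "\<phi> \<in> fsupp UNIV" for b \<phi>
  proof -
    note ev = evG[OF fsupp_l1_ball[OF that]]
    show "Hop \<omega> \<phi> \<bullet> R b \<phi> \<le> b * (\<phi> \<bullet> R b \<phi>)"
    proof (rule tendsto_le[OF G(1)])
      show "((\<lambda>N. (b + slack N) * (\<phi> \<bullet> Bop \<omega> N b \<phi>)) \<longlongrightarrow> b * (\<phi> \<bullet> R b \<phi>)) G"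
        by (intro tendsto_mult sl lim)
      show "\<forall>\<^sub>F N in G. Hop \<omega> \<phi> \<bullet> Bop \<omega> N b \<phi> \<le> (b + slack N) * (\<phi> \<bullet> Bop \<omega> N b \<phi>)"
        using ev by eventually_elim (simp add: B(5) Bop_energy(2))
    qed (rule lim)
    show "b * (\<phi> \<bullet> (\<phi> - R b \<phi>)) \<le> Hop \<omega> \<phi> \<bullet> (\<phi> - R b \<phi>)"
    proof (rule tendsto_le[OF G(1)])
      show "((\<lambda>N. (b + slack N) * (\<phi> \<bullet> (\<phi> - Bop \<omega> N b \<phi>))) \<longlongrightarrow> b * (\<phi> \<bullet> (\<phi> - R b \<phi>))) G"
        "((\<lambda>N. Hop \<omega> \<phi> \<bullet> (\<phi> - Bop \<omega> N b \<phi>)) \<longlongrightarrow> Hop \<omega> \<phi> \<bullet> (\<phi> - R b \<phi>)) G"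
        unfolding inner_diff_right by (intro tendsto_intros sl lim)+
      have nq: "\<phi> \<bullet> (\<phi> - Bop \<omega> N b \<phi>) = (norm (\<phi> - Bop \<omega> N b \<phi>))\<^sup>2" for N
        using B(5)[where \<phi> = \<phi> and N = N and a = b] by (simp add: power2_norm_eq_inner inner_diff_left inner_diff_right B(2))
      show "\<forall>\<^sub>F N in G. (b + slack N) * (\<phi> \<bullet> (\<phi> - Bop \<omega> N b \<phi>)) \<le> Hop \<omega> \<phi> \<bullet> (\<phi> - Bop \<omega> N b \<phi>)"
        using ev by eventually_elim (simp add: nq Bop_energy(3))
    qed
  qed
  have up: "Hop \<omega> \<phi> \<bullet> R b \<phi> \<le> b * (\<phi> \<bullet> R b \<phi>)" and lo: "b * (\<phi> \<bullet> (\<phi> - R b \<phi>)) \<le> Hop \<omega> \<phi> \<bullet> (\<phi> - R b \<phi>)"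
    if "\<phi> \<in> Hdom \<omega>" for b \<phi>
  proof -
    note c = cutoff_tendsto[of \<phi>] and g = Hop_graph_dense[OF that]
    show "Hop \<omega> \<phi> \<bullet> R b \<phi> \<le> b * (\<phi> \<bullet> R b \<phi>)"
    proof (rule tendsto_le[OF Hn])
      show "((\<lambda>F. b * (cutoff F \<phi> \<bullet> R b (cutoff F \<phi>))) \<longlongrightarrow> b * (\<phi> \<bullet> R b \<phi>)) ?H"
        "((\<lambda>F. Hop \<omega> (cutoff F \<phi>) \<bullet> R b (cutoff F \<phi>)) \<longlongrightarrow> Hop \<omega> \<phi> \<bullet> R b \<phi>) ?H"
        by (intro tendsto_intros Rcont c g)+
      show "\<forall>\<^sub>F F in ?H. Hop \<omega> (cutoff F \<phi>) \<bullet> R b (cutoff F \<phi>) \<le> b * (cutoff F \<phi> \<bullet> R b (cutoff F \<phi>))"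
        using evfs[of \<phi>] by eventually_elim (rule up_fs)
    qed
    show "b * (\<phi> \<bullet> (\<phi> - R b \<phi>)) \<le> Hop \<omega> \<phi> \<bullet> (\<phi> - R b \<phi>)"
    proof (rule tendsto_le[OF Hn])
      show "((\<lambda>F. b * (cutoff F \<phi> \<bullet> (cutoff F \<phi> - R b (cutoff F \<phi>)))) \<longlongrightarrow> b * (\<phi> \<bullet> (\<phi> - R b \<phi>))) ?H"
        "((\<lambda>F. Hop \<omega> (cutoff F \<phi>) \<bullet> (cutoff F \<phi> - R b (cutoff F \<phi>))) \<longlongrightarrow> Hop \<omega> \<phi> \<bullet> (\<phi> - R b \<phi>)) ?H"
        by (intro tendsto_intros Rcont c g)+
      show "\<forall>\<^sub>F F in ?H. b * (cutoff F \<phi> \<bullet> (cutoff F \<phi> - R b (cutoff F \<phi>))) \<le> Hop \<omega> (cutoff F \<phi>) \<bullet> (cutoff F \<phi> - R b (cutoff F \<phi>))"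
        using evfs[of \<phi>] by eventually_elim (rule lo_fs)
    qed
  qed
  have "pfam UNIV (Hdom \<omega>) (Hop \<omega>) R"
    unfolding pfam_def
  proof (intro conjI ballI allI impI roi)
    fix \<phi> x assume d: "\<phi> \<in> Hdom \<omega>"
    show "R x \<phi> \<in> Hdom \<omega>" "Hop \<omega> (R x \<phi>) = R x (Hop \<omega> \<phi>)" by (fact RD[OF d] RT[OF d])+
    show "\<phi> \<bullet> Hop \<omega> \<phi> \<le> x * (norm \<phi>)\<^sup>2" if "R x \<phi> = \<phi>"
      using up[OF d, of x] that by (simp add: inner_commute power2_norm_eq_inner)
    show "x * (norm \<phi>)\<^sup>2 \<le> \<phi> \<bullet> Hop \<omega> \<phi>" if "R x \<phi> = 0"
      using lo[OF d, of x] that by (simp add: inner_commute power2_norm_eq_inner)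
  qed
  then show ?thesis by (rule that)
qed

subsection \<open>The density of states\<close>

text \<open>The diagonal matrix element at the origin, finite volume counterpart of
  \<open>dos\<close>; it is used for \<Lambda> containing 0.\<close>

definition pfin :: "(int ^ 'd) set \<Rightarrow> (int ^ 'd \<Rightarrow> real) \<Rightarrow> real \<Rightarrow> real" where
  "pfin \<Lambda> \<omega> x = (norm (Qf \<Lambda> \<omega> x (dl 0)))\<^sup>2"

definition dos :: "(int ^ 'd \<Rightarrow> real) \<Rightarrow> real \<Rightarrow> real" where
  "dos \<omega> x = Re (ell2_inner (delta 0)
     (spectral_projection_atMost UNIV (hamiltonian_domain \<omega>) (hamiltonian \<omega>) x (delta 0)))"

lemma ids_eq_dos: "ids P x = (\<integral>\<omega>. dos \<omega> x \<partial>P)"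
  by (simp add: ids_def dos_def)

lemma dos_spectral:
  fixes \<omega> :: "int ^ 'd \<Rightarrow> real"
  obtains Q where "pfam UNIV (Hdom \<omega>) (Hop \<omega>) Q" "\<And>x. dos \<omega> x = (norm (Q x (dl 0)))\<^sup>2"
proof -
  interpret sym_op UNIV "Hdom \<omega>" "Hop \<omega>" by (rule sym_op_Hop)
  obtain Q0 where Q0: "pfam UNIV (Hdom \<omega>) (Hop \<omega>) Q0" by (rule Hop_pfam_exists)
  obtain Q where Q: "pfam UNIV (Hdom \<omega>) (Hop \<omega>) Q"
    "\<And>x \<phi>. \<phi> \<in> lsp UNIV \<Longrightarrow> spectral_projection_atMost UNIV (l2_fun ` Hdom \<omega>) (hamiltonian \<omega>) x (l2_fun \<phi>) = l2_fun (Q x \<phi>)"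
    using spectral_projection_atMost_pfam[OF hamiltonian_eq_Hop Q0] by blast
  have "dos \<omega> x = (norm (Q x (dl 0)))\<^sup>2" for x
  proof -
    have "dos \<omega> x = dl 0 \<bullet> Q x (dl 0)"
      unfolding dos_def hamiltonian_domain_eq l2_fun_dl[symmetric] by (subst Q(2)) (simp_all add: ell2_inner_eq)
    then show ?thesis using roi_inner[OF pfam_roi[OF Q(1)], of "dl 0" x] by simp
  qed
  then show ?thesis using Q(1) that by blast
qed

lemma norm_projection_bounds:
  assumes "roi S Q" "\<phi> \<in> lsp S" "norm \<phi> = 1"
  shows "0 \<le> (norm (Q x \<phi>))\<^sup>2" "(norm (Q x \<phi>))\<^sup>2 \<le> 1" "x \<le> y \<Longrightarrow> (norm (Q x \<phi>))\<^sup>2 \<le> (norm (Q y \<phi>))\<^sup>2"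
    "continuous (at_right x) (\<lambda>x. (norm (Q x \<phi>))\<^sup>2)" "((\<lambda>x. (norm (Q x \<phi>))\<^sup>2) \<longlongrightarrow> 1) at_top"
    "(norm (\<phi> - Q x \<phi>))\<^sup>2 = 1 - (norm (Q x \<phi>))\<^sup>2"
proof -
  show "0 \<le> (norm (Q x \<phi>))\<^sup>2" by simp
  show "(norm (Q x \<phi>))\<^sup>2 \<le> 1"
    using oproj_norm(2)[OF roi_oproj[OF assms(1)] assms(2), of x] assms(3) by (simp add: power_le_one)
  show "x \<le> y \<Longrightarrow> (norm (Q x \<phi>))\<^sup>2 \<le> (norm (Q y \<phi>))\<^sup>2"
    using roi_mono[OF assms(1,2)] by (simp add: roi_inner[OF assms(1,2)])
  show "continuous (at_right x) (\<lambda>x. (norm (Q x \<phi>))\<^sup>2)"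
    unfolding continuous_within by (intro tendsto_intros roi_tendsto(1)[OF assms(1,2)])
  have "((\<lambda>x. (norm (Q x \<phi>))\<^sup>2) \<longlongrightarrow> (norm \<phi>)\<^sup>2) at_top"
    by (intro tendsto_intros roi_tendsto(3)[OF assms(1,2)])
  then show "((\<lambda>x. (norm (Q x \<phi>))\<^sup>2) \<longlongrightarrow> 1) at_top" by (simp add: assms(3))
  show "(norm (\<phi> - Q x \<phi>))\<^sup>2 = 1 - (norm (Q x \<phi>))\<^sup>2"
    using oproj_norm(1)[OF roi_oproj[OF assms(1)] assms(2), of x] assms(3) by simp
qed

lemma dos_props:
  shows "0 \<le> dos \<omega> x" "dos \<omega> x \<le> 1" "x \<le> y \<Longrightarrow> dos \<omega> x \<le> dos \<omega> y" "continuous (at_right x) (dos \<omega>)"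
proof -
  obtain Q where Q: "pfam UNIV (Hdom \<omega>) (Hop \<omega>) Q" "\<And>x. dos \<omega> x = (norm (Q x (dl 0)))\<^sup>2"
    by (rule dos_spectral[of \<omega>]) blast
  have r: "roi UNIV Q" using Q(1) by (simp add: pfam_def)
  have "dos \<omega> = (\<lambda>x. (norm (Q x (dl 0)))\<^sup>2)" using Q(2) by blast
  then show "0 \<le> dos \<omega> x" "dos \<omega> x \<le> 1" "x \<le> y \<Longrightarrow> dos \<omega> x \<le> dos \<omega> y" "continuous (at_right x) (dos \<omega>)"
    using norm_projection_bounds[OF r, of "dl 0"] by simp_all
qed

lemma square_le_add:
  fixes u v e :: real
  assumes "u \<le> v + e" "0 \<le> u" "0 \<le> v" "v \<le> 1" "0 \<le> e"
  shows "u\<^sup>2 \<le> v\<^sup>2 + (2 * e + e\<^sup>2)"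
proof -
  have "u\<^sup>2 \<le> (v + e)\<^sup>2" using assms by (intro power_mono) auto
  also have "\<dots> = v\<^sup>2 + 2 * e * v + e\<^sup>2" by (simp add: power2_eq_square algebra_simps)
  also have "2 * e * v \<le> 2 * e * 1" using assms by (intro mult_left_mono) auto
  finally show ?thesis by simp
qed

text \<open>The tent fixes \<open>dl 0\<close>. Splitting \<open>dl 0\<close> by the infinite volume
  projection and applying \<open>transfer_bounds\<close> to one part compares the norms of the
  projected vectors up to \<epsilon>; squaring numbers at most 1 turns this into 2 \<epsilon> +
  \<epsilon>^2. The second bound compares the complements.\<close>

lemma dos_compare:
  fixes \<omega> :: "int ^ 'd \<Rightarrow> real"
  assumes fin: "finite \<Lambda>" and sub: "l1_ball N \<subseteq> \<Lambda>" "N \<ge> 1" and ab: "a < b"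
  defines "\<epsilon> \<equiv> real (card (nb :: (int ^ 'd) set)) * (1 / real N) / (b - a)"
  shows "pfin \<Lambda> \<omega> a \<le> dos \<omega> b + (2 * \<epsilon> + \<epsilon>\<^sup>2)" "dos \<omega> a \<le> pfin \<Lambda> \<omega> b + (2 * \<epsilon> + \<epsilon>\<^sup>2)"
proof -
  obtain Q where Q: "pfam UNIV (Hdom \<omega>) (Hop \<omega>) Q" "\<And>x. dos \<omega> x = (norm (Q x (dl 0)))\<^sup>2"
    by (rule dos_spectral[of \<omega>]) blast
  have r: "roi UNIV Q" using Q(1) by (simp add: pfam_def)
  note rf = Qf_roi[OF fin, of \<omega>]
  let ?m = "mulop (eta N) :: (int ^ 'd) l2 \<Rightarrow> _" and ?d = "dl 0 :: (int ^ 'd) l2"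
  note e = eta_props[OF sub(2)]
  have supp: "eta N z = 0" if "z \<notin> \<Lambda>" for z using e(2)[of z] that sub by auto
  have ml: "?m v \<in> lsp \<Lambda>" for v using supp by (auto simp: lsp_def l2_fun_mulop_bounded[OF e(1)])
  have md: "?m ?d = ?d" by (rule l2_eqI) (auto simp: l2_fun_mulop_bounded[OF e(1)] e(4))
  have dL: "?d \<in> lsp \<Lambda>" using ml[of ?d] md by simp
  have \<epsilon>: "0 \<le> \<epsilon>" using ab by (simp add: \<epsilon>_def)
  note tb = transfer_bounds[OF sym_op_Hop Q(1) fin supp e(1) lsp_Hdom[OF fin ml]
      Hop_commutator[OF fin supp e(1) e(3)] ab, of ?d, folded \<epsilon>_def, simplified]
  have t1: "norm (Qf \<Lambda> \<omega> a (?m (?d - Q b ?d))) \<le> \<epsilon>"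
    using tb(1) by simp
  have t2: "norm (?m (Q a ?d) - Qf \<Lambda> \<omega> b (?m (Q a ?d))) \<le> \<epsilon>"
    using tb(2) by simp
  note Qlin = roi_linear(1,2)[OF rf]
  note mlin = mulop_linear(1,2)[of "eta N", OF e(1)]
  have le1: "norm (Q x ?d) \<le> 1" "norm (?d - Q x ?d) \<le> 1" for x
    using oproj_norm(2,3)[OF roi_oproj[OF r], of ?d x] by auto
  have "Qf \<Lambda> \<omega> a ?d = Qf \<Lambda> \<omega> a (?m (?d - Q b ?d)) + Qf \<Lambda> \<omega> a (?m (Q b ?d))"
    using md by (simp add: Qlin(1)[OF ml ml, symmetric] mlin(1)[symmetric])
  also have "norm \<dots> \<le> \<epsilon> + norm (Q b ?d)"
  proof (rule order_trans[OF norm_triangle_ineq add_mono[OF t1]])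
    have "norm (Qf \<Lambda> \<omega> a (?m (Q b ?d))) \<le> norm (?m (Q b ?d))" by (rule oproj_norm(2)[OF roi_oproj[OF rf] ml])
    also have "\<dots> \<le> norm (Q b ?d)" by (rule norm_mulop_le1[OF e(1)])
    finally show "norm (Qf \<Lambda> \<omega> a (?m (Q b ?d))) \<le> norm (Q b ?d)" .
  qed
  finally have "norm (Qf \<Lambda> \<omega> a ?d) \<le> norm (Q b ?d) + \<epsilon>" by simp
  then show "pfin \<Lambda> \<omega> a \<le> dos \<omega> b + (2 * \<epsilon> + \<epsilon>\<^sup>2)"
    unfolding pfin_def Q(2) by (rule square_le_add) (use le1 \<epsilon> in auto)
  let ?v = "?m (?d - Q a ?d)" and ?w = "?m (Q a ?d)"
  have "?d = ?v + ?w" using md mlin(2)[where \<phi> = ?d and \<psi> = "Q a ?d"] by simp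
  then have "?d - Qf \<Lambda> \<omega> b ?d = (?v - Qf \<Lambda> \<omega> b ?v) + (?w - Qf \<Lambda> \<omega> b ?w)"
    using Qlin(1)[OF ml[of "?d - Q a ?d"] ml[of "Q a ?d"], of b] by (metis add_diff_add)
  also have "norm \<dots> \<le> norm (?d - Q a ?d) + \<epsilon>"
  proof (rule order_trans[OF norm_triangle_ineq add_mono[OF _ t2]])
    have "norm (?v - Qf \<Lambda> \<omega> b ?v) \<le> norm ?v" by (rule oproj_norm(3)[OF roi_oproj[OF rf] ml])
    also have "\<dots> \<le> norm (?d - Q a ?d)" by (rule norm_mulop_le1[OF e(1)])
    finally show "norm (?v - Qf \<Lambda> \<omega> b ?v) \<le> norm (?d - Q a ?d)" .
  qed
  finally have "(norm (?d - Qf \<Lambda> \<omega> b ?d))\<^sup>2 \<le> (norm (?d - Q a ?d))\<^sup>2 + (2 * \<epsilon> + \<epsilon>\<^sup>2)"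
    by (rule square_le_add) (use le1 \<epsilon> in auto)
  then show "dos \<omega> a \<le> pfin \<Lambda> \<omega> b + (2 * \<epsilon> + \<epsilon>\<^sup>2)"
    unfolding norm_projection_bounds(6)[OF rf dL norm_dl] norm_projection_bounds(6)[OF r _ norm_dl, simplified]
    by (simp add: pfin_def Q(2))
qed

text \<open>The energy gap \<open>slack N\<close> lets the comparison error vanish, and
  right-continuity of \<open>dos\<close> closes the interval between x and x + 2 slack N.
  Measurability of \<open>dos\<close> rests on this limit.\<close>

lemma pfin_tendsto_dos:
  fixes \<omega> :: "int ^ 'd \<Rightarrow> real"
  shows "(\<lambda>N. pfin (l1_ball (Suc N)) \<omega> (x + slack N)) \<longlonglongrightarrow> dos \<omega> x"
proof -
  define \<epsilon> where "\<epsilon> N = real (card (nb :: (int ^ 'd) set)) * (1 / real (Suc N)) / slack N" for N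
  have "\<epsilon> \<longlonglongrightarrow> 0"
    using tendsto_mult_left[OF slack_props(4), of "real (card (nb :: (int ^ 'd) set))"] by (simp add: \<epsilon>_def[abs_def])
  then have "(\<lambda>N. 2 * \<epsilon> N + (\<epsilon> N)\<^sup>2) \<longlonglongrightarrow> 2 * 0 + 0\<^sup>2" by (intro tendsto_intros)
  then have e: "(\<lambda>N. 2 * \<epsilon> N + (\<epsilon> N)\<^sup>2) \<longlonglongrightarrow> 0" by simp
  have "filterlim (\<lambda>N. x + 2 * slack N) (at_right x) sequentially"
  proof (rule tendsto_imp_filterlim_at_right)
    have "(\<lambda>N. x + 2 * slack N) \<longlonglongrightarrow> x + 2 * 0" by (intro tendsto_intros slack_props(2))
    then show "(\<lambda>N. x + 2 * slack N) \<longlonglongrightarrow> x" by simp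
  qed (simp add: slack_props(1))
  moreover have "(dos \<omega> \<longlongrightarrow> dos \<omega> x) (at_right x)" using dos_props(4)[of x \<omega>] by (simp add: continuous_within)
  ultimately have d: "(\<lambda>N. dos \<omega> (x + 2 * slack N)) \<longlonglongrightarrow> dos \<omega> x" by (rule filterlim_compose[rotated])
  have ub: "pfin (l1_ball (Suc N)) \<omega> (x + slack N) \<le> dos \<omega> (x + 2 * slack N) + (2 * \<epsilon> N + (\<epsilon> N)\<^sup>2)" for N
    using dos_compare(1)[of "l1_ball (Suc N)" "Suc N" "x + slack N" "x + 2 * slack N" \<omega>] slack_props(1)[of N]
    by (simp add: \<epsilon>_def)
  have lb: "dos \<omega> x - (2 * \<epsilon> N + (\<epsilon> N)\<^sup>2) \<le> pfin (l1_ball (Suc N)) \<omega> (x + slack N)" for N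
    using dos_compare(2)[of "l1_ball (Suc N)" "Suc N" "x" "x + slack N" \<omega>] slack_props(1)[of N]
    by (simp add: \<epsilon>_def)
  show ?thesis
  proof (rule tendsto_sandwich)
    show "(\<lambda>N. dos \<omega> x - (2 * \<epsilon> N + (\<epsilon> N)\<^sup>2)) \<longlonglongrightarrow> dos \<omega> x" using tendsto_diff[OF tendsto_const e] by simp
    show "(\<lambda>N. dos \<omega> (x + 2 * slack N) + (2 * \<epsilon> N + (\<epsilon> N)\<^sup>2)) \<longlonglongrightarrow> dos \<omega> x" using tendsto_add[OF d e] by simp
  qed (use ub lb in auto)
qed

text \<open>As \<open>\<omega>'\<close> tends to \<open>\<omega>\<close> this becomes upper semicontinuity, whence measurability in
  the configuration.\<close>

lemma Qf_perturb:
  assumes fin: "finite \<Lambda>" and d: "\<And>z. z \<in> \<Lambda> \<Longrightarrow> \<bar>\<omega>' z - \<omega> z\<bar> \<le> \<delta>" "0 \<le> \<delta>" and ab: "a < b" and \<phi>: "\<phi> \<in> lsp \<Lambda>"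
  shows "norm (Qf \<Lambda> \<omega> a \<phi>) \<le> norm (Qf \<Lambda> \<omega>' b \<phi>) + \<delta> / (b - a) * norm \<phi>"
proof -
  have bd: "\<bar>indicator \<Lambda> z :: real\<bar> \<le> 1" for z by (simp add: indicator_def)
  have c: "mulop (indicator \<Lambda>) v = v" if "v \<in> lsp \<Lambda>" for v using cutoff_lsp[OF that] .
  note rf = Qf_roi[OF fin]
  have \<kappa>: "norm (Hloc \<Lambda> \<omega>' (cutoff \<Lambda> v) - cutoff \<Lambda> (Hloc \<Lambda> \<omega> v)) \<le> \<delta> * norm v" if v: "v \<in> lsp \<Lambda>" for v
  proof -
    define g where "g z = (if z \<in> \<Lambda> then \<omega>' z - \<omega> z else 0)" for z
    have g: "\<bar>g z\<bar> \<le> \<delta>" for z using d by (auto simp: g_def)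
    have "Hloc \<Lambda> \<omega>' (cutoff \<Lambda> v) - cutoff \<Lambda> (Hloc \<Lambda> \<omega> v) = mulop g v"
      unfolding cutoff_lsp[OF v] using v
      by (intro l2_eqI) (simp add: Hloc_eq_cutoff[OF fin v] Hop_def l2_fun_mulop_Hdom lsp_Hdom[OF fin]
            l2_fun_mulop_bounded[OF g] g_def algebra_simps)
    then show ?thesis using norm_mulop_le[of g \<delta> v] g by simp
  qed
  have "norm (Qf \<Lambda> \<omega> a (cutoff \<Lambda> (\<phi> - Qf \<Lambda> \<omega>' b \<phi>))) \<le> \<delta> / (b - a) * norm \<phi>"
    by (rule transfer_bounds(1)[OF sym_op_Hloc[OF fin] Qf_pfam[OF fin] fin _ bd _ \<kappa> ab d(2) \<phi>]) auto
  moreover have "cutoff \<Lambda> (\<phi> - Qf \<Lambda> \<omega>' b \<phi>) = \<phi> - Qf \<Lambda> \<omega>' b \<phi>"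
    by (rule cutoff_lsp) (use \<phi> roi_lsp[OF rf \<phi>] in blast)
  moreover have "Qf \<Lambda> \<omega> a (\<phi> - Qf \<Lambda> \<omega>' b \<phi>) = Qf \<Lambda> \<omega> a \<phi> - Qf \<Lambda> \<omega> a (Qf \<Lambda> \<omega>' b \<phi>)"
    by (rule roi_linear(2)[OF rf \<phi> roi_lsp[OF rf \<phi>]])
  moreover have "norm (Qf \<Lambda> \<omega> a (Qf \<Lambda> \<omega>' b \<phi>)) \<le> norm (Qf \<Lambda> \<omega>' b \<phi>)"
    by (rule oproj_norm(2)[OF roi_oproj[OF rf] roi_lsp[OF rf \<phi>]])
  ultimately show ?thesis
    using norm_triangle_sub[of "Qf \<Lambda> \<omega> a \<phi>" "Qf \<Lambda> \<omega> a (Qf \<Lambda> \<omega>' b \<phi>)"] by simp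
qed

text \<open>Strict sublevel sets are open: right-continuity in the energy leaves room to raise x to
  some b > x, and \<open>Qf_perturb\<close> spends this room on changing \<omega> at the finitely
  many sites of \<Lambda>.\<close>

lemma Qf_measurable:
  assumes fin: "finite \<Lambda>" and \<phi>: "\<phi> \<in> lsp \<Lambda>"
  shows "(\<lambda>\<omega>. norm (Qf \<Lambda> \<omega> x \<phi>)) \<in> borel_measurable borel"
proof (rule borel_measurableI_less)
  fix c
  have "open {\<omega>. norm (Qf \<Lambda> \<omega> x \<phi>) < c}"
    unfolding open_subopen[of "{\<omega>. norm (Qf \<Lambda> \<omega> x \<phi>) < c}"]
  proof clarify
    fix \<omega>' assume "norm (Qf \<Lambda> \<omega>' x \<phi>) < c"
    moreover have "((\<lambda>b. norm (Qf \<Lambda> \<omega>' b \<phi>)) \<longlongrightarrow> norm (Qf \<Lambda> \<omega>' x \<phi>)) (at_right x)"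
      by (intro tendsto_intros roi_tendsto(1)[OF Qf_roi[OF fin] \<phi>])
    ultimately have "\<forall>\<^sub>F b in at_right x. norm (Qf \<Lambda> \<omega>' b \<phi>) < c" by (rule order_tendstoD(2)[rotated])
    then have "\<forall>\<^sub>F b in at_right x. norm (Qf \<Lambda> \<omega>' b \<phi>) < c \<and> x < b"
      using eventually_at_right_less by (rule eventually_conj)
    then obtain b where b: "norm (Qf \<Lambda> \<omega>' b \<phi>) < c" "x < b"
      using eventually_happens'[OF trivial_limit_at_right_real] by blast
    \<comment> \<open>The perturbation error becomes less than half of the distance left below c;
      the summand 2 avoids division by 0.\<close>
    define \<delta> where "\<delta> = (b - x) * (c - norm (Qf \<Lambda> \<omega>' b \<phi>)) / (2 * norm \<phi> + 2)"
    have \<delta>: "0 < \<delta>" unfolding \<delta>_def using b by (intro divide_pos_pos mult_pos_pos) (auto intro: add_nonneg_pos)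
    have small: "\<delta> / (b - x) * norm \<phi> < c - norm (Qf \<Lambda> \<omega>' b \<phi>)"
    proof -
      have "\<delta> / (b - x) * norm \<phi> = (c - norm (Qf \<Lambda> \<omega>' b \<phi>)) * (norm \<phi> / (2 * norm \<phi> + 2))"
        using b by (simp add: \<delta>_def)
      also have "\<dots> < (c - norm (Qf \<Lambda> \<omega>' b \<phi>)) * 1"
      proof (rule mult_strict_left_mono)
        have n: "0 \<le> norm \<phi>" by simp
        have "0 < 2 * norm \<phi> + 2" using n by linarith
        moreover have "norm \<phi> < 2 * norm \<phi> + 2" using n by linarith
        ultimately show "norm \<phi> / (2 * norm \<phi> + 2) < 1" by (simp only: pos_divide_less_eq mult_1)
      qed (use b in simp)
      finally show ?thesis by simp
    qed
    define U where "U = (\<Inter>z\<in>\<Lambda>. {\<omega> :: int ^ 'a \<Rightarrow> real. \<bar>\<omega>' z - \<omega> z\<bar> < \<delta>})"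
    have "open U"
      unfolding U_def using fin
      by (intro open_INT ballI open_Collect_less continuous_intros continuous_on_product_coordinates)
    moreover have "\<omega>' \<in> U" using \<delta> by (simp add: U_def)
    moreover have "U \<subseteq> {\<omega>. norm (Qf \<Lambda> \<omega> x \<phi>) < c}"
    proof
      fix \<omega> assume "\<omega> \<in> U"
      then have "norm (Qf \<Lambda> \<omega> x \<phi>) \<le> norm (Qf \<Lambda> \<omega>' b \<phi>) + \<delta> / (b - x) * norm \<phi>"
        using \<delta> by (intro Qf_perturb[OF fin _ _ b(2) \<phi>]) (auto simp: U_def intro: less_imp_le)
      then show "\<omega> \<in> {\<omega>. norm (Qf \<Lambda> \<omega> x \<phi>) < c}" using small by simp
    qed
    ultimately show "\<exists>T. open T \<and> \<omega>' \<in> T \<and> T \<subseteq> {\<omega>. norm (Qf \<Lambda> \<omega> x \<phi>) < c}" by blast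
  qed
  then show "{\<omega> \<in> space borel. norm (Qf \<Lambda> \<omega> x \<phi>) < c} \<in> sets borel" by simp
qed

lemma eigenvalue_count_measurable:
  assumes "finite \<Lambda>"
  shows "(\<lambda>\<omega>. eigenvalue_count \<Lambda> \<omega> x) \<in> borel_measurable borel"
  unfolding eigenvalue_count_trace[OF assms]
  by (intro borel_measurable_sum borel_measurable_power Qf_measurable assms) auto

lemma pfin_measurable: "finite \<Lambda> \<Longrightarrow> 0 \<in> \<Lambda> \<Longrightarrow> (\<lambda>\<omega>. pfin \<Lambda> \<omega> x) \<in> borel_measurable borel"
  unfolding pfin_def by (intro borel_measurable_power Qf_measurable) auto

lemma dos_measurable: "(\<lambda>\<omega>. dos \<omega> x) \<in> borel_measurable borel"
  by (rule borel_measurable_LIMSEQ_real[OF pfin_tendsto_dos pfin_measurable[OF finite_l1_ball]])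
     (simp add: l1_ball_def)

section \<open>Elementary properties of the counting function\<close>

lemma eigenvalue_count_props:
  assumes fin: "finite \<Lambda>"
  shows "0 \<le> eigenvalue_count \<Lambda> \<omega> x" "eigenvalue_count \<Lambda> \<omega> x \<le> real (card \<Lambda>)"
    "x \<le> y \<Longrightarrow> eigenvalue_count \<Lambda> \<omega> x \<le> eigenvalue_count \<Lambda> \<omega> y"
    "continuous (at_right x) (eigenvalue_count \<Lambda> \<omega>)" "(eigenvalue_count \<Lambda> \<omega> \<longlongrightarrow> real (card \<Lambda>)) at_top"
proof -
  note b = norm_projection_bounds[OF Qf_roi[OF fin, of \<omega>] lsp_closed(9) norm_dl]
  have eq: "eigenvalue_count \<Lambda> \<omega> = (\<lambda>x. \<Sum>z\<in>\<Lambda>. (norm (Qf \<Lambda> \<omega> x (dl z)))\<^sup>2)"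
    by (rule ext) (rule eigenvalue_count_trace[OF fin])
  show "0 \<le> eigenvalue_count \<Lambda> \<omega> x" unfolding eq by (intro sum_nonneg) simp
  have "(\<Sum>z\<in>\<Lambda>. (norm (Qf \<Lambda> \<omega> x (dl z)))\<^sup>2) \<le> (\<Sum>z\<in>\<Lambda>. 1)" by (intro sum_mono b)
  then show "eigenvalue_count \<Lambda> \<omega> x \<le> real (card \<Lambda>)" by (simp add: eq)
  show "x \<le> y \<Longrightarrow> eigenvalue_count \<Lambda> \<omega> x \<le> eigenvalue_count \<Lambda> \<omega> y" unfolding eq by (intro sum_mono b)
  have "((\<lambda>x. \<Sum>z\<in>\<Lambda>. (norm (Qf \<Lambda> \<omega> x (dl z)))\<^sup>2) \<longlongrightarrow> (\<Sum>z\<in>\<Lambda>. (norm (Qf \<Lambda> \<omega> x (dl z)))\<^sup>2)) (at_right x)"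
    by (intro tendsto_intros roi_tendsto(1)[OF Qf_roi[OF fin]] lsp_closed)
  then show "continuous (at_right x) (eigenvalue_count \<Lambda> \<omega>)" by (simp add: eq continuous_within)
  have "((\<lambda>x. \<Sum>z\<in>\<Lambda>. (norm (Qf \<Lambda> \<omega> x (dl z)))\<^sup>2) \<longlongrightarrow> (\<Sum>z\<in>\<Lambda>. 1)) at_top" by (intro tendsto_sum b(5))
  then show "(eigenvalue_count \<Lambda> \<omega> \<longlongrightarrow> real (card \<Lambda>)) at_top" by (simp add: eq)
qed

lemma Hloc_local: "(\<And>z. z \<in> \<Lambda> \<Longrightarrow> \<omega> z = \<omega>' z) \<Longrightarrow> Hloc \<Lambda> \<omega> = Hloc \<Lambda> \<omega>'"
  unfolding Hloc_def by (intro ext arg_cong[where f = "cutoff \<Lambda>"]) (simp cong: if_cong)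

lemma Qf_local: "(\<And>z. z \<in> \<Lambda> \<Longrightarrow> \<omega> z = \<omega>' z) \<Longrightarrow> Qf \<Lambda> \<omega> = Qf \<Lambda> \<omega>'"
  using Hloc_local[of \<Lambda> \<omega> \<omega>'] by (simp add: ebasis_def)

lemma eigenvalue_count_local:
  "finite \<Lambda> \<Longrightarrow> (\<And>z. z \<in> \<Lambda> \<Longrightarrow> \<omega> z = \<omega>' z) \<Longrightarrow> eigenvalue_count \<Lambda> \<omega> = eigenvalue_count \<Lambda> \<omega>'"
  using Qf_local[of \<Lambda> \<omega> \<omega>'] by (intro ext) (simp add: eigenvalue_count_trace)

text \<open>A larger potential enlarges the quadratic form on every vector, so
  \<open>cnt_compare\<close> applies with the empty set of constraints.\<close>

lemma eigenvalue_count_antimono: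
  assumes fin: "finite \<Lambda>" and le: "\<And>z. z \<in> \<Lambda> \<Longrightarrow> \<omega> z \<le> \<omega>' z"
  shows "eigenvalue_count \<Lambda> \<omega>' x \<le> eigenvalue_count \<Lambda> \<omega> x"
proof -
  have "cnt (Hloc \<Lambda> \<omega>') (ebasis \<Lambda> \<omega>') x \<le> cnt (Hloc \<Lambda> \<omega>) (ebasis \<Lambda> \<omega>) x + card ({} :: (int ^ 'a) l2 set)"
  proof (rule cnt_compare[OF ebasis[OF fin] Hloc_lin_on[OF fin] ebasis[OF fin] Hloc_lin_on[OF fin]])
    fix w :: "(int ^ 'a) l2" assume w: "w \<in> lsp \<Lambda>"
    have "w \<bullet> Hloc \<Lambda> \<omega>' w - w \<bullet> Hloc \<Lambda> \<omega> w = w \<bullet> (Hloc \<Lambda> \<omega>' w - Hloc \<Lambda> \<omega> w)" by (simp add: inner_diff_right)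
    also have "\<dots> = (\<Sum>\<^sub>\<infinity>z. (if z \<in> \<Lambda> then \<omega>' z - \<omega> z else 0) * (cmod (l2_fun w z))\<^sup>2)"
      unfolding inner_l2_eq
    proof (rule infsum_cong)
      fix z
      have "l2_fun (Hloc \<Lambda> \<omega>' w - Hloc \<Lambda> \<omega> w) z = of_real (if z \<in> \<Lambda> then \<omega>' z - \<omega> z else 0) * l2_fun w z"
        by (simp add: Hloc_eq_cutoff[OF fin w] Hop_def l2_fun_mulop_Hdom lsp_Hdom[OF fin w] algebra_simps)
      then have "cnj (l2_fun w z) * l2_fun (Hloc \<Lambda> \<omega>' w - Hloc \<Lambda> \<omega> w) z =
          of_real (if z \<in> \<Lambda> then \<omega>' z - \<omega> z else 0) * (l2_fun w z * cnj (l2_fun w z))" by (simp only: mult_ac)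
      also have "\<dots> = of_real ((if z \<in> \<Lambda> then \<omega>' z - \<omega> z else 0) * (cmod (l2_fun w z))\<^sup>2)"
        unfolding complex_norm_square[symmetric] by simp
      finally show "Re (cnj (l2_fun w z) * l2_fun (Hloc \<Lambda> \<omega>' w - Hloc \<Lambda> \<omega> w) z) =
          (if z \<in> \<Lambda> then \<omega>' z - \<omega> z else 0) * (cmod (l2_fun w z))\<^sup>2" by (simp only: Re_complex_of_real)
    qed
    also have "\<dots> \<ge> 0" by (rule infsum_nonneg) (auto simp: le)
    finally show "w \<bullet> Hloc \<Lambda> \<omega> w \<le> w \<bullet> Hloc \<Lambda> \<omega>' w" by simp
  qed simp
  then show ?thesis by (simp add: eigenvalue_count_cnt[OF fin ebasis[OF fin]])
qed

subsection \<open>Almost additivity\<close>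

lemma mem_translate: "x \<in> translate \<Lambda> z \<longleftrightarrow> x - z \<in> \<Lambda>"
proof
  assume "x - z \<in> \<Lambda>"
  then have "(x - z) + z \<in> translate \<Lambda> z" unfolding translate_def by (rule imageI)
  then show "x \<in> translate \<Lambda> z" by simp
qed (auto simp: translate_def)

lemma card_translate [simp]: "card (translate \<Lambda> z) = card \<Lambda>"
  unfolding translate_def by (rule card_image) (simp add: inj_on_def)

lemma finite_translate [simp]: "finite \<Lambda> \<Longrightarrow> finite (translate \<Lambda> z)"
  by (simp add: translate_def)

lemma translate_translate [simp]: "translate (translate \<Lambda> z) u = translate \<Lambda> (z + u)" "translate \<Lambda> 0 = \<Lambda>"
  by (auto simp: mem_translate diff_diff_eq add.commute)

lemma lsp_shiftop: "\<phi> \<in> lsp (translate \<Lambda> z) \<Longrightarrow> shiftop z \<phi> \<in> lsp \<Lambda>"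
  by (auto simp: lsp_def mem_translate)

lemma inj_shiftop: "inj_on (shiftop z) E"
  by (rule inj_on_inverseI[where g = "shiftop (- z)"]) simp

lemma Hloc_shiftop:
  assumes fin: "finite \<Lambda>" and \<phi>: "\<phi> \<in> lsp (translate \<Lambda> z)"
  shows "Hloc \<Lambda> (shift z \<omega>) (shiftop z \<phi>) = shiftop z (Hloc (translate \<Lambda> z) \<omega> \<phi>)"
  by (rule l2_eqI)
     (simp add: Hloc_eq_cutoff[OF fin lsp_shiftop[OF \<phi>]] Hloc_eq_cutoff[OF finite_translate[OF fin] \<phi>] Hop_def
       l2_fun_mulop_Hdom lsp_Hdom[OF fin lsp_shiftop[OF \<phi>]] lsp_Hdom[OF finite_translate[OF fin] \<phi>]
       mem_translate shift_def lap_def ac_simps)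

lemma eigbasis_shiftop:
  assumes fin: "finite \<Lambda>" and E: "eigbasis (translate \<Lambda> z) (Hloc (translate \<Lambda> z) \<omega>) E"
  shows "eigbasis \<Lambda> (Hloc \<Lambda> (shift z \<omega>)) (shiftop z ` E)"
    "e \<in> E \<Longrightarrow> shiftop z e \<bullet> Hloc \<Lambda> (shift z \<omega>) (shiftop z e) = e \<bullet> Hloc (translate \<Lambda> z) \<omega> e"
proof -
  note D = eigbasisD[OF E]
  show form: "shiftop z e \<bullet> Hloc \<Lambda> (shift z \<omega>) (shiftop z e) = e \<bullet> Hloc (translate \<Lambda> z) \<omega> e" if "e \<in> E" for e
    using Hloc_shiftop[OF fin D(5)[OF that]] by simp
  show "eigbasis \<Lambda> (Hloc \<Lambda> (shift z \<omega>)) (shiftop z ` E)"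
    unfolding eigbasis_def
  proof (intro conjI ballI impI)
    show "finite (shiftop z ` E)" using D(1) by simp
    show "shiftop z ` E \<subseteq> lsp \<Lambda>" using D(5) lsp_shiftop by blast
    show "onset (shiftop z ` E)" using D(3) by (auto simp: onset_def)
    fix f assume "f \<in> shiftop z ` E"
    then obtain e where e: "e \<in> E" "f = shiftop z e" by blast
    have "Hloc \<Lambda> (shift z \<omega>) f = shiftop z ((e \<bullet> Hloc (translate \<Lambda> z) \<omega> e) *\<^sub>R e)"
      using Hloc_shiftop[OF fin D(5)[OF e(1)]] D(4)[OF e(1)] e(2) by simp
    then show "Hloc \<Lambda> (shift z \<omega>) f = (f \<bullet> Hloc \<Lambda> (shift z \<omega>) f) *\<^sub>R f"
      using form[OF e(1)] e(2) by simp
  next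
    fix \<phi> assume \<phi>: "\<phi> \<in> lsp \<Lambda>" "\<forall>f\<in>shiftop z ` E. f \<bullet> \<phi> = 0"
    have "shiftop (- z) \<phi> = 0"
    proof (rule D(6))
      show "shiftop (- z) \<phi> \<in> lsp (translate \<Lambda> z)" by (rule lsp_shiftop) (use \<phi> in simp)
      show "e \<bullet> shiftop (- z) \<phi> = 0" if "e \<in> E" for e using \<phi>(2) that by (simp add: shiftop_inner)
    qed
    then have "shiftop z (shiftop (- z) \<phi>) = shiftop z 0" by simp
    then show "\<phi> = 0" by (simp add: l2_eqI)
  qed
qed

text \<open>Shifting an eigenbasis gives an eigenbasis of the shifted operator with the same
  eigenvalues, and the count does not depend on the basis.\<close>

lemma eigenvalue_count_translate:
  assumes fin: "finite \<Lambda>"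
  shows "eigenvalue_count (translate \<Lambda> z) \<omega> x = eigenvalue_count \<Lambda> (shift z \<omega>) x"
proof -
  let ?H = "Hloc (translate \<Lambda> z) \<omega>" and ?E = "ebasis (translate \<Lambda> z) \<omega>"
  have E: "eigbasis (translate \<Lambda> z) ?H ?E" by (rule ebasis) (simp add: fin)
  note s = eigbasis_shiftop[OF fin E]
  have "{f \<in> shiftop z ` ?E. f \<bullet> Hloc \<Lambda> (shift z \<omega>) f \<le> x} = shiftop z ` {e \<in> ?E. e \<bullet> ?H e \<le> x}"
    using s(2) by auto
  then have "cnt (Hloc \<Lambda> (shift z \<omega>)) (shiftop z ` ?E) x = cnt ?H ?E x"
    unfolding cnt_def by (simp add: card_image[OF inj_shiftop])
  then show ?thesis
    unfolding eigenvalue_count_cnt[OF fin s(1)] eigenvalue_count_cnt[OF finite_translate[OF fin] E] by simp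
qed

lemma Qf_translate:
  assumes fin: "finite \<Lambda>" and \<phi>: "\<phi> \<in> lsp (translate \<Lambda> z)"
  shows "norm (Qf \<Lambda> (shift z \<omega>) x (shiftop z \<phi>)) = norm (Qf (translate \<Lambda> z) \<omega> x \<phi>)"
proof -
  let ?H = "Hloc (translate \<Lambda> z) \<omega>" and ?E = "ebasis (translate \<Lambda> z) \<omega>"
  have E: "eigbasis (translate \<Lambda> z) ?H ?E" by (rule ebasis) (simp add: fin)
  note s = eigbasis_shiftop[OF fin E]
  have eq: "{f \<in> shiftop z ` ?E. f \<bullet> Hloc \<Lambda> (shift z \<omega>) f \<le> x} = shiftop z ` {e \<in> ?E. e \<bullet> ?H e \<le> x}"
    using s(2) by auto
  have "Qf \<Lambda> (shift z \<omega>) x (shiftop z \<phi>) = (\<Sum>e | e \<in> ?E \<and> e \<bullet> ?H e \<le> x. (e \<bullet> \<phi>) *\<^sub>R shiftop z e)"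
    unfolding Qf_eq[OF fin s(1) lsp_shiftop[OF \<phi>]] unfolding eproj_def eq
    by (subst sum.reindex[OF inj_shiftop]) simp
  also have "\<dots> = shiftop z (Qf (translate \<Lambda> z) \<omega> x \<phi>)" by (rule l2_eqI) (simp add: eproj_def)
  finally show ?thesis by simp
qed

lemma eigenvalue_count_pfin:
  assumes fin: "finite \<Lambda>"
  shows "eigenvalue_count \<Lambda> \<omega> x = (\<Sum>z\<in>\<Lambda>. pfin (translate \<Lambda> (- z)) (shift z \<omega>) x)"
  unfolding eigenvalue_count_trace[OF fin]
proof (rule sum.cong[OF refl])
  fix z assume z: "z \<in> \<Lambda>"
  have "shiftop z (dl z) = dl 0" by (rule l2_eqI) auto
  then show "(norm (Qf \<Lambda> \<omega> x (dl z)))\<^sup>2 = pfin (translate \<Lambda> (- z)) (shift z \<omega>) x"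
    using Qf_translate[of "translate \<Lambda> (- z)" "dl z" z \<omega> x] fin z by (simp add: pfin_def lsp_closed)
qed

section \<open>Distances, boundaries and decoupling\<close>

lemma set_dist_le_iff: "set_dist X Y \<le> enat r \<longleftrightarrow> (\<exists>x\<in>X. \<exists>y\<in>Y. l1_norm (x - y) \<le> r)"
proof
  assume le: "set_dist X Y \<le> enat r"
  show "\<exists>x\<in>X. \<exists>y\<in>Y. l1_norm (x - y) \<le> r"
  proof (rule ccontr)
    assume "\<not> ?thesis"
    then have "enat (Suc r) \<le> enat (l1_norm (x - y))" if "x \<in> X" "y \<in> Y" for x y
      using that by (auto simp: not_le Suc_le_eq)
    then have "enat (Suc r) \<le> set_dist X Y" unfolding set_dist_def by (intro INF_greatest)
    then have "enat (Suc r) \<le> enat r" using le by (rule order_trans)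
    then show False by simp
  qed
next
  assume "\<exists>x\<in>X. \<exists>y\<in>Y. l1_norm (x - y) \<le> r"
  then obtain x y where xy: "x \<in> X" "y \<in> Y" "l1_norm (x - y) \<le> r" by blast
  have "set_dist X Y \<le> enat (l1_norm (x - y))"
    unfolding set_dist_def by (rule INF_lower2[OF xy(1) INF_lower[OF xy(2)]])
  then show "set_dist X Y \<le> enat r" using xy(3) by (metis enat_ord_simps(1) order_trans)
qed

lemma mem_bdry:
  "x \<in> bdry r \<Lambda> \<longleftrightarrow> (x \<in> \<Lambda> \<and> (\<exists>y. y \<notin> \<Lambda> \<and> l1_norm (x - y) \<le> r)) \<or> (x \<notin> \<Lambda> \<and> (\<exists>y\<in>\<Lambda>. l1_norm (x - y) \<le> r))"
  by (auto simp: bdry_def set_dist_le_iff)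

lemma mem_inner_part: "x \<in> inner_part r \<Lambda> \<longleftrightarrow> x \<in> \<Lambda> \<and> (\<forall>y. y \<notin> \<Lambda> \<longrightarrow> l1_norm (x - y) > r)"
  by (auto simp: inner_part_def mem_bdry not_le)

lemma finite_bdry:
  assumes "finite \<Lambda>"
  shows "finite (bdry r \<Lambda>)"
proof (rule finite_subset)
  show "bdry r \<Lambda> \<subseteq> \<Lambda> \<union> (\<Union>y\<in>\<Lambda>. translate {u. l1_norm u \<le> r} y)"
    by (auto simp: mem_bdry mem_translate)
qed (use assms in \<open>auto intro!: finite_translate finite_l1_norm_le\<close>)

lemma inner_part_translate: "inner_part r (translate \<Lambda> z) = translate (inner_part r \<Lambda>) z"
proof (rule set_eqI)
  fix x
  have "(\<forall>y. y - z \<notin> \<Lambda> \<longrightarrow> l1_norm (x - y) > r) \<longleftrightarrow> (\<forall>y. y \<notin> \<Lambda> \<longrightarrow> l1_norm (x - z - y) > r)"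
  proof
    assume a: "\<forall>y. y - z \<notin> \<Lambda> \<longrightarrow> l1_norm (x - y) > r"
    show "\<forall>y. y \<notin> \<Lambda> \<longrightarrow> l1_norm (x - z - y) > r"
    proof (intro allI impI)
      fix y assume "y \<notin> \<Lambda>"
      then show "l1_norm (x - z - y) > r" using a[rule_format, of "y + z"] by (simp add: algebra_simps)
    qed
  next
    assume a: "\<forall>y. y \<notin> \<Lambda> \<longrightarrow> l1_norm (x - z - y) > r"
    show "\<forall>y. y - z \<notin> \<Lambda> \<longrightarrow> l1_norm (x - y) > r"
      using a by (metis diff_diff_eq2 diff_add_cancel)
  qed
  then show "x \<in> inner_part r (translate \<Lambda> z) \<longleftrightarrow> x \<in> translate (inner_part r \<Lambda>) z"
    by (simp add: mem_inner_part mem_translate)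
qed

text \<open>The number of sites with a neighbour outside, the places where cutting \<Lambda> out
  changes the Hamiltonian. It is at most |\<Lambda>| and at most the size of the boundary, so both
  boundary constants can be 1.\<close>

definition bterm :: "(int ^ 'd) set \<Rightarrow> real" where
  "bterm \<Lambda> = real (card (\<Lambda> - inner_part 1 \<Lambda>))"

lemma bterm_translate [simp]: "bterm (translate \<Lambda> z) = bterm \<Lambda>"
proof -
  have "translate \<Lambda> z - inner_part 1 (translate \<Lambda> z) = translate (\<Lambda> - inner_part 1 \<Lambda>) z"
    by (auto simp: inner_part_translate mem_translate)
  then show ?thesis by (simp add: bterm_def)
qed

lemma inner_part_neighbour: "z \<in> inner_part 1 \<Lambda> \<Longrightarrow> u \<in> nb \<Longrightarrow> z + u \<in> \<Lambda>"
  using mem_inner_part[of z 1 \<Lambda>] by (auto simp: nb_def dest: spec[of _ "z + u"])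

text \<open>Away from their boundaries the pieces do not interact, so the decoupled operator and the
  full one have the same quadratic form under \<open>2 |B|\<close> real linear constraints.\<close>

theorem eigenvalue_count_decouple:
  fixes \<Lambda>s :: "'i \<Rightarrow> (int ^ 'd) set"
  assumes I: "finite I" and fins: "\<And>i. i \<in> I \<Longrightarrow> finite (\<Lambda>s i)" and disj: "disjoint_family_on \<Lambda>s I"
  shows "\<bar>eigenvalue_count (\<Union>i\<in>I. \<Lambda>s i) \<omega> x - (\<Sum>i\<in>I. eigenvalue_count (\<Lambda>s i) \<omega> x)\<bar> \<le> (\<Sum>i\<in>I. bterm (\<Lambda>s i))"
proof -
  define \<Lambda> where "\<Lambda> = (\<Union>i\<in>I. \<Lambda>s i)"
  define B where "B = (\<Union>i\<in>I. \<Lambda>s i - inner_part 1 (\<Lambda>s i))"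
  \<comment> \<open>The decoupled operator: a direct sum, whose eigenbasis is the union of the
    eigenbases of the pieces.\<close>
  define A' where "A' \<phi> = (\<Sum>i\<in>I. Hloc (\<Lambda>s i) \<omega> (cutoff (\<Lambda>s i) \<phi>))" for \<phi>
  define E' where "E' = (\<Union>i\<in>I. ebasis (\<Lambda>s i) \<omega>)"
  have fin: "finite \<Lambda>" using I fins by (simp add: \<Lambda>_def)
  have finB: "finite B" using I fins by (simp add: B_def)
  have djD: "z \<notin> \<Lambda>s j" if "i \<in> I" "j \<in> I" "i \<noteq> j" "z \<in> \<Lambda>s i" for i j z
    using disj that by (auto simp: disjoint_family_on_def)
  note Ei = ebasis[OF fins, of _ \<omega>]
  have Hz: "Hloc (\<Lambda>s i) \<omega> 0 = 0" if "i \<in> I" for i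
    by (rule lin_onD(4)[OF Hloc_lin_on[OF fins[OF that]] lsp_closed(6)])
  have sub: "\<Lambda>s i \<subseteq> \<Lambda>" if "i \<in> I" for i using that by (auto simp: \<Lambda>_def)
  have cut0: "cutoff (\<Lambda>s j) e = 0" if "i \<in> I" "j \<in> I" "i \<noteq> j" "e \<in> lsp (\<Lambda>s i)" for i j e
    by (rule l2_eqI) (use that djD[of i j] in \<open>auto simp: lsp_def\<close>)
  have A'e: "A' e = Hloc (\<Lambda>s i) \<omega> e" if "i \<in> I" "e \<in> lsp (\<Lambda>s i)" for i e
  proof -
    have "A' e = (\<Sum>j\<in>I. if j = i then Hloc (\<Lambda>s i) \<omega> e else 0)"
      unfolding A'_def by (intro sum.cong refl) (use that cut0[of i] Hz cutoff_lsp[OF that(2)] in auto)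
    then show ?thesis using that I by simp
  qed
  have cross: "e \<bullet> f = 0" if "i \<in> I" "j \<in> I" "i \<noteq> j" "e \<in> lsp (\<Lambda>s i)" "f \<in> lsp (\<Lambda>s j)" for i j e f
    using cutoff_inner[of "\<Lambda>s i" e f] cutoff_lsp[OF that(4)] cut0[of j i f] that by simp
  have A'lsp: "A' \<phi> \<in> lsp \<Lambda>" for \<phi>
    unfolding A'_def
  proof (rule lsp_sum)
    fix i assume "i \<in> I"
    then have "Hloc (\<Lambda>s i) \<omega> (cutoff (\<Lambda>s i) \<phi>) \<in> lsp (\<Lambda>s i)" by (simp add: Hloc_def lsp_closed)
    then show "Hloc (\<Lambda>s i) \<omega> (cutoff (\<Lambda>s i) \<phi>) \<in> lsp \<Lambda>" using lsp_mono[OF sub[OF \<open>i \<in> I\<close>]] by blast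
  qed
  have lin': "lin_on \<Lambda> A'"
    unfolding lin_on_def A'_def
    by (auto simp: sum.distrib[symmetric] scaleR_sum_right lin_onD[OF Hloc_lin_on[OF fins]] lsp_closed
        intro!: sum.cong)
  have basis: "eigbasis \<Lambda> A' E'"
    unfolding eigbasis_def
  proof (intro conjI ballI impI)
    show "finite E'" unfolding E'_def using I eigbasisD(1)[OF Ei] by blast
    show "E' \<subseteq> lsp \<Lambda>" unfolding E'_def using eigbasisD(2)[OF Ei] lsp_mono[OF sub] by blast
    show "onset E'"
      unfolding onset_def E'_def
    proof (intro conjI ballI impI)
      fix e assume "e \<in> (\<Union>i\<in>I. ebasis (\<Lambda>s i) \<omega>)"
      then obtain i where i: "i \<in> I" "e \<in> ebasis (\<Lambda>s i) \<omega>" by blast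
      then show "norm e = 1" using eigbasisD(3)[OF Ei[OF i(1)]] by (simp add: onset_def)
      fix f assume "f \<in> (\<Union>i\<in>I. ebasis (\<Lambda>s i) \<omega>)" "e \<noteq> f"
      then obtain j where j: "j \<in> I" "f \<in> ebasis (\<Lambda>s j) \<omega>" by blast
      show "e \<bullet> f = 0"
        using cross[of i j e f] i j eigbasisD(5)[OF Ei[OF i(1)] i(2)] eigbasisD(5)[OF Ei[OF j(1)] j(2)]
          eigbasisD(3)[OF Ei[OF i(1)]] \<open>e \<noteq> f\<close> by (cases "i = j") (auto simp: onset_def)
    qed
    fix e assume "e \<in> E'"
    then obtain i where i: "i \<in> I" "e \<in> ebasis (\<Lambda>s i) \<omega>" by (auto simp: E'_def)
    show "A' e = (e \<bullet> A' e) *\<^sub>R e"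
      using A'e[OF i(1) eigbasisD(5)[OF Ei[OF i(1)] i(2)]] eigbasisD(4)[OF Ei[OF i(1)] i(2)] by simp
  next
    fix \<phi> assume \<phi>: "\<phi> \<in> lsp \<Lambda>" "\<forall>e\<in>E'. e \<bullet> \<phi> = 0"
    have z: "cutoff (\<Lambda>s i) \<phi> = 0" if i: "i \<in> I" for i
    proof (rule eigbasisD(6)[OF Ei[OF i]])
      fix e assume e: "e \<in> ebasis (\<Lambda>s i) \<omega>"
      then have "e \<bullet> cutoff (\<Lambda>s i) \<phi> = e \<bullet> \<phi>"
        using cutoff_inner[of "\<Lambda>s i" e \<phi>] cutoff_lsp[OF eigbasisD(5)[OF Ei[OF i] e]] by simp
      then show "e \<bullet> cutoff (\<Lambda>s i) \<phi> = 0" using \<phi>(2) e i by (auto simp: E'_def)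
    qed blast
    show "\<phi> = 0"
    proof (rule l2_eqI)
      fix y show "l2_fun \<phi> y = l2_fun 0 y"
      proof (cases "y \<in> \<Lambda>")
        case True
        then obtain i where "i \<in> I" "y \<in> \<Lambda>s i" by (auto simp: \<Lambda>_def)
        then show ?thesis using arg_cong[OF z[of i], of "\<lambda>\<psi>. l2_fun \<psi> y"] by simp
      qed (use \<phi>(1) in \<open>simp add: lsp_def\<close>)
    qed
  qed
  have cntE': "cnt A' E' x = (\<Sum>i\<in>I. cnt (Hloc (\<Lambda>s i) \<omega>) (ebasis (\<Lambda>s i) \<omega>) x)"
  proof -
    let ?C = "\<lambda>i. {e \<in> ebasis (\<Lambda>s i) \<omega>. e \<bullet> Hloc (\<Lambda>s i) \<omega> e \<le> x}"
    have "{e \<in> E'. e \<bullet> A' e \<le> x} = (\<Union>i\<in>I. ?C i)"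
      using A'e eigbasisD(5)[OF Ei] by (auto simp: E'_def)
    moreover have "card (\<Union>i\<in>I. ?C i) = (\<Sum>i\<in>I. card (?C i))"
    proof (rule card_UN_disjoint[OF I])
      show "\<forall>i\<in>I. finite (?C i)" using eigbasisD(1)[OF Ei] by simp
      show "\<forall>i\<in>I. \<forall>j\<in>I. i \<noteq> j \<longrightarrow> ?C i \<inter> ?C j = {}"
      proof (intro ballI impI)
        fix i j assume ij: "i \<in> I" "j \<in> I" "i \<noteq> j"
        have "e \<bullet> e = 0" if "e \<in> ebasis (\<Lambda>s i) \<omega>" "e \<in> ebasis (\<Lambda>s j) \<omega>" for e
          using cross[OF ij] eigbasisD(5)[OF Ei] ij that by blast
        moreover have "norm e = 1" if "e \<in> ebasis (\<Lambda>s i) \<omega>" for e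
          using eigbasisD(3)[OF Ei[OF ij(1)]] that by (simp add: onset_def)
        ultimately show "?C i \<inter> ?C j = {}" by fastforce
      qed
    qed
    ultimately show ?thesis by (simp add: cnt_def)
  qed
  \<comment> \<open>Vanishing of real and imaginary parts on B amounts to at most 2 |B| real
    constraints, which become |B| when the real counts are halved.\<close>
  define U where "U = dl ` B \<union> (\<lambda>z. imul (dl z)) ` B"
  have finU: "finite U" using finB by (simp add: U_def)
  have "card U \<le> card (dl ` B) + card ((\<lambda>z. imul (dl z)) ` B)" unfolding U_def by (rule card_Un_le)
  also have "\<dots> \<le> card B + card B" by (intro add_mono card_image_le finB)
  finally have cardU: "card U \<le> 2 * card B" by simp
  have formeq: "w \<bullet> Hloc \<Lambda> \<omega> w = w \<bullet> A' w" if w: "w \<in> lsp \<Lambda>" and Uw: "\<And>u. u \<in> U \<Longrightarrow> u \<bullet> w = 0" for w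
  proof -
    have w0: "l2_fun w z = 0" if "z \<in> B" for z
      using Uw[of "dl z"] Uw[of "imul (dl z)"] that
      by (simp add: U_def inner_commute inner_dl inner_imul_dl complex_eq_iff)
    \<comment> \<open>Off B every neighbour of z lies in the same piece, so the two operators act
      alike; on B the vector w vanishes. Hence the forms agree at w.\<close>
    have eqz: "l2_fun (Hloc \<Lambda> \<omega> w) z = l2_fun (A' w) z" if zB: "z \<notin> B" for z
    proof (cases "z \<in> \<Lambda>")
      case False
      then show ?thesis using A'lsp[of w] by (simp add: lsp_def Hloc_def)
    next
      case True
      then obtain i where i: "i \<in> I" "z \<in> \<Lambda>s i" by (auto simp: \<Lambda>_def)
      have inn: "z \<in> inner_part 1 (\<Lambda>s i)" using zB i by (auto simp: B_def)
      have ci: "cutoff (\<Lambda>s i) w \<in> lsp (\<Lambda>s i)" by blast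
      have "l2_fun (A' w) z = (\<Sum>j\<in>I. if j = i then l2_fun (Hloc (\<Lambda>s i) \<omega> (cutoff (\<Lambda>s i) w)) z else 0)"
        unfolding A'_def l2_fun_sum
        by (intro sum.cong refl) (use djD[of i _ z] i in \<open>auto simp: Hloc_def\<close>)
      also have "\<dots> = l2_fun (Hloc (\<Lambda>s i) \<omega> (cutoff (\<Lambda>s i) w)) z" using i I by simp
      also have "\<dots> = of_real (\<omega> z) * l2_fun w z - (\<Sum>u\<in>nb. l2_fun w (z + u) - l2_fun w z)"
        using i inner_part_neighbour[OF inn]
        by (simp add: Hloc_eq_cutoff[OF fins[OF i(1)] ci] Hop_def l2_fun_mulop_Hdom lsp_Hdom[OF fins[OF i(1)] ci] lap_def
            cong: sum.cong)
      also have "\<dots> = l2_fun (Hloc \<Lambda> \<omega> w) z"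
        using True by (simp add: Hloc_eq_cutoff[OF fin w] Hop_def l2_fun_mulop_Hdom lsp_Hdom[OF fin w] lap_def)
      finally show ?thesis by simp
    qed
    have "w \<bullet> (Hloc \<Lambda> \<omega> w - A' w) = 0"
      unfolding inner_l2_eq by (rule infsum_0) (metis eqz w0 complex_cnj_zero l2_fun_diff mult_zero_left mult_zero_right right_minus_eq zero_complex.simps(1))
    then show ?thesis by (simp add: inner_diff_right)
  qed
  have c1: "cnt A' E' x \<le> cnt (Hloc \<Lambda> \<omega>) (ebasis \<Lambda> \<omega>) x + card U"
    by (rule cnt_compare[OF ebasis[OF fin] Hloc_lin_on[OF fin] basis lin' finU]) (simp add: formeq)
  have c2: "cnt (Hloc \<Lambda> \<omega>) (ebasis \<Lambda> \<omega>) x \<le> cnt A' E' x + card U"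
    by (rule cnt_compare[OF basis lin' ebasis[OF fin] Hloc_lin_on[OF fin] finU]) (simp add: formeq)
  have f: "eigenvalue_count \<Lambda> \<omega> x = real (cnt (Hloc \<Lambda> \<omega>) (ebasis \<Lambda> \<omega>) x) / 2"
    by (rule eigenvalue_count_cnt[OF fin ebasis[OF fin]])
  have fs: "(\<Sum>i\<in>I. eigenvalue_count (\<Lambda>s i) \<omega> x) = real (cnt A' E' x) / 2"
    unfolding cntE' of_nat_sum sum_divide_distrib
    by (intro sum.cong refl eigenvalue_count_cnt fins Ei)
  have "real (card B) \<le> (\<Sum>i\<in>I. bterm (\<Lambda>s i))"
    using card_UN_le[OF I, of "\<lambda>i. \<Lambda>s i - inner_part 1 (\<Lambda>s i)"] unfolding B_def bterm_def of_nat_sum[symmetric] of_nat_le_iff .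
  moreover have "\<bar>eigenvalue_count \<Lambda> \<omega> x - (\<Sum>i\<in>I. eigenvalue_count (\<Lambda>s i) \<omega> x)\<bar> \<le> real (card U) / 2"
  proof -
    have "real (cnt A' E' x) \<le> real (cnt (Hloc \<Lambda> \<omega>) (ebasis \<Lambda> \<omega>) x) + real (card U)"
      "real (cnt (Hloc \<Lambda> \<omega>) (ebasis \<Lambda> \<omega>) x) \<le> real (cnt A' E' x) + real (card U)"
      using c1 c2 by (simp_all flip: of_nat_add)
    then show ?thesis unfolding f fs by linarith
  qed
  moreover have "real (card U) \<le> 2 * real (card B)" using cardU by linarith
  ultimately show ?thesis unfolding \<Lambda>_def by linarith
qed

section \<open>Counting sites in cubes\<close>

lemma card_vec_box: "card {x :: int ^ 'd. \<forall>i. a \<le> x $ i \<and> x $ i < b} = nat (b - a) ^ CARD('d)"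
proof -
  have "bij_betw vec_lambda (PiE UNIV (\<lambda>_ :: 'd. {a..<b})) {x :: int ^ 'd. \<forall>i. a \<le> x $ i \<and> x $ i < b}"
    by (rule bij_betw_byWitness[where f' = vec_nth]) (auto simp: PiE_def Pi_def)
  then have "card {x :: int ^ 'd. \<forall>i. a \<le> x $ i \<and> x $ i < b} = card (PiE UNIV (\<lambda>_ :: 'd. {a..<b}))"
    by (rule bij_betw_same_card[symmetric])
  then show ?thesis by (simp add: card_PiE)
qed

lemma card_cube: "card (cube n :: (int ^ 'd) set) = n ^ CARD('d)"
  using card_vec_box[of 0 "int n"] by (simp add: cube_def)

lemma finite_cube [simp]: "finite (cube n)"
  by (rule finite_subset[OF _ finite_vec_box[of 0 "int n"]]) (auto simp: cube_def intro: less_imp_le)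

lemma l1_norm_axis: "l1_norm (\<chi> j. if j = i then k else 0) = nat \<bar>k\<bar>"
  by (simp add: l1_norm_def if_distrib cong: if_cong)

text \<open>The shortest way out of a cube runs along a coordinate axis. Truncated subtraction makes
  the right side empty when m \<le> 2r.\<close>

lemma inner_part_cube:
  "inner_part r (cube m :: (int ^ 'd) set) = translate (cube (m - 2 * r)) (\<chi> i. int r)"
proof (rule set_eqI)
  fix x :: "int ^ 'd"
  have "x \<in> inner_part r (cube m) \<longleftrightarrow> (\<forall>i. int r \<le> x $ i \<and> x $ i < int m - int r)"
  proof
    assume x: "x \<in> inner_part r (cube m)"
    show "\<forall>i. int r \<le> x $ i \<and> x $ i < int m - int r"
    proof
      fix i
      have c: "0 \<le> x $ i" "x $ i < int m" using x by (auto simp: mem_inner_part cube_def)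
      \<comment> \<open>The point x moved by k along the i-th axis is outside the cube, so |k|
        exceeds r; the two extreme choices of k give both bounds for the i-th coordinate.\<close>
      have far: "l1_norm (x - (x + (\<chi> j. if j = i then k else 0))) > r" if "x $ i + k < 0 \<or> int m \<le> x $ i + k" for k
      proof -
        have "x + (\<chi> j. if j = i then k else 0) \<notin> cube m" using that by (auto simp: cube_def intro!: exI[of _ i])
        then show ?thesis using x unfolding mem_inner_part by blast
      qed
      have e: "x - (x + v) = - v" for v :: "int ^ 'd" by simp
      show "int r \<le> x $ i \<and> x $ i < int m - int r"
        using far[of "- x $ i - 1"] far[of "int m - x $ i"] c unfolding e l1_norm_minus l1_norm_axis by auto
    qed
  next
    assume b: "\<forall>i. int r \<le> x $ i \<and> x $ i < int m - int r"
    show "x \<in> inner_part r (cube m)"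
      unfolding mem_inner_part
    proof (intro conjI allI impI)
      show "x \<in> cube m"
        unfolding cube_def mem_Collect_eq
      proof
        fix i show "0 \<le> x $ i \<and> x $ i < int m" using b[rule_format, of i] by linarith
      qed
      fix y :: "int ^ 'd" assume "y \<notin> cube m"
      then have "\<exists>i. y $ i < 0 \<or> int m \<le> y $ i" by (auto simp: cube_def not_le not_less)
      then obtain i where "y $ i < 0 \<or> int m \<le> y $ i" by blast
      then have "int r < \<bar>(x - y) $ i\<bar>" using b[rule_format, of i] by auto
      then show "r < l1_norm (x - y)" using component_le_l1_norm[of "x - y" i] by linarith
    qed
  qed
  also have "\<dots> \<longleftrightarrow> x \<in> translate (cube (m - 2 * r)) (\<chi> i. int r)"
  proof -
    have "int r \<le> a \<and> a < int m - int r \<longleftrightarrow> 0 \<le> a - int r \<and> a - int r < int (m - 2 * r)" for a :: int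
      by arith
    then show ?thesis by (simp add: mem_translate cube_def)
  qed
  finally show "x \<in> inner_part r (cube m) \<longleftrightarrow> x \<in> translate (cube (m - 2 * r)) (\<chi> i. int r)" .
qed

lemma card_inner_part_cube: "card (inner_part r (cube m :: (int ^ 'd) set)) = (m - 2 * r) ^ CARD('d)"
  by (simp add: inner_part_cube card_cube)

lemma finite_inner_part_cube [simp]: "finite (inner_part r (cube m))"
  by (simp add: inner_part_def)

lemma power_defect:
  assumes "0 \<le> t" "t \<le> (1::real)"
  shows "1 - (1 - t) ^ d \<le> real d * t"
  using Bernoulli_inequality[of "- t" d] assms by simp

text \<open>Bernoulli's inequality for (1 - 2r/m)^d. If 0 < m \<le> 2r the inner part is empty and
  the factor in front of m^d is at least 1, so the bound holds for all m and r.\<close>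

lemma card_cube_inner_defect:
  "real m ^ CARD('d) - real (card (inner_part r (cube m :: (int ^ 'd) set))) \<le> real CARD('d) * (2 * real r / real m) * real m ^ CARD('d)"
proof (cases "m \<le> 2 * r \<or> m = 0")
  case True
  have "real m ^ CARD('d) * 1 \<le> real m ^ CARD('d) * (real CARD('d) * (2 * real r / real m))"
  proof (cases "m = 0")
    case False
    then have "1 \<le> 2 * real r / real m" using True by (simp add: field_simps)
    then have "1 * 1 \<le> real CARD('d) * (2 * real r / real m)" by (intro mult_mono) auto
    then show ?thesis by (intro mult_left_mono) auto
  qed (simp add: power_0_left)
  then show ?thesis using True by (auto simp: card_inner_part_cube mult.commute power_0_left)
next
  case False
  then have m: "0 < m" "2 * r \<le> m" by auto
  have e: "real (card (inner_part r (cube m :: (int ^ 'd) set))) = (real m * (1 - 2 * real r / real m)) ^ CARD('d)"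
  proof -
    have "real m * (1 - 2 * real r / real m) = real (m - 2 * r)"
      using m by (simp add: of_nat_diff right_diff_distrib)
    then show ?thesis by (simp add: card_inner_part_cube)
  qed
  have "real m ^ CARD('d) - real (card (inner_part r (cube m :: (int ^ 'd) set))) =
      real m ^ CARD('d) * (1 - (1 - 2 * real r / real m) ^ CARD('d))"
    unfolding e power_mult_distrib by (simp only: right_diff_distrib mult_1_right)
  also have "\<dots> \<le> real m ^ CARD('d) * (real CARD('d) * (2 * real r / real m))"
    by (intro mult_left_mono power_defect) (use m in \<open>auto simp: field_simps\<close>)
  finally show ?thesis by (simp add: mult_ac)
qed

lemma bterm_cube: "bterm (cube s :: (int ^ 'd) set) \<le> real CARD('d) * (2 / real s) * real s ^ CARD('d)"
proof -
  have "inner_part 1 (cube s :: (int ^ 'd) set) \<subseteq> cube s" by (auto simp: inner_part_def)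
  then have "bterm (cube s :: (int ^ 'd) set) = real s ^ CARD('d) - real (card (inner_part 1 (cube s :: (int ^ 'd) set)))"
    unfolding bterm_def by (subst card_Diff_subset) (auto simp: card_cube of_nat_diff card_mono simp flip: card_cube intro: finite_subset)
  then show ?thesis using card_cube_inner_defect[where m = s and r = 1 and 'd = 'd] by simp
qed

section \<open>Membership of the counting function in the admissible class\<close>

lemma sup_norm_le:
  assumes "\<And>x. \<bar>F x\<bar> \<le> C"
  shows "sup_norm F \<le> C"
  unfolding sup_norm_def by (rule cSUP_least) (use assms in auto)

lemma le_sup_norm:
  assumes "bounded (range F)"
  shows "\<bar>F x\<bar> \<le> sup_norm F"
proof -
  obtain C where "\<And>x. \<bar>F x\<bar> \<le> C" using assms unfolding bounded_iff by auto
  then show ?thesis unfolding sup_norm_def by (intro cSUP_upper bdd_aboveI[of _ C]) auto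
qed

lemma bterm_bounds: "finite \<Lambda> \<Longrightarrow> 0 \<le> bterm \<Lambda> \<and> bterm \<Lambda> \<le> real (card \<Lambda>)"
  by (auto simp: bterm_def intro: card_mono)

lemma bterm_boundary_term: "boundary_term A (eigenvalue_count :: 'd::finite field) bterm 1"
  unfolding boundary_term_def
proof (intro conjI allI impI ballI)
  show "0 \<le> bterm \<Lambda>" "bterm \<Lambda> \<le> 1 * real (card \<Lambda>)" if "finite \<Lambda>" for \<Lambda> :: "(int ^ 'd) set"
    using bterm_bounds[OF that] by auto
  show "bterm (translate \<Lambda> z) = bterm \<Lambda>" for \<Lambda> :: "(int ^ 'd) set" and z by simp
  show "0 < (1::real)" by simp
  show "sup_norm (\<lambda>E. eigenvalue_count (\<Union>i\<in>{1..n}. \<Lambda>s i) \<omega> E - (\<Sum>i\<in>{1..n}. eigenvalue_count (\<Lambda>s i) \<omega> E))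
      \<le> (\<Sum>i\<in>{1..n}. bterm (\<Lambda>s i))"
    if "\<forall>i\<in>{1..n}. finite (\<Lambda>s i)" "disjoint_family_on \<Lambda>s {1..n}" for \<omega> and n :: nat and \<Lambda>s :: "nat \<Rightarrow> (int ^ 'd) set"
    by (rule sup_norm_le, rule eigenvalue_count_decouple) (use that in auto)
  fix \<Lambda>s :: "nat \<Rightarrow> (int ^ 'd) set" and N :: "nat \<Rightarrow> nat"
  assume N: "strict_mono N" and c: "\<forall>i. is_cube (N i) (\<Lambda>s i)"
  have bc: "bterm (\<Lambda>s i) = bterm (cube (N i) :: (int ^ 'd) set)" "card (\<Lambda>s i) = N i ^ CARD('d)" for i
  proof -
    obtain z where "\<Lambda>s i = translate (cube (N i)) z" using c unfolding is_cube_def by (elim allE exE)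
    then show "bterm (\<Lambda>s i) = bterm (cube (N i) :: (int ^ 'd) set)" "card (\<Lambda>s i) = N i ^ CARD('d)"
      by (simp_all add: card_cube)
  qed
  show "(\<lambda>i. bterm (\<Lambda>s i) / real (card (\<Lambda>s i))) \<longlonglongrightarrow> 0"
  proof (rule tendsto_sandwich[OF _ _ tendsto_const])
    show "\<forall>\<^sub>F i in sequentially. 0 \<le> bterm (\<Lambda>s i) / real (card (\<Lambda>s i))" by (simp add: bterm_def)
    show "\<forall>\<^sub>F i in sequentially. bterm (\<Lambda>s i) / real (card (\<Lambda>s i)) \<le> real CARD('d) * (2 / real (N i))"
      using eventually_gt_at_top[of 0]
    proof eventually_elim
      case (elim i)
      then have "0 < N i" using seq_suble[OF N, of i] by simp
      then show ?case using bterm_cube[where s = "N i" and 'd = 'd] by (simp add: bc pos_divide_le_eq)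
    qed
    have "(\<lambda>i. real CARD('d) * (2 / real (N i))) \<longlonglongrightarrow> real CARD('d) * 0"
      by (intro tendsto_mult_left filterlim_compose[OF lim_const_over_n filterlim_subseq[OF N]])
    then show "(\<lambda>i. real CARD('d) * (2 / real (N i))) \<longlonglongrightarrow> 0" by simp
  qed
qed

lemma eigenvalue_count_rc_bounded: "finite \<Lambda> \<Longrightarrow> eigenvalue_count \<Lambda> \<omega> \<in> rc_bounded"
  using eigenvalue_count_props[where \<Lambda> = \<Lambda> and \<omega> = \<omega>] by (auto simp: rc_bounded_def bounded_iff intro!: exI[of _ "real (card \<Lambda>)"])

lemma eigenvalue_count_sup_norm: "finite \<Lambda> \<Longrightarrow> sup_norm (eigenvalue_count \<Lambda> \<omega>) \<le> real (card \<Lambda>)"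
  using eigenvalue_count_props[where \<Lambda> = \<Lambda> and \<omega> = \<omega>] by (intro sup_norm_le) auto

theorem eigenvalue_count_admissible: "admissible A (eigenvalue_count :: 'd::finite field)"
  unfolding admissible_def
proof (intro conjI allI impI ballI)
  show "eigenvalue_count \<Lambda> \<omega> \<in> rc_bounded" if "finite \<Lambda>" for \<Lambda> :: "(int ^ 'd) set" and \<omega>
    by (rule eigenvalue_count_rc_bounded[OF that])
  show "eigenvalue_count (translate \<Lambda> z) \<omega> = eigenvalue_count \<Lambda> (shift z \<omega>)" if "finite \<Lambda>"
    for \<Lambda> :: "(int ^ 'd) set" and z \<omega> by (rule ext) (rule eigenvalue_count_translate[OF that])
  show "eigenvalue_count \<Lambda> \<omega> = eigenvalue_count \<Lambda> \<omega>'" if "finite \<Lambda>" "restrict \<omega> \<Lambda> = restrict \<omega>' \<Lambda>"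
    for \<Lambda> :: "(int ^ 'd) set" and \<omega> \<omega>'
    by (rule eigenvalue_count_local[OF that(1)]) (metis that(2) restrict_apply')
  show "\<exists>b D. boundary_term A (eigenvalue_count :: 'd field) b D" using bterm_boundary_term by blast
  show "bdd_above ((\<lambda>\<omega>. sup_norm (eigenvalue_count {0 :: int ^ 'd} \<omega>)) ` configs A)"
    using eigenvalue_count_sup_norm[of "{0 :: int ^ 'd}"] by (intro bdd_aboveI[of _ 1]) auto
  show "\<exists>s :: int ^ 'd \<Rightarrow> int. (\<forall>z. s z \<in> {-1, 1}) \<and>
      (\<forall>\<Lambda>. finite \<Lambda> \<longrightarrow> (\<forall>\<omega>\<in>configs A. \<forall>\<omega>'\<in>configs A. \<forall>z\<in>\<Lambda>. \<forall>E.
         restrict \<omega> (\<Lambda> - {z}) = restrict \<omega>' (\<Lambda> - {z}) \<longrightarrow> \<omega> z \<le> \<omega>' z \<longrightarrow>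
         (s z = 1 \<longrightarrow> eigenvalue_count \<Lambda> \<omega> E \<le> eigenvalue_count \<Lambda> \<omega>' E) \<and>
         (s z = -1 \<longrightarrow> eigenvalue_count \<Lambda> \<omega> E \<ge> eigenvalue_count \<Lambda> \<omega>' E)))"
  \<comment> \<open>Raising the potential raises the eigenvalues and so lowers their number up to E;
    every sign is -1.\<close>
  proof (intro exI[of _ "\<lambda>_. -1"] conjI allI impI ballI)
    fix \<Lambda> :: "(int ^ 'd) set" and \<omega> \<omega>' :: "int ^ 'd \<Rightarrow> real" and z E
    assume fin: "finite \<Lambda>" and eq: "restrict \<omega> (\<Lambda> - {z}) = restrict \<omega>' (\<Lambda> - {z})" and le: "\<omega> z \<le> \<omega>' z"
    show "eigenvalue_count \<Lambda> \<omega>' E \<le> eigenvalue_count \<Lambda> \<omega> E"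
    proof (rule eigenvalue_count_antimono[OF fin])
      fix y assume "y \<in> \<Lambda>"
      then show "\<omega> y \<le> \<omega>' y" using le fun_cong[OF eq, of y] by (cases "y = z") auto
    qed
  qed auto
qed

text \<open>The normalized norm and all boundary constants are at most 1. A nonempty set of
  configurations makes \<open>field_bound\<close> a supremum over a nonempty set.\<close>

theorem eigenvalue_count_in_class:
  assumes "(configs A :: (int ^ 'd \<Rightarrow> real) set) \<noteq> {}"
  shows "(eigenvalue_count :: 'd::finite field) \<in> admissible_class A 9 8 8 1"
  unfolding admissible_class_def mem_Collect_eq
proof (intro conjI eigenvalue_count_admissible exI[of _ bterm] exI[of _ "1::real"] exI[of _ "1::nat"] bterm_boundary_term)
  show "field_bound A (eigenvalue_count :: 'd field) \<le> 9"
    unfolding field_bound_def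
  proof (rule cSUP_least)
    have "{0} \<in> {\<Lambda> :: (int ^ 'd) set. finite \<Lambda> \<and> \<Lambda> \<noteq> {}}" by simp
    then have "{\<Lambda> :: (int ^ 'd) set. finite \<Lambda> \<and> \<Lambda> \<noteq> {}} \<noteq> {}" by (metis empty_iff)
    then show "{\<Lambda> :: (int ^ 'd) set. finite \<Lambda> \<and> \<Lambda> \<noteq> {}} \<times> (configs A :: (int ^ 'd \<Rightarrow> real) set) \<noteq> {}"
      using assms by (simp only: Times_empty simp_thms)
    fix p :: "(int ^ 'd) set \<times> (int ^ 'd \<Rightarrow> real)"
    assume "p \<in> {\<Lambda>. finite \<Lambda> \<and> \<Lambda> \<noteq> {}} \<times> configs A"
    then obtain \<Lambda> :: "(int ^ 'd) set" and \<omega> where p: "p = (\<Lambda>, \<omega>)" "finite \<Lambda>" "\<Lambda> \<noteq> {}" by auto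
    then have "0 < card \<Lambda>" by (simp add: card_gt_0_iff)
    then have "sup_norm (eigenvalue_count \<Lambda> \<omega>) / real (card \<Lambda>) \<le> 1"
      using eigenvalue_count_sup_norm[OF p(2)] by (simp add: pos_divide_le_eq)
    then show "(case p of (\<Lambda>, \<omega>) \<Rightarrow> sup_norm (eigenvalue_count \<Lambda> \<omega>) / real (card \<Lambda>)) \<le> 9"
      by (simp add: p(1))
  qed
  show "proper_boundary_term (bterm :: (int ^ 'd) set \<Rightarrow> real) 1 1"
    unfolding proper_boundary_term_def
  proof (intro conjI allI impI)
    fix n and \<Lambda> :: "(int ^ 'd) set" assume "is_cube n \<Lambda>"
    then have "finite \<Lambda>" by (auto simp: is_cube_def)
    moreover have "\<Lambda> - inner_part 1 \<Lambda> \<subseteq> bdry 1 \<Lambda>" by (auto simp: inner_part_def)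
    ultimately show "bterm \<Lambda> \<le> 1 * real (card (bdry 1 \<Lambda>))"
      by (simp add: bterm_def card_mono finite_bdry)
  qed auto
qed auto

subsection \<open>Stationary random fields and tilings\<close>

lemma abs_le_of_nonneg: "0 \<le> a \<Longrightarrow> a \<le> b \<Longrightarrow> \<bar>a\<bar> \<le> b" for a b :: real
  by simp

locale random_field = prob_space P
  for P :: "(int ^ 'd \<Rightarrow> real) measure" +
  fixes A :: "real set" and \<mu> :: "int ^ 'd \<Rightarrow> real measure" and r :: nat
  assumes sets_P: "sets P = sets (config_algebra A UNIV)"
    and stat: "stationary A P" and dens: "has_densities A \<mu> P" and corr: "correlation_length A \<mu> P r"
begin

lemma space_config_algebra: "space (config_algebra A \<Lambda>) = PiE \<Lambda> (\<lambda>_. A)"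
  by (simp add: config_algebra_def space_PiM space_restrict_space)

lemma space_P: "space P = configs A"
  using sets_eq_imp_space_eq[OF sets_P] by (auto simp: space_config_algebra configs_def PiE_def Pi_def)

lemma configs_nonempty: "(configs A :: (int ^ 'd \<Rightarrow> real) set) \<noteq> {}"
  using not_empty space_P by simp

text \<open>A fixed colour by which patterns on \<Lambda> are extended to configurations, see
  \<open>ext\<close>.\<close>

definition a0 :: real where "a0 = (SOME a. a \<in> A)"

lemma a0: "a0 \<in> A"
proof -
  obtain \<omega> :: "int ^ 'd \<Rightarrow> real" where "\<omega> \<in> configs A" using configs_nonempty by blast
  then have "\<omega> 0 \<in> A" by (auto simp: configs_def)
  then show ?thesis unfolding a0_def by (rule someI)
qed

lemma id_measurable_borel: "(\<lambda>x. x) \<in> restrict_space borel A \<rightarrow>\<^sub>M borel"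
  by (rule measurable_restrict_space1) simp

lemma component_measurable: "z \<in> \<Lambda> \<Longrightarrow> (\<lambda>\<eta>. \<eta> z) \<in> config_algebra A \<Lambda> \<rightarrow>\<^sub>M borel"
  unfolding config_algebra_def
  by (rule measurable_compose[where f = "\<lambda>\<eta>. \<eta> z" and g = "\<lambda>x. x" and N = "restrict_space borel A"])
     (auto intro: measurable_component_singleton id_measurable_borel)

text \<open>The lattice is countable, so the Borel sets of the product topology form the product
  \<sigma>-algebra. Measurability proved by topology thus carries over to P.\<close>

lemma to_borel_measurable:
  fixes G :: "'c \<Rightarrow> int ^ 'd \<Rightarrow> real"
  assumes "\<And>z. (\<lambda>x. G x z) \<in> M \<rightarrow>\<^sub>M borel"
  shows "G \<in> M \<rightarrow>\<^sub>M borel"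
proof -
  have "G \<in> M \<rightarrow>\<^sub>M Pi\<^sub>M UNIV (\<lambda>_. borel)"
    by (rule measurable_PiM_single') (use assms in auto)
  then show ?thesis using measurable_cong_sets[OF refl sets_PiM_equal_borel] by blast
qed

lemma meas_P: "h \<in> borel_measurable borel \<Longrightarrow> h \<in> borel_measurable P"
proof -
  assume h: "h \<in> borel_measurable borel"
  have "(\<lambda>\<omega>. \<omega>) \<in> P \<rightarrow>\<^sub>M borel"
    by (rule to_borel_measurable) (simp add: measurable_cong_sets[OF sets_P refl] component_measurable)
  from measurable_compose[OF this h] show ?thesis by simp
qed

lemma to_config_algebra_measurable:
  assumes "\<And>z. z \<in> \<Lambda> \<Longrightarrow> (\<lambda>x. G x z) \<in> M \<rightarrow>\<^sub>M restrict_space borel A" "\<And>x. x \<in> space M \<Longrightarrow> G x \<in> PiE \<Lambda> (\<lambda>_. A)"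
  shows "G \<in> M \<rightarrow>\<^sub>M config_algebra A \<Lambda>"
  unfolding config_algebra_def
  by (rule measurable_PiM_single') (use assms in \<open>auto simp: space_restrict_space PiE_def\<close>)

lemma coord_P: "(\<lambda>\<omega>. \<omega> z) \<in> P \<rightarrow>\<^sub>M restrict_space borel A"
  unfolding measurable_cong_sets[OF sets_P refl] config_algebra_def by (rule measurable_component_singleton) simp

lemma shift_configs: "\<omega> \<in> configs A \<Longrightarrow> shift z \<omega> \<in> configs A"
  by (auto simp: configs_def shift_def)

lemma shift_measurable: "shift z \<in> P \<rightarrow>\<^sub>M config_algebra A UNIV"
  by (rule to_config_algebra_measurable)
     (auto simp: shift_def coord_P space_P configs_def)

lemma restrict_measurable: "(\<lambda>\<omega>. restrict \<omega> \<Lambda>) \<in> P \<rightarrow>\<^sub>M config_algebra A \<Lambda>"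
proof (rule to_config_algebra_measurable)
  fix z assume "z \<in> \<Lambda>"
  then show "(\<lambda>x. restrict x \<Lambda> z) \<in> P \<rightarrow>\<^sub>M restrict_space borel A" using coord_P by simp
qed (auto simp: space_P configs_def)

lemma expectation_shift:
  fixes h :: "(int ^ 'd \<Rightarrow> real) \<Rightarrow> real"
  assumes "h \<in> borel_measurable P"
  shows "(\<lambda>\<omega>. h (shift z \<omega>)) \<in> borel_measurable P" "expectation (\<lambda>\<omega>. h (shift z \<omega>)) = expectation h"
proof -
  have h: "h \<in> borel_measurable (config_algebra A UNIV)" using assms measurable_cong_sets[OF sets_P refl] by blast
  show "(\<lambda>\<omega>. h (shift z \<omega>)) \<in> borel_measurable P" by (rule measurable_compose[OF shift_measurable h])
  have "expectation h = integral\<^sup>L (distr P (config_algebra A UNIV) (shift z)) h"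
    using stat by (simp add: stationary_def)
  also have "\<dots> = expectation (\<lambda>\<omega>. h (shift z \<omega>))" by (rule integral_distr[OF shift_measurable h])
  finally show "expectation (\<lambda>\<omega>. h (shift z \<omega>)) = expectation h" by simp
qed

lemma bounded_integrable:
  fixes h :: "(int ^ 'd \<Rightarrow> real) \<Rightarrow> real"
  assumes "h \<in> borel_measurable P" "\<And>\<omega>. \<bar>h \<omega>\<bar> \<le> C"
  shows "integrable P h"
  by (rule integrable_const_bound[where B = C]) (use assms in auto)

text \<open>Dominated convergence along sequences that approach x from the right.\<close>

lemma expectation_rc:
  fixes g :: "(int ^ 'd \<Rightarrow> real) \<Rightarrow> real \<Rightarrow> real"
  assumes m: "\<And>x. (\<lambda>\<omega>. g \<omega> x) \<in> borel_measurable P" and bd: "\<And>\<omega> x. \<bar>g \<omega> x\<bar> \<le> C"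
    and rc: "\<And>\<omega>. continuous (at_right x) (g \<omega>)"
  shows "continuous (at_right x) (\<lambda>x. expectation (\<lambda>\<omega>. g \<omega> x))"
  unfolding continuous_within
proof (rule tendsto_at_right_sequentially[of x "x + 1"])
  fix S :: "nat \<Rightarrow> real" assume S: "\<And>n. x < S n" "S \<longlonglongrightarrow> x"
  have "filterlim S (at_right x) sequentially" by (rule tendsto_imp_filterlim_at_right[OF S(2)]) (use S(1) in simp)
  then have "(\<lambda>n. g \<omega> (S n)) \<longlonglongrightarrow> g \<omega> x" for \<omega>
    using rc[of \<omega>] unfolding continuous_within by (rule filterlim_compose[rotated])
  then show "(\<lambda>n. expectation (\<lambda>\<omega>. g \<omega> (S n))) \<longlonglongrightarrow> expectation (\<lambda>\<omega>. g \<omega> x)"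
    by (intro integral_dominated_convergence[where w = "\<lambda>_. C"]) (use m bd in auto)
qed simp

lemma dos_P: "(\<lambda>\<omega>. dos \<omega> x) \<in> borel_measurable P" "integrable P (\<lambda>\<omega>. dos \<omega> x)"
proof -
  show m: "(\<lambda>\<omega>. dos \<omega> x) \<in> borel_measurable P" by (rule meas_P[OF dos_measurable])
  show "integrable P (\<lambda>\<omega>. dos \<omega> x)"
    by (rule bounded_integrable[OF m, of 1]) (use dos_props(1,2) in \<open>auto intro!: abs_le_of_nonneg\<close>)
qed

lemma ids_rc_bounded: "ids P \<in> rc_bounded"
proof -
  have "ids P = (\<lambda>x. expectation (\<lambda>\<omega>. dos \<omega> x))" by (rule ext) (rule ids_eq_dos)
  moreover have "continuous (at_right x) (\<lambda>x. expectation (\<lambda>\<omega>. dos \<omega> x))" for x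
    by (rule expectation_rc[where C = 1]) (use dos_props dos_P in \<open>auto intro!: abs_le_of_nonneg\<close>)
  moreover have "\<bar>expectation (\<lambda>\<omega>. dos \<omega> x)\<bar> \<le> 1" for x
  proof -
    have "expectation (\<lambda>\<omega>. dos \<omega> x) \<le> expectation (\<lambda>\<omega>. 1)" by (rule integral_mono) (use dos_P dos_props in auto)
    moreover have "0 \<le> expectation (\<lambda>\<omega>. dos \<omega> x)" by (rule Bochner_Integration.integral_nonneg) (rule dos_props)
    ultimately show ?thesis by (simp add: prob_space)
  qed
  ultimately show ?thesis by (auto simp: rc_bounded_def bounded_iff intro!: exI[of _ 1])
qed

section \<open>Expected counting functions and the density of states\<close>

abbreviation Ef :: "(int ^ 'd) set \<Rightarrow> real \<Rightarrow> real" where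
  "Ef \<Lambda> x \<equiv> expectation (\<lambda>\<omega>. eigenvalue_count \<Lambda> \<omega> x)"

lemma f_P: "finite \<Lambda> \<Longrightarrow> (\<lambda>\<omega>. eigenvalue_count \<Lambda> \<omega> x) \<in> borel_measurable P"
  "finite \<Lambda> \<Longrightarrow> integrable P (\<lambda>\<omega>. eigenvalue_count \<Lambda> \<omega> x)"
proof -
  assume fin: "finite \<Lambda>"
  show m: "(\<lambda>\<omega>. eigenvalue_count \<Lambda> \<omega> x) \<in> borel_measurable P" by (rule meas_P[OF eigenvalue_count_measurable[OF fin]])
  show "integrable P (\<lambda>\<omega>. eigenvalue_count \<Lambda> \<omega> x)"
    by (rule bounded_integrable[OF m, of "real (card \<Lambda>)"]) (use eigenvalue_count_props(1,2)[OF fin] in \<open>auto intro!: abs_le_of_nonneg\<close>)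
qed

lemma Ef_bounds:
  assumes fin: "finite \<Lambda>"
  shows "0 \<le> Ef \<Lambda> x" "Ef \<Lambda> x \<le> real (card \<Lambda>)" "x \<le> y \<Longrightarrow> Ef \<Lambda> x \<le> Ef \<Lambda> y"
    "continuous (at_right x) (Ef \<Lambda>)"
proof -
  note p = eigenvalue_count_props[OF fin]
  show "0 \<le> Ef \<Lambda> x" by (rule Bochner_Integration.integral_nonneg) (rule p)
  have "Ef \<Lambda> x \<le> expectation (\<lambda>\<omega>. real (card \<Lambda>))" by (rule integral_mono) (use f_P[OF fin] p in auto)
  then show "Ef \<Lambda> x \<le> real (card \<Lambda>)" by (simp add: prob_space)
  show "x \<le> y \<Longrightarrow> Ef \<Lambda> x \<le> Ef \<Lambda> y" by (rule integral_mono) (use f_P[OF fin] p in auto)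
  show "continuous (at_right x) (Ef \<Lambda>)"
    by (rule expectation_rc[where C = "real (card \<Lambda>)"]) (use f_P[OF fin] p in \<open>auto intro!: abs_le_of_nonneg\<close>)
qed

text \<open>Stationarity undoes the shift that moved each site to the origin in
  \<open>eigenvalue_count_pfin\<close>.\<close>

lemma Ef_pfin:
  assumes fin: "finite \<Lambda>"
  shows "Ef \<Lambda> x = (\<Sum>z\<in>\<Lambda>. expectation (\<lambda>\<omega>. pfin (translate \<Lambda> (- z)) \<omega> x))"
    "z \<in> \<Lambda> \<Longrightarrow> integrable P (\<lambda>\<omega>. pfin (translate \<Lambda> (- z)) \<omega> x)"
    "z \<in> \<Lambda> \<Longrightarrow> 0 \<le> pfin (translate \<Lambda> (- z)) \<omega> x \<and> pfin (translate \<Lambda> (- z)) \<omega> x \<le> 1"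
proof -
  have m: "(\<lambda>\<omega>. pfin (translate \<Lambda> (- z)) \<omega> x) \<in> borel_measurable P" if "z \<in> \<Lambda>" for z
    by (rule meas_P[OF pfin_measurable]) (use fin that in \<open>auto simp: mem_translate\<close>)
  show b: "0 \<le> pfin (translate \<Lambda> (- z)) \<omega> x \<and> pfin (translate \<Lambda> (- z)) \<omega> x \<le> 1" if "z \<in> \<Lambda>" for z \<omega>
  proof -
    have "0 \<in> translate \<Lambda> (- z)" using that by (simp add: mem_translate)
    then show ?thesis
      using norm_projection_bounds(1,2)[OF Qf_roi[OF finite_translate[OF fin]] lsp_closed(9) norm_dl] by (simp add: pfin_def)
  qed
  show i: "integrable P (\<lambda>\<omega>. pfin (translate \<Lambda> (- z)) \<omega> x)" if "z \<in> \<Lambda>" for z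
    by (rule bounded_integrable[OF m[OF that], of 1]) (use b[OF that] in \<open>auto intro!: abs_le_of_nonneg\<close>)
  have ish: "integrable P (\<lambda>\<omega>. pfin (translate \<Lambda> (- z)) (shift z \<omega>) x)" if "z \<in> \<Lambda>" for z
    by (rule bounded_integrable[OF expectation_shift(1)[OF m[OF that]], where C = 1]) (use b[OF that] in \<open>auto intro!: abs_le_of_nonneg\<close>)
  show "Ef \<Lambda> x = (\<Sum>z\<in>\<Lambda>. expectation (\<lambda>\<omega>. pfin (translate \<Lambda> (- z)) \<omega> x))"
    unfolding eigenvalue_count_pfin[OF fin]
    by (subst Bochner_Integration.integral_sum[OF ish]) (auto intro!: sum.cong expectation_shift(2)[OF m])
qed

lemma ball_in_translate:
  fixes \<Lambda> :: "(int ^ 'd) set"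
  assumes "z \<in> inner_part L \<Lambda>"
  shows "l1_ball L \<subseteq> translate \<Lambda> (- z)"
proof
  fix y :: "int ^ 'd" assume y: "y \<in> l1_ball L"
  have "y + z \<in> \<Lambda>"
  proof (rule ccontr)
    assume "y + z \<notin> \<Lambda>"
    then have "L < l1_norm (z - (y + z))" using assms unfolding mem_inner_part by blast
    then have "L < l1_norm (- y)" by simp
    then show False using y unfolding l1_norm_minus by (simp add: l1_ball_def)
  qed
  then show "y \<in> translate \<Lambda> (- z)" by (simp add: mem_translate)
qed

text \<open>Sites deeper than L in the cube are surrounded by a full ball of radius L, where
  \<open>dos_compare\<close> applies. The others form a fraction of at most 2dL/n, and each
  contributes a number between 0 and 1.\<close>

lemma Ef_ids_compare:
  assumes n: "1 \<le> n" and L: "1 \<le> L" and ab: "a < b"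
  defines "\<epsilon> \<equiv> real (card (nb :: (int ^ 'd) set)) * (1 / real L) / (b - a)"
  defines "e \<equiv> 2 * \<epsilon> + \<epsilon>\<^sup>2 + real CARD('d) * (2 * real L / real n)"
  shows "Ef (cube n) a / real n ^ CARD('d) \<le> ids P b + e" "ids P a \<le> Ef (cube n) b / real n ^ CARD('d) + e"
proof -
  let ?I = "inner_part L (cube n) :: (int ^ 'd) set" and ?C = "cube n :: (int ^ 'd) set"
  have sub: "?I \<subseteq> ?C" by (auto simp: inner_part_def)
  have \<epsilon>: "0 \<le> \<epsilon>" using ab by (simp add: \<epsilon>_def)
  define p where "p x z = expectation (\<lambda>\<omega>. pfin (translate ?C (- z)) \<omega> x)" for x z
  have Ef: "Ef ?C x = (\<Sum>z\<in>?C. p x z)" for x unfolding p_def by (rule Ef_pfin) simp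
  have p01: "0 \<le> p x z" "p x z \<le> 1" if "z \<in> ?C" for x z
  proof -
    show "0 \<le> p x z" unfolding p_def by (rule Bochner_Integration.integral_nonneg) (use Ef_pfin(3)[OF finite_cube that] in simp)
    have "p x z \<le> expectation (\<lambda>\<omega>. 1)"
      unfolding p_def by (rule integral_mono) (use Ef_pfin(2,3)[OF finite_cube that] in auto)
    then show "p x z \<le> 1" by (simp add: prob_space)
  qed
  have cmp: "p a z \<le> ids P b + (2 * \<epsilon> + \<epsilon>\<^sup>2)" "ids P a \<le> p b z + (2 * \<epsilon> + \<epsilon>\<^sup>2)" if z: "z \<in> ?I" for z
  proof -
    have zC: "z \<in> ?C" using z sub by blast
    note i = Ef_pfin(2)[OF finite_cube zC] and dc = dos_compare[OF finite_translate[OF finite_cube] ball_in_translate[OF z] L ab, folded \<epsilon>_def]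
    have "p a z \<le> expectation (\<lambda>\<omega>. dos \<omega> b + (2 * \<epsilon> + \<epsilon>\<^sup>2))"
      unfolding p_def by (rule integral_mono) (use i dos_P dc in auto)
    then show "p a z \<le> ids P b + (2 * \<epsilon> + \<epsilon>\<^sup>2)" using dos_P by (simp add: ids_eq_dos prob_space)
    have "ids P a \<le> expectation (\<lambda>\<omega>. pfin (translate ?C (- z)) \<omega> b + (2 * \<epsilon> + \<epsilon>\<^sup>2))"
      unfolding ids_eq_dos by (rule integral_mono) (use i dos_P dc in auto)
    then show "ids P a \<le> p b z + (2 * \<epsilon> + \<epsilon>\<^sup>2)" using i by (simp add: p_def prob_space)
  qed
  have ids01: "0 \<le> ids P x" "ids P x \<le> 1" for x
  proof -
    show "0 \<le> ids P x" unfolding ids_eq_dos by (rule Bochner_Integration.integral_nonneg) (rule dos_props)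
    have "ids P x \<le> expectation (\<lambda>\<omega>. 1)" unfolding ids_eq_dos by (rule integral_mono) (use dos_P dos_props in auto)
    then show "ids P x \<le> 1" by (simp add: prob_space)
  qed
  have cC: "real (card ?C) = real n ^ CARD('d)" by (simp add: card_cube)
  have N: "0 < real n ^ CARD('d)" using n by simp
  have rest: "real (card (?C - ?I)) \<le> real CARD('d) * (2 * real L / real n) * real n ^ CARD('d)"
  proof -
    have "real (card (?C - ?I)) = real (card ?C) - real (card ?I)"
      using sub by (subst card_Diff_subset) (auto simp: of_nat_diff card_mono)
    then show ?thesis using card_cube_inner_defect[where m = n and r = L and 'd = 'd] by (simp add: cC)
  qed
  have split: "sum g ?C = sum g ?I + sum g (?C - ?I)" for g :: "int ^ 'd \<Rightarrow> real"
    using sum.subset_diff[OF sub finite_cube, of g] by simp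
  have cs: "sum (\<lambda>z. c) ?I \<le> c * real n ^ CARD('d)" if "0 \<le> c" for c :: real
    using that card_mono[OF finite_cube sub] by (simp add: cC[symmetric] mult.commute mult_left_mono)
  have "Ef ?C a \<le> (\<Sum>z\<in>?I. ids P b + (2 * \<epsilon> + \<epsilon>\<^sup>2)) + (\<Sum>z\<in>?C - ?I. 1)"
    unfolding Ef split by (intro add_mono sum_mono cmp p01) auto
  also have "\<dots> \<le> (ids P b + (2 * \<epsilon> + \<epsilon>\<^sup>2)) * real n ^ CARD('d) + real CARD('d) * (2 * real L / real n) * real n ^ CARD('d)"
    by (intro add_mono cs) (use ids01 \<epsilon> rest in auto)
  also have "\<dots> = (ids P b + e) * real n ^ CARD('d)" by (simp add: e_def algebra_simps)
  finally show "Ef ?C a / real n ^ CARD('d) \<le> ids P b + e" using N by (simp add: pos_divide_le_eq)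
  have "ids P a * real n ^ CARD('d) = (\<Sum>z\<in>?I. ids P a) + (\<Sum>z\<in>?C - ?I. ids P a)"
    using split[of "\<lambda>_. ids P a"] by (simp add: cC mult.commute)
  also have "\<dots> \<le> (\<Sum>z\<in>?I. p b z + (2 * \<epsilon> + \<epsilon>\<^sup>2)) + (\<Sum>z\<in>?C - ?I. p b z + 1)"
    by (intro add_mono sum_mono cmp) (use p01 ids01(2) in \<open>auto intro: add_increasing\<close>)
  also have "\<dots> = Ef ?C b + (\<Sum>z\<in>?I. 2 * \<epsilon> + \<epsilon>\<^sup>2) + real (card (?C - ?I))"
    unfolding Ef split[of "p b"] by (simp add: sum.distrib)
  also have "\<dots> \<le> Ef ?C b + (2 * \<epsilon> + \<epsilon>\<^sup>2) * real n ^ CARD('d) + real CARD('d) * (2 * real L / real n) * real n ^ CARD('d)"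
    by (intro add_mono order_refl cs rest) (use \<epsilon> in simp)
  also have "\<dots> = Ef ?C b + e * real n ^ CARD('d)" by (simp add: e_def algebra_simps)
  finally have "ids P a * real n ^ CARD('d) / real n ^ CARD('d) \<le> (Ef ?C b + e * real n ^ CARD('d)) / real n ^ CARD('d)"
    using N by (intro divide_right_mono) auto
  then show "ids P a \<le> Ef ?C b / real n ^ CARD('d) + e" using N by (simp add: add_divide_distrib)
qed

end

section \<open>Tiling a cube by smaller cubes\<close>

lemma mem_tiles:
  fixes t :: "int ^ 'd"
  assumes "1 \<le> m"
  shows "t \<in> tiles m n \<longleftrightarrow> (\<forall>i. int m dvd t $ i \<and> 0 \<le> t $ i \<and> t $ i + int m \<le> int n)"
proof -
  have "translate (cube m) t \<subseteq> cube n \<longleftrightarrow> (\<forall>i. 0 \<le> t $ i \<and> t $ i + int m \<le> int n)" for t :: "int ^ 'd"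
  proof
    assume s: "translate (cube m) t \<subseteq> cube n"
    have "t \<in> translate (cube m) t" "t + (\<chi> i. int m - 1) \<in> translate (cube m) t"
      using assms by (auto simp: mem_translate cube_def)
    then have "t \<in> cube n" "t + (\<chi> i. int m - 1) \<in> cube n" using s by auto
    then have "0 \<le> t $ i" "t $ i + (int m - 1) < int n" for i by (simp_all add: cube_def)
    then show "\<forall>i. 0 \<le> t $ i \<and> t $ i + int m \<le> int n" by (metis add_diff_eq zle_diff1_eq diff_add_cancel zless_add1_eq add1_zle_eq)
  next
    assume a: "\<forall>i. 0 \<le> t $ i \<and> t $ i + int m \<le> int n"
    show "translate (cube m) t \<subseteq> cube n"
    proof
      fix x assume "x \<in> translate (cube m) t"
      then have "0 \<le> x $ i - t $ i \<and> x $ i - t $ i < int m" for i by (simp add: mem_translate cube_def)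
      then show "x \<in> cube n" using a unfolding cube_def by (smt (verit) mem_Collect_eq)
    qed
  qed
  then show ?thesis by (auto simp: tiles_def)
qed

lemma card_tiles:
  assumes m: "1 \<le> m"
  shows "card (tiles m n :: (int ^ 'd) set) = (n div m) ^ CARD('d)"
proof -
  have "bij_betw (\<lambda>u. \<chi> i. int m * u $ i) (cube (n div m)) (tiles m n :: (int ^ 'd) set)"
  proof (rule bij_betw_byWitness[where f' = "\<lambda>t. \<chi> i. t $ i div int m"])
    show "\<forall>u\<in>cube (n div m). (\<chi> i. (\<chi> i. int m * u $ i) $ i div int m) = (u :: int ^ 'd)"
      using m by (simp add: vec_eq_iff)
    show "\<forall>t\<in>tiles m n. (\<chi> i. int m * (\<chi> i. t $ i div int m) $ i) = (t :: int ^ 'd)"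
      using m by (simp add: vec_eq_iff mem_tiles)
    have key: "int m * k + int m \<le> int n \<longleftrightarrow> k < int (n div m)" for k
    proof -
      have "int m * k + int m = int m * (k + 1)" by (simp add: algebra_simps)
      moreover have "int m * (k + 1) \<le> int n \<longleftrightarrow> k + 1 \<le> int n div int m"
      proof
        assume "int m * (k + 1) \<le> int n"
        then have "int m * (k + 1) div int m \<le> int n div int m" using m by (intro zdiv_mono1) auto
        then show "k + 1 \<le> int n div int m" using m by simp
      next
        assume "k + 1 \<le> int n div int m"
        then have "int m * (k + 1) \<le> int m * (int n div int m)" by (intro mult_left_mono) auto
        also have "\<dots> = int n - int n mod int m" by (rule minus_mod_eq_mult_div[symmetric])
        also have "\<dots> \<le> int n" using m by simp
        finally show "int m * (k + 1) \<le> int n" .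
      qed
      ultimately show ?thesis by (simp add: zdiv_int add1_zle_eq)
    qed
    show "(\<lambda>u. \<chi> i. int m * u $ i) ` cube (n div m) \<subseteq> (tiles m n :: (int ^ 'd) set)"
      using m key by (auto simp: mem_tiles cube_def)
    show "(\<lambda>t. \<chi> i. t $ i div int m) ` (tiles m n :: (int ^ 'd) set) \<subseteq> cube (n div m)"
    proof clarify
      fix t :: "int ^ 'd" assume t: "t \<in> tiles m n"
      show "(\<chi> i. t $ i div int m) \<in> cube (n div m)"
        unfolding cube_def mem_Collect_eq
      proof
        fix i
        have "int m dvd t $ i" "0 \<le> t $ i" "t $ i + int m \<le> int n" using t m by (auto simp: mem_tiles)
        then show "0 \<le> (\<chi> i. t $ i div int m) $ i \<and> (\<chi> i. t $ i div int m) $ i < int (n div m)"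
          using key[of "t $ i div int m"] m by (simp add: pos_imp_zdiv_nonneg_iff)
      qed
    qed
  qed
  then show ?thesis using bij_betw_same_card card_cube by metis
qed

lemma finite_tiles:
  assumes "1 \<le> m"
  shows "finite (tiles m n)"
proof (rule finite_subset[OF _ finite_vec_box[of 0 "int n"]], clarify)
  fix t :: "int ^ 'a" and i assume "t \<in> tiles m n"
  then have "0 \<le> t $ i \<and> t $ i + int m \<le> int n" using assms by (simp add: mem_tiles)
  then show "0 \<le> t $ i \<and> t $ i \<le> int n" by linarith
qed

text \<open>Distinct multiples of m differ by at least m, so distinct tiles are separated in some
  coordinate.\<close>

lemma tiles_disjoint:
  assumes m: "1 \<le> m" and st: "s \<in> tiles m n" "t \<in> tiles m n" "s \<noteq> t" and x: "x \<in> translate (cube m) s"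
  shows "x \<notin> translate (cube m) t"
proof
  assume x': "x \<in> translate (cube m) t"
  obtain i where i: "s $ i \<noteq> t $ i" using st(3) by (auto simp: vec_eq_iff)
  obtain j k where jk: "s $ i = int m * j" "t $ i = int m * k" using st(1,2) m by (auto simp: mem_tiles dvd_def) metis
  have b: "\<bar>s $ i - t $ i\<bar> < int m"
    using x x' by (auto simp: mem_translate cube_def abs_less_iff) (smt (verit))+
  have "1 \<le> \<bar>j - k\<bar>" using i jk by auto
  then have "int m * 1 \<le> int m * \<bar>j - k\<bar>" by (intro mult_left_mono) auto
  also have "\<dots> = \<bar>s $ i - t $ i\<bar>" using jk by (simp add: abs_mult right_diff_distrib[symmetric])
  finally show False using b by simp
qed

text \<open>The cube is cut into the shrunken tiles and a remainder R. The remainder costs its count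
  and its boundary term, each at most |R|, and |R|/n^d consists of the uncovered fraction \<theta>
  and the corridors. Normalizing by the covered volume instead of n^d costs \<theta> once more. The
  total is 2d/m + 4dr/m + 3 \<theta>.\<close>

lemma tiling_estimate:
  fixes \<omega> :: "int ^ 'd \<Rightarrow> real" and r :: nat
  assumes m: "1 \<le> m" "m < n"
  defines "\<Lambda>' \<equiv> inner_part r (cube m) :: (int ^ 'd) set" and "T \<equiv> tiles m n :: (int ^ 'd) set"
  shows "\<bar>eigenvalue_count (cube n) \<omega> x / real n ^ CARD('d) -
      (\<Sum>t\<in>T. eigenvalue_count \<Lambda>' (shift t \<omega>) x) / real (card T) / real m ^ CARD('d)\<bar>
    \<le> real CARD('d) * (2 + 4 * real r) / real m + 3 * real CARD('d) * real m / real n"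
proof -
  let ?d = "CARD('d)" and ?C = "cube n :: (int ^ 'd) set"
  define R where "R = ?C - (\<Union>t\<in>T. translate \<Lambda>' t)"
  \<comment> \<open>The remainder gets the index \<open>None\<close>, so that one disjoint family
    covers the whole cube.\<close>
  define \<Lambda>s where "\<Lambda>s i = (case i of None \<Rightarrow> R | Some t \<Rightarrow> translate \<Lambda>' t)" for i
  define I where "I = insert None (Some ` T)"
  have finT: "finite T" unfolding T_def by (rule finite_tiles[OF m(1)])
  have fin': "finite \<Lambda>'" by (simp add: \<Lambda>'_def)
  have sub': "\<Lambda>' \<subseteq> cube m" by (auto simp: \<Lambda>'_def inner_part_def)
  have tsub: "translate \<Lambda>' t \<subseteq> translate (cube m) t" for t using sub' by (auto simp: mem_translate)
  have tC: "translate \<Lambda>' t \<subseteq> ?C" if "t \<in> T" for t using tsub[of t] that by (auto simp: T_def tiles_def)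
  have dj: "translate \<Lambda>' s \<inter> translate \<Lambda>' t = {}" if "s \<in> T" "t \<in> T" "s \<noteq> t" for s t
    using tiles_disjoint[OF m(1), of s n t] that tsub unfolding T_def by blast
  have finI: "finite I" using finT by (simp add: I_def)
  have fins: "finite (\<Lambda>s i)" if "i \<in> I" for i using fin' by (auto simp: \<Lambda>s_def R_def split: option.split)
  have disj: "disjoint_family_on \<Lambda>s I"
    unfolding disjoint_family_on_def I_def using dj by (auto simp: \<Lambda>s_def R_def)
  have un: "(\<Union>i\<in>I. \<Lambda>s i) = ?C" using tC by (auto simp: I_def \<Lambda>s_def R_def)
  have sumI: "(\<Sum>i\<in>I. g (\<Lambda>s i)) = g R + (\<Sum>t\<in>T. g (translate \<Lambda>' t))" for g :: "(int ^ 'd) set \<Rightarrow> real"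
    unfolding I_def using finT by (simp add: \<Lambda>s_def sum.reindex)
  define S where "S = (\<Sum>t\<in>T. eigenvalue_count \<Lambda>' (shift t \<omega>) x)"
  define N where "N = real n ^ ?d"
  define M where "M = real m ^ ?d"
  define c' where "c' = real (card \<Lambda>')"
  define k where "k = real (card T)"
  have pos: "0 < N" "0 < M" using m by (auto simp: N_def M_def)
  have k: "k = real (n div m) ^ ?d" using card_tiles[OF m(1), where n = n and 'd = 'd] by (simp add: k_def T_def)
  have "1 \<le> n div m" using m by (simp add: div_greater_zero_iff Suc_le_eq)
  then have k1: "1 \<le> k" unfolding k by (simp add: one_le_power)
  have c': "0 \<le> c'" "c' \<le> M"
    using card_mono[OF finite_cube sub'] by (auto simp: c'_def M_def card_cube simp flip: of_nat_power)
  have cR: "real (card R) = N - k * c'"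
  proof -
    have "card (\<Union>t\<in>T. translate \<Lambda>' t) = (\<Sum>t\<in>T. card (translate \<Lambda>' t))"
      by (rule card_UN_disjoint) (use finT fin' dj in auto)
    then have cU: "card (\<Union>t\<in>T. translate \<Lambda>' t) = card T * card \<Lambda>'" by simp
    have "card R = card ?C - card T * card \<Lambda>'"
      unfolding R_def cU[symmetric] by (rule card_Diff_subset) (use finT fin' tC in auto)
    moreover have "card T * card \<Lambda>' \<le> card ?C"
      unfolding cU[symmetric] by (rule card_mono) (use tC in auto)
    ultimately show ?thesis by (simp add: of_nat_diff N_def k_def c'_def card_cube)
  qed
  have "\<bar>eigenvalue_count ?C \<omega> x - (eigenvalue_count R \<omega> x + S)\<bar> \<le> bterm R + k * bterm \<Lambda>'"
    using eigenvalue_count_decouple[OF finI fins disj, of \<omega> x, unfolded un sumI[of "\<lambda>\<Lambda>. eigenvalue_count \<Lambda> \<omega> x"] sumI[of bterm]]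
    by (simp add: S_def k_def eigenvalue_count_translate[OF fin'])
  moreover have "0 \<le> eigenvalue_count R \<omega> x" "eigenvalue_count R \<omega> x \<le> real (card R)" "bterm R \<le> real (card R)"
    using eigenvalue_count_props(1,2)[of R \<omega> x] bterm_bounds[of R] by (simp_all add: R_def)
  ultimately have main: "\<bar>eigenvalue_count ?C \<omega> x - S\<bar> \<le> k * bterm \<Lambda>' + 2 * real (card R)" by linarith
  have S: "0 \<le> S" "S \<le> k * c'"
    unfolding S_def k_def c'_def using eigenvalue_count_props(1,2)[OF fin']
    by (auto intro!: sum_nonneg sum_bounded_above)
  \<comment> \<open>The fraction of the cube that the full tiles leave uncovered;
    \<open>k * M\<close> is their total volume.\<close>
  define \<theta> where "\<theta> = 1 - k * M / N"
  have \<theta>: "0 \<le> \<theta>" "\<theta> \<le> real ?d * real m / real n"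
  proof -
    let ?t = "real (n mod m) / real n"
    have nm: "real n = real (n div m) * real m + real (n mod m)"
      by (metis div_mult_mod_eq of_nat_add of_nat_mult)
    have t: "0 \<le> ?t" "?t \<le> 1" using m by (auto simp: mod_less_eq_dividend)
    have "real (n div m) * real m / real n = 1 - ?t" using m nm by (simp add: field_simps)
    then have "k * M / N = (1 - ?t) ^ ?d" unfolding k M_def N_def by (simp add: power_mult_distrib[symmetric] power_divide[symmetric])
    then have eq: "\<theta> = 1 - (1 - ?t) ^ ?d" by (simp add: \<theta>_def)
    show "0 \<le> \<theta>" unfolding eq using t by (simp add: power_le_one)
    have "\<theta> \<le> real ?d * ?t" unfolding eq by (rule power_defect[OF t])
    also have "\<dots> \<le> real ?d * (real m / real n)"
      using m by (intro mult_left_mono divide_right_mono) (auto simp: less_imp_le)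
    finally show "\<theta> \<le> real ?d * real m / real n" by simp
  qed
  have kM: "k * M \<le> N" using \<theta>(1) pos by (simp add: \<theta>_def field_simps)
  have cdef: "1 - c' / M \<le> 2 * real ?d * real r / real m"
  proof -
    have "M - c' \<le> real ?d * (2 * real r / real m) * M"
      using card_cube_inner_defect[where m = m and r = r and 'd = 'd] by (simp add: M_def c'_def \<Lambda>'_def)
    then have "(M - c') / M \<le> real ?d * (2 * real r / real m)" using pos by (simp add: pos_divide_le_eq)
    moreover have "real ?d * (2 * real r / real m) = 2 * real ?d * real r / real m" by simp
    ultimately show ?thesis using pos by (simp add: diff_divide_distrib mult.assoc mult.left_commute)
  qed
  have Rn: "real (card R) / N \<le> \<theta> + 2 * real ?d * real r / real m"
  proof -
    have "real (card R) / N = \<theta> + (k * M / N) * (1 - c' / M)"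
      using pos by (simp add: cR \<theta>_def field_simps)
    also have "\<dots> \<le> \<theta> + 1 * (1 - c' / M)"
      using kM pos c' by (intro add_left_mono mult_right_mono) (auto simp: field_simps)
    finally show ?thesis using cdef by simp
  qed
  have bt: "bterm \<Lambda>' \<le> 2 * real ?d / real m * M"
  proof -
    let ?s = "m - 2 * r"
    have "bterm \<Lambda>' = bterm (cube ?s :: (int ^ 'd) set)" by (simp add: \<Lambda>'_def inner_part_cube)
    also have "\<dots> \<le> real ?d * (2 / real ?s) * real ?s ^ ?d" by (rule bterm_cube)
    \<comment> \<open>If the shrunken tile is empty the left side is 0, the positive power of 0
      being a factor.\<close>
    also have "\<dots> \<le> 2 * real ?d * real ?s ^ (?d - 1)"
      by (cases "?s = 0") (auto simp: power_eq_if)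
    also have "\<dots> \<le> 2 * real ?d * real m ^ (?d - 1)" by (intro mult_left_mono power_mono) auto
    also have "\<dots> = 2 * real ?d / real m * M" using m by (simp add: M_def power_eq_if)
    finally show ?thesis .
  qed
  have kb: "k * bterm \<Lambda>' / N \<le> 2 * real ?d / real m"
  proof -
    have "k * bterm \<Lambda>' \<le> k * (2 * real ?d / real m * M)" using bt k1 by (intro mult_left_mono) auto
    also have "\<dots> = 2 * real ?d / real m * (k * M)" by simp
    also have "\<dots> \<le> 2 * real ?d / real m * N" using kM by (intro mult_left_mono) auto
    finally show ?thesis using pos by (simp add: pos_divide_le_eq)
  qed
  have "\<bar>eigenvalue_count ?C \<omega> x / N - S / N\<bar> = \<bar>eigenvalue_count ?C \<omega> x - S\<bar> / N"
    using pos by (simp add: diff_divide_distrib[symmetric])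
  also have "\<dots> \<le> (k * bterm \<Lambda>' + 2 * real (card R)) / N" using main pos by (intro divide_right_mono) auto
  also have "\<dots> = k * bterm \<Lambda>' / N + 2 * (real (card R) / N)" by (simp add: add_divide_distrib)
  finally have 1: "\<bar>eigenvalue_count ?C \<omega> x / N - S / N\<bar> \<le> 2 * real ?d / real m + (2 * \<theta> + 2 * (2 * real ?d * real r / real m))"
    using kb mult_left_mono[OF Rn, of 2] unfolding distrib_left by linarith
  have 2: "\<bar>S / N - S / k / M\<bar> \<le> \<theta>"
  proof -
    have "S / k / M - S / N = S / (k * M) * \<theta>" using pos k1 by (simp add: \<theta>_def field_simps)
    moreover have "S / (k * M) \<le> 1"
    proof -
      have "S \<le> k * M" using S(2) c'(2) k1 by (meson mult_left_mono order_trans zero_le_one)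
      then show ?thesis using pos k1 by (simp add: pos_divide_le_eq)
    qed
    moreover have "0 \<le> S / (k * M)" using S(1) pos k1 by simp
    ultimately have "\<bar>S / k / M - S / N\<bar> \<le> 1 * \<theta>"
      using \<theta>(1) mult_right_mono[of "S / (k * M)" 1 \<theta>] by (simp only: abs_mult abs_of_nonneg)
    then show ?thesis by (simp add: abs_minus_commute)
  qed
  have "2 * real ?d / real m + (2 * \<theta> + 2 * (2 * real ?d * real r / real m)) + \<theta>
    = real ?d * (2 + 4 * real r) / real m + 3 * \<theta>" by (simp add: add_divide_distrib algebra_simps)
  also have "\<dots> \<le> real ?d * (2 + 4 * real r) / real m + 3 * real ?d * real m / real n" using \<theta>(2) by simp
  finally have "\<bar>eigenvalue_count ?C \<omega> x / N - S / k / M\<bar> \<le> real ?d * (2 + 4 * real r) / real m + 3 * real ?d * real m / real n"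
    using 1 2 by linarith
  then show ?thesis by (simp add: N_def S_def k_def M_def)
qed

context random_field begin

text \<open>Expectation of \<open>tiling_estimate\<close>: by stationarity all tiles have the same
  mean.\<close>

lemma Ef_tiling:
  assumes m: "1 \<le> m" "m < n"
  shows "\<bar>Ef (cube n) x / real n ^ CARD('d) - Ef (inner_part r (cube m)) x / real m ^ CARD('d)\<bar>
    \<le> real CARD('d) * (2 + 4 * real r) / real m + 3 * real CARD('d) * real m / real n" (is "_ \<le> ?e")
proof -
  let ?\<Lambda>' = "inner_part r (cube m) :: (int ^ 'd) set" and ?T = "tiles m n :: (int ^ 'd) set"
  have fT: "finite ?T" by (rule finite_tiles[OF m(1)])
  have "0 < card ?T" using m by (simp add: card_tiles div_greater_zero_iff)
  have f': "(\<lambda>\<omega>. eigenvalue_count ?\<Lambda>' \<omega> x) \<in> borel_measurable P" by (rule f_P) simp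
  have ish: "integrable P (\<lambda>\<omega>. eigenvalue_count ?\<Lambda>' (shift t \<omega>) x)" for t
    by (rule bounded_integrable[OF expectation_shift(1)[OF f'], where C = "real (card ?\<Lambda>')"])
       (use eigenvalue_count_props(1,2)[of ?\<Lambda>'] in simp)
  define g where "g \<omega> = eigenvalue_count (cube n) \<omega> x / real n ^ CARD('d) -
      (\<Sum>t\<in>?T. eigenvalue_count ?\<Lambda>' (shift t \<omega>) x) / real (card ?T) / real m ^ CARD('d)" for \<omega> :: "int ^ 'd \<Rightarrow> real"
  have ig: "integrable P g" unfolding g_def using ish f_P(2)[OF finite_cube] by (intro Bochner_Integration.integrable_diff) auto
  have "expectation g = Ef (cube n) x / real n ^ CARD('d) - (\<Sum>t\<in>?T. Ef ?\<Lambda>' x) / real (card ?T) / real m ^ CARD('d)"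
    unfolding g_def using ish f_P(2)[OF finite_cube]
    by (subst Bochner_Integration.integral_diff) (auto simp: Bochner_Integration.integral_sum[OF ish] expectation_shift(2)[OF f'])
  also have "\<dots> = Ef (cube n) x / real n ^ CARD('d) - Ef ?\<Lambda>' x / real m ^ CARD('d)" using \<open>0 < card ?T\<close> by simp
  finally have eq: "expectation g = Ef (cube n) x / real n ^ CARD('d) - Ef ?\<Lambda>' x / real m ^ CARD('d)" .
  have b: "\<bar>g \<omega>\<bar> \<le> ?e" for \<omega> unfolding g_def by (rule tiling_estimate[OF m])
  have "\<bar>expectation g\<bar> \<le> expectation (\<lambda>\<omega>. \<bar>g \<omega>\<bar>)" by (rule integral_abs_bound)
  also have "\<dots> \<le> expectation (\<lambda>\<omega>. ?e)" by (rule integral_mono) (use ig b in auto)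
  finally show ?thesis unfolding eq[symmetric] by (simp add: prob_space)
qed

text \<open>Comparison through a cube of side L^2 with depth L: the shallow sites form a fraction
  O(1/L), the commutator error is O(1/L) and the tiling error depending on the cube is O(m/L^2). As
  L grows only the part of the tiling error proportional to 1/m remains. Right-continuity of both
  functions then closes the gap a < b.\<close>

lemma ids_Ef_inner:
  assumes m: "1 \<le> m"
  shows "\<bar>ids P x - Ef (inner_part r (cube m)) x / real m ^ CARD('d)\<bar> \<le> real CARD('d) * (2 + 4 * real r) / real m"
proof -
  let ?D = "real CARD('d) * (2 + 4 * real r) / real m"
  define H where "H y = Ef (inner_part r (cube m)) y / real m ^ CARD('d)" for y
  define \<epsilon> where "\<epsilon> L c = real (card (nb :: (int ^ 'd) set)) * (1 / real L) / c" for L c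
  define e where "e L c n = 2 * \<epsilon> L c + (\<epsilon> L c)\<^sup>2 + real CARD('d) * (2 * real L / real n)" for L c n
  have e0: "(\<lambda>L. e L c (L * L)) \<longlonglongrightarrow> 0" for c
  proof -
    have "(\<lambda>L. real (card (nb :: (int ^ 'd) set)) * (1 / real L) / c) \<longlonglongrightarrow> real (card (nb :: (int ^ 'd) set)) * 0 * inverse c"
      unfolding divide_inverse[of _ c] by (intro tendsto_intros lim_const_over_n)
    then have "(\<lambda>L. \<epsilon> L c) \<longlonglongrightarrow> 0" by (simp add: \<epsilon>_def)
    then have "(\<lambda>L. 2 * \<epsilon> L c + (\<epsilon> L c)\<^sup>2 + real CARD('d) * (2 / real L)) \<longlonglongrightarrow> 2 * 0 + 0\<^sup>2 + real CARD('d) * 0"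
      by (intro tendsto_intros lim_const_over_n)
    moreover have "2 * real L / real (L * L) = 2 / real L" for L by simp
    ultimately show ?thesis unfolding e_def by simp
  qed
  define q where "q L = 3 * real CARD('d) * real m / real (L * L)" for L :: nat
  have q0: "q \<longlonglongrightarrow> 0"
  proof -
    have "(\<lambda>L. (3 * real CARD('d) * real m / real L) * (1 / real L)) \<longlonglongrightarrow> 0 * 0"
      by (intro tendsto_intros lim_const_over_n)
    then show ?thesis by (simp add: q_def[abs_def])
  qed
  have lim: "(\<lambda>L. c + (?D + q L + e L t (L * L))) \<longlonglongrightarrow> c + ?D" for c t
    using tendsto_add[OF tendsto_const[of "c + ?D"] tendsto_add[OF q0 e0[of t]]] by (simp add: add.assoc)
  have 1: "H a \<le> ids P b + ?D" and 2: "ids P a \<le> H b + ?D" if ab: "a < b" for a b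
  proof -
    have ev: "\<forall>\<^sub>F L in sequentially. H a \<le> ids P b + (?D + q L + e L (b - a) (L * L)) \<and>
        ids P a \<le> H b + (?D + q L + e L (b - a) (L * L))"
      using eventually_gt_at_top[of m]
    proof eventually_elim
      case (elim L)
      have "L * 1 \<le> L * L" by (intro mult_le_mono2) (use elim in simp)
      then have n: "m < L * L" "1 \<le> L * L" "1 \<le> L" using elim m by linarith+
      show ?case
        using Ef_ids_compare[OF n(2,3) ab, folded \<epsilon>_def, folded e_def] Ef_tiling[OF m n(1), of a] Ef_tiling[OF m n(1), of b]
        unfolding H_def q_def by linarith
    qed
    show "H a \<le> ids P b + ?D"
      by (rule tendsto_lowerbound[OF lim[of "ids P b" "b - a"]]) (use ev in \<open>auto elim: eventually_mono\<close>)
    show "ids P a \<le> H b + ?D"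
      by (rule tendsto_lowerbound[OF lim[of "H b" "b - a"]]) (use ev in \<open>auto elim: eventually_mono\<close>)
  qed
  have limits: "(ids P \<longlongrightarrow> ids P x) (at_right x)" "(H \<longlongrightarrow> H x) (at_right x)"
  proof -
    show "(ids P \<longlongrightarrow> ids P x) (at_right x)" using ids_rc_bounded by (simp add: rc_bounded_def continuous_within)
    show "(H \<longlongrightarrow> H x) (at_right x)"
      unfolding H_def using Ef_bounds(4)[of "inner_part r (cube m)" x] m
      by (intro tendsto_divide tendsto_const) (auto simp: continuous_within)
  qed
  have "H x \<le> ids P x + ?D"
    by (rule tendsto_lowerbound[OF tendsto_add[OF limits(1) tendsto_const]])
       (use 1 eventually_at_right_less[of x] in \<open>auto elim: eventually_mono\<close>)
  moreover have "ids P x \<le> H x + ?D"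
    by (rule tendsto_lowerbound[OF tendsto_add[OF limits(2) tendsto_const]])
       (use 2 eventually_at_right_less[of x] in \<open>auto elim: eventually_mono\<close>)
  ultimately show ?thesis unfolding H_def by linarith
qed

end

subsection \<open>Independence and a uniform law of large numbers\<close>

lemma eigenvalue_count_at_bot:
  assumes fin: "finite \<Lambda>"
  shows "(eigenvalue_count \<Lambda> \<omega> \<longlongrightarrow> 0) at_bot"
proof -
  have eq: "eigenvalue_count \<Lambda> \<omega> = (\<lambda>x. \<Sum>z\<in>\<Lambda>. (norm (Qf \<Lambda> \<omega> x (dl z)))\<^sup>2)"
    by (rule ext) (rule eigenvalue_count_trace[OF fin])
  have "((\<lambda>x. \<Sum>z\<in>\<Lambda>. (norm (Qf \<Lambda> \<omega> x (dl z)))\<^sup>2) \<longlongrightarrow> (\<Sum>z\<in>\<Lambda>. (norm (0 :: (int ^ 'a) l2))\<^sup>2)) at_bot"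
    by (intro tendsto_intros roi_tendsto(2)[OF Qf_roi[OF fin]] lsp_closed)
  then show ?thesis by (simp add: eq)
qed

lemma set_dist_disjoint:
  assumes "set_dist X Y > enat r"
  shows "X \<inter> Y = {}"
proof -
  have "\<not> (\<exists>x\<in>X. \<exists>y\<in>Y. l1_norm (x - y) \<le> r)" using assms unfolding set_dist_le_iff[symmetric] by simp
  moreover have "l1_norm (x - x) \<le> r" for x :: "int ^ 'a" by (simp add: l1_norm_def)
  ultimately show ?thesis by blast
qed

context random_field begin

section \<open>Independence of distant patterns\<close>

lemma product_sigma_finite_mu: "product_sigma_finite \<mu>"
  using dens by (simp add: has_densities_def product_sigma_finite_def)

lemma sets_PiM_mu: "sets (Pi\<^sub>M \<Lambda> \<mu>) = sets (config_algebra A \<Lambda>)"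
  unfolding config_algebra_def by (rule sets_PiM_cong) (use dens in \<open>auto simp: has_densities_def\<close>)

lemma space_PiM_mu: "space (Pi\<^sub>M \<Lambda> \<mu>) = PiE \<Lambda> (\<lambda>_. A)"
  using sets_eq_imp_space_eq[OF sets_PiM_mu[of \<Lambda>]] by (simp add: space_config_algebra)

abbreviation \<rho> :: "(int ^ 'd) set \<Rightarrow> (int ^ 'd \<Rightarrow> real) \<Rightarrow> ennreal" where
  "\<rho> \<Lambda> \<equiv> marginal_density A \<mu> P \<Lambda>"

lemma density_measurable: "\<rho> \<Lambda> \<in> borel_measurable (Pi\<^sub>M \<Lambda> \<mu>)"
  unfolding marginal_density_def by measurable

lemma emeasure_block:
  assumes fin: "finite \<Lambda>" and E: "E \<in> sets (config_algebra A \<Lambda>)"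
  shows "emeasure P {\<omega> \<in> space P. restrict \<omega> \<Lambda> \<in> E} = (\<integral>\<^sup>+\<eta>. \<rho> \<Lambda> \<eta> * indicator E \<eta> \<partial>Pi\<^sub>M \<Lambda> \<mu>)"
proof -
  interpret product_sigma_finite \<mu> by (rule product_sigma_finite_mu)
  interpret sigma_finite_measure "Pi\<^sub>M \<Lambda> \<mu>" by (rule sigma_finite[OF fin])
  have "sets (marginal A P \<Lambda>) = sets (Pi\<^sub>M \<Lambda> \<mu>)" by (simp add: marginal_def sets_PiM_mu)
  then have "marginal A P \<Lambda> = density (Pi\<^sub>M \<Lambda> \<mu>) (\<rho> \<Lambda>)"
    unfolding marginal_density_def using dens fin by (simp add: has_densities_def density_RN_deriv)
  then have "emeasure (marginal A P \<Lambda>) E = (\<integral>\<^sup>+\<eta>. \<rho> \<Lambda> \<eta> * indicator E \<eta> \<partial>Pi\<^sub>M \<Lambda> \<mu>)"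
    using E density_measurable by (simp add: emeasure_density sets_PiM_mu)
  moreover have "emeasure (marginal A P \<Lambda>) E = emeasure P ((\<lambda>\<omega>. restrict \<omega> \<Lambda>) -` E \<inter> space P)"
    unfolding marginal_def by (rule emeasure_distr[OF restrict_measurable E])
  moreover have "(\<lambda>\<omega>. restrict \<omega> \<Lambda>) -` E \<inter> space P = {\<omega> \<in> space P. restrict \<omega> \<Lambda> \<in> E}" by auto
  ultimately show ?thesis by simp
qed

lemma restrict_config_measurable:
  "\<Lambda>' \<subseteq> \<Lambda> \<Longrightarrow> (\<lambda>\<eta>. restrict \<eta> \<Lambda>') \<in> config_algebra A \<Lambda> \<rightarrow>\<^sub>M config_algebra A \<Lambda>'"
  unfolding config_algebra_def by (rule measurable_restrict_subset)

text \<open>The joint density factorizes almost everywhere by the correlation length, the indicator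
  of the event factorizes as well, and integrating over the product of the two blocks gives the
  product. Both orders of the distance appear because the correlation condition ranges over ordered
  pairs.\<close>

lemma two_blocks:
  assumes fin: "finite \<Lambda>1" "finite \<Lambda>2" and ne: "\<Lambda>1 \<noteq> {}" "\<Lambda>2 \<noteq> {}"
    and far: "set_dist \<Lambda>1 \<Lambda>2 > enat r" "set_dist \<Lambda>2 \<Lambda>1 > enat r"
    and E1: "E1 \<in> sets (config_algebra A \<Lambda>1)" and E2: "E2 \<in> sets (config_algebra A \<Lambda>2)"
  shows "emeasure P {\<omega> \<in> space P. restrict \<omega> \<Lambda>1 \<in> E1 \<and> restrict \<omega> \<Lambda>2 \<in> E2} =
    emeasure P {\<omega> \<in> space P. restrict \<omega> \<Lambda>1 \<in> E1} * emeasure P {\<omega> \<in> space P. restrict \<omega> \<Lambda>2 \<in> E2}"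
proof -
  interpret product_sigma_finite \<mu> by (rule product_sigma_finite_mu)
  let ?\<Lambda> = "\<Lambda>1 \<union> \<Lambda>2"
  have dj: "\<Lambda>1 \<inter> \<Lambda>2 = {}" by (rule set_dist_disjoint[OF far(1)])
  define E where "E = {\<eta> \<in> space (config_algebra A ?\<Lambda>). restrict \<eta> \<Lambda>1 \<in> E1 \<and> restrict \<eta> \<Lambda>2 \<in> E2}"
  have "E = ((\<lambda>\<eta>. restrict \<eta> \<Lambda>1) -` E1 \<inter> space (config_algebra A ?\<Lambda>)) \<inter> ((\<lambda>\<eta>. restrict \<eta> \<Lambda>2) -` E2 \<inter> space (config_algebra A ?\<Lambda>))"
    by (auto simp: E_def)
  then have E: "E \<in> sets (config_algebra A ?\<Lambda>)"
    using measurable_sets[OF restrict_config_measurable[of \<Lambda>1 ?\<Lambda>] E1] measurable_sets[OF restrict_config_measurable[of \<Lambda>2 ?\<Lambda>] E2]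
    by auto
  \<comment> \<open>The correlation condition speaks of families enumerated from 1; here n =
    2.\<close>
  define j where "j = (\<lambda>i :: nat. if i = 1 then \<Lambda>1 else \<Lambda>2)"
  have i12: "{1..2::nat} = {1, 2}" by auto
  have un: "(\<Union>i\<in>{1..2}. j i) = ?\<Lambda>" unfolding i12 by (auto simp: j_def)
  have "AE \<eta> in Pi\<^sub>M (\<Union>i\<in>{1..2}. j i) \<mu>. \<rho> (\<Union>i\<in>{1..2}. j i) \<eta> = (\<Prod>i\<in>{1..2}. \<rho> (j i) (restrict \<eta> (j i)))"
    by (rule corr[unfolded correlation_length_def, rule_format]) (use fin ne far in \<open>auto simp: j_def split: if_splits\<close>)
  then have ae: "AE \<eta> in Pi\<^sub>M ?\<Lambda> \<mu>. \<rho> ?\<Lambda> \<eta> = \<rho> \<Lambda>1 (restrict \<eta> \<Lambda>1) * \<rho> \<Lambda>2 (restrict \<eta> \<Lambda>2)"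
    unfolding un unfolding i12 by (simp add: j_def)
  define u where "u \<Lambda> E \<eta> = \<rho> \<Lambda> \<eta> * indicator E \<eta>" for \<Lambda> E \<eta>
  have um: "u \<Lambda> E \<in> borel_measurable (Pi\<^sub>M \<Lambda> \<mu>)" if "E \<in> sets (config_algebra A \<Lambda>)" for \<Lambda> E
    unfolding u_def using density_measurable[of \<Lambda>] that sets_PiM_mu[of \<Lambda>]
    by (intro borel_measurable_times_ennreal borel_measurable_indicator) auto
  have rm: "(\<lambda>\<eta>. restrict \<eta> \<Lambda>') \<in> Pi\<^sub>M \<Lambda> \<mu> \<rightarrow>\<^sub>M Pi\<^sub>M \<Lambda>' \<mu>" if "\<Lambda>' \<subseteq> \<Lambda>" for \<Lambda>' \<Lambda>
    by (rule measurable_restrict_subset[OF that])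
  have "emeasure P {\<omega> \<in> space P. restrict \<omega> \<Lambda>1 \<in> E1 \<and> restrict \<omega> \<Lambda>2 \<in> E2} = emeasure P {\<omega> \<in> space P. restrict \<omega> ?\<Lambda> \<in> E}"
    by (rule arg_cong[where f = "emeasure P"]) (auto simp: E_def space_P space_config_algebra configs_def Int_absorb1 Int_commute)
  also have "\<dots> = (\<integral>\<^sup>+\<eta>. \<rho> ?\<Lambda> \<eta> * indicator E \<eta> \<partial>Pi\<^sub>M ?\<Lambda> \<mu>)" by (rule emeasure_block) (use fin E in auto)
  also have "\<dots> = (\<integral>\<^sup>+\<eta>. u \<Lambda>1 E1 (restrict \<eta> \<Lambda>1) * u \<Lambda>2 E2 (restrict \<eta> \<Lambda>2) \<partial>Pi\<^sub>M ?\<Lambda> \<mu>)"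
  proof (rule nn_integral_cong_AE)
    show "AE \<eta> in Pi\<^sub>M ?\<Lambda> \<mu>. \<rho> ?\<Lambda> \<eta> * indicator E \<eta> = u \<Lambda>1 E1 (restrict \<eta> \<Lambda>1) * u \<Lambda>2 E2 (restrict \<eta> \<Lambda>2)"
      using ae AE_space
    proof eventually_elim
      case (elim \<eta>)
      then show ?case by (auto simp: E_def u_def indicator_def space_PiM_mu space_config_algebra)
    qed
  qed
  also have "\<dots> = (\<integral>\<^sup>+x. (\<integral>\<^sup>+y. u \<Lambda>1 E1 (restrict (merge \<Lambda>1 \<Lambda>2 (x, y)) \<Lambda>1) * u \<Lambda>2 E2 (restrict (merge \<Lambda>1 \<Lambda>2 (x, y)) \<Lambda>2) \<partial>Pi\<^sub>M \<Lambda>2 \<mu>) \<partial>Pi\<^sub>M \<Lambda>1 \<mu>)"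
    by (rule product_nn_integral_fold[OF dj fin])
       (intro borel_measurable_times_ennreal measurable_compose[OF rm um] E1 E2; auto)
  also have "\<dots> = (\<integral>\<^sup>+x. (\<integral>\<^sup>+y. u \<Lambda>1 E1 x * u \<Lambda>2 E2 y \<partial>Pi\<^sub>M \<Lambda>2 \<mu>) \<partial>Pi\<^sub>M \<Lambda>1 \<mu>)"
    by (intro nn_integral_cong) (simp add: restrict_merge[OF dj] space_PiM_mu PiE_restrict)
  also have "\<dots> = (\<integral>\<^sup>+x. u \<Lambda>1 E1 x * (\<integral>\<^sup>+y. u \<Lambda>2 E2 y \<partial>Pi\<^sub>M \<Lambda>2 \<mu>) \<partial>Pi\<^sub>M \<Lambda>1 \<mu>)"
    by (intro nn_integral_cong nn_integral_cmult um E2)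
  also have "\<dots> = (\<integral>\<^sup>+x. u \<Lambda>1 E1 x \<partial>Pi\<^sub>M \<Lambda>1 \<mu>) * (\<integral>\<^sup>+y. u \<Lambda>2 E2 y \<partial>Pi\<^sub>M \<Lambda>2 \<mu>)"
    by (intro nn_integral_multc um E1)
  finally show ?thesis by (simp add: u_def emeasure_block[OF fin(1) E1] emeasure_block[OF fin(2) E2])
qed

text \<open>Induction on the blocks: the union of the remaining ones is itself a block, still
  farther than r from the new one, so \<open>two_blocks\<close> applies.\<close>

lemma blocks_independent:
  assumes J: "finite J" and B: "\<And>j. j \<in> J \<Longrightarrow> finite (B j) \<and> B j \<noteq> {}"
    and far: "\<And>i j. i \<in> J \<Longrightarrow> j \<in> J \<Longrightarrow> i \<noteq> j \<Longrightarrow> set_dist (B i) (B j) > enat r"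
    and E: "\<And>j. j \<in> J \<Longrightarrow> E j \<in> sets (config_algebra A (B j))"
  shows "prob {\<omega> \<in> space P. \<forall>j\<in>J. restrict \<omega> (B j) \<in> E j} = (\<Prod>j\<in>J. prob {\<omega> \<in> space P. restrict \<omega> (B j) \<in> E j})"
  using J B far E
proof (induction J)
  case empty
  then show ?case by (simp add: prob_space)
next
  case (insert i J)
  show ?case
  \<comment> \<open>The correlation condition concerns nonempty sets, and a union of no blocks is
    empty.\<close>
  proof (cases "J = {}")
    case False
    let ?U = "\<Union>j\<in>J. B j"
    define F where "F = {\<eta> \<in> space (config_algebra A ?U). \<forall>j\<in>J. restrict \<eta> (B j) \<in> E j}"
    have F: "F \<in> sets (config_algebra A ?U)"
      unfolding F_def
    proof (intro sets.sets_Collect_finite_All' insert.hyps(1) False)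
      fix j assume j: "j \<in> J"
      have "(\<lambda>\<eta>. restrict \<eta> (B j)) \<in> config_algebra A ?U \<rightarrow>\<^sub>M config_algebra A (B j)"
        by (rule restrict_config_measurable) (use j in auto)
      from measurable_sets[OF this insert.prems(3)[of j]] j
      have "(\<lambda>\<eta>. restrict \<eta> (B j)) -` E j \<inter> space (config_algebra A ?U) \<in> sets (config_algebra A ?U)" by simp
      moreover have "(\<lambda>\<eta>. restrict \<eta> (B j)) -` E j \<inter> space (config_algebra A ?U) = {\<eta> \<in> space (config_algebra A ?U). restrict \<eta> (B j) \<in> E j}"
        by auto
      ultimately show "{\<eta> \<in> space (config_algebra A ?U). restrict \<eta> (B j) \<in> E j} \<in> sets (config_algebra A ?U)" by simp
    qed
    have nf: "\<not> l1_norm (x - y) \<le> r" if "i' \<in> insert i J" "j' \<in> insert i J" "i' \<noteq> j'" "x \<in> B i'" "y \<in> B j'" for i' j' x y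
    proof -
      have "\<not> set_dist (B i') (B j') \<le> enat r" using insert.prems(2)[OF that(1,2,3)] by simp
      then show ?thesis using that(4,5) unfolding set_dist_le_iff by blast
    qed
    have far': "set_dist (B i) ?U > enat r" "set_dist ?U (B i) > enat r"
      unfolding not_le[symmetric] set_dist_le_iff using nf insert.hyps(2) by fastforce+
    have r: "restrict (restrict \<omega> ?U) (B j) = restrict \<omega> (B j)" if "j \<in> J" for j and \<omega> :: "int ^ 'd \<Rightarrow> real"
      using that by (auto simp: restrict_def fun_eq_iff)
    have sp: "restrict \<omega> ?U \<in> space (config_algebra A ?U)" if "\<omega> \<in> space P" for \<omega>
      using that by (auto simp: space_config_algebra space_P configs_def)
    have eqF: "{\<omega> \<in> space P. restrict \<omega> ?U \<in> F} = {\<omega> \<in> space P. \<forall>j\<in>J. restrict \<omega> (B j) \<in> E j}"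
      unfolding F_def using r sp by auto
    have "{\<omega> \<in> space P. \<forall>j\<in>insert i J. restrict \<omega> (B j) \<in> E j} = {\<omega> \<in> space P. restrict \<omega> (B i) \<in> E i \<and> restrict \<omega> ?U \<in> F}"
      using eqF by blast
    then have "emeasure P {\<omega> \<in> space P. \<forall>j\<in>insert i J. restrict \<omega> (B j) \<in> E j} =
        emeasure P {\<omega> \<in> space P. restrict \<omega> (B i) \<in> E i} * emeasure P {\<omega> \<in> space P. restrict \<omega> ?U \<in> F}"
      using two_blocks[OF _ _ _ _ far' insert.prems(3)[of i] F] insert.prems(1) insert.hyps(1) False by auto
    then have "prob {\<omega> \<in> space P. \<forall>j\<in>insert i J. restrict \<omega> (B j) \<in> E j} =
        prob {\<omega> \<in> space P. restrict \<omega> (B i) \<in> E i} * prob {\<omega> \<in> space P. restrict \<omega> ?U \<in> F}"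
      by (simp add: emeasure_eq_measure ennreal_mult[symmetric])
    also have "prob {\<omega> \<in> space P. restrict \<omega> ?U \<in> F} = (\<Prod>j\<in>J. prob {\<omega> \<in> space P. restrict \<omega> (B j) \<in> E j})"
      unfolding eqF by (rule insert.IH) (use insert.prems in auto)
    finally show ?thesis by (simp only: prod.insert[OF insert.hyps(1,2)])
  qed simp
qed

definition ext :: "(int ^ 'd) set \<Rightarrow> (int ^ 'd \<Rightarrow> real) \<Rightarrow> int ^ 'd \<Rightarrow> real" where
  "ext \<Lambda> \<eta> z = (if z \<in> \<Lambda> then \<eta> z else a0)"

definition local_on :: "(int ^ 'd) set \<Rightarrow> ((int ^ 'd \<Rightarrow> real) \<Rightarrow> real) \<Rightarrow> bool" where
  "local_on \<Lambda> h \<longleftrightarrow> (\<forall>\<omega>\<in>configs A. \<forall>\<omega>'\<in>configs A. (\<forall>z\<in>\<Lambda>. \<omega> z = \<omega>' z) \<longrightarrow> h \<omega> = h \<omega>')"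

lemma ext_measurable: "ext \<Lambda> \<in> config_algebra A \<Lambda> \<rightarrow>\<^sub>M P"
  unfolding measurable_cong_sets[OF refl sets_P]
proof (rule to_config_algebra_measurable)
  fix z
  show "(\<lambda>x. ext \<Lambda> x z) \<in> config_algebra A \<Lambda> \<rightarrow>\<^sub>M restrict_space borel A"
  proof (cases "z \<in> \<Lambda>")
    case True
    then show ?thesis unfolding ext_def config_algebra_def by (simp add: measurable_component_singleton)
  next
    case False
    then show ?thesis unfolding ext_def using a0 by (simp add: space_restrict_space)
  qed
qed (use a0 in \<open>auto simp: ext_def space_config_algebra\<close>)

lemma ext_configs: "\<eta> \<in> space (config_algebra A \<Lambda>) \<Longrightarrow> ext \<Lambda> \<eta> \<in> configs A"
  using measurable_space[OF ext_measurable] space_P by auto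

lemma local_factor: "local_on \<Lambda> h \<Longrightarrow> \<omega> \<in> configs A \<Longrightarrow> h (ext \<Lambda> (restrict \<omega> \<Lambda>)) = h \<omega>"
proof -
  assume h: "local_on \<Lambda> h" and \<omega>: "\<omega> \<in> configs A"
  have "ext \<Lambda> (restrict \<omega> \<Lambda>) \<in> configs A" using \<omega> by (intro ext_configs) (auto simp: space_config_algebra configs_def)
  moreover have "\<forall>z\<in>\<Lambda>. ext \<Lambda> (restrict \<omega> \<Lambda>) z = \<omega> z" by (simp add: ext_def)
  ultimately show ?thesis using h \<omega> unfolding local_on_def by blast
qed

lemma local_shift: "local_on \<Lambda> h \<Longrightarrow> local_on (translate \<Lambda> t) (\<lambda>\<omega>. h (shift t \<omega>))"
  unfolding local_on_def
proof clarify
  fix \<omega> \<omega>' assume h: "\<forall>\<omega>\<in>configs A. \<forall>\<omega>'\<in>configs A. (\<forall>z\<in>\<Lambda>. \<omega> z = \<omega>' z) \<longrightarrow> h \<omega> = h \<omega>'"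
    and \<omega>: "\<omega> \<in> configs A" "\<omega>' \<in> configs A" and eq: "\<forall>z\<in>translate \<Lambda> t. \<omega> z = \<omega>' z"
  have "\<forall>z\<in>\<Lambda>. shift t \<omega> z = shift t \<omega>' z" using eq by (simp add: shift_def translate_def)
  then show "h (shift t \<omega>) = h (shift t \<omega>')" using h shift_configs[OF \<omega>(1)] shift_configs[OF \<omega>(2)] by blast
qed

text \<open>A local variable factors through the pattern on its block (\<open>local_factor\<close>),
  so its events are block events and \<open>blocks_independent\<close> applies.\<close>

lemma indep_vars_local:
  assumes B: "\<And>j. j \<in> I \<Longrightarrow> finite (B j) \<and> B j \<noteq> {}"
    and far: "\<And>i j. i \<in> I \<Longrightarrow> j \<in> I \<Longrightarrow> i \<noteq> j \<Longrightarrow> set_dist (B i) (B j) > enat r"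
    and X: "\<And>j. j \<in> I \<Longrightarrow> X j \<in> borel_measurable P" "\<And>j. j \<in> I \<Longrightarrow> local_on (B j) (X j)"
  shows "indep_vars (\<lambda>_. borel) X I"
  unfolding indep_vars_def2
proof (intro conjI ballI)
  show "random_variable borel (X j)" if "j \<in> I" for j by (rule X(1)[OF that])
  show "indep_sets (\<lambda>i. {X i -` S \<inter> space P |S. S \<in> sets borel}) I"
  proof (rule indep_setsI)
    show "{X i -` S \<inter> space P |S. S \<in> sets borel} \<subseteq> events" if "i \<in> I" for i
      using measurable_sets[OF X(1)[OF that]] by auto
  next
    fix F J assume J: "J \<noteq> {}" "J \<subseteq> I" "finite J" and F: "\<forall>j\<in>J. F j \<in> {X j -` S \<inter> space P |S. S \<in> sets borel}"
    from F have "\<forall>j\<in>J. \<exists>S. S \<in> sets borel \<and> F j = X j -` S \<inter> space P" by blast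
    from bchoice[OF this] obtain S where S: "\<And>j. j \<in> J \<Longrightarrow> S j \<in> sets borel \<and> F j = X j -` S j \<inter> space P" by blast
    define E where "E j = (\<lambda>\<eta>. X j (ext (B j) \<eta>)) -` S j \<inter> space (config_algebra A (B j))" for j
    have E: "E j \<in> sets (config_algebra A (B j))" if "j \<in> J" for j
      unfolding E_def
      by (rule measurable_sets[OF measurable_compose[OF ext_measurable X(1)]]) (use that J(2) S in auto)
    have Fj: "F j = {\<omega> \<in> space P. restrict \<omega> (B j) \<in> E j}" if "j \<in> J" for j
    proof -
      have "X j (ext (B j) (restrict \<omega> (B j))) = X j \<omega>" if "\<omega> \<in> space P" for \<omega>
        by (rule local_factor[OF X(2)]) (use that space_P J(2) \<open>j \<in> J\<close> in auto)
      moreover have "restrict \<omega> (B j) \<in> space (config_algebra A (B j))" if "\<omega> \<in> space P" for \<omega>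
        using that by (auto simp: space_config_algebra space_P configs_def)
      ultimately show ?thesis using S[OF that] by (auto simp: E_def)
    qed
    have "(\<Inter>j\<in>J. F j) = {\<omega> \<in> space P. \<forall>j\<in>J. restrict \<omega> (B j) \<in> E j}" using J(1) Fj by auto
    then have "prob (\<Inter>j\<in>J. F j) = (\<Prod>j\<in>J. prob {\<omega> \<in> space P. restrict \<omega> (B j) \<in> E j})"
      using blocks_independent[OF J(3), of B E] B far E J(2) by (simp add: subset_iff)
    then show "prob (\<Inter>j\<in>J. F j) = (\<Prod>j\<in>J. prob (F j))" using Fj by (simp cong: prod.cong)
  qed
qed

text \<open>Everything within r of an r-interior point of a tile belongs to that tile. This is the
  purpose of the corridors.\<close>

lemma tiles_far:
  assumes m: "1 \<le> m" and st: "s \<in> tiles m n" "t \<in> tiles m n" "s \<noteq> t"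
  shows "set_dist (translate (inner_part r (cube m)) s) (translate (inner_part r (cube m)) t) > enat r"
  unfolding not_le[symmetric] set_dist_le_iff
proof clarify
  fix x y assume xy: "x \<in> translate (inner_part r (cube m)) s" "y \<in> translate (inner_part r (cube m)) t" "l1_norm (x - y) \<le> r"
  have "x \<in> inner_part r (translate (cube m) s)" "y \<in> translate (cube m) t"
    using xy(1,2) unfolding inner_part_translate[symmetric] by (auto simp: mem_inner_part)
  moreover have "y \<notin> translate (cube m) s" by (rule tiles_disjoint[OF m st(2,1)]) (use st(3) calculation(2) in auto)
  ultimately show False using xy(3) by (auto simp: mem_inner_part)
qed

section \<open>Laws of large numbers for averages over tiles\<close>

abbreviation avg :: "nat \<Rightarrow> nat \<Rightarrow> ((int ^ 'd \<Rightarrow> real) \<Rightarrow> real) \<Rightarrow> (int ^ 'd \<Rightarrow> real) \<Rightarrow> real" where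
  "avg m n h \<omega> \<equiv> (\<Sum>t\<in>tiles m n. h (shift t \<omega>)) / real (card (tiles m n :: (int ^ 'd) set))"

text \<open>Hoeffding's inequality for independent summands, one per tile; when tiles exist their
  number is at least n/m - 1. The bound is written as a geometric sequence in n, ready for
  Borel--Cantelli.\<close>

lemma avg_deviation:
  assumes m: "1 \<le> m" and ne: "inner_part r (cube m) \<noteq> ({} :: (int ^ 'd) set)"
    and h: "h \<in> borel_measurable P" "local_on (inner_part r (cube m)) h" "\<And>\<omega>. \<bar>h \<omega>\<bar> \<le> C" and C: "0 < C" and e: "0 < e"
  shows "prob {\<omega> \<in> space P. \<bar>avg m n h \<omega> - expectation h\<bar> \<ge> e}
    \<le> 2 * exp (e\<^sup>2 / (2 * C\<^sup>2)) * exp (- (e\<^sup>2 / (2 * C\<^sup>2) / real m)) ^ n"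
proof -
  let ?T = "tiles m n :: (int ^ 'd) set" and ?\<Lambda> = "inner_part r (cube m) :: (int ^ 'd) set"
  define c where "c = e\<^sup>2 / (2 * C\<^sup>2)"
  have c: "0 \<le> c" by (simp add: c_def)
  have rhs: "2 * exp c * exp (- (c / real m)) ^ n = 2 * exp (- (c * (real n / real m - 1)))"
    by (simp add: exp_of_nat_mult[symmetric] mult_exp_exp algebra_simps)
  have finT: "finite ?T" by (rule finite_tiles[OF m])
  show ?thesis unfolding c_def[symmetric] rhs
  \<comment> \<open>Without tiles n < m, and the right side is at least 1.\<close>
  proof (cases "?T = {}")
    case True
    then have "card ?T = 0" by simp
    then have "n div m = 0" using card_tiles[OF m, where n = n and 'd = 'd] by simp
    then have "n < m" using m by (simp add: div_eq_0_iff)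
    then have "c * (real n / real m - 1) \<le> 0" using c by (intro mult_nonneg_nonpos) (auto simp: field_simps)
    then have "1 \<le> exp (- (c * (real n / real m - 1)))" by simp
    then have "1 \<le> 2 * exp (- (c * (real n / real m - 1)))" by linarith
    then show "prob {\<omega> \<in> space P. \<bar>avg m n h \<omega> - expectation h\<bar> \<ge> e} \<le> 2 * exp (- (c * (real n / real m - 1)))"
      using prob_le_1 order_trans by blast
  next
    case False
    let ?k = "real (card ?T)"
    have k: "0 < ?k" using False finT by (simp add: card_gt_0_iff)
    interpret H: Hoeffding_ineq P ?T "\<lambda>t \<omega>. h (shift t \<omega>)" "\<lambda>_. - C" "\<lambda>_. C" "?k * expectation h"
    proof unfold_locales
      show "finite ?T" by (rule finT)
      show "indep_vars (\<lambda>_. borel) (\<lambda>t \<omega>. h (shift t \<omega>)) ?T"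
        by (rule indep_vars_local[where B = "translate ?\<Lambda>"])
           (use ne tiles_far[OF m] expectation_shift(1)[OF h(1)] local_shift[OF h(2)] in \<open>auto simp: translate_def\<close>)
      show "AE \<omega> in P. h (shift t \<omega>) \<in> {- C..C}" for t using h(3) by (auto simp: abs_le_iff minus_le_iff)
      show "?k * expectation h \<equiv> \<Sum>t\<in>?T. expectation (\<lambda>\<omega>. h (shift t \<omega>))"
        by (simp add: expectation_shift(2)[OF h(1)])
    qed
    have sq: "(\<Sum>t\<in>?T. (C - - C)\<^sup>2) = ?k * (4 * C\<^sup>2)" by (simp add: power2_eq_square)
    have "{\<omega> \<in> space P. \<bar>avg m n h \<omega> - expectation h\<bar> \<ge> e} = {\<omega> \<in> space P. \<bar>(\<Sum>t\<in>?T. h (shift t \<omega>)) - ?k * expectation h\<bar> \<ge> e * ?k}"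
    proof -
      have "e \<le> \<bar>s / ?k - v\<bar> \<longleftrightarrow> e * ?k \<le> \<bar>s - ?k * v\<bar>" for s v
      proof -
        have "s / ?k - v = (s - ?k * v) / ?k" using k by (simp add: diff_divide_distrib)
        then have "\<bar>s / ?k - v\<bar> = \<bar>s - ?k * v\<bar> / ?k" using k by simp
        then show ?thesis using k by (simp add: pos_le_divide_eq)
      qed
      then show ?thesis by simp
    qed
    then have "prob {\<omega> \<in> space P. \<bar>avg m n h \<omega> - expectation h\<bar> \<ge> e} \<le> 2 * exp (- 2 * (e * ?k)\<^sup>2 / (?k * (4 * C\<^sup>2)))"
      using H.Hoeffding_ineq_abs_ge[of "e * ?k"] e k C unfolding sq by simp
    also have "- 2 * (e * ?k)\<^sup>2 / (?k * (4 * C\<^sup>2)) = - (c * ?k)"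
      using k C by (simp add: c_def power2_eq_square field_simps)
    \<comment> \<open>The growth of one dimension is enough: (n div m)^d is at least n div
      m.\<close>
    also have "2 * exp (- (c * ?k)) \<le> 2 * exp (- (c * (real n / real m - 1)))"
    proof -
      have "real n / real m \<le> real (n div m) + 1"
      proof -
        have "real n = real (n div m) * real m + real (n mod m)" by (metis div_mult_mod_eq of_nat_add of_nat_mult)
        moreover have "real (n mod m) \<le> real m" using m by (simp add: less_imp_le)
        ultimately have "real n \<le> (real (n div m) + 1) * real m" by (simp add: algebra_simps)
        then show ?thesis using m by (simp add: pos_divide_le_eq)
      qed
      moreover have "1 \<le> n div m"
      proof (rule ccontr)
        assume "\<not> 1 \<le> n div m"
        then have "card ?T = 0" using card_tiles[OF m, where n = n and 'd = 'd] by simp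
        then show False using k by simp
      qed
      then have "n div m ^ 1 \<le> (n div m) ^ CARD('d)" by (simp add: self_le_power)
      then have "real (n div m) \<le> ?k" using card_tiles[OF m, where n = n and 'd = 'd] by simp
      ultimately have "real n / real m - 1 \<le> ?k" by linarith
      then show ?thesis using c by (simp add: mult_left_mono)
    qed
    finally show "prob {\<omega> \<in> space P. \<bar>avg m n h \<omega> - expectation h\<bar> \<ge> e} \<le> 2 * exp (- (c * (real n / real m - 1)))" .
  qed
qed

lemma avg_measurable:
  assumes h: "h \<in> borel_measurable P"
  shows "avg m n h \<in> borel_measurable P"
proof -
  note s = expectation_shift(1)[OF h]
  show ?thesis by (intro borel_measurable_divide borel_measurable_sum borel_measurable_const s)
qed

lemma strong_law:
  assumes m: "1 \<le> m" and ne: "inner_part r (cube m) \<noteq> ({} :: (int ^ 'd) set)"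
    and h: "h \<in> borel_measurable P" "local_on (inner_part r (cube m)) h" "\<And>\<omega>. \<bar>h \<omega>\<bar> \<le> C"
  shows "AE \<omega> in P. (\<lambda>n. avg m n h \<omega>) \<longlonglongrightarrow> expectation h"
proof -
  define C' where "C' = max C 1"
  have C': "0 < C'" "\<bar>h \<omega>\<bar> \<le> C'" for \<omega> using h(3)[of \<omega>] by (auto simp: C'_def)
  have "AE \<omega> in P. \<forall>k :: nat. eventually (\<lambda>n. \<bar>avg m n h \<omega> - expectation h\<bar> < 1 / real (Suc k)) sequentially"
    unfolding AE_all_countable
  proof
    fix k :: nat
    let ?e = "1 / real (Suc k)"
    let ?S = "\<lambda>n. {\<omega> \<in> space P. \<bar>avg m n h \<omega> - expectation h\<bar> \<ge> ?e}"
    let ?c = "?e\<^sup>2 / (2 * C'\<^sup>2)"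
    have S: "?S n \<in> sets P" for n using avg_measurable[OF h(1), of m n] by measurable
    have "summable (\<lambda>n. prob (?S n))"
    proof (rule summable_comparison_test_ev)
      show "\<forall>\<^sub>F n in sequentially. norm (prob (?S n)) \<le> 2 * exp ?c * exp (- (?c / real m)) ^ n"
        using avg_deviation[OF m ne h(1,2) C'(2) C'(1), of ?e] by (auto intro!: always_eventually)
      have "0 < ?c / real m" using m C' by (intro divide_pos_pos) auto
      then show "summable (\<lambda>n. 2 * exp ?c * exp (- (?c / real m)) ^ n)"
        by (intro summable_mult summable_geometric) simp
    qed
    then have "AE \<omega> in P. eventually (\<lambda>n. \<omega> \<in> space P - ?S n) sequentially"
      by (intro borel_cantelli_AE1 S) (auto simp: emeasure_eq_measure)
    then show "AE \<omega> in P. eventually (\<lambda>n. \<bar>avg m n h \<omega> - expectation h\<bar> < ?e) sequentially"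
      by eventually_elim (auto elim!: eventually_mono)
  qed
  then show ?thesis
  proof eventually_elim
    case (elim \<omega>)
    show ?case
    proof (rule tendstoI)
      fix e :: real assume "0 < e"
      then obtain k :: nat where k: "1 / real (Suc k) < e" using nat_approx_posE by metis
      show "\<forall>\<^sub>F n in sequentially. dist (avg m n h \<omega>) (expectation h) < e"
        using elim[rule_format, of k]
      proof eventually_elim
        case (elim n)
        then show ?case using k unfolding dist_real_def by linarith
      qed
    qed
  qed
qed

text \<open>x is the quantile of the expected count at level c, an infimum attained by
  right-continuity. Dominated convergence gives the limits 0 and |\<Lambda>| at the two ends, so
  every level strictly between has a quantile.\<close>

lemma Ef_level:
  assumes fin: "finite \<Lambda>" and c: "0 < c" "c < real (card \<Lambda>)"
  obtains x where "c \<le> Ef \<Lambda> x" "\<And>y. y < x \<Longrightarrow> Ef \<Lambda> y < c"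
proof -
  have lim: "(\<lambda>n. Ef \<Lambda> (s n)) \<longlonglongrightarrow> b"
    if "\<And>\<omega>. (\<lambda>n. eigenvalue_count \<Lambda> \<omega> (s n)) \<longlonglongrightarrow> b" for s :: "nat \<Rightarrow> real" and b
  proof -
    have "(\<lambda>n. Ef \<Lambda> (s n)) \<longlonglongrightarrow> expectation (\<lambda>\<omega>. b)"
      by (rule integral_dominated_convergence[where w = "\<lambda>_. real (card \<Lambda>)"])
         (use that f_P[OF fin] eigenvalue_count_props(1,2)[OF fin] in \<open>auto intro!: abs_le_of_nonneg\<close>)
    then show ?thesis by (simp add: prob_space)
  qed
  have "(\<lambda>n. Ef \<Lambda> (real n)) \<longlonglongrightarrow> real (card \<Lambda>)"
    by (intro lim filterlim_compose[OF eigenvalue_count_props(5)[OF fin]] filterlim_real_sequentially)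
  from order_tendstoD(1)[OF this c(2)] obtain n where n: "c < Ef \<Lambda> (real n)"
    unfolding eventually_sequentially by blast
  have "(\<lambda>n. Ef \<Lambda> (- real n)) \<longlonglongrightarrow> 0"
    by (intro lim filterlim_compose[OF eigenvalue_count_at_bot[OF fin]] filterlim_compose[OF filterlim_uminus_at_bot_at_top] filterlim_real_sequentially)
  from order_tendstoD(2)[OF this c(1)] obtain n' where n': "Ef \<Lambda> (- real n') < c"
    unfolding eventually_sequentially by blast
  define S where "S = {x. c \<le> Ef \<Lambda> x}"
  have ne: "S \<noteq> {}" using n by (auto simp: S_def intro: less_imp_le)
  have lb: "- real n' \<le> s" if "s \<in> S" for s
    using Ef_bounds(3)[OF fin, of s "- real n'"] n' that by (force simp: S_def)
  have bdd: "bdd_below S" using lb by (rule bdd_belowI)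
  show ?thesis
  proof
    show "Ef \<Lambda> y < c" if "y < Inf S" for y
      using cInf_lower[OF _ bdd, of y] that by (force simp: S_def)
    show "c \<le> Ef \<Lambda> (Inf S)"
    proof (rule tendsto_lowerbound)
      show "(Ef \<Lambda> \<longlongrightarrow> Ef \<Lambda> (Inf S)) (at_right (Inf S))"
        using Ef_bounds(4)[OF fin, of "Inf S"] by (simp add: continuous_within)
      have "c \<le> Ef \<Lambda> y" if y: "Inf S < y" for y
      proof -
        obtain s where "s \<in> S" "s < y" using cInf_less_iff[OF ne bdd, of y] y by blast
        then show ?thesis using Ef_bounds(3)[OF fin, of s y] by (auto simp: S_def)
      qed
      then show "\<forall>\<^sub>F y in at_right (Inf S). c \<le> Ef \<Lambda> y"
        using eventually_at_right_less[of "Inf S"] by (auto elim: eventually_mono)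
    qed simp
  qed
qed

text \<open>At a quantile the expected count may jump over c, so the law of large numbers at x
  itself gives no good upper bound for energies below x. The left limit h does: it dominates the
  counts below x, and its mean stays at most c.\<close>

lemma left_limit_count:
  assumes fin: "finite \<Lambda>"
  obtains h where "h \<in> borel_measurable P" "local_on \<Lambda> h" "\<And>\<omega>. \<bar>h \<omega>\<bar> \<le> real (card \<Lambda>)"
    "\<And>\<omega> y. y < x \<Longrightarrow> eigenvalue_count \<Lambda> \<omega> y \<le> h \<omega>"
    "\<And>c. (\<And>y. y < x \<Longrightarrow> Ef \<Lambda> y \<le> c) \<Longrightarrow> expectation h \<le> c"
proof -
  note p = eigenvalue_count_props[OF fin]
  define s where "s k = x - 1 / real (Suc k)" for k
  define u where "u k \<omega> = eigenvalue_count \<Lambda> \<omega> (s k)" for k \<omega>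
  define h where "h \<omega> = lim (\<lambda>k. u k \<omega>)" for \<omega>
  have u: "0 \<le> u k \<omega>" "u k \<omega> \<le> real (card \<Lambda>)" for k \<omega> using p by (auto simp: u_def)
  have "incseq (\<lambda>k. u k \<omega>)" for \<omega>
    unfolding u_def by (intro monoI p(3)) (auto simp: s_def frac_le)
  then have conv: "(\<lambda>k. u k \<omega>) \<longlonglongrightarrow> h \<omega>" for \<omega>
    unfolding h_def convergent_LIMSEQ_iff[symmetric] using u(2)
    by (metis incseq_convergent convergentI)
  have um: "u k \<in> borel_measurable P" for k using f_P(1)[OF fin] by (simp add: u_def[abs_def])
  have hm: "h \<in> borel_measurable P" by (rule borel_measurable_LIMSEQ_real[OF conv um])
  show ?thesis
  proof
    show "h \<in> borel_measurable P" by (rule hm)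
    show "local_on \<Lambda> h"
      unfolding local_on_def h_def u_def using eigenvalue_count_local[OF fin] by metis
    have "0 \<le> h \<omega>" "h \<omega> \<le> real (card \<Lambda>)" for \<omega>
      using LIMSEQ_le_const[OF conv] LIMSEQ_le_const2[OF conv] u by blast+
    then show "\<bar>h \<omega>\<bar> \<le> real (card \<Lambda>)" for \<omega> by (rule abs_le_of_nonneg)
    have s: "s \<longlonglongrightarrow> x"
      unfolding s_def[abs_def] using tendsto_diff[OF tendsto_const LIMSEQ_Suc[OF lim_const_over_n[of "1 :: real"]], of x] by simp
    show "eigenvalue_count \<Lambda> \<omega> y \<le> h \<omega>" if "y < x" for \<omega> y
    proof (rule tendsto_lowerbound[OF conv])
      show "\<forall>\<^sub>F k in sequentially. eigenvalue_count \<Lambda> \<omega> y \<le> u k \<omega>"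
        using order_tendstoD(1)[OF s that] by eventually_elim (simp add: u_def p(3))
    qed simp
    show "expectation h \<le> c" if c: "\<And>y. y < x \<Longrightarrow> Ef \<Lambda> y \<le> c" for c
    proof (rule tendsto_upperbound)
      show "(\<lambda>k. expectation (u k)) \<longlonglongrightarrow> expectation h"
        by (rule integral_dominated_convergence[where w = "\<lambda>_. real (card \<Lambda>)"])
           (use um hm conv u in \<open>auto intro!: abs_le_of_nonneg\<close>)
      show "\<forall>\<^sub>F k in sequentially. expectation (u k) \<le> c"
        by (rule always_eventually) (auto simp: u_def[abs_def] s_def intro!: c)
    qed simp
  qed
qed

lemma avg_bounds: "(\<And>\<omega>. h \<omega> \<le> g \<omega>) \<Longrightarrow> avg m n h \<omega> \<le> avg m n g \<omega>"
  by (intro divide_right_mono sum_mono) auto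

lemma avg_count_bounds:
  assumes "finite \<Lambda>"
  shows "0 \<le> avg m n (\<lambda>\<omega>. eigenvalue_count \<Lambda> \<omega> x) \<omega>" "avg m n (\<lambda>\<omega>. eigenvalue_count \<Lambda> \<omega> x) \<omega> \<le> real (card \<Lambda>)"
proof -
  note p = eigenvalue_count_props[OF assms]
  show "0 \<le> avg m n (\<lambda>\<omega>. eigenvalue_count \<Lambda> \<omega> x) \<omega>" by (intro divide_nonneg_nonneg sum_nonneg p(1)) auto
  have "avg m n (\<lambda>\<omega>. eigenvalue_count \<Lambda> \<omega> x) \<omega> \<le> avg m n (\<lambda>\<omega>. real (card \<Lambda>)) \<omega>" by (rule avg_bounds) (rule p(2))
  also have "\<dots> \<le> real (card \<Lambda>)" by (simp add: divide_le_eq)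
  finally show "avg m n (\<lambda>\<omega>. eigenvalue_count \<Lambda> \<omega> x) \<omega> \<le> real (card \<Lambda>)" .
qed

text \<open>Quantiles are taken at the levels i K/(j+1). Between consecutive quantiles monotonicity
  bounds the average from below by its value at the lower one and from above by the left limit at
  the upper one. There are countably many levels, hence a single exceptional set.\<close>

theorem uniform_strong_law:
  assumes m: "1 \<le> m"
  defines "\<Lambda> \<equiv> inner_part r (cube m) :: (int ^ 'd) set"
  shows "AE \<omega> in P. \<forall>e>0. \<forall>\<^sub>F n in sequentially. \<forall>x. \<bar>avg m n (\<lambda>\<omega>. eigenvalue_count \<Lambda> \<omega> x) \<omega> - Ef \<Lambda> x\<bar> \<le> e"
proof (cases "\<Lambda> = {}")
  case True
  have "eigenvalue_count {} \<omega> x = 0" for \<omega> :: "int ^ 'd \<Rightarrow> real" and x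
    using eigenvalue_count_props(1,2)[of "{} :: (int ^ 'd) set" \<omega> x] by simp
  then show ?thesis using True by simp
next
  case False
  have fin: "finite \<Lambda>" by (simp add: \<Lambda>_def)
  define K where "K = real (card \<Lambda>)"
  have K: "0 < K" using False fin by (simp add: K_def card_gt_0_iff)
  let ?P = "\<lambda>c x h. c \<le> Ef \<Lambda> x \<and> (\<forall>y<x. Ef \<Lambda> y < c) \<and> h \<in> borel_measurable P \<and> local_on \<Lambda> h \<and> (\<forall>\<omega>. \<bar>h \<omega>\<bar> \<le> K) \<and>
      (\<forall>\<omega>. \<forall>y<x. eigenvalue_count \<Lambda> \<omega> y \<le> h \<omega>) \<and> expectation h \<le> c"
  \<comment> \<open>The condition on c sits inside the statement, so that quantiles and left limits
    can be chosen as total functions of c.\<close>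
  have "\<forall>c. \<exists>x h. 0 < c \<and> c < K \<longrightarrow> ?P c x h"
  proof
    fix c
    show "\<exists>x h. 0 < c \<and> c < K \<longrightarrow> ?P c x h"
    proof (cases "0 < c \<and> c < K")
      case True
      then obtain x where x: "c \<le> Ef \<Lambda> x" "\<And>y. y < x \<Longrightarrow> Ef \<Lambda> y < c" using Ef_level[OF fin, of c] by (auto simp: K_def)
      obtain h where h: "h \<in> borel_measurable P" "local_on \<Lambda> h" "\<And>\<omega>. \<bar>h \<omega>\<bar> \<le> real (card \<Lambda>)"
        "\<And>\<omega> y. y < x \<Longrightarrow> eigenvalue_count \<Lambda> \<omega> y \<le> h \<omega>" "\<And>c. (\<And>y. y < x \<Longrightarrow> Ef \<Lambda> y \<le> c) \<Longrightarrow> expectation h \<le> c"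
        by (rule left_limit_count[OF fin, of x]) blast
      have "expectation h \<le> c" by (rule h(5)) (rule less_imp_le[OF x(2)])
      then have "?P c x h" using x h(1-4) by (simp add: K_def)
      then show ?thesis by blast
    qed blast
  qed
  from choice[OF this] obtain X where "\<forall>c. \<exists>h. 0 < c \<and> c < K \<longrightarrow> ?P c (X c) h" ..
  from choice[OF this] obtain H where XH: "\<And>c. 0 < c \<Longrightarrow> c < K \<Longrightarrow> ?P c (X c) (H c)" by blast
  define c where "c j i = real i * K / real (Suc j)" for j i :: nat
  have cpos: "0 < c j i" if "0 < i" for i j using that K by (simp add: c_def)
  have clt: "c j i < K" if "i \<le> j" for i j using that K by (simp add: c_def pos_divide_less_eq)
  let ?G = "\<lambda>n x \<omega>. avg m n (\<lambda>\<omega>. eigenvalue_count \<Lambda> \<omega> x) \<omega>"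
  have "AE \<omega> in P. \<forall>j i. 0 < i \<longrightarrow> i \<le> j \<longrightarrow> (\<lambda>n. ?G n (X (c j i)) \<omega>) \<longlonglongrightarrow> Ef \<Lambda> (X (c j i)) \<and>
      (\<lambda>n. avg m n (H (c j i)) \<omega>) \<longlonglongrightarrow> expectation (H (c j i))"
    unfolding AE_all_countable
  proof (intro allI)
    fix j i :: nat
    show "AE \<omega> in P. 0 < i \<longrightarrow> i \<le> j \<longrightarrow> (\<lambda>n. ?G n (X (c j i)) \<omega>) \<longlonglongrightarrow> Ef \<Lambda> (X (c j i)) \<and>
      (\<lambda>n. avg m n (H (c j i)) \<omega>) \<longlonglongrightarrow> expectation (H (c j i))"
    proof (cases "0 < i \<and> i \<le> j")
      case True
      note h = XH[OF cpos clt, of i j]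
      have "AE \<omega> in P. (\<lambda>n. avg m n (H (c j i)) \<omega>) \<longlonglongrightarrow> expectation (H (c j i))"
        by (rule strong_law[OF m False[unfolded \<Lambda>_def], where C = K]) (use h True in \<open>auto simp: \<Lambda>_def\<close>)
      moreover have "AE \<omega> in P. (\<lambda>n. ?G n (X (c j i)) \<omega>) \<longlonglongrightarrow> Ef \<Lambda> (X (c j i))"
      proof (rule strong_law[OF m False[unfolded \<Lambda>_def], where C = K])
        show "local_on (inner_part r (cube m)) (\<lambda>\<omega>. eigenvalue_count \<Lambda> \<omega> (X (c j i)))"
          unfolding local_on_def \<Lambda>_def[symmetric] using eigenvalue_count_local[OF fin] by metis
      qed (use f_P(1)[OF fin] eigenvalue_count_props(1,2)[OF fin] in \<open>auto simp: K_def intro!: abs_le_of_nonneg\<close>)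
      ultimately show ?thesis by eventually_elim simp
    qed auto
  qed
  then show ?thesis
  proof eventually_elim
    case (elim \<omega>)
    show ?case
    proof (intro allI impI)
      fix e :: real assume e: "0 < e"
      have "(\<lambda>j. K / real (Suc j)) \<longlonglongrightarrow> 0" by (rule LIMSEQ_Suc[OF lim_const_over_n])
      from order_tendstoD(2)[OF this half_gt_zero[OF e]] obtain j where j: "K / real (Suc j) < e / 2"
        unfolding eventually_sequentially by blast
      have "\<forall>\<^sub>F n in sequentially. \<forall>i\<in>{1..j}. Ef \<Lambda> (X (c j i)) - e / 2 < ?G n (X (c j i)) \<omega> \<and>
          avg m n (H (c j i)) \<omega> < expectation (H (c j i)) + e / 2"
      proof (rule eventually_ball_finite, simp, intro ballI)
        fix i assume i: "i \<in> {1..j}"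
        then have "(\<lambda>n. ?G n (X (c j i)) \<omega>) \<longlonglongrightarrow> Ef \<Lambda> (X (c j i))" "(\<lambda>n. avg m n (H (c j i)) \<omega>) \<longlonglongrightarrow> expectation (H (c j i))"
          using elim[rule_format, of i j] by auto
        from order_tendstoD(1)[OF this(1), of "Ef \<Lambda> (X (c j i)) - e / 2"] order_tendstoD(2)[OF this(2), of "expectation (H (c j i)) + e / 2"] e
        show "\<forall>\<^sub>F n in sequentially. Ef \<Lambda> (X (c j i)) - e / 2 < ?G n (X (c j i)) \<omega> \<and>
          avg m n (H (c j i)) \<omega> < expectation (H (c j i)) + e / 2"
          by (simp add: eventually_conj)
      qed
      then show "\<forall>\<^sub>F n in sequentially. \<forall>x. \<bar>?G n x \<omega> - Ef \<Lambda> x\<bar> \<le> e"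
      proof eventually_elim
        case (elim n)
        show ?case
        proof
          fix x
          \<comment> \<open>The last level not exceeding the expected count at x. Level 0 always
            qualifies, and level j + 1 is K, which no count exceeds.\<close>
          define I where "I = {i. i \<le> j \<and> c j i \<le> Ef \<Lambda> x}"
          have I: "finite I" "0 \<in> I" using Ef_bounds(1)[OF fin] by (auto simp: I_def c_def)
          define i where "i = Max I"
          have "i \<in> I" unfolding i_def by (rule Max_in) (use I in auto)
          then have i: "i \<le> j" "c j i \<le> Ef \<Lambda> x" by (auto simp: I_def)
          have up: "Ef \<Lambda> x < c j (Suc i)" if "i \<noteq> j"
          proof (rule ccontr)
            assume "\<not> ?thesis"
            then have "Suc i \<in> I" using i that by (auto simp: I_def)
            then show False using Max_ge[OF I(1), of "Suc i"] by (simp add: i_def[symmetric])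
          qed
          have step: "c j (Suc i) - c j i < e / 2" using j by (simp add: c_def diff_divide_distrib[symmetric] algebra_simps)
          have top: "c j (Suc j) = K" by (simp add: c_def)
          have upF: "Ef \<Lambda> x \<le> c j (Suc i)" using up top Ef_bounds(2)[OF fin, of x] by (cases "i = j") (auto simp: K_def)
          have lower: "c j i - e / 2 \<le> ?G n x \<omega>"
          proof (cases "i = 0")
            case True
            then show ?thesis using avg_count_bounds(1)[OF fin, where m = m and n = n and x = x and \<omega> = \<omega>] e by (simp add: c_def)
          next
            case False
            then have h: "?P (c j i) (X (c j i)) (H (c j i))" using XH cpos clt i by simp
            then have "X (c j i) \<le> x" using i(2) by (meson not_le)
            then have "?G n (X (c j i)) \<omega> \<le> ?G n x \<omega>" by (intro avg_bounds eigenvalue_count_props(3)[OF fin])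
            moreover have "Ef \<Lambda> (X (c j i)) - e / 2 < ?G n (X (c j i)) \<omega>" using elim False i by auto
            ultimately show ?thesis using h by linarith
          qed
          have upper: "?G n x \<omega> \<le> c j (Suc i) + e / 2"
          proof (cases "i = j")
            case True
            then show ?thesis using avg_count_bounds(2)[OF fin, where m = m and n = n and x = x and \<omega> = \<omega>] top e by (simp add: K_def)
          next
            case False
            then have h: "?P (c j (Suc i)) (X (c j (Suc i))) (H (c j (Suc i)))" using XH cpos clt i by simp
            have "x < X (c j (Suc i))"
            proof (rule ccontr)
              assume "\<not> ?thesis"
              then have "Ef \<Lambda> (X (c j (Suc i))) \<le> Ef \<Lambda> x" by (intro Ef_bounds(3)[OF fin]) simp
              then show False using up[OF False] h by linarith
            qed
            then have "?G n x \<omega> \<le> avg m n (H (c j (Suc i))) \<omega>" using h by (intro avg_bounds) simp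
            moreover have "avg m n (H (c j (Suc i))) \<omega> < expectation (H (c j (Suc i))) + e / 2" using elim False i by auto
            ultimately show ?thesis using h by linarith
          qed
          show "\<bar>?G n x \<omega> - Ef \<Lambda> x\<bar> \<le> e" using lower upper step upF i(2) by linarith
        qed
      qed
    qed
  qed
qed

end

subsection \<open>Convergence and its rate\<close>

text \<open>This includes integrands that are not integrable: their integral is 0 by convention, and
  C is nonnegative because a probability space is nonempty. Pairings can thus be bounded uniformly
  over the admissible class.\<close>

lemma abs_integral_completion_le:
  fixes k :: "'a \<Rightarrow> real"
  assumes "prob_space M" and k: "\<And>x. x \<in> space M \<Longrightarrow> \<bar>k x\<bar> \<le> C"
  shows "\<bar>\<integral>x. k x \<partial>completion M\<bar> \<le> C"
proof -
  interpret prob_space "completion M"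
    by (rule prob_spaceI) (simp add: emeasure_completion assms(1) prob_space.emeasure_space_1)
  show ?thesis
  proof (cases "integrable (completion M) k")
    case True
    have "\<bar>\<integral>x. k x \<partial>completion M\<bar> \<le> (\<integral>x. \<bar>k x\<bar> \<partial>completion M)" by (rule integral_abs_bound)
    also have "\<dots> \<le> (\<integral>x. C \<partial>completion M)" by (rule integral_mono) (use True k in auto)
    finally show ?thesis using prob_space.prob_space[OF assms(1)] by simp
  next
    case False
    obtain x where "x \<in> space M" using prob_space.not_empty[OF assms(1)] by blast
    then have "0 \<le> C" using k[of x] by linarith
    then show ?thesis using False by (simp add: not_integrable_integral_eq)
  qed
qed

section \<open>Uniform bounds for admissible fields\<close>

lemma admissible_D:
  assumes "admissible A g"
  shows "finite \<Lambda> \<Longrightarrow> \<omega> \<in> configs A \<Longrightarrow> g \<Lambda> \<omega> \<in> rc_bounded"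
    "finite \<Lambda> \<Longrightarrow> \<omega> \<in> configs A \<Longrightarrow> g (translate \<Lambda> z) \<omega> = g \<Lambda> (shift z \<omega>)"
    "finite \<Lambda> \<Longrightarrow> \<omega> \<in> configs A \<Longrightarrow> \<omega>' \<in> configs A \<Longrightarrow> restrict \<omega> \<Lambda> = restrict \<omega>' \<Lambda> \<Longrightarrow> g \<Lambda> \<omega> = g \<Lambda> \<omega>'"
    "bdd_above ((\<lambda>\<omega>. sup_norm (g {0} \<omega>)) ` configs A)"
proof -
  note a = assms[unfolded admissible_def]
  note a2 = a[THEN conjunct2] and a3 = a[THEN conjunct2, THEN conjunct2]
  show "finite \<Lambda> \<Longrightarrow> \<omega> \<in> configs A \<Longrightarrow> g \<Lambda> \<omega> \<in> rc_bounded"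
    by (rule a[THEN conjunct1, rule_format])
  show "finite \<Lambda> \<Longrightarrow> \<omega> \<in> configs A \<Longrightarrow> g (translate \<Lambda> z) \<omega> = g \<Lambda> (shift z \<omega>)"
    by (rule a2[THEN conjunct1, rule_format])
  show "finite \<Lambda> \<Longrightarrow> \<omega> \<in> configs A \<Longrightarrow> \<omega>' \<in> configs A \<Longrightarrow> restrict \<omega> \<Lambda> = restrict \<omega>' \<Lambda> \<Longrightarrow> g \<Lambda> \<omega> = g \<Lambda> \<omega>'"
    by (rule a3[THEN conjunct1, rule_format])
  show "bdd_above ((\<lambda>\<omega>. sup_norm (g {0} \<omega>)) ` configs A)"
    by (rule a3[THEN conjunct2, THEN conjunct2, THEN conjunct2])
qed

lemma rc_bounded_le_sup_norm: "F \<in> rc_bounded \<Longrightarrow> \<bar>F x\<bar> \<le> sup_norm F"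
  by (rule le_sup_norm) (simp add: rc_bounded_def)

text \<open>\<open>sup_norm\<close> controls pointwise values only for bounded functions, so
  boundedness of the difference is established before the supremum is used.\<close>

lemma boundary_term_D:
  assumes g: "admissible A g" and b: "boundary_term A g b D" and \<omega>: "\<omega> \<in> configs A"
    and n: "1 \<le> n" and fin: "\<And>i. i \<in> {1..n} \<Longrightarrow> finite (\<Lambda>s i)" and dj: "disjoint_family_on \<Lambda>s {1..n::nat}"
  shows "\<bar>g (\<Union>i\<in>{1..n}. \<Lambda>s i) \<omega> x - (\<Sum>i\<in>{1..n}. g (\<Lambda>s i) \<omega> x)\<bar> \<le> (\<Sum>i\<in>{1..n}. D * real (card (\<Lambda>s i)))"
proof -
  let ?F = "\<lambda>x. g (\<Union>i\<in>{1..n}. \<Lambda>s i) \<omega> x - (\<Sum>i\<in>{1..n}. g (\<Lambda>s i) \<omega> x)"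
  have gb: "\<bar>g \<Lambda> \<omega> x\<bar> \<le> sup_norm (g \<Lambda> \<omega>)" if "finite \<Lambda>" for \<Lambda> x
    by (rule rc_bounded_le_sup_norm[OF admissible_D(1)[OF g that \<omega>]])
  have "\<bar>?F x\<bar> \<le> sup_norm (g (\<Union>i\<in>{1..n}. \<Lambda>s i) \<omega>) + (\<Sum>i\<in>{1..n}. sup_norm (g (\<Lambda>s i) \<omega>))" for x
  proof -
    have "\<bar>\<Sum>i\<in>{1..n}. g (\<Lambda>s i) \<omega> x\<bar> \<le> (\<Sum>i\<in>{1..n}. sup_norm (g (\<Lambda>s i) \<omega>))"
      by (rule order_trans[OF sum_abs]) (intro sum_mono gb fin)
    moreover have "\<bar>g (\<Union>i\<in>{1..n}. \<Lambda>s i) \<omega> x\<bar> \<le> sup_norm (g (\<Union>i\<in>{1..n}. \<Lambda>s i) \<omega>)" by (rule gb) (use fin in auto)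
    ultimately show ?thesis by linarith
  qed
  then have "bounded (range ?F)" unfolding bounded_iff by auto
  then have "\<bar>?F x\<bar> \<le> sup_norm ?F" by (rule le_sup_norm)
  also have "\<dots> \<le> (\<Sum>i\<in>{1..n}. b (\<Lambda>s i))" 
    by (rule b[unfolded boundary_term_def, THEN conjunct2, THEN conjunct1, rule_format]) (use \<omega> n fin dj in auto)
  also have "\<dots> \<le> (\<Sum>i\<in>{1..n}. D * real (card (\<Lambda>s i)))" 
    by (rule sum_mono, rule b[unfolded boundary_term_def, THEN conjunct2, THEN conjunct2, THEN conjunct2, THEN conjunct2, THEN conjunct1, rule_format], rule fin)
  finally show ?thesis .
qed

text \<open>\<open>field_bound\<close> dominates its members only if they are bounded above.
  Splitting \<Lambda> into single sites gives such a bound: by translation covariance and the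
  boundary term each site costs at most S + Dg.\<close>

lemma admissible_class_bound:
  assumes g: "g \<in> admissible_class A K D D' r'" and fin: "finite \<Lambda>" and \<omega>: "\<omega> \<in> configs A"
  shows "\<bar>g \<Lambda> \<omega> x\<bar> \<le> K * real (card \<Lambda>)"
proof -
  obtain b Dg where ad: "admissible A g" and K: "field_bound A g \<le> K" and b: "boundary_term A g b Dg"
    using g unfolding admissible_class_def by blast
  show ?thesis
  proof (cases "\<Lambda> = {}")
    case True
    \<comment> \<open>The empty set is the disjoint union of two empty sets, so |g({}) - 2 g({})|
      \<le> 0 forces the value 0.\<close>
    have "\<bar>g (\<Union>i\<in>{1..2::nat}. {}) \<omega> x - (\<Sum>i\<in>{1..2::nat}. g {} \<omega> x)\<bar> \<le> (\<Sum>i\<in>{1..2::nat}. Dg * real (card ({} :: (int ^ 'a) set)))"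
      by (rule boundary_term_D[OF ad b \<omega>]) (auto simp: disjoint_family_on_def)
    then show ?thesis using True by simp
  next
    case False
    obtain S where S: "\<And>\<omega>. \<omega> \<in> configs A \<Longrightarrow> sup_norm (g {0} \<omega>) \<le> S"
      using admissible_D(4)[OF ad] unfolding bdd_above_def by auto
    have single: "\<bar>g {z} \<omega> x\<bar> \<le> S" if "\<omega> \<in> configs A" for \<omega> z x
    proof -
      have s: "shift z \<omega> \<in> configs A" using that by (simp add: configs_def shift_def)
      have "g {z} \<omega> = g {0} (shift z \<omega>)" using admissible_D(2)[OF ad _ that, of "{0}" z] by (simp add: translate_def)
      then show ?thesis
        using rc_bounded_le_sup_norm[OF admissible_D(1)[OF ad _ s], of "{0}" x] S[OF s] by simp
    qed
    have "sup_norm (g \<Lambda> \<omega>) / real (card \<Lambda>) \<le> S + Dg" if "finite \<Lambda>" "\<Lambda> \<noteq> {}" "\<omega> \<in> configs A" for \<Lambda> \<omega>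
    proof -
      let ?n = "card \<Lambda>"
      have n: "1 \<le> ?n" using that by (simp add: card_gt_0_iff Suc_le_eq)
      obtain e where e: "bij_betw e {1..?n} \<Lambda>" using ex_bij_betw_nat_finite_1[OF \<open>finite \<Lambda>\<close>] by blast
      have un: "(\<Union>i\<in>{1..?n}. {e i}) = \<Lambda>" using bij_betw_imp_surj_on[OF e] by auto
      have dj: "disjoint_family_on (\<lambda>i. {e i}) {1..?n}"
        by (simp add: disjoint_family_on_def inj_on_eq_iff[OF bij_betw_imp_inj_on[OF e]])
      have "\<bar>g \<Lambda> \<omega> x\<bar> \<le> real ?n * (S + Dg)" for x
      proof -
        have "\<bar>g \<Lambda> \<omega> x - (\<Sum>i\<in>{1..?n}. g {e i} \<omega> x)\<bar> \<le> (\<Sum>i\<in>{1..?n}. Dg * real (card {e i}))"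
          using boundary_term_D[OF ad b that(3) n _ dj, of x] unfolding un by simp
        moreover have "\<bar>\<Sum>i\<in>{1..?n}. g {e i} \<omega> x\<bar> \<le> (\<Sum>i\<in>{1..?n}. S)"
          by (rule order_trans[OF sum_abs]) (intro sum_mono single that)
        ultimately show ?thesis by (simp add: algebra_simps)
      qed
      then have "sup_norm (g \<Lambda> \<omega>) \<le> real ?n * (S + Dg)" by (rule sup_norm_le)
      then show ?thesis using n by (simp add: pos_divide_le_eq mult.commute)
    qed
    then have "bdd_above ((\<lambda>(\<Lambda>, \<omega>). sup_norm (g \<Lambda> \<omega>) / real (card \<Lambda>)) ` ({\<Lambda>. finite \<Lambda> \<and> \<Lambda> \<noteq> {}} \<times> configs A))"
      by (intro bdd_aboveI[of _ "S + Dg"]) auto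
    from cSUP_upper[OF _ this, of "(\<Lambda>, \<omega>)"] have "sup_norm (g \<Lambda> \<omega>) / real (card \<Lambda>) \<le> field_bound A g"
      using False fin \<omega> by (simp add: field_bound_def)
    then have "sup_norm (g \<Lambda> \<omega>) / real (card \<Lambda>) \<le> K" using K by linarith
    then have "sup_norm (g \<Lambda> \<omega>) \<le> K * real (card \<Lambda>)" using False fin by (simp add: pos_divide_le_eq card_gt_0_iff)
    then show ?thesis using rc_bounded_le_sup_norm[OF admissible_D(1)[OF ad fin \<omega>], of x] by linarith
  qed
qed

text \<open>Three comparisons: 2d \<le> 2^(d+1), k \<le> k^d for natural k, and n - m \<le> n, m - r
  \<le> m for the denominators. They leave the numerators 3m/2 and 2 + 4r, which lie below those of
  the claimed rate.\<close>

lemma error_term_bound: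
  fixes d :: nat
  assumes d: "1 \<le> d" and m: "r < m" "m < n"
  shows "real d * (2 + 4 * real r) / real m + (real d * (2 + 4 * real r) / real m + 3 * real d * real m / real n)
    \<le> 2 ^ (d + 1) * ((26 * real m ^ d + 8) / (real n - real m) + (34 * real r ^ d + 24) / (real m - real r))"
proof -
  have dd: "2 * real d \<le> 2 ^ (d + 1)" using of_nat_less_two_power[of d, where 'a = real] by simp
  have pw: "real k \<le> real k ^ d" for k :: nat
    using self_le_power[of k d] d by (cases "k = 0") (simp_all flip: of_nat_power)
  have q: "3 / 2 * real m \<le> 26 * real m ^ d + 8" "2 + 4 * real r \<le> 34 * real r ^ d + 24"
    using pw[of m] pw[of r] of_nat_0_le_iff[of m, where 'a = real] of_nat_0_le_iff[of r, where 'a = real] by linarith+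
  have "3 * real d * real m / real n = (2 * real d) * (3 / 2 * real m / real n)" by simp
  also have "\<dots> \<le> 2 ^ (d + 1) * ((26 * real m ^ d + 8) / (real n - real m))"
    using q(1) m by (intro mult_mono frac_le dd) auto
  finally have 1: "3 * real d * real m / real n \<le> 2 ^ (d + 1) * ((26 * real m ^ d + 8) / (real n - real m))" .
  have "real d * (2 + 4 * real r) / real m + real d * (2 + 4 * real r) / real m = (2 * real d) * ((2 + 4 * real r) / real m)" by simp
  also have "\<dots> \<le> 2 ^ (d + 1) * ((34 * real r ^ d + 24) / (real m - real r))"
    using q(2) m by (intro mult_mono frac_le dd) auto
  finally show ?thesis using 1 by (simp only: distrib_left)
qed

context random_field begin

section \<open>Pairings with the marginal and the empirical measure\<close>

lemma restrict_space_config: "\<omega> \<in> configs A \<Longrightarrow> restrict \<omega> \<Lambda> \<in> space (config_algebra A \<Lambda>)"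
  by (auto simp: space_config_algebra configs_def)

lemma localize_choice:
  fixes \<Lambda> :: "(int ^ 'd) set"
  assumes "\<eta> \<in> space (config_algebra A \<Lambda>)"
  obtains \<omega> where "\<omega> \<in> configs A" "restrict \<omega> \<Lambda> = \<eta>" "localize A g \<Lambda> \<eta> = g \<Lambda> \<omega>"
proof -
  have "restrict (ext \<Lambda> \<eta>) \<Lambda> = \<eta>"
    using assms by (auto simp: space_config_algebra PiE_def extensional_def restrict_def ext_def)
  then have "\<exists>\<omega>. \<omega> \<in> configs A \<and> restrict \<omega> \<Lambda> = \<eta>" using ext_configs[OF assms] by blast
  from someI_ex[OF this] show ?thesis by (intro that) (auto simp: localize_def)
qed

lemma localize_restrict:
  fixes \<Lambda> :: "(int ^ 'd) set"
  assumes g: "admissible A g" and fin: "finite \<Lambda>" and \<omega>: "\<omega> \<in> configs A"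
  shows "localize A g \<Lambda> (restrict \<omega> \<Lambda>) = g \<Lambda> \<omega>"
proof -
  obtain \<omega>' where "\<omega>' \<in> configs A" "restrict \<omega>' \<Lambda> = restrict \<omega> \<Lambda>" "localize A g \<Lambda> (restrict \<omega> \<Lambda>) = g \<Lambda> \<omega>'"
    by (rule localize_choice[OF restrict_space_config[OF \<omega>], where \<Lambda> = \<Lambda> and g = g]) blast
  then show ?thesis using admissible_D(3)[OF g fin _ \<omega>] by metis
qed

lemma localize_count: "finite (\<Lambda> :: (int ^ 'd) set) \<Longrightarrow> \<omega> \<in> configs A \<Longrightarrow> localize A eigenvalue_count \<Lambda> (restrict \<omega> \<Lambda>) = eigenvalue_count \<Lambda> \<omega>"
  by (rule localize_restrict[OF eigenvalue_count_admissible])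

text \<open>The arbitrary extension chosen in \<open>localize\<close> may be replaced by the
  measurable extension \<open>ext\<close>, since the count depends only on the pattern.\<close>

lemma localize_count_measurable:
  fixes \<Lambda> :: "(int ^ 'd) set"
  assumes fin: "finite \<Lambda>"
  shows "(\<lambda>\<eta>. localize A eigenvalue_count \<Lambda> \<eta> x) \<in> borel_measurable (config_algebra A \<Lambda>)"
proof -
  have "(\<lambda>\<eta>. eigenvalue_count \<Lambda> (ext \<Lambda> \<eta>) x) \<in> borel_measurable (config_algebra A \<Lambda>)"
    by (rule measurable_compose[OF ext_measurable f_P(1)[OF fin]])
  moreover have "eigenvalue_count \<Lambda> (ext \<Lambda> \<eta>) x = localize A eigenvalue_count \<Lambda> \<eta> x"
    if \<eta>: "\<eta> \<in> space (config_algebra A \<Lambda>)" for \<eta>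
  proof -
    have "restrict (ext \<Lambda> \<eta>) \<Lambda> = \<eta>"
      using \<eta> by (auto simp: space_config_algebra PiE_def extensional_def restrict_def ext_def)
    then show ?thesis using localize_count[OF fin ext_configs[OF \<eta>]] by simp
  qed
  ultimately show ?thesis by (simp cong: measurable_cong)
qed

text \<open>For a measurable integrand the integral over the completion is the ordinary one.\<close>

lemma pairing_distr:
  fixes \<Lambda> :: "(int ^ 'd) set"
  assumes fin: "finite \<Lambda>" and G: "G \<in> M \<rightarrow>\<^sub>M config_algebra A \<Lambda>"
  shows "pairing (localize A eigenvalue_count \<Lambda>) (distr M (config_algebra A \<Lambda>) G) x = (\<integral>y. localize A eigenvalue_count \<Lambda> (G y) x \<partial>M)"
proof -
  note k = localize_count_measurable[OF fin, of x]
  have "(\<lambda>\<eta>. localize A eigenvalue_count \<Lambda> \<eta> x) \<in> borel_measurable (distr M (config_algebra A \<Lambda>) G)" using k by simp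
  from integral_completion[OF this] show ?thesis
    unfolding pairing_def using integral_distr[OF G k] by simp
qed

lemma pairing_marginal: "finite \<Lambda> \<Longrightarrow> pairing (localize A eigenvalue_count \<Lambda>) (marginal A P \<Lambda>) x = Ef \<Lambda> x"
  unfolding marginal_def
  by (subst pairing_distr[OF _ restrict_measurable]) (auto intro!: Bochner_Integration.integral_cong simp: space_P localize_count)

lemma pattern_measurable:
  assumes "\<omega> \<in> configs A"
  shows "(\<lambda>t. restrict (shift t \<omega>) \<Lambda>) \<in> uniform_count_measure T \<rightarrow>\<^sub>M config_algebra A \<Lambda>"
  using restrict_space_config[OF shift_configs[OF assms]]
  by (auto simp: measurable_def space_uniform_count_measure sets_uniform_count_measure)

lemma pairing_empirical:
  assumes \<omega>: "\<omega> \<in> configs A" and m: "1 \<le> m"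
  shows "pairing (localize A eigenvalue_count (inner_part r (cube m))) (empirical_measure A r m n \<omega>) x =
    avg m n (\<lambda>\<omega>. eigenvalue_count (inner_part r (cube m)) \<omega> x) \<omega>"
  unfolding empirical_measure_def
  by (subst pairing_distr[OF finite_inner_part_cube pattern_measurable[OF \<omega>]])
     (simp add: integral_uniform_count_measure finite_tiles[OF m] localize_count shift_configs[OF \<omega>])

lemma pairing_bound:
  fixes \<Lambda> :: "(int ^ 'd) set"
  assumes g: "g \<in> admissible_class A K D D' r'" and fin: "finite \<Lambda>"
    and M: "prob_space M" and G: "G \<in> M \<rightarrow>\<^sub>M config_algebra A \<Lambda>"
  shows "\<bar>pairing (localize A g \<Lambda>) (distr M (config_algebra A \<Lambda>) G) x\<bar> \<le> K * real (card \<Lambda>)"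
  unfolding pairing_def
proof (rule abs_integral_completion_le)
  show "prob_space (distr M (config_algebra A \<Lambda>) G)" by (rule prob_space.prob_space_distr[OF M G])
  fix \<eta> assume "\<eta> \<in> space (distr M (config_algebra A \<Lambda>) G)"
  then have "\<eta> \<in> space (config_algebra A \<Lambda>)" by simp
  then obtain \<omega> where "\<omega> \<in> configs A" "localize A g \<Lambda> \<eta> = g \<Lambda> \<omega>" by (rule localize_choice[where g = g]) blast
  then show "\<bar>localize A g \<Lambda> \<eta> x\<bar> \<le> K * real (card \<Lambda>)" using admissible_class_bound[OF g fin] by simp
qed

abbreviation discrepancy :: "'d field \<Rightarrow> nat \<Rightarrow> nat \<Rightarrow> (int ^ 'd \<Rightarrow> real) \<Rightarrow> real \<Rightarrow> real" where
  "discrepancy g m n \<omega> E \<equiv> pairing (localize A g (inner_part r (cube m))) (empirical_measure A r m n \<omega>) E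
     - pairing (localize A g (inner_part r (cube m))) (marginal A P (inner_part r (cube m))) E"

lemma discrepancy_bound:
  assumes g: "g \<in> admissible_class A K D D' r'" and \<omega>: "\<omega> \<in> configs A" and m: "1 \<le> m" "m < n"
  shows "\<bar>discrepancy g m n \<omega> E\<bar> \<le> 2 * (K * real (card (inner_part r (cube m) :: (int ^ 'd) set)))"
proof -
  have "card (tiles m n :: (int ^ 'd) set) \<noteq> 0" using m by (simp add: card_tiles div_greater_zero_iff)
  then have "tiles m n \<noteq> ({} :: (int ^ 'd) set)" by auto
  then have "prob_space (uniform_count_measure (tiles m n :: (int ^ 'd) set))"
    using finite_tiles[OF m(1)] by (intro prob_space_uniform_count_measure)
  from pairing_bound[OF g finite_inner_part_cube this pattern_measurable[OF \<omega>]]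
  have "\<bar>pairing (localize A g (inner_part r (cube m))) (empirical_measure A r m n \<omega>) E\<bar>
      \<le> K * real (card (inner_part r (cube m) :: (int ^ 'd) set))"
    by (simp add: empirical_measure_def)
  moreover have "\<bar>pairing (localize A g (inner_part r (cube m))) (marginal A P (inner_part r (cube m))) E\<bar>
      \<le> K * real (card (inner_part r (cube m) :: (int ^ 'd) set))"
    unfolding marginal_def by (rule pairing_bound[OF g finite_inner_part_cube prob_space_axioms restrict_measurable])
  ultimately show ?thesis by linarith
qed

text \<open>Two intermediate quantities, the empirical average over the tiles and its mean:
  \<open>tiling_estimate\<close> links the first to the cube, \<open>ids_Ef_inner\<close> the second
  to the density of states.\<close>

lemma ids_deviation:
  assumes m: "1 \<le> m" "m < n"
  defines "\<Lambda> \<equiv> inner_part r (cube m) :: (int ^ 'd) set"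
  shows "\<bar>eigenvalue_count (cube n) \<omega> x / real (card (cube n :: (int ^ 'd) set)) - ids P x\<bar>
    \<le> real CARD('d) * (2 + 4 * real r) / real m
      + (real CARD('d) * (2 + 4 * real r) / real m + 3 * real CARD('d) * real m / real n)
      + \<bar>avg m n (\<lambda>\<omega>. eigenvalue_count \<Lambda> \<omega> x) \<omega> - Ef \<Lambda> x\<bar> / real (card (cube m :: (int ^ 'd) set))"
proof -
  let ?M = "real m ^ CARD('d)" and ?a = "avg m n (\<lambda>\<omega>. eigenvalue_count \<Lambda> \<omega> x) \<omega>"
  have "\<bar>a / ?M - b / ?M\<bar> = \<bar>a - b\<bar> / ?M" for a b
    unfolding diff_divide_distrib[symmetric] abs_divide by simp
  from this[of ?a "Ef \<Lambda> x"] have "\<bar>?a / ?M - Ef \<Lambda> x / ?M\<bar> = \<bar>?a - Ef \<Lambda> x\<bar> / ?M" .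
  then show ?thesis
    using tiling_estimate[OF m, where \<omega> = \<omega> and x = x and r = r, folded \<Lambda>_def] ids_Ef_inner[OF m(1), of x, folded \<Lambda>_def]
    unfolding card_cube of_nat_power by linarith
qed

lemma quantitative_bound:
  assumes \<omega>: "\<omega> \<in> configs A" and m: "r < m" "m < n"
  shows "sup_norm (\<lambda>x. eigenvalue_count (cube n) \<omega> x / real (card (cube n :: (int ^ 'd) set)) - ids P x)
    \<le> 2 ^ (CARD('d) + 1) * ((26 * real m ^ CARD('d) + 8) / (real n - real m) + (34 * real r ^ CARD('d) + 24) / (real m - real r)) +
      (SUP g \<in> admissible_class A 9 8 8 1. sup_norm (\<lambda>E. discrepancy g m n \<omega> E) / real (card (cube m :: (int ^ 'd) set)))"
proof (rule sup_norm_le)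
  fix x
  let ?M = "real (card (cube m :: (int ^ 'd) set))" and ?\<Lambda> = "inner_part r (cube m) :: (int ^ 'd) set"
  have m1: "1 \<le> m" using m by simp
  let ?F = "\<lambda>g. sup_norm (\<lambda>E. discrepancy g m n \<omega> E) / ?M"
  have f: "(eigenvalue_count :: 'd field) \<in> admissible_class A 9 8 8 1" by (rule eigenvalue_count_in_class[OF configs_nonempty])
  \<comment> \<open>The supremum over the class dominates its members only once they are bounded
    above; 9 is the constant K of the class.\<close>
  have "bdd_above (?F ` admissible_class A 9 8 8 1)"
  proof (rule bdd_aboveI2)
    fix g :: "'d field" assume g: "g \<in> admissible_class A 9 8 8 1"
    show "?F g \<le> 2 * (9 * real (card ?\<Lambda>)) / ?M"
      by (intro divide_right_mono sup_norm_le discrepancy_bound[OF g \<omega> m1 m(2)]) simp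
  qed
  from cSUP_upper[OF f this] have S: "?F eigenvalue_count \<le> (SUP g \<in> admissible_class A 9 8 8 1. ?F g)" .
  have "bounded (range (discrepancy eigenvalue_count m n \<omega>))"
    unfolding bounded_iff using discrepancy_bound[OF f \<omega> m1 m(2)] by auto
  from le_sup_norm[OF this, of x]
  have "\<bar>avg m n (\<lambda>\<omega>. eigenvalue_count ?\<Lambda> \<omega> x) \<omega> - Ef ?\<Lambda> x\<bar> / ?M \<le> ?F eigenvalue_count"
    unfolding pairing_empirical[OF \<omega> m1] pairing_marginal[OF finite_inner_part_cube] by (rule divide_right_mono) simp
  moreover have "1 \<le> CARD('d)" by (simp add: Suc_le_eq)
  ultimately show "\<bar>eigenvalue_count (cube n) \<omega> x / real (card (cube n :: (int ^ 'd) set)) - ids P x\<bar>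
    \<le> 2 ^ (CARD('d) + 1) * ((26 * real m ^ CARD('d) + 8) / (real n - real m) + (34 * real r ^ CARD('d) + 24) / (real m - real r)) +
      (SUP g \<in> admissible_class A 9 8 8 1. ?F g)"
    using ids_deviation[OF m1 m(2), of \<omega> x] error_term_bound[OF _ m, of "CARD('d)"] S by linarith
qed

text \<open>The tile size m is fixed first, to make the part of the error of order 1/m small, and
  then n grows. Exceptional sets depend on m, but there are only countably many m.\<close>

lemma ids_uniform_convergence:
  "AE \<omega> in P. (\<lambda>n. sup_norm (\<lambda>x. eigenvalue_count (cube n) \<omega> x / real (card (cube n :: (int ^ 'd) set)) - ids P x)) \<longlonglongrightarrow> 0"
proof -
  let ?\<Lambda> = "\<lambda>m. inner_part r (cube m) :: (int ^ 'd) set"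
  have "AE \<omega> in P. \<forall>m. \<forall>e>0. \<forall>\<^sub>F n in sequentially. \<forall>x.
      \<bar>avg (Suc m) n (\<lambda>\<omega>. eigenvalue_count (?\<Lambda> (Suc m)) \<omega> x) \<omega> - Ef (?\<Lambda> (Suc m)) x\<bar> \<le> e"
    unfolding AE_all_countable[where 'i = nat] by (intro allI uniform_strong_law) simp
  then show ?thesis
  proof eventually_elim
    case (elim \<omega>)
    let ?F = "\<lambda>n x. eigenvalue_count (cube n) \<omega> x / real (card (cube n :: (int ^ 'd) set)) - ids P x"
    show ?case
    proof (rule tendstoI)
      fix e :: real assume e: "0 < e"
      define D where "D = real CARD('d) * (2 + 4 * real r)"
      have "(\<lambda>m. D / real (Suc m)) \<longlonglongrightarrow> 0" by (rule LIMSEQ_Suc[OF lim_const_over_n])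
      from order_tendstoD(2)[OF this, of "e / 5"] e have "\<forall>\<^sub>F m in sequentially. D / real (Suc m) < e / 5" by simp
      then obtain m where m: "D / real (Suc m) < e / 5" unfolding eventually_sequentially by blast
      have "(\<lambda>n. 3 * real CARD('d) * real (Suc m) / real n) \<longlonglongrightarrow> 0" by (rule lim_const_over_n)
      from order_tendstoD(2)[OF this, of "e / 5"] e
      have ev: "\<forall>\<^sub>F n in sequentially. 3 * real CARD('d) * real (Suc m) / real n < e / 5" by simp
      have ev': "\<forall>\<^sub>F n in sequentially. \<forall>x. \<bar>avg (Suc m) n (\<lambda>\<omega>. eigenvalue_count (?\<Lambda> (Suc m)) \<omega> x) \<omega> - Ef (?\<Lambda> (Suc m)) x\<bar> \<le> e / 5"
        using elim[rule_format, of "e / 5" m] e by simp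
      show "\<forall>\<^sub>F n in sequentially. dist (sup_norm (?F n)) 0 < e"
        using ev ev' eventually_gt_at_top[of "Suc m"]
      proof eventually_elim
        case (elim n)
        \<comment> \<open>D/m enters twice, from the tiling and from the density of states. With
          3dm/n and the empirical error this makes four terms of at most e/5.\<close>
        have b: "\<bar>?F n x\<bar> \<le> 4 / 5 * e" for x
        proof -
          let ?a = "\<bar>avg (Suc m) n (\<lambda>\<omega>. eigenvalue_count (?\<Lambda> (Suc m)) \<omega> x) \<omega> - Ef (?\<Lambda> (Suc m)) x\<bar>"
          have "1 \<le> real (card (cube (Suc m) :: (int ^ 'd) set))" by (simp add: card_cube one_le_power)
          then have "?a / real (card (cube (Suc m) :: (int ^ 'd) set)) \<le> ?a / 1" by (intro divide_left_mono) auto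
          then show ?thesis
            using ids_deviation[of "Suc m" n \<omega> x] elim(1,3) elim(2)[rule_format, of x] m unfolding D_def by simp
        qed
        have "sup_norm (?F n) \<le> 4 / 5 * e" by (rule sup_norm_le) (rule b)
        moreover have "0 \<le> sup_norm (?F n)"
        proof -
          have "bounded (range (?F n))" unfolding bounded_iff using b by (intro exI[of _ "4 / 5 * e"]) simp
          from le_sup_norm[OF this, of 0] show ?thesis by linarith
        qed
        ultimately show ?case using e by simp
      qed
    qed
  qed
qed

end

theorem theorem7p2:
  fixes A :: "real set"
    and P :: "(int ^ 'd \<Rightarrow> real) measure"
    and \<mu> :: "int ^ 'd \<Rightarrow> real measure"
    and r :: nat
  assumes "prob_space P"
    and "sets P = sets (config_algebra A UNIV)"
    and "stationary A P"
    and "has_densities A \<mu> P"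
    and "correlation_length A \<mu> P r"
  shows "ids P \<in> rc_bounded \<and>
    (\<exists>\<Omega>' \<in> sets P. measure P \<Omega>' = 1 \<and>
      (\<forall>\<omega>\<in>\<Omega>'.
        (\<lambda>n. sup_norm (\<lambda>x. eigenvalue_count (cube n) \<omega> x / real (card (cube n :: (int ^ 'd) set))
               - ids P x)) \<longlonglongrightarrow> 0 \<and>
        (\<forall>n m :: nat. r < m \<longrightarrow> m < n \<longrightarrow>
          sup_norm (\<lambda>x. eigenvalue_count (cube n) \<omega> x / real (card (cube n :: (int ^ 'd) set))
               - ids P x)
            \<le> 2 ^ (CARD('d) + 1) *
                ((26 * real m ^ CARD('d) + 8) / (real n - real m) +
                 (34 * real r ^ CARD('d) + 24) / (real m - real r)) +
              (SUP g \<in> admissible_class A 9 8 8 1.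
                 sup_norm (\<lambda>E.
                     pairing (localize A g (inner_part r (cube m))) (empirical_measure A r m n \<omega>) E
                   - pairing (localize A g (inner_part r (cube m)))
                       (marginal A P (inner_part r (cube m))) E)
                 / real (card (cube m :: (int ^ 'd) set))))))"
proof -
  interpret prob_space P by (rule assms(1))
  interpret random_field P A \<mu> r by unfold_locales (use assms in auto)
  \<comment> \<open>N is a measurable null set containing the configurations without convergence, so
    its complement is an event of probability 1.\<close>
  obtain N where N: "{\<omega> \<in> space P. \<not> (\<lambda>n. sup_norm (\<lambda>x. eigenvalue_count (cube n) \<omega> x / real (card (cube n :: (int ^ 'd) set)) - ids P x)) \<longlonglongrightarrow> 0} \<subseteq> N"
      "emeasure P N = 0" "N \<in> sets P"
    by (rule AE_E[OF ids_uniform_convergence])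
  have "measure P N = 0" using N(2) by (simp add: measure_def)
  then have "measure P (space P - N) = 1" using N(3) by (simp add: prob_compl)
  moreover have "space P - N \<in> sets P" using N by auto
  ultimately show ?thesis
    using ids_rc_bounded N(1) quantitative_bound by (intro conjI bexI[of _ "space P - N"]) (auto simp: space_P)
qed

end
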